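(* For every real $\epsilon>0$ and every integer $k\ge 3$ there is a polynomial time algorithm for $k$-Set Packing that, given a family $\mathcal{F}\subseteq 2^U$ of sets of size at most $k$, outputs a subfamily $\mathcal{S}\subseteq\mathcal{F}$ of pairwise disjoint sets with $|OPT|\le \frac{k+1+\epsilon}{3}\,|\mathcal{S}|$, where $OPT$ is a maximum size subfamily of $\mathcal{F}$ consisting of pairwise disjoint sets.
   Context: $k$-Set Packing: given a family $\mathcal{F}\subseteq 2^U$ of sets of size at most $k$, find a maximum size subfamily of $\mathcal{F}$ of pairwise disjoint sets. Here $k$ and $\epsilon$ are fixed constants, and "polynomial time" is polynomial in the input size $|\mathcal{F}|+|U|$. *)

theory Defs
  imports Complex_Main "HOL-Library.Disjoint_Sets"
begin

text \<open>Symbols are natural numbers, 0 is the blank. States are natural numbers,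
  0 is the start state and 1 is the (unique) halting state. A machine is a
  transition function together with a finite number of states Q and tape
  symbols Sg; well-formedness says that the machine never leaves these finite
  ranges, so only finitely many transitions matter.\<close>

datatype dir = Left | Right

type_synonym trans = "nat \<Rightarrow> nat \<Rightarrow> nat \<times> nat \<times> dir"

definition tm_wf :: "nat \<Rightarrow> nat \<Rightarrow> trans \<Rightarrow> bool" where
  "tm_wf Q Sg \<delta> \<longleftrightarrow> 2 \<le> Q \<and> 5 \<le> Sg \<and>
     (\<forall>q<Q. \<forall>s<Sg. fst (\<delta> q s) < Q \<and> fst (snd (\<delta> q s)) < Sg)"

text \<open>Configuration: (state, tape left of the head reversed, tape from the head on).\<close>
type_synonym config = "nat \<times> nat list \<times> nat list"

definition head_sym :: "nat list \<Rightarrow> nat" where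
  "head_sym rs = (case rs of [] \<Rightarrow> 0 | s # _ \<Rightarrow> s)"

definition tm_step :: "trans \<Rightarrow> config \<Rightarrow> config" where
  "tm_step \<delta> c = (case c of (q, ls, rs) \<Rightarrow>
     if q = 1 then c else
     (case \<delta> q (head_sym rs) of (q', w, d) \<Rightarrow>
       (case d of
          Left \<Rightarrow> (case ls of [] \<Rightarrow> (q', [], w # tl rs)
                             | l # ls' \<Rightarrow> (q', ls', l # w # tl rs))
        | Right \<Rightarrow> (q', w # ls, tl rs))))"

definition tm_run :: "trans \<Rightarrow> nat \<Rightarrow> nat list \<Rightarrow> config" where
  "tm_run \<delta> t inp = (tm_step \<delta> ^^ t) (0, [], inp)"

definition tm_output :: "config \<Rightarrow> nat list" where
  "tm_output c = takeWhile (\<lambda>s. s \<noteq> 0) (snd (snd c))"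

function bits :: "nat \<Rightarrow> nat list" where
  "bits n = (if n < 2 then [n + 1] else bits (n div 2) @ [n mod 2 + 1])"
  by auto
termination by (relation "measure id") auto

definition enc_nats :: "nat list \<Rightarrow> nat list" where
  "enc_nats xs = concat (map (\<lambda>x. bits x @ [3]) xs)"

text \<open>Instance: universe {0..<n}, family given as a list of sets (each a strictly
  sorted list); n in binary, then each set followed by separator symbol 4.\<close>
definition enc_instance :: "nat \<Rightarrow> nat list list \<Rightarrow> nat list" where
  "enc_instance n xss = bits n @ [4] @ concat (map (\<lambda>xs. enc_nats xs @ [4]) xss)"

definition valid_instance :: "nat \<Rightarrow> nat \<Rightarrow> nat list list \<Rightarrow> bool" where
  "valid_instance k n xss \<longleftrightarrow> distinct xss \<and>
     (\<forall>xs\<in>set xss. sorted_wrt (<) xs \<and> length xs \<le> k \<and> set xs \<subseteq> {..<n})"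

definition is_packing :: "'a set set \<Rightarrow> 'a set set \<Rightarrow> bool" where
  "is_packing F S \<longleftrightarrow> S \<subseteq> F \<and> pairwise disjnt S"

definition opt_packing :: "'a set set \<Rightarrow> nat" where
  "opt_packing F = Max {card S | S. is_packing F S}"

end

theory Submission
  imports Defs "HOL-Library.Nat_Bijection"
begin

text \<open>
  The algorithm is a local search over the packing \<open>S\<close>: as long as some family \<open>X\<close> of pairwise disjoint
  sets meets fewer than \<open>card X\<close> members of \<open>S\<close>, exchange them. It suffices to look for
  families \<open>X\<close> of size \<open>O(log n)\<close> that can be built up step by step with a bag of constantly many
  members of \<open>S\<close> in memory: if the packing is too small, then the conflict graph between \<open>S\<close> and an
  optimal packing contains a dense piece of logarithmic size and bounded bag width.
  Disjointness of the members of \<open>X\<close> is controlled by colour coding: a perfect hash function, described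
  by numbers of logarithmic length, maps the \<open>O(log n)\<close> used elements injectively to \<open>O(log n)\<close>
  colours, so that the set of used colours is itself a number of polynomial size and the
  search becomes reachability in a polynomial state space.

  Polynomial time is obtained uniformly: the whole algorithm is written in a small language of
  first-order queries over \<open>{..<N}\<close> with bounded loops, where \<open>N\<close> is a power of the
  input length, and every program of that language is compiled to a Turing machine.
\<close>

section \<open>Local search processes with a bounded bag\<close>

text \<open>The ratio (k+1)/3 comes from sorting the sets of a larger packing by the number of their
  conflicts outside a bottom part K of S: at most one, exactly two, at least three. Sets of the
  first kind are matched with owners, those of the second kind are edges of a graph on S - K that
  has to be sparse, and counting incidences bounds the rest. Exchanges of logarithmic size cannot be
  enumerated in polynomial time, and a bounded bag cannot remember which members of S were removed
  already. A member that is needed again is therefore charged again, which can only underestimate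
  the gain. Likewise no soundness rests on the hash: a bad colouring merely makes the search miss
  exchanges, so all descriptions may simply be tried. Reachability reports only that an exchange
  exists. To obtain one, candidates are deleted as long as the test still succeeds. The test is
  monotone in the candidates, and every success is already a success for the family it exchanges;
  hence the minimal family left over is itself the exchange.\<close>

inductive preach :: "'a set \<Rightarrow> ('b \<Rightarrow> 'a set) \<Rightarrow> 'b set \<Rightarrow> nat \<Rightarrow> nat \<Rightarrow> 'a set \<Rightarrow> 'b set \<Rightarrow> int \<Rightarrow> bool"
  for A N F w where
  \<comment> \<open>\<open>A\<close> is the current packing, \<open>N b\<close> the part of it that
    \<open>b\<close> meets, \<open>F\<close> the candidates; \<open>g\<close> counts additions minus
    payments during \<open>t\<close> moves. Dropping refunds nothing, so \<open>g\<close> is at most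
    the size of \<open>X\<close> minus the number of distinct members ever paid, and gain 1
    certifies an improvement.\<close>
  init: "preach A N F w 0 {} {} 0"
| pay: "preach A N F w t P X g \<Longrightarrow> a \<in> A \<Longrightarrow> card (insert a P) \<le> w \<Longrightarrow> preach A N F w (Suc t) (insert a P) X (g - 1)"
| drop: "preach A N F w t P X g \<Longrightarrow> P' \<subseteq> P \<Longrightarrow> preach A N F w t P' X g"
| add: "preach A N F w t P X g \<Longrightarrow> b \<in> F - X \<Longrightarrow> N b \<subseteq> P \<Longrightarrow> preach A N F w (Suc t) P (insert b X) (g + 1)"

lemma preach_inv:
  "preach A N F w t P X g \<Longrightarrow> finite P \<and> card P \<le> w \<and> P \<subseteq> A \<and> finite X \<and> X \<subseteq> F \<and> card X \<le> t \<and> - int t \<le> g \<and> g \<le> int t"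
proof (induction rule: preach.induct)
  case (drop t P X g P')
  then show ?case using card_mono[of P P'] finite_subset[of P' P] by auto
next
  case (add t P X g b)
  then show ?case by (auto simp: card_insert_if)
qed auto

lemma preach_pays:
  assumes "preach A N F w t P X g"
  shows "finite Y \<Longrightarrow> Y \<subseteq> A \<Longrightarrow> card (P \<union> Y) \<le> w \<Longrightarrow> preach A N F w (t + card Y) (P \<union> Y) X (g - int (card Y))"
proof (induction Y rule: finite_induct)
  case (insert y Y)
  have fP: "finite P" using preach_inv[OF assms] by simp
  have "card (P \<union> Y) \<le> card (P \<union> insert y Y)" using fP insert by (intro card_mono) auto
  then have 1: "preach A N F w (t + card Y) (P \<union> Y) X (g - int (card Y))" using insert by auto
  have "insert y (P \<union> Y) = P \<union> insert y Y" by auto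
  then show ?case using preach.pay[OF 1, of y] insert by (simp add: algebra_simps)
qed (use assms in simp)

lemma preach_adds:
  assumes "preach A N F w t P X g"
  shows "finite Z \<Longrightarrow> Z \<subseteq> F \<Longrightarrow> Z \<inter> X = {} \<Longrightarrow> (\<And>z. z \<in> Z \<Longrightarrow> N z \<subseteq> P) \<Longrightarrow>
    preach A N F w (t + card Z) P (X \<union> Z) (g + int (card Z))"
proof (induction Z rule: finite_induct)
  case (insert z Z)
  then have 1: "preach A N F w (t + card Z) P (X \<union> Z) (g + int (card Z))" by auto
  have "preach A N F w (Suc (t + card Z)) P (insert z (X \<union> Z)) (g + int (card Z) + 1)"
    by (rule preach.add[OF 1]) (use insert in auto)
  then show ?case using insert by (simp add: algebra_simps)
qed (use assms in simp)

text \<open>A graph with average degree above 2 contains two cycles within logarithmic distance: pass to a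
  minimal dense subgraph, in which balls grow exponentially until one of them has two non-tree
  edges. The root paths of their endpoints are processed level by level, so the bag stays small.\<close>

lemma dense_graph_process:
  fixes ends :: "'e \<Rightarrow> 'v set" and \<epsilon> :: real
  assumes fin: "finite V" "finite E" and ends: "\<And>e. e \<in> E \<Longrightarrow> ends e \<subseteq> V \<and> card (ends e) = 2"
    and \<epsilon>: "0 < \<epsilon>" and dense: "(1 + \<epsilon>) * card V \<le> card E" and V: "V \<noteq> {}" and T: "real (card V) < (1 + \<epsilon>) ^ T"
  shows "\<exists>t P X. t \<le> 8 * T + 3 \<and> preach V ends E 8 t P X 1"
proof -
  define dn where "dn W \<longleftrightarrow> W \<subseteq> V \<and> W \<noteq> {} \<and> (1 + \<epsilon>) * card W \<le> card {e\<in>E. ends e \<subseteq> W}" for W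
  have "{e\<in>E. ends e \<subseteq> V} = E" using ends by auto
  then have "dn V" using dense V by (simp add: dn_def)
  then obtain W where W: "dn W" and min: "\<And>W'. dn W' \<Longrightarrow> card W \<le> card W'"
    using ex_has_least_nat[of dn V card] by blast
  define E' where "E' = {e\<in>E. ends e \<subseteq> W}"
  have WV: "W \<subseteq> V" "W \<noteq> {}" "finite W" "finite E'" and dW: "(1 + \<epsilon>) * card W \<le> card E'"
    using W fin finite_subset by (auto simp: dn_def E'_def)
  \<comment> \<open>Minimality of \<open>W\<close>: if \<open>U\<close> touched fewer edges,
    removing it would leave a smaller dense set. If \<open>U\<close> is all of \<open>W\<close>, no
    edge remains, since every edge has two ends.\<close>
  have touch: "(1 + \<epsilon>) * card U \<le> card {e\<in>E'. ends e \<inter> U \<noteq> {}}" if U: "U \<subseteq> W" "U \<noteq> {}" for U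
  proof -
    have "E' = {e\<in>E'. ends e \<inter> U \<noteq> {}} \<union> {e\<in>E. ends e \<subseteq> W - U}" using U by (auto simp: E'_def)
    moreover have "{e\<in>E'. ends e \<inter> U \<noteq> {}} \<inter> {e\<in>E. ends e \<subseteq> W - U} = {}" by auto
    ultimately have c: "card E' = card {e\<in>E'. ends e \<inter> U \<noteq> {}} + card {e\<in>E. ends e \<subseteq> W - U}"
      using WV fin card_Un_disjoint[of "{e\<in>E'. ends e \<inter> U \<noteq> {}}" "{e\<in>E. ends e \<subseteq> W - U}"] by simp
    have cW: "card W = card U + card (W - U)"
      using U WV card_Diff_subset[of U W] card_mono[of W U] finite_subset[of U W] by simp
    have "card {e\<in>E. ends e \<subseteq> W - U} \<le> (1 + \<epsilon>) * card (W - U)"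
    proof (cases "W - U = {}")
      case True
      have "ends e \<noteq> {}" if "e \<in> E" for e using ends[OF that] by (metis card.empty zero_neq_numeral)
      then have "{e\<in>E. ends e \<subseteq> W - U} = {}" unfolding True by blast
      then show ?thesis using \<epsilon> by (simp only: card.empty) simp
    next
      case False
      have "card U > 0" using U WV finite_subset by (metis card_gt_0_iff)
      then have "\<not> dn (W - U)" using min[of "W - U"] cW by auto
      then show ?thesis using False WV by (auto simp: dn_def)
    qed
    moreover have "(1 + \<epsilon>) * card W = (1 + \<epsilon>) * card U + (1 + \<epsilon>) * card (W - U)"
      by (simp add: cW algebra_simps)
    ultimately show ?thesis using dW c by linarith
  qed
  obtain r where r: "r \<in> W" using WV by auto
  define ball where "ball = rec_nat {r} (\<lambda>_ S. S \<union> \<Union> (ends ` {e\<in>E'. ends e \<inter> S \<noteq> {}}))"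
  have b0: "ball 0 = {r}" and bS: "ball (Suc j) = ball j \<union> \<Union> (ends ` {e\<in>E'. ends e \<inter> ball j \<noteq> {}})" for j
    by (auto simp: ball_def)
  have bW: "ball j \<subseteq> W" for j by (induction j) (use r in \<open>auto simp: b0 bS E'_def\<close>)
  have bfin: "finite (ball j)" for j using bW WV finite_subset by blast
  have bne: "ball j \<noteq> {}" for j by (induction j) (auto simp: b0 bS)
  have bmono: "i \<le> j \<Longrightarrow> ball i \<subseteq> ball j" for i j by (rule lift_Suc_mono_le[of ball]) (auto simp: bS)
  define EB where "EB j = {e\<in>E'. ends e \<subseteq> ball j}" for j
  have grow: "(1 + \<epsilon>) * card (ball j) \<le> card (EB (Suc j))" for j
  proof -
    have "{e\<in>E'. ends e \<inter> ball j \<noteq> {}} \<subseteq> EB (Suc j)" by (auto simp: EB_def bS)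
    then have "card {e\<in>E'. ends e \<inter> ball j \<noteq> {}} \<le> card (EB (Suc j))"
      using WV by (intro card_mono) (auto simp: EB_def)
    then show ?thesis using touch[OF bW bne, of j] by linarith
  qed
  \<comment> \<open>Otherwise \<open>grow\<close> multiplies the size of the ball by 1 + \<epsilon>
    in each of \<open>T\<close> steps, and the last ball is larger than \<open>V\<close>.\<close>
  have "\<exists>t\<le>T. card (ball t) < card (EB t)"
  proof (rule ccontr)
    assume "\<not> ?thesis"
    then have le: "card (EB t) \<le> card (ball t)" if "t \<le> T" for t using that by (meson not_le)
    have "(1 + \<epsilon>) ^ t \<le> card (ball t)" if "t \<le> T" for t
      using that
    proof (induction t)
      case (Suc t)
      have "(1 + \<epsilon>) ^ Suc t \<le> (1 + \<epsilon>) * card (ball t)" using Suc \<epsilon> by simp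
      also have "\<dots> \<le> card (ball (Suc t))" using grow[of t] le[OF Suc.prems] by linarith
      finally show ?case .
    qed (simp add: b0)
    then have "(1 + \<epsilon>) ^ T \<le> card (ball T)" by simp
    moreover have "card (ball T) \<le> card V" using bW WV fin by (intro card_mono) auto
    ultimately show False using T by linarith
  qed
  then obtain t where t: "t \<le> T" "card (ball t) < card (EB t)" by blast
  define d where "d v = (LEAST j. v \<in> ball j)" for v
  have dball: "v \<in> ball (d v)" if "v \<in> ball j" for v j
    unfolding d_def using that by (rule LeastI)
  have dle: "d v \<le> j" if "v \<in> ball j" for v j
    unfolding d_def using that by (rule Least_le)
  have dr: "d r = 0" using dle[of r 0] b0 by simp
  have d0: "v = r" if "v \<in> ball j" "d v = 0" for v j
    using dball[OF that(1)] that(2) b0 by simp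
  have "\<exists>e u. e \<in> EB t \<and> ends e = {v, u} \<and> u \<in> ball t \<and> Suc (d u) = d v" if v: "v \<in> ball t" "v \<noteq> r" for v
  proof -
    have "d v \<noteq> 0" using d0 v by blast
    then obtain j where j: "d v = Suc j" using not0_implies_Suc by blast
    have nj: "v \<notin> ball j" using dle[of v j] j by auto
    have "v \<in> ball (Suc j)" using dball[OF v(1)] j by simp
    then obtain e where e: "e \<in> E'" "v \<in> ends e" "ends e \<inter> ball j \<noteq> {}" using nj by (auto simp: bS)
    then obtain u where u: "u \<in> ends e" "u \<in> ball j" by auto
    have uv: "u \<noteq> v" using nj u by auto
    have "card (ends e) = 2" using e ends by (auto simp: E'_def)
    then have ee: "ends e = {v, u}" using e(2) u(1) uv by (auto simp: card_2_iff)
    have "Suc j \<le> t" using dle[OF v(1)] j by simp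
    then have ut: "u \<in> ball t" using u bmono[of j t] by auto
    have "d u = j"
    proof (rule ccontr)
      assume "d u \<noteq> j"
      then have "Suc (d u) \<le> j" using dle[OF u(2)] by simp
      moreover have "v \<in> ball (Suc (d u))" using e u dball[OF u(2)] by (auto simp: bS)
      ultimately show False using bmono nj by blast
    qed
    moreover have "e \<in> EB t" using e(1) ee ut v by (simp add: EB_def)
    ultimately show ?thesis using ee ut j by metis
  qed
  \<comment> \<open>A breadth-first tree rooted at \<open>r\<close>: the edge \<open>te v\<close>
    leads to the parent \<open>par v\<close>, one level closer to the root.\<close>
  then obtain te par where tp: "\<And>v. v \<in> ball t \<Longrightarrow> v \<noteq> r \<Longrightarrow> te v \<in> EB t \<and> ends (te v) = {v, par v} \<and> par v \<in> ball t \<and> Suc (d (par v)) = d v"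
    by metis
  have te_inj: "inj_on te (ball t - {r})"
  proof (rule inj_onI, rule ccontr)
    fix x y assume x: "x \<in> ball t - {r}" and y: "y \<in> ball t - {r}" and eq: "te x = te y" and ne: "x \<noteq> y"
    have "{x, par x} = {y, par y}" using tp[of x] tp[of y] x y eq by simp
    then have "x = par y" "y = par x" using ne by (auto simp: doubleton_eq_iff)
    then show False using tp[of x] tp[of y] x y by auto
  qed
  let ?TE = "te ` (ball t - {r})"
  have EBfin: "finite (EB t)" using WV by (simp add: EB_def)
  have rt: "r \<in> ball t" using bmono[of 0 t] b0 by auto
  have "card ?TE = card (ball t) - 1" using card_image[OF te_inj] rt by simp
  moreover have "?TE \<subseteq> EB t" using tp by auto
  moreover have "card (ball t) > 0" using bfin bne by (simp add: card_gt_0_iff)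
  \<comment> \<open>The tree has one edge less than the ball has vertices and \<open>EB t\<close>
    has at least one more, so two edges close cycles.\<close>
  ultimately have "2 \<le> card (EB t - ?TE)" using card_Diff_subset[of ?TE "EB t"] t EBfin bfin by simp
  then obtain S where "S \<subseteq> EB t - ?TE" "card S = 2" using obtain_subset_with_card_n by metis
  then obtain e1 e2 where e12: "e1 \<in> EB t - ?TE" "e2 \<in> EB t - ?TE" "e1 \<noteq> e2" by (auto simp: card_2_iff)
  let ?X4 = "ends e1 \<union> ends e2"
  have X4: "?X4 \<subseteq> ball t" "finite ?X4" using e12 bfin[of t] finite_subset by (auto simp: EB_def)
  have cX4: "card ?X4 \<le> 4"
  proof -
    have "card (ends e1) = 2" "card (ends e2) = 2" using e12 ends by (auto simp: EB_def E'_def)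
    then show ?thesis using card_Un_le[of "ends e1" "ends e2"] by simp
  qed
  have X4ne: "?X4 \<noteq> {}" using e12 ends[of e1] by (auto simp: EB_def E'_def)
  \<comment> \<open>The ancestor of \<open>x\<close> at depth \<open>j\<close>, or \<open>x\<close>
    itself if its depth is at most \<open>j\<close>: the truncated difference is then 0. So
    \<open>Bg j\<close> is the front of the root paths at level \<open>j\<close>, with at most four
    vertices.\<close>
  define m where "m j x = (par ^^ (d x - j)) x" for j x
  have anc: "(par ^^ i) x \<in> ball t \<and> d ((par ^^ i) x) = d x - i" if "x \<in> ball t" "i \<le> d x" for x i
    using that(2)
  proof (induction i)
    case (Suc i)
    then have IH: "(par ^^ i) x \<in> ball t" "d ((par ^^ i) x) = d x - i" by auto
    then have "(par ^^ i) x \<noteq> r" using Suc.prems dr by auto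
    from tp[OF IH(1) this] IH(2) show ?case by auto
  qed (use that in simp)
  have m1: "m j x \<in> ball t" "d (m j x) = min j (d x)" if "x \<in> ?X4" for j x
    using anc[of x "d x - j"] X4 that by (auto simp: m_def)
  define Bg where "Bg j = m j ` ?X4" for j
  have Bg: "finite (Bg j)" "card (Bg j) \<le> 4" "Bg j \<subseteq> ball t" for j
    using X4 cX4 card_image_le[of ?X4 "m j"] m1 by (auto simp: Bg_def intro: le_trans)
  define Nw where "Nw j = {v \<in> Bg (Suc j). d v = Suc j}" for j
  have Nw: "finite (Nw j)" "card (Nw j) \<le> 4" "Nw j \<subseteq> ball t - {r}" for j
    using Bg[of "Suc j"] card_mono[of "Bg (Suc j)" "Nw j"] dr by (auto simp: Nw_def)
  have sub: "Bg (Suc j) \<subseteq> Bg j \<union> Nw j" for j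
  proof
    fix v assume v: "v \<in> Bg (Suc j)"
    then obtain x where x: "x \<in> ?X4" "v = m (Suc j) x" by (auto simp: Bg_def)
    show "v \<in> Bg j \<union> Nw j"
    proof (cases "d x \<le> j")
      case True
      then have "v = m j x" using x by (simp add: m_def)
      then show ?thesis using x by (auto simp: Bg_def)
    next
      case False
      then have "d v = Suc j" using m1[OF x(1)] x(2) by simp
      then show ?thesis using v by (simp add: Nw_def)
    qed
  qed
  have parB: "par v \<in> Bg j" if v: "v \<in> Nw j" for v j
  proof -
    obtain x where x: "x \<in> ?X4" "v = m (Suc j) x" "d v = Suc j" using v unfolding Nw_def Bg_def by blast
    then have "Suc j \<le> d x" using m1(2)[OF x(1), of "Suc j"] by simp
    then have "d x - j = Suc (d x - Suc j)" by simp
    then have "par v = m j x" using x by (simp add: m_def)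
    then show ?thesis using x by (auto simp: Bg_def)
  qed
  \<comment> \<open>Each new vertex is paid for and compensated by its tree edge; only the root is
    not, so the gain stays -1 until the two closing edges raise it to 1. Old and new front together
    have at most 4 + 4 vertices, which is the bag size 8; a level takes at most four payments and
    four additions.\<close>
  have proc: "\<exists>t' X. t' \<le> 1 + 8 * j \<and> X \<subseteq> te ` {v \<in> ball t - {r}. d v \<le> j} \<and> preach V ends E 8 t' (Bg j) X (- 1)" for j
  proof (induction j)
    case 0
    have "m 0 x = r" if "x \<in> ?X4" for x using m1[OF that, of 0] d0 by auto
    then have "Bg 0 = {r}" using X4ne unfolding Bg_def by auto
    moreover have "preach V ends E 8 (Suc 0) {r} {} (0 - 1)"
      by (rule preach.pay[OF preach.init]) (use r WV in auto)
    ultimately show ?case by (intro exI[of _ 1] exI[of _ "{}"]) auto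
  next
    case (Suc j)
    then obtain t' X where IH: "t' \<le> 1 + 8 * j" "X \<subseteq> te ` {v \<in> ball t - {r}. d v \<le> j}" "preach V ends E 8 t' (Bg j) X (- 1)"
      by blast
    have 1: "preach V ends E 8 (t' + card (Nw j)) (Bg j \<union> Nw j) X (- 1 - int (card (Nw j)))"
    proof (rule preach_pays[OF IH(3)])
      show "Nw j \<subseteq> V" using Nw(3)[of j] bW[of t] WV by auto
      show "card (Bg j \<union> Nw j) \<le> 8" using card_Un_le[of "Bg j" "Nw j"] Bg(2)[of j] Nw(2)[of j] by simp
    qed (rule Nw)
    have inj: "inj_on te (Nw j)" using te_inj Nw(3) by (rule inj_on_subset)
    have 2: "preach V ends E 8 (t' + card (Nw j) + card (te ` Nw j)) (Bg j \<union> Nw j) (X \<union> te ` Nw j)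
      (- 1 - int (card (Nw j)) + int (card (te ` Nw j)))"
    proof (rule preach_adds[OF 1])
      show "te ` Nw j \<subseteq> E" using tp Nw(3)[of j] by (auto simp: EB_def E'_def)
      show "te ` Nw j \<inter> X = {}"
      proof (rule ccontr)
        assume "\<not> ?thesis"
        then obtain v v' where "v \<in> Nw j" "v' \<in> ball t - {r}" "d v' \<le> j" "te v = te v'"
          using IH(2) by blast
        moreover from this have "v = v'" using te_inj Nw(3)[of j] by (auto simp: inj_on_def)
        ultimately show False by (simp add: Nw_def)
      qed
      show "ends z \<subseteq> Bg j \<union> Nw j" if z: "z \<in> te ` Nw j" for z
      proof -
        obtain v where v: "v \<in> Nw j" "z = te v" using z by blast
        then have "ends z = {v, par v}" using tp[of v] Nw(3)[of j] by auto
        then show ?thesis using v parB by auto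
      qed
    qed (use Nw in simp)
    have 3: "preach V ends E 8 (t' + card (Nw j) + card (te ` Nw j)) (Bg (Suc j)) (X \<union> te ` Nw j) (- 1)"
      using preach.drop[OF 2 sub] card_image[OF inj] by simp
    have "Nw j \<subseteq> {v \<in> ball t - {r}. d v \<le> Suc j}" using Nw(3)[of j] by (auto simp: Nw_def)
    moreover have "{v \<in> ball t - {r}. d v \<le> j} \<subseteq> {v \<in> ball t - {r}. d v \<le> Suc j}" by auto
    ultimately have "X \<union> te ` Nw j \<subseteq> te ` {v \<in> ball t - {r}. d v \<le> Suc j}"
      using IH(2) by blast
    moreover have "t' + card (Nw j) + card (te ` Nw j) \<le> 1 + 8 * Suc j"
      using IH(1) Nw(2)[of j] card_image[OF inj] by simp
    ultimately show ?case using 3 by blast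
  qed
  from proc[of t] obtain t' X where X: "t' \<le> 1 + 8 * t" "X \<subseteq> ?TE" "preach V ends E 8 t' (Bg t) X (- 1)" by blast
  have "m t x = x" if "x \<in> ?X4" for x using dle[of x t] X4 that by (auto simp: m_def)
  then have BX: "Bg t = ?X4" by (auto simp: Bg_def)
  have "preach V ends E 8 (t' + card {e1, e2}) (Bg t) (X \<union> {e1, e2}) (- 1 + int (card {e1, e2}))"
    by (rule preach_adds[OF X(3)]) (use e12 X(2) BX in \<open>auto simp: EB_def E'_def\<close>)
  then have "preach V ends E 8 (t' + 2) (Bg t) (X \<union> {e1, e2}) 1" using e12 by simp
  moreover have "t' + 2 \<le> 8 * T + 3" using X(1) t(1) by simp
  ultimately show ?thesis by blast
qed

text \<open>The classes are the connected components of the hypergraph, named by one of their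
  vertices. A hyperedge with h vertices joins at most h components into one, so it lowers their
  number by at most h - 1.\<close>

lemma hyperedge_classes:
  fixes H :: "'j \<Rightarrow> 'a set"
  assumes "finite J" "finite K" and "\<And>j. j \<in> J \<Longrightarrow> H j \<subseteq> K \<and> H j \<noteq> {}"
  shows "\<exists>col :: 'a \<Rightarrow> 'a. (\<forall>j\<in>J. \<forall>x\<in>H j. \<forall>y\<in>H j. col x = col y) \<and>
    (\<forall>c. card {x\<in>K. col x = c} \<le> 1 + (\<Sum>j\<in>{j\<in>J. H j \<subseteq> {x\<in>K. col x = c}}. card (H j) - 1))"
  using assms(1,3)
proof (induction J rule: finite_induct)
  case empty
  have "card {x\<in>K. x = c} \<le> 1" for c
    using card_mono[of "{c}" "{x\<in>K. x = c}"] by auto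
  then show ?case by (intro exI[of _ "\<lambda>x. x"]) simp
next
  case (insert j J)
  have "\<exists>col :: 'a \<Rightarrow> 'a. (\<forall>j\<in>J. \<forall>x\<in>H j. \<forall>y\<in>H j. col x = col y) \<and>
    (\<forall>c. card {x\<in>K. col x = c} \<le> 1 + (\<Sum>j\<in>{j\<in>J. H j \<subseteq> {x\<in>K. col x = c}}. card (H j) - 1))"
    by (rule insert.IH) (use insert.prems in auto)
  then obtain col :: "'a \<Rightarrow> 'a" where mono: "\<forall>i\<in>J. \<forall>x\<in>H i. \<forall>y\<in>H i. col x = col y"
    and cl: "\<forall>c. card {x\<in>K. col x = c} \<le> 1 + (\<Sum>i\<in>{i\<in>J. H i \<subseteq> {x\<in>K. col x = c}}. card (H i) - 1)"
    by blast
  have HK: "H j \<subseteq> K" "H j \<noteq> {}" using insert.prems by auto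
  note Hj = HK finite_subset[OF HK(1) assms(2)]
  then obtain x0 where x0: "x0 \<in> H j" by blast
  define col' where "col' x = (if col x \<in> col ` H j then col x0 else col x)" for x
  let ?C = "\<lambda>c. {x\<in>K. col x = c}" and ?C' = "\<lambda>c. {x\<in>K. col' x = c}"
  let ?S = "\<lambda>J C. \<Sum>i\<in>{i\<in>J. H i \<subseteq> C}. card (H i) - 1"
  have "card (?C' c) \<le> 1 + ?S (insert j J) (?C' c)" for c
  proof (cases "c = col x0")
    case False
    show ?thesis
    proof (cases "c \<in> col ` H j")
      case True
      then have "?C' c = {}" using False by (auto simp: col'_def)
      then show ?thesis by (simp only: card.empty)
    next
      case c: False
      have "?C' c = ?C c" using False c by (auto simp: col'_def)
      moreover have "?S J (?C c) \<le> ?S (insert j J) (?C c)"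
        using insert.hyps by (intro sum_mono2) auto
      ultimately show ?thesis using spec[OF cl, of c] by simp
    qed
  next
    case True
    \<comment> \<open>The new class is the union of the old classes met by the hyperedge. There are
      at most \<open>card (H j)\<close> of them and each contributes its own 1.\<close>
    have C': "?C' c = (\<Union>c'\<in>col ` H j. ?C c')" using x0 by (auto simp: col'_def True)
    have "card (?C' c) \<le> (\<Sum>c'\<in>col ` H j. card (?C c'))"
      unfolding C' using Hj by (intro card_UN_le) auto
    also have "\<dots> \<le> (\<Sum>c'\<in>col ` H j. 1 + ?S J (?C c'))" by (intro sum_mono spec[OF cl])
    also have "\<dots> = card (col ` H j) + (\<Sum>c'\<in>col ` H j. ?S J (?C c'))"
      by (simp only: sum.distrib card_eq_sum)
    also have "(\<Sum>c'\<in>col ` H j. ?S J (?C c')) = (\<Sum>i\<in>(\<Union>c'\<in>col ` H j. {i\<in>J. H i \<subseteq> ?C c'}). card (H i) - 1)"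
    proof (rule sum.UNION_disjoint[symmetric])
      show "\<forall>c1\<in>col ` H j. \<forall>c2\<in>col ` H j. c1 \<noteq> c2 \<longrightarrow> {i\<in>J. H i \<subseteq> ?C c1} \<inter> {i\<in>J. H i \<subseteq> ?C c2} = {}"
      proof (intro ballI impI equals0I)
        fix c1 c2 i assume c: "c1 \<noteq> c2" and i: "i \<in> {i\<in>J. H i \<subseteq> ?C c1} \<inter> {i\<in>J. H i \<subseteq> ?C c2}"
        then obtain y where "y \<in> H i" using insert.prems[of i] by auto
        then show False using c i by auto
      qed
    qed (use Hj insert.hyps in auto)
    also have "\<dots> \<le> ?S J (?C' c)"
      using insert.hyps C' by (intro sum_mono2) auto
    finally have 1: "card (?C' c) \<le> card (col ` H j) + ?S J (?C' c)" by simp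
    have "H j \<subseteq> ?C' c" using Hj by (auto simp: col'_def True)
    then have "{i\<in>insert j J. H i \<subseteq> ?C' c} = insert j {i\<in>J. H i \<subseteq> ?C' c}" by auto
    then have 2: "?S (insert j J) (?C' c) = (card (H j) - 1) + ?S J (?C' c)"
      using insert.hyps by simp
    have "card (col ` H j) \<le> card (H j)" "0 < card (H j)"
      using Hj by (auto simp: card_image_le card_gt_0_iff)
    then show ?thesis using 1 2 by linarith
  qed
  moreover have "\<forall>i\<in>insert j J. \<forall>x\<in>H i. \<forall>y\<in>H i. col' x = col' y"
  proof (intro ballI)
    fix i x y assume i: "i \<in> insert j J" and xy: "x \<in> H i" "y \<in> H i"
    show "col' x = col' y"
    proof (cases "i = j")
      case True
      then show ?thesis using xy by (simp add: col'_def)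
    next
      case False
      then have "col x = col y" using mono i xy by blast
      then show ?thesis by (simp add: col'_def)
    qed
  qed
  ultimately show ?case by blast
qed

section \<open>Owned elements, neutral exchanges and the counting of conflicts\<close>

locale conflict =
  fixes A :: "'a set" and B :: "'b set" and N :: "'b \<Rightarrow> 'a set" and k :: nat
  \<comment> \<open>Both bounds by \<open>k\<close> hold for two packings of sets of size at most
    \<open>k\<close>: pairwise disjoint sets meet a set of size \<open>k\<close> in different
    points.\<close>
  assumes finA: "finite A" and finB: "finite B" and N: "\<And>b. b \<in> B \<Longrightarrow> N b \<subseteq> A \<and> card (N b) \<le> k"
    and deg: "\<And>a. a \<in> A \<Longrightarrow> card {b\<in>B. a \<in> N b} \<le> k" and k: "2 \<le> k"
begin

lemma finN: "b \<in> B \<Longrightarrow> finite (N b)"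
  using N finA finite_subset by blast

text \<open>An element of layer \<open>i + 1\<close> is owned by a set all of whose other conflicts lie in layer \<open>i\<close>;
  exchanging a closed part of the layers for its owners is neutral.\<close>

primrec Lay :: "nat \<Rightarrow> 'a set" where
  "Lay 0 = {}"
| "Lay (Suc i) = Lay i \<union> {a\<in>A. \<exists>b\<in>B. a \<in> N b \<and> N b \<subseteq> insert a (Lay i)}"

lemma Lay_A: "Lay i \<subseteq> A"
  by (induction i) auto

lemma finLay: "finite (Lay i)"
  using Lay_A finA finite_subset by blast

lemma Lay_mono: "i \<le> j \<Longrightarrow> Lay i \<subseteq> Lay j"
  by (rule lift_Suc_mono_le[of Lay]) auto

definition lev :: "'a \<Rightarrow> nat" where "lev a = (LEAST j. a \<in> Lay j)"

definition own :: "'a \<Rightarrow> 'b" where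
  "own a = (SOME b. b \<in> B \<and> a \<in> N b \<and> N b \<subseteq> insert a (Lay (lev a - 1)))"

lemma lev: "a \<in> Lay j \<Longrightarrow> a \<in> Lay (lev a) \<and> lev a \<le> j \<and> 0 < lev a"
proof -
  assume a: "a \<in> Lay j"
  have 1: "a \<in> Lay (lev a)" "lev a \<le> j" unfolding lev_def using a by (rule LeastI, rule Least_le)
  then have "lev a \<noteq> 0" by (metis Lay.simps(1) empty_iff)
  with 1 show ?thesis by simp
qed

lemma own: "a \<in> Lay j \<Longrightarrow> own a \<in> B \<and> a \<in> N (own a) \<and> N (own a) \<subseteq> insert a (Lay (lev a - 1))"
proof -
  assume "a \<in> Lay j"
  note l = lev[OF this]
  then obtain i where i: "lev a = Suc i" using not0_implies_Suc by fastforce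
  have "a \<notin> Lay i" using i not_less_Least[of i "\<lambda>j. a \<in> Lay j"] by (simp add: lev_def)
  then have "\<exists>b. b \<in> B \<and> a \<in> N b \<and> N b \<subseteq> insert a (Lay (lev a - 1))" using l i by auto
  from someI_ex[OF this] show ?thesis by (simp add: own_def)
qed

lemma own_sub: "a \<in> Lay (Suc j) \<Longrightarrow> N (own a) \<subseteq> insert a (Lay j)"
  using own[of a "Suc j"] lev[of a "Suc j"] Lay_mono[of "lev a - 1" j] by fastforce

lemma own_Lay: "a \<in> Lay j \<Longrightarrow> N (own a) \<subseteq> Lay j"
proof (cases j)
  case (Suc i)
  assume "a \<in> Lay j"
  then show ?thesis using own_sub[of a i] Suc by auto
qed simp

text \<open>All conflicts of \<open>own x\<close> except \<open>x\<close> lie strictly below the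
  level of \<open>x\<close>. If \<open>own x = own y\<close> with x and y different, each would lie
  strictly below the other.\<close>

lemma own_inj: "inj_on own (Lay j)"
proof (rule inj_onI, rule ccontr)
  have *: False if xy: "x \<in> Lay j" "y \<in> Lay j" "own x = own y" "x \<noteq> y" "lev x \<le> lev y" for x y
  proof -
    have "y \<in> insert x (Lay (lev x - 1))" using own[OF xy(1)] own[OF xy(2)] xy(3) by auto
    then have "y \<in> Lay (lev x - 1)" using xy(4) by simp
    then have "lev y \<le> lev x - 1" using lev by blast
    then show False using lev[OF xy(1)] xy(5) by auto
  qed
  fix x y assume "x \<in> Lay j" "y \<in> Lay j" "own x = own y" "x \<noteq> y"
  then show False using *[of x y] *[of y x] by (cases "lev x \<le> lev y") auto
qed

text \<open>Every element calls for at most \<open>k\<close> conflicts of its owner, and the new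
  ones lie one layer lower, so after \<open>i\<close> layers nothing is missing. The bound depends
  only on \<open>k\<close>, \<open>i\<close> and the size of \<open>S\<close>; a closed set around
  the conflicts of one set therefore fits into a bag of constant size.\<close>

lemma closure: "S \<subseteq> Lay i \<Longrightarrow> \<exists>D. S \<subseteq> D \<and> D \<subseteq> Lay i \<and> (\<forall>a\<in>D. N (own a) \<subseteq> D) \<and> card D \<le> (k + 1) ^ i * card S"
proof (induction i arbitrary: S)
  case 0
  then show ?case by (intro exI[of _ "{}"]) auto
next
  case (Suc i)
  define S' where "S' = (\<Union>a\<in>S. N (own a)) \<inter> Lay i"
  have finS: "finite S" using Suc.prems finLay finite_subset by blast
  have oB: "own a \<in> B" if "a \<in> S" for a using own Suc.prems that by blast
  have "card S' \<le> card (\<Union>a\<in>S. N (own a))"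
    unfolding S'_def using finS finN oB by (intro card_mono) auto
  also have "\<dots> \<le> (\<Sum>a\<in>S. card (N (own a)))" by (rule card_UN_le[OF finS])
  also have "\<dots> \<le> (\<Sum>a\<in>S. k)" using N oB by (intro sum_mono) blast
  finally have cS': "card S' \<le> k * card S" by (simp add: mult.commute)
  have "S' \<subseteq> Lay i" by (simp add: S'_def)
  from Suc.IH[OF this] obtain D where D: "S' \<subseteq> D" "D \<subseteq> Lay i" "\<forall>a\<in>D. N (own a) \<subseteq> D" "card D \<le> (k + 1) ^ i * card S'"
    by blast
  have "N (own a) \<subseteq> S \<union> D" if a: "a \<in> S" for a
  proof -
    have "N (own a) \<subseteq> insert a (Lay i)" using own_sub Suc.prems a by blast
    then have "N (own a) \<subseteq> insert a S'" using a by (auto simp: S'_def)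
    then show ?thesis using D(1) a by blast
  qed
  then have cl: "\<forall>a\<in>S \<union> D. N (own a) \<subseteq> S \<union> D" using D(3) by blast
  have "card (S \<union> D) \<le> card S + card D" by (rule card_Un_le)
  also have "\<dots> \<le> card S + (k + 1) ^ i * (k * card S)"
    using D(4) cS' by (meson add_left_mono le_trans mult_le_mono2)
  also have "\<dots> \<le> (k + 1) ^ i * card S + (k + 1) ^ i * (k * card S)" by simp
  also have "\<dots> = (k + 1) ^ Suc i * card S" by (simp add: algebra_simps)
  finally have "card (S \<union> D) \<le> (k + 1) ^ Suc i * card S" .
  moreover have "S \<union> D \<subseteq> Lay (Suc i)" using D(2) Suc.prems by auto
  ultimately show ?case using cl by blast
qed

text \<open>Owners are distinct and all their conflicts lie in the closed set \<open>D\<close>, so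
  \<open>card D\<close> payments and \<open>card D\<close> additions cancel.\<close>

lemma closed_exchange:
  assumes pr: "preach A N B w t P X g" and D: "D \<subseteq> Lay i" "\<forall>a\<in>D. N (own a) \<subseteq> D" and w: "card (P \<union> D) \<le> w"
    and disj: "own ` D \<inter> X = {}"
  shows "preach A N B w (t + 2 * card D) (P \<union> D) (X \<union> own ` D) g"
proof -
  have finD: "finite D" using D finLay finite_subset by blast
  have 1: "preach A N B w (t + card D) (P \<union> D) X (g - int (card D))"
    by (rule preach_pays[OF pr finD _ w]) (use D Lay_A in blast)
  have "preach A N B w (t + card D + card (own ` D)) (P \<union> D) (X \<union> own ` D) (g - int (card D) + int (card (own ` D)))"
  proof (rule preach_adds[OF 1])
    show "own ` D \<subseteq> B" using own D by blast
    show "N z \<subseteq> P \<union> D" if "z \<in> own ` D" for z using that D by blast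
  qed (use finD disj in auto)
  moreover have "card (own ` D) = card D" using own_inj D(1) by (intro card_image) (rule inj_on_subset)
  ultimately show ?thesis by (simp add: mult_2 add.assoc)
qed

text \<open>The closure of \<open>N b\<close> can be exchanged neutrally, and adding
  \<open>b\<close> afterwards would be a gain of 1 unless \<open>b\<close> is an owner. Hence,
  without an improvement, a layer covers no more sets than it has elements.\<close>

lemma covered_is_owned:
  assumes no: "\<not> (\<exists>t P X. t \<le> 2 * w + 1 \<and> preach A N B w t P X 1)" and w: "(k + 1) ^ j * k \<le> w"
    and b: "b \<in> B" "N b \<subseteq> Lay j"
  shows "b \<in> own ` Lay j"
proof (rule ccontr)
  assume nb: "b \<notin> own ` Lay j"
  obtain D where D: "N b \<subseteq> D" "D \<subseteq> Lay j" "\<forall>a\<in>D. N (own a) \<subseteq> D" "card D \<le> (k + 1) ^ j * card (N b)"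
    using closure[OF b(2)] by blast
  have "(k + 1) ^ j * card (N b) \<le> (k + 1) ^ j * k" using N[OF b(1)] by (intro mult_le_mono2) simp
  then have cD: "card D \<le> w" using D(4) w by linarith
  have 1: "preach A N B w (0 + 2 * card D) ({} \<union> D) ({} \<union> own ` D) 0"
    by (rule closed_exchange[OF preach.init D(2,3)]) (use cD in auto)
  have "preach A N B w (Suc (0 + 2 * card D)) ({} \<union> D) (insert b ({} \<union> own ` D)) (0 + 1)"
    by (rule preach.add[OF 1]) (use b nb D in auto)
  moreover have "Suc (0 + 2 * card D) \<le> 2 * w + 1" using cD by simp
  ultimately show False using no by auto
qed

lemma double_count:
  assumes "S \<subseteq> A" "C \<subseteq> B"
  shows "(\<Sum>b\<in>C. card (N b \<inter> S)) \<le> k * card S"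
proof -
  have fS: "finite S" "finite C" using assms finA finB finite_subset by blast+
  have "(\<Sum>b\<in>C. card (N b \<inter> S)) = (\<Sum>b\<in>C. \<Sum>a\<in>S. of_bool (a \<in> N b))"
    using fS by (intro sum.cong) (auto simp: Int_commute)
  also have "\<dots> = (\<Sum>a\<in>S. \<Sum>b\<in>C. of_bool (a \<in> N b))" by (rule sum.swap)
  also have "\<dots> \<le> (\<Sum>a\<in>S. k)"
  proof (rule sum_mono)
    fix a assume "a \<in> S"
    have "(\<Sum>b\<in>C. of_bool (a \<in> N b)) = card {b\<in>C. a \<in> N b}"
      using sum.inter_filter[OF fS(2), of "\<lambda>_. 1::nat" "\<lambda>b. a \<in> N b"] by (simp add: of_bool_def)
    also have "\<dots> \<le> card {b\<in>B. a \<in> N b}" using assms finB by (intro card_mono) auto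
    also have "\<dots> \<le> k" using deg assms \<open>a \<in> S\<close> by blast
    finally show "(\<Sum>b\<in>C. of_bool (a \<in> N b)) \<le> k" .
  qed
  finally show ?thesis by (simp add: mult.commute)
qed

text \<open>Before the process on the graph outside \<open>Lay i\<close> adds an edge
  \<open>b\<close>, the closed set \<open>Dd b\<close> is exchanged neutrally; it is dropped after
  the addition. This replaces one move by at most 2 w1 + 1. Disjointness of the sets
  \<open>Dd b\<close> guarantees that no owner would have to be added twice, for which there is no
  second gain.\<close>

lemma lift_process:
  assumes E: "E \<subseteq> B" "E \<inter> own ` Lay i = {}"
    and Dd: "\<And>b. b \<in> E \<Longrightarrow> N b \<inter> Lay i \<subseteq> Dd b \<and> Dd b \<subseteq> Lay i \<and> (\<forall>a\<in>Dd b. N (own a) \<subseteq> Dd b) \<and> card (Dd b) \<le> w1"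
    and disj: "\<And>b b'. b \<in> E \<Longrightarrow> b' \<in> E \<Longrightarrow> b \<noteq> b' \<Longrightarrow> Dd b \<inter> Dd b' = {}"
    and w: "w2 + w1 \<le> w"
    and pr: "preach (A - Lay i) (\<lambda>b. N b - Lay i) E w2 t P X g"
  shows "\<exists>t' \<le> t * (2 * w1 + 1). preach A N B w t' P (X \<union> own ` (\<Union>b\<in>X. Dd b)) g"
  using pr
proof (induction rule: preach.induct)
  case init
  then show ?case using preach.init by fastforce
next
  case (pay t P X g a)
  then obtain t' where t': "t' \<le> t * (2 * w1 + 1)" "preach A N B w t' P (X \<union> own ` (\<Union>b\<in>X. Dd b)) g" by blast
  have "preach A N B w (Suc t') (insert a P) (X \<union> own ` (\<Union>b\<in>X. Dd b)) (g - 1)"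
    by (rule preach.pay[OF t'(2)]) (use pay w in auto)
  moreover have "Suc t' \<le> Suc t * (2 * w1 + 1)" using t'(1) by simp
  ultimately show ?case by blast
next
  case (drop t P X g P')
  then show ?case using preach.drop by metis
next
  case (add t P X g b)
  then obtain t' where t': "t' \<le> t * (2 * w1 + 1)" "preach A N B w t' P (X \<union> own ` (\<Union>b\<in>X. Dd b)) g" by blast
  have b: "b \<in> E" "b \<notin> X" using add by auto
  note D = Dd[OF b(1)]
  have XE: "X \<subseteq> E" and P: "card P \<le> w2" "finite P" using preach_inv[OF add.hyps(1)] by auto
  have cPD: "card (P \<union> Dd b) \<le> w" using card_Un_le[of P "Dd b"] P D w by linarith
  have "Dd b \<inter> (\<Union>b\<in>X. Dd b) = {}" using disj[of b] b XE by blast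
  moreover have "(\<Union>b\<in>X. Dd b) \<subseteq> Lay i" using Dd XE by blast
  ultimately have "own ` Dd b \<inter> own ` (\<Union>b\<in>X. Dd b) = {}"
    using own_inj[of i] D by (simp add: inj_on_image_Int[symmetric])
  moreover have "own ` Dd b \<inter> X = {}" using E(2) XE D by blast
  ultimately have "own ` Dd b \<inter> (X \<union> own ` (\<Union>b\<in>X. Dd b)) = {}" by blast
  from closed_exchange[OF t'(2) _ _ cPD this, of i] D
  have 1: "preach A N B w (t' + 2 * card (Dd b)) (P \<union> Dd b) (X \<union> own ` (\<Union>b\<in>X. Dd b) \<union> own ` Dd b) g" by blast
  have 2: "preach A N B w (Suc (t' + 2 * card (Dd b))) (P \<union> Dd b) (insert b (X \<union> own ` (\<Union>b\<in>X. Dd b) \<union> own ` Dd b)) (g + 1)"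
  proof (rule preach.add[OF 1])
    have "b \<notin> own ` Lay i" using E(2) b by blast
    moreover have "(\<Union>b\<in>X. Dd b) \<subseteq> Lay i" using Dd XE by blast
    ultimately show "b \<in> B - (X \<union> own ` (\<Union>b\<in>X. Dd b) \<union> own ` Dd b)" using b E(1) D by blast
    show "N b \<subseteq> P \<union> Dd b" using add.hyps(3) D by blast
  qed
  have "insert b (X \<union> own ` (\<Union>b\<in>X. Dd b) \<union> own ` Dd b) = insert b X \<union> own ` (\<Union>b\<in>insert b X. Dd b)" by auto
  with preach.drop[OF 2, of P] have "preach A N B w (Suc (t' + 2 * card (Dd b))) P (insert b X \<union> own ` (\<Union>b\<in>insert b X. Dd b)) (g + 1)"
    by simp
  moreover have "Suc (t' + 2 * card (Dd b)) \<le> Suc t * (2 * w1 + 1)" using t'(1) D by simp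
  ultimately show ?case by blast
qed

text \<open>All layers lie in \<open>A\<close>, so they cannot grow by more than the fraction
  \<epsilon> of \<open>A\<close> at each of the first 1/\<epsilon> (rounded up) steps.\<close>

lemma Lay_stop:
  fixes \<epsilon> :: real
  assumes "0 < \<epsilon>"
  shows "\<exists>i < nat \<lceil>1 / \<epsilon>\<rceil>. real (card (Lay (Suc i))) \<le> card (Lay i) + \<epsilon> * card A"
proof (rule ccontr)
  let ?m = "nat \<lceil>1 / \<epsilon>\<rceil>"
  assume "\<not> ?thesis"
  then have st: "card (Lay i) + \<epsilon> * card A < real (card (Lay (Suc i)))" if "i < ?m" for i using that by (meson not_le)
  have "i * (\<epsilon> * card A) + of_bool (0 < i) \<le> (if i = 0 then 0 else real (card (Lay i)) + 1) \<and> i * (\<epsilon> * card A) \<le> real (card (Lay i))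
    \<and> (0 < i \<longrightarrow> i * (\<epsilon> * card A) < real (card (Lay i)))" if "i \<le> ?m" for i
    using that
  proof (induction i)
    case (Suc i)
    then have "i * (\<epsilon> * card A) \<le> real (card (Lay i))" "i < ?m" by auto
    with st[of i] have "i * (\<epsilon> * card A) + \<epsilon> * card A < real (card (Lay (Suc i)))" by linarith
    then show ?case by (simp add: algebra_simps)
  qed simp
  from this[of ?m] have "0 < ?m \<longrightarrow> ?m * (\<epsilon> * card A) < real (card (Lay ?m))" by simp
  moreover have "0 < ?m" using assms by simp
  moreover have "real (card (Lay ?m)) \<le> card A" using card_mono[OF finA Lay_A] by simp
  moreover have "real (card A) \<le> ?m * (\<epsilon> * card A)"
  proof -
    have "1 / \<epsilon> \<le> ?m" by linarith
    then have "1 \<le> ?m * \<epsilon>" using pos_divide_le_eq[OF assms, of 1 "real ?m"] by blast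
    then have "1 * real (card A) \<le> ?m * \<epsilon> * card A" by (intro mult_right_mono) auto
    then show ?thesis by (simp add: mult.assoc)
  qed
  ultimately show False by linarith
qed

text \<open>Let x1, x2, x3 be the numbers of sets with at most one, exactly two, at least three
  conflicts outside K, the layer where growth stops. Without an improvement, ownership gives x1
  \<le> |K| + \<epsilon>|A|, sparsity gives x2 \<le> (1+\<epsilon>)|A-K| + (k-2)|K|, and counting
  incidences gives 2 x2 + 3 x3 \<le> k |A-K|. Three times the first plus the other two is 3|B| \<le>
  (k+1+4\<epsilon>)|A|.\<close>

lemma improvement_exists:
  fixes \<epsilon> :: real
  assumes \<epsilon>: "0 < \<epsilon>" and i: "real (card (Lay (Suc i))) \<le> card (Lay i) + \<epsilon> * card A"
    and big: "(real k + 1 + 4 * \<epsilon>) * real (card A) < 3 * real (card B)"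
    and w: "(k + 1) ^ Suc i * k + 8 \<le> w" and T: "real (card A) < (1 + \<epsilon>) ^ T"
  shows "\<exists>t P X. t \<le> (8 * T + 3) * (2 * w + 1) \<and> preach A N B w t P X 1"
proof (rule ccontr)
  assume contra: "\<not> ?thesis"
  define K where "K = Lay i"
  define w1 where "w1 = (k + 1) ^ Suc i * k"
  have KA: "K \<subseteq> A" "finite K" using Lay_A finLay by (auto simp: K_def)
  have no: "\<not> (\<exists>t P X. t \<le> 2 * w + 1 \<and> preach A N B w t P X 1)"
  proof -
    have "1 * (2 * w + 1) \<le> (8 * T + 3) * (2 * w + 1)" by (intro mult_le_mono1) simp
    then have "2 * w + 1 \<le> (8 * T + 3) * (2 * w + 1)" by (simp only: mult_1)
    then show ?thesis using contra le_trans by blast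
  qed
  define B01 where "B01 = {b\<in>B. card (N b - K) \<le> 1}"
  define E2 where "E2 = {b\<in>B. card (N b - K) = 2}"
  \<comment> \<open>A single conflict outside \<open>K\<close> belongs to the next layer by
    definition, so \<open>Lay (Suc i)\<close> covers the whole set.\<close>
  have sub: "B01 \<subseteq> own ` Lay (Suc i)"
  proof
    fix b assume "b \<in> B01"
    then have b: "b \<in> B" "card (N b - K) \<le> 1" by (auto simp: B01_def)
    have "N b \<subseteq> Lay (Suc i)"
    proof (cases "N b - K = {}")
      case True
      then show ?thesis using Lay_mono[of i "Suc i"] by (auto simp: K_def)
    next
      case False
      then have "card (N b - K) = 1" using b finN[OF b(1)] by (simp add: Suc_leI card_gt_0_iff le_antisym)
      then obtain a where a: "N b - K = {a}" by (auto simp: card_1_singleton_iff)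
      then have "a \<in> Lay (Suc i)" using N[OF b(1)] b(1) by (auto simp: K_def)
      then show ?thesis using a Lay_mono[of i "Suc i"] by (auto simp: K_def)
    qed
    then show "b \<in> own ` Lay (Suc i)" by (intro covered_is_owned[OF no _ b(1)]) (use w in auto)
  qed
  have cB01: "card B01 \<le> card (Lay (Suc i))"
    using card_mono[OF _ sub] card_image_le[of "Lay (Suc i)" own] finLay by (meson finite_imageI le_trans)
  have oK: "own ` K \<inter> E2 = {}"
  proof -
    have "card (N (own a) - K) = 0" if "a \<in> K" for a
      using own_Lay[of a i] that by (simp add: K_def Diff_eq_empty_iff[THEN iffD2])
    then show ?thesis by (auto simp: E2_def)
  qed
  \<comment> \<open>Lifting needs edges with disjoint closed sets in \<open>K\<close>. Closed sets
    can be kept inside the components of the hypergraph formed by the owners' conflicts, so it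
    suffices to use at most one edge per component.\<close>
  obtain col :: "'a \<Rightarrow> 'a" where mono: "\<forall>a\<in>K. \<forall>x\<in>N (own a). \<forall>y\<in>N (own a). col x = col y"
    and cls: "\<forall>c. card {x\<in>K. col x = c} \<le> 1 + (\<Sum>a\<in>{a\<in>K. N (own a) \<subseteq> {x\<in>K. col x = c}}. card (N (own a)) - 1)"
  proof -
    have "N (own a) \<subseteq> K \<and> N (own a) \<noteq> {}" if "a \<in> K" for a
      using own_Lay own that by (fastforce simp: K_def)
    from hyperedge_classes[OF KA(2) KA(2), of "\<lambda>a. N (own a)", OF this] show ?thesis using that by blast
  qed
  have colo: "col x = col a" if "a \<in> K" "x \<in> N (own a)" for a x
  proof -
    have "a \<in> N (own a)" using own[of a i] that(1) by (simp add: K_def)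
    then show ?thesis using mono that by blast
  qed
  define Kc where "Kc c = {x\<in>K. col x = c}" for c
  define Tc where "Tc c = {b\<in>E2. N b \<inter> Kc c \<noteq> {}}" for c
  have finE2: "finite E2" using finB by (simp add: E2_def)
  \<comment> \<open>A component with v elements has v owners, and connectivity makes the sizes of
    their conflict sets sum up to at least 2 v - 1. At most k v incidences are available, which
    leaves at most (k - 2) v + 1 for edges.\<close>
  have Tc_le: "card (Tc c) + 2 * card (Kc c) \<le> k * card (Kc c) + 1" for c
  proof -
    have fin: "finite (Kc c)" "finite (Tc c)" using KA finE2 by (auto simp: Kc_def Tc_def)
    have KcK: "Kc c \<subseteq> Lay i" by (auto simp: Kc_def K_def)
    have NK: "N (own a) \<subseteq> Kc c" if a: "a \<in> Kc c" for a
    proof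
      fix x assume x: "x \<in> N (own a)"
      have "a \<in> K" "col a = c" using a by (simp_all add: Kc_def)
      then show "x \<in> Kc c" using colo[OF _ x] own_Lay[of a i] x by (auto simp: Kc_def K_def)
    qed
    have "{a\<in>K. N (own a) \<subseteq> {x\<in>K. col x = c}} = Kc c"
    proof
      show "{a\<in>K. N (own a) \<subseteq> {x\<in>K. col x = c}} \<subseteq> Kc c"
      proof
        fix a assume a: "a \<in> {a\<in>K. N (own a) \<subseteq> {x\<in>K. col x = c}}"
        then have "a \<in> N (own a)" using own[of a i] by (simp add: K_def)
        then show "a \<in> Kc c" using a by (auto simp: Kc_def)
      qed
      show "Kc c \<subseteq> {a\<in>K. N (own a) \<subseteq> {x\<in>K. col x = c}}"
        using NK by (auto simp: Kc_def)
    qed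
    then have "card (Kc c) \<le> 1 + (\<Sum>a\<in>Kc c. card (N (own a)) - 1)"
      using spec[OF cls, of c] by (simp add: Kc_def)
    moreover have "(\<Sum>a\<in>Kc c. card (N (own a)) - 1) + card (Kc c) = (\<Sum>a\<in>Kc c. card (N (own a)))"
    proof -
      have "0 < card (N (own a))" if "a \<in> Kc c" for a
        using own[of a i] finN that KcK by (auto simp: card_gt_0_iff)
      then have "(\<Sum>a\<in>Kc c. card (N (own a))) = (\<Sum>a\<in>Kc c. (card (N (own a)) - 1) + 1)"
        by (intro sum.cong) auto
      then show ?thesis by (simp only: sum.distrib card_eq_sum)
    qed
    moreover have "(\<Sum>a\<in>Kc c. card (N (own a))) + card (Tc c) \<le> k * card (Kc c)"
    proof -
      have inj: "inj_on own (Kc c)" using own_inj KcK by (rule inj_on_subset)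
      have "(\<Sum>a\<in>Kc c. card (N (own a))) = (\<Sum>a\<in>Kc c. card (N (own a) \<inter> Kc c))"
        using NK by (intro sum.cong) (auto simp: Int_absorb2)
      also have "\<dots> = (\<Sum>b\<in>own ` Kc c. card (N b \<inter> Kc c))"
        by (simp add: sum.reindex[OF inj])
      finally have 1: "(\<Sum>a\<in>Kc c. card (N (own a))) = (\<Sum>b\<in>own ` Kc c. card (N b \<inter> Kc c))" .
      have 2: "card (Tc c) \<le> (\<Sum>b\<in>Tc c. card (N b \<inter> Kc c))"
      proof -
        have "1 \<le> card (N b \<inter> Kc c)" if "b \<in> Tc c" for b
          using that fin by (simp add: Tc_def Suc_le_eq card_gt_0_iff)
        then have "(\<Sum>b\<in>Tc c. 1) \<le> (\<Sum>b\<in>Tc c. card (N b \<inter> Kc c))" by (intro sum_mono) auto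
        then show ?thesis by simp
      qed
      have dj: "own ` Kc c \<inter> Tc c = {}" using oK by (auto simp: Kc_def Tc_def)
      have "(\<Sum>b\<in>own ` Kc c. card (N b \<inter> Kc c)) + (\<Sum>b\<in>Tc c. card (N b \<inter> Kc c))
        = (\<Sum>b\<in>own ` Kc c \<union> Tc c. card (N b \<inter> Kc c))"
        using fin dj by (intro sum.union_disjoint[symmetric]) auto
      also have "\<dots> \<le> k * card (Kc c)"
        by (rule double_count) (use KA own KcK in \<open>auto simp: Kc_def Tc_def E2_def\<close>)
      finally show ?thesis using 1 2 by linarith
    qed
    ultimately show ?thesis by linarith
  qed
  \<comment> \<open>One edge is kept per component, so a component with v elements loses at most (k
    - 2) v. An edge survives in \<open>E\<close> only if it is the kept one in all components that
    it meets.\<close>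
  define rp where "rp c = (SOME b. b \<in> Tc c)" for c
  define E where "E = {b\<in>E2. \<forall>a\<in>N b \<inter> K. b = rp (col a)}"
  have EE2: "E \<subseteq> E2" by (auto simp: E_def)
  have del: "card (E2 - E) \<le> (k - 2) * card K"
  proof -
    have "E2 - E \<subseteq> (\<Union>c\<in>col ` K. Tc c - {rp c})"
      by (auto simp: E_def Tc_def Kc_def)
    then have "card (E2 - E) \<le> card (\<Union>c\<in>col ` K. Tc c - {rp c})"
      using KA finE2 by (intro card_mono) (auto simp: Tc_def)
    also have "\<dots> \<le> (\<Sum>c\<in>col ` K. card (Tc c - {rp c}))" using KA by (intro card_UN_le) auto
    also have "\<dots> \<le> (\<Sum>c\<in>col ` K. (k - 2) * card (Kc c))"
    proof (rule sum_mono)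
      fix c
      show "card (Tc c - {rp c}) \<le> (k - 2) * card (Kc c)"
      proof (cases "Tc c = {}")
        case False
        then have "rp c \<in> Tc c" unfolding rp_def by (metis ex_in_conv someI)
        then have "card (Tc c - {rp c}) = card (Tc c) - 1" by simp
        then show ?thesis using Tc_le[of c] by (simp add: diff_mult_distrib)
      qed simp
    qed
    also have "\<dots> = (k - 2) * card K"
    proof -
      have "card K = (\<Sum>c\<in>col ` K. card (Kc c))"
        unfolding Kc_def using sum.image_gen[OF KA(2), of "\<lambda>_. 1::nat" col] by simp
      then show ?thesis by (simp add: sum_distrib_left)
    qed
    finally show ?thesis .
  qed
  have "\<exists>D. N b \<inter> K \<subseteq> D \<and> D \<subseteq> K \<and> (\<forall>a\<in>D. N (own a) \<subseteq> D) \<and> card D \<le> w1 \<and> col ` D \<subseteq> col ` (N b \<inter> K)"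
    if b: "b \<in> E" for b
  proof -
    obtain D where D: "N b \<inter> K \<subseteq> D" "D \<subseteq> K" "\<forall>a\<in>D. N (own a) \<subseteq> D" "card D \<le> (k + 1) ^ i * card (N b \<inter> K)"
      using closure[of "N b \<inter> K" i] by (auto simp: K_def)
    \<comment> \<open>Cutting the closure down to the colours of the conflicts of \<open>b\<close>
      keeps it closed, because the conflicts of an owner have one colour.\<close>
    let ?D = "{a\<in>D. col a \<in> col ` (N b \<inter> K)}"
    have bB: "b \<in> B" using b by (auto simp: E_def E2_def)
    have "card ?D \<le> card D" using D KA finite_subset by (intro card_mono) auto
    also have "\<dots> \<le> (k + 1) ^ i * k"
    proof -
      have "card (N b \<inter> K) \<le> k" using N[OF bB] card_mono[OF finN[OF bB], of "N b \<inter> K"] by simp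
      then show ?thesis using D(4) by (meson le_trans mult_le_mono2)
    qed
    also have "\<dots> \<le> w1" unfolding w1_def by (intro mult_le_mono1 power_increasing) auto
    finally have "card ?D \<le> w1" .
    moreover have "\<forall>a\<in>?D. N (own a) \<subseteq> ?D"
    proof (intro ballI subsetI)
      fix a x assume a: "a \<in> ?D" and x: "x \<in> N (own a)"
      then have "a \<in> K" "x \<in> D" using D by auto
      then show "x \<in> ?D" using colo[OF _ x] a by simp
    qed
    moreover have "N b \<inter> K \<subseteq> ?D" "?D \<subseteq> K" "col ` ?D \<subseteq> col ` (N b \<inter> K)" using D by auto
    ultimately show ?thesis by blast
  qed
  then obtain Dd where Dd: "\<And>b. b \<in> E \<Longrightarrow> N b \<inter> K \<subseteq> Dd b \<and> Dd b \<subseteq> K \<and> (\<forall>a\<in>Dd b. N (own a) \<subseteq> Dd b) \<and>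
      card (Dd b) \<le> w1 \<and> col ` Dd b \<subseteq> col ` (N b \<inter> K)" by metis
  have disj: "Dd b \<inter> Dd b' = {}" if b: "b \<in> E" "b' \<in> E" "b \<noteq> b'" for b b'
  proof (rule ccontr)
    assume "Dd b \<inter> Dd b' \<noteq> {}"
    then obtain x where x: "x \<in> Dd b" "x \<in> Dd b'" by blast
    have "col x \<in> col ` (N b \<inter> K)" "col x \<in> col ` (N b' \<inter> K)" using Dd[OF b(1)] Dd[OF b(2)] x by blast+
    moreover have "y = rp (col x)" if y: "y \<in> E" "col x \<in> col ` (N y \<inter> K)" for y
    proof -
      obtain a where "a \<in> N y \<inter> K" "col x = col a" using y(2) by blast
      then show ?thesis using y(1) by (simp add: E_def)
    qed
    ultimately have "b = rp (col x)" "b' = rp (col x)" using b by blast+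
    then show False using b(3) by simp
  qed
  have cA: "card A = card K + card (A - K)"
    using card_Diff_subset[OF KA(2,1)] card_mono[OF finA KA(1)] by simp
  \<comment> \<open>With more edges \<open>dense_graph_process\<close> would apply to the graph
    outside \<open>K\<close>, and its process, lifted, would be an improvement.\<close>
  have cE: "real (card E) \<le> (1 + \<epsilon>) * card (A - K)"
  proof (rule ccontr)
    assume n: "\<not> ?thesis"
    have ends: "N e - K \<subseteq> A - K \<and> card (N e - K) = 2" if "e \<in> E" for e
      using that N by (auto simp: E_def E2_def)
    have "A - K \<noteq> {}"
    proof
      assume z: "A - K = {}"
      have "E = {}"
      proof (rule ccontr)
        assume "E \<noteq> {}"
        then obtain e where e: "N e - K = {}" "card (N e - K) = 2" using ends z by blast
        from e(2)[unfolded e(1)] show False by simp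
      qed
      then show False using n z by simp
    qed
    moreover have "real (card (A - K)) < (1 + \<epsilon>) ^ T"
      using T cA by linarith
    moreover have "finite (A - K)" "finite E" using finA finE2 EE2 finite_subset by auto
    moreover have "(1 + \<epsilon>) * card (A - K) \<le> card E" using n by simp
    ultimately obtain t P X where t: "t \<le> 8 * T + 3" "preach (A - K) (\<lambda>b. N b - K) E 8 t P X 1"
      using dense_graph_process[of "A - K" E "\<lambda>b. N b - K" \<epsilon> T] ends \<epsilon> by blast
    have "\<exists>t' \<le> t * (2 * w1 + 1). preach A N B w t' P (X \<union> own ` (\<Union>b\<in>X. Dd b)) 1"
    proof (rule lift_process[where i = i and E = E and ?w2.0 = 8])
      show "E \<subseteq> B" using EE2 by (auto simp: E2_def)
      show "E \<inter> own ` Lay i = {}" using oK EE2 by (auto simp: K_def)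
      show "8 + w1 \<le> w" using w by (simp add: w1_def)
      show "N b \<inter> Lay i \<subseteq> Dd b \<and> Dd b \<subseteq> Lay i \<and> (\<forall>a\<in>Dd b. N (own a) \<subseteq> Dd b) \<and> card (Dd b) \<le> w1" if "b \<in> E" for b
        using Dd[OF that] by (simp add: K_def)
      show "preach (A - Lay i) (\<lambda>b. N b - Lay i) E 8 t P X 1" using t(2) by (simp add: K_def)
    qed (rule disj)
    then obtain t' where t': "t' \<le> t * (2 * w1 + 1)" "preach A N B w t' P (X \<union> own ` (\<Union>b\<in>X. Dd b)) 1" by blast
    have "t * (2 * w1 + 1) \<le> (8 * T + 3) * (2 * w + 1)"
      using t(1) w by (intro mult_le_mono) (auto simp: w1_def)
    then show False using contra t' le_trans by blast
  qed
  define E3 where "E3 = B - B01 - E2"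
  have fin: "finite B01" "finite E3" using finB by (auto simp: B01_def E3_def)
  have dj: "B01 \<inter> E2 = {}" by (auto simp: B01_def E2_def)
  have cB: "card B = card B01 + card E2 + card E3"
  proof -
    have "B = (B01 \<union> E2) \<union> E3" by (auto simp: E3_def B01_def E2_def)
    moreover have "card ((B01 \<union> E2) \<union> E3) = card (B01 \<union> E2) + card E3"
      using fin finE2 by (intro card_Un_disjoint) (auto simp: E3_def)
    ultimately show ?thesis using card_Un_disjoint[OF fin(1) finE2 dj] by simp
  qed
  have edges: "2 * card E2 + 3 * card E3 \<le> k * card (A - K)"
  proof -
    have NI: "N b \<inter> (A - K) = N b - K" if "b \<in> B" for b using N[OF that] by auto
    have "2 * card E2 = (\<Sum>b\<in>E2. card (N b \<inter> (A - K)))"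
      using NI by (simp add: E2_def)
    moreover have "3 * card E3 \<le> (\<Sum>b\<in>E3. card (N b \<inter> (A - K)))"
    proof -
      have "3 \<le> card (N b \<inter> (A - K))" if "b \<in> E3" for b
        using that NI[of b] by (auto simp: E3_def B01_def E2_def)
      then have "(\<Sum>b\<in>E3. 3) \<le> (\<Sum>b\<in>E3. card (N b \<inter> (A - K)))" by (intro sum_mono) auto
      then show ?thesis by simp
    qed
    moreover have "(\<Sum>b\<in>E2. card (N b \<inter> (A - K))) + (\<Sum>b\<in>E3. card (N b \<inter> (A - K))) = (\<Sum>b\<in>E2 \<union> E3. card (N b \<inter> (A - K)))"
      using fin finE2 by (intro sum.union_disjoint[symmetric]) (auto simp: E3_def)
    moreover have "(\<Sum>b\<in>E2 \<union> E3. card (N b \<inter> (A - K))) \<le> k * card (A - K)"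
      by (rule double_count) (auto simp: E2_def E3_def)
    ultimately show ?thesis by linarith
  qed
  have cE2: "card E2 = card E + card (E2 - E)"
    using card_Diff_subset[OF finite_subset[OF EE2 finE2] EE2] card_mono[OF finE2 EE2] by simp
  have "real (card E2) \<le> (1 + \<epsilon>) * card (A - K) + (real k - 2) * card K"
  proof -
    have "real ((k - 2) * card K) = (real k - 2) * card K" using k by (simp add: of_nat_diff)
    then have "real (card (E2 - E)) \<le> (real k - 2) * card K" using del by (metis of_nat_le_iff)
    then show ?thesis using cE cE2 by simp
  qed
  moreover have "\<epsilon> * card (A - K) \<le> \<epsilon> * card A" using \<epsilon> cA by simp
  moreover have "2 * real (card E2) + 3 * real (card E3) \<le> real k * card (A - K)"
    using edges by (metis (mono_tags, lifting) of_nat_add of_nat_le_iff of_nat_mult of_nat_numeral)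
  moreover have "real (card B01) \<le> card K + \<epsilon> * card A" using cB01 i by (simp add: K_def)
  moreover have "real (card B) = card B01 + card E2 + card E3" using cB by simp
  moreover have "real (card A) = card K + card (A - K)" using cA by simp
  ultimately have "3 * real (card B) \<le> (real k + 1 + 4 * \<epsilon>) * real (card A)"
    by (simp add: algebra_simps)
  then show False using big by linarith
qed

end

text \<open>Passing to \<epsilon>/4 absorbs the error 4 \<epsilon> of the counting. The number of
  layers, and hence \<open>w\<close>, depends on \<epsilon> and \<open>k\<close> alone; with 2 < (1
  + \<delta>) ^ c, the growth argument can use T = c m.\<close>

lemma bounded_improvement:
  fixes \<epsilon> :: real
  assumes \<epsilon>: "0 < \<epsilon>" and k: "2 \<le> k"
  shows "\<exists>w C. \<forall>(A :: 'a set) (B :: 'b set) N m. conflict A B N k \<longrightarrow> (real k + 1 + \<epsilon>) * real (card A) < 3 * real (card B) \<longrightarrow>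
    card A < 2 ^ m \<longrightarrow> (\<exists>t P X. t \<le> C * (m + 1) \<and> preach A N B w t P X 1)"
proof -
  define \<delta> where "\<delta> = \<epsilon> / 4"
  have \<delta>: "0 < \<delta>" using \<epsilon> by (simp add: \<delta>_def)
  define M where "M = nat \<lceil>1 / \<delta>\<rceil>"
  define w where "w = (k + 1) ^ M * k + 8"
  obtain c where c: "2 < (1 + \<delta>) ^ c" using real_arch_pow[of "1 + \<delta>" 2] \<delta> by auto
  define C where "C = (8 * c + 3) * (2 * w + 1)"
  have "\<exists>t P X. t \<le> C * (m + 1) \<and> preach A N B w t P X 1"
    if "conflict A B N k" and big: "(real k + 1 + \<epsilon>) * real (card A) < 3 * real (card B)" and m: "card A < 2 ^ m"
    for A :: "'a set" and B :: "'b set" and N m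
  proof -
    interpret conflict A B N k by fact
    obtain i where i: "i < M" "real (card (Lay (Suc i))) \<le> card (Lay i) + \<delta> * card A"
      using Lay_stop[OF \<delta>] by (auto simp: M_def)
    have "\<exists>t P X. t \<le> (8 * (c * m) + 3) * (2 * w + 1) \<and> preach A N B w t P X 1"
    proof (rule improvement_exists[OF \<delta> i(2)])
      show "(real k + 1 + 4 * \<delta>) * real (card A) < 3 * real (card B)" using big by (simp add: \<delta>_def)
      have "(k + 1) ^ Suc i \<le> (k + 1) ^ M" using i by (intro power_increasing) auto
      then show "(k + 1) ^ Suc i * k + 8 \<le> w" unfolding w_def by (intro add_mono mult_le_mono1) auto
      have "real (card A) < 2 ^ m" using m by (metis of_nat_less_iff of_nat_numeral of_nat_power)
      also have "\<dots> \<le> ((1 + \<delta>) ^ c) ^ m" using c by (intro power_mono) auto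
      finally show "real (card A) < (1 + \<delta>) ^ (c * m)" by (simp add: power_mult)
    qed
    moreover have "(8 * (c * m) + 3) * (2 * w + 1) \<le> C * (m + 1)"
    proof -
      have "8 * (c * m) + 3 \<le> (8 * c + 3) * (m + 1)" by (simp add: algebra_simps)
      then have "(8 * (c * m) + 3) * (2 * w + 1) \<le> ((8 * c + 3) * (m + 1)) * (2 * w + 1)" by (rule mult_le_mono1)
      then show ?thesis by (simp only: C_def mult_ac)
    qed
    ultimately show ?thesis using le_trans by blast
  qed
  note claim = this
  show ?thesis
    by (rule exI[of _ w], rule exI[of _ C], intro allI impI, rule claim)
qed

section \<open>Hash functions described by few bits\<close>

text \<open>Multiply-shift hashing of \<open>w\<close>-bit keys to \<open>c\<close> bits; only odd multipliers are considered.\<close>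

definition mshift :: "nat \<Rightarrow> nat \<Rightarrow> nat \<Rightarrow> nat \<Rightarrow> nat" where
  "mshift w c a x = (a * x mod 2 ^ w) * 2 ^ c div 2 ^ w"

lemma mshift_div: "c \<le> w \<Longrightarrow> mshift w c a x = (a * x mod 2 ^ w) div 2 ^ (w - c)"
proof -
  assume "c \<le> w"
  then have "(2::nat) ^ w = 2 ^ (w - c) * 2 ^ c" by (simp flip: power_add)
  then show ?thesis unfolding mshift_def by (metis div_mult_mult2 power_not_zero zero_neq_numeral)
qed

lemma mshift_less: "mshift w c a x < 2 ^ c"
proof -
  have "(a * x mod 2 ^ w) * 2 ^ c < 2 ^ c * 2 ^ w" by simp
  then show ?thesis unfolding mshift_def by (rule less_mult_imp_div_less)
qed

lemma odd_part: "0 < (z::nat) \<Longrightarrow> \<exists>s z'. z = 2 ^ s * z' \<and> odd z'"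
proof (induction z rule: less_induct)
  case (less z)
  show ?case
  proof (cases "even z")
    case True
    then obtain y where y: "z = 2 * y" by blast
    then have "y < z" "0 < y" using less.prems by auto
    from less.IH[OF this] obtain s z' where "y = 2 ^ s * z'" "odd z'" by blast
    then show ?thesis using y by (intro exI[of _ "Suc s"] exI[of _ z']) simp
  next
    case False
    then show ?thesis by (intro exI[of _ 0] exI[of _ z]) simp
  qed
qed

text \<open>The odd part of \<open>z\<close> is invertible, so multipliers with the same product
  agree modulo 2 ^ (w - s); they differ only in the quotient by this modulus, which has 2 ^ s
  values.\<close>

lemma mult_fiber:
  fixes z z' :: nat
  assumes z: "z = 2 ^ s * z'" "odd z'" "s \<le> w"
  shows "card {a::nat. a < 2 ^ w \<and> a * z mod 2 ^ w = v} \<le> 2 ^ s"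
proof -
  let ?F = "{a::nat. a < 2 ^ w \<and> a * z mod 2 ^ w = v}"
  let ?m = "2 ^ (w - s) :: nat"
  have W: "(2::nat) ^ w = 2 ^ s * ?m" using z(3) by (simp flip: power_add)
  have cong: "a mod ?m = b mod ?m" if "a \<in> ?F" "b \<in> ?F" for a b
  proof -
    have "(int a * int z) mod 2 ^ w = (int b * int z) mod 2 ^ w"
      using that by (metis (mono_tags, lifting) mem_Collect_eq of_nat_mult of_nat_numeral of_nat_power zmod_int)
    then have "2 ^ w dvd (int a - int b) * int z" by (simp add: mod_eq_dvd_iff left_diff_distrib)
    then have "2 ^ s * 2 ^ (w - s) dvd 2 ^ s * ((int a - int b) * int z')"
      using z W by (simp add: ac_simps flip: power_add)
    then have "2 ^ (w - s) dvd (int a - int b) * int z'" by simp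
    moreover have "coprime (2 ^ (w - s)) (int z')" using z(2) by simp
    ultimately have "2 ^ (w - s) dvd int a - int b" by (simp add: coprime_dvd_mult_left_iff)
    then have "int a mod 2 ^ (w - s) = int b mod 2 ^ (w - s)" by (simp add: mod_eq_dvd_iff)
    then show ?thesis by (metis of_nat_eq_iff of_nat_numeral of_nat_power zmod_int)
  qed
  have "inj_on (\<lambda>a. a div ?m) ?F"
  proof (rule inj_onI)
    fix a b assume "a \<in> ?F" "b \<in> ?F" "a div ?m = b div ?m"
    then show "a = b" using cong[of a b] by (metis div_mult_mod_eq)
  qed
  moreover have "(\<lambda>a. a div ?m) ` ?F \<subseteq> {..<2 ^ s}"
    using W by (auto intro!: less_mult_imp_div_less)
  ultimately show ?thesis using card_inj_on_le[of "\<lambda>a. a div ?m" ?F "{..<2 ^ s}"] by simp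
qed

text \<open>If two keys collide, the product of \<open>a\<close> with their difference is within V =
  2 ^ (w - c) of 0 modulo 2 ^ w. It is nonzero because \<open>a\<close> is odd, and a multiple of 2
  ^ s. There are at most 2 V / 2 ^ s such values, each attained by at most 2 ^ s
  multipliers.\<close>

lemma mshift_collisions_less:
  assumes c: "c \<le> w" and xy: "y < x" "x < 2 ^ w"
  shows "card {a::nat. a < 2 ^ w \<and> odd a \<and> mshift w c a x = mshift w c a y} \<le> 2 * 2 ^ (w - c)"
proof -
  define W V :: nat where "W = 2 ^ w" and "V = 2 ^ (w - c)"
  define z where "z = x - y"
  have z0: "0 < z" "z < W" using xy by (auto simp: z_def W_def)
  obtain s z' where z: "z = 2 ^ s * z'" "odd z'" using odd_part[OF z0(1)] by blast
  have "0 < z'" using z(2) by (simp add: odd_pos)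
  then have "2 ^ s \<le> z" using z by simp
  then have "(2::nat) ^ s < 2 ^ w" using z0 W_def by linarith
  then have sw: "s < w" by simp
  have VW: "V \<le> W" by (simp add: V_def W_def)
  have sW: "2 ^ s dvd W" using sw by (simp add: W_def le_imp_power_dvd)
  define Vs where "Vs = {v. 0 < v \<and> v < W \<and> 2 ^ s dvd v \<and> (v < V \<or> W < v + V)}"
  have sub: "{a. a < W \<and> odd a \<and> mshift w c a x = mshift w c a y} \<subseteq> (\<Union>v\<in>Vs. {a. a < W \<and> a * z mod W = v})"
  proof
    fix a assume "a \<in> {a. a < W \<and> odd a \<and> mshift w c a x = mshift w c a y}"
    then have a: "a < W" "odd a" and eq: "(a * x mod W) div V = (a * y mod W) div V"
      using c by (auto simp: mshift_div W_def V_def)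
    define p q where "p = a * x mod W" and "q = a * y mod W"
    have pq: "p < W" "q < W" by (auto simp: p_def q_def W_def)
    have pqV: "p < q + V" "q < p + V"
    proof -
      have e: "p div V = q div V" using eq by (simp add: p_def q_def)
      have "V * (p div V) + p mod V = p" by (rule mult_div_mod_eq)
      moreover have "V * (p div V) + q mod V = q" unfolding e by (rule mult_div_mod_eq)
      moreover have "p mod V < V" "q mod V < V" by (simp_all add: V_def)
      ultimately show "p < q + V" "q < p + V" by linarith+
    qed
    have "int (a * z mod W) = (int p - int q) mod int W"
      using xy by (simp add: p_def q_def z_def zmod_int of_nat_diff right_diff_distrib mod_diff_eq)
    then have m: "a * z mod W = (if q \<le> p then p - q else W + p - q)"
    proof (cases "q \<le> p")
      case True
      then have "(int p - int q) mod int W = int (p - q)" using pq by (simp add: of_nat_diff)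
      then show ?thesis using \<open>int (a * z mod W) = _\<close> True by simp
    next
      case False
      have "(int p - int q) mod int W = (int p - int q + int W) mod int W" by simp
      also have "int p - int q + int W = int (W + p - q)" using pq by (simp add: of_nat_diff)
      also have "\<dots> mod int W = int (W + p - q)"
      proof -
        have "W + p - q < W" using False pq by linarith
        then show ?thesis by (simp only: zmod_int[symmetric] mod_less)
      qed
      finally show ?thesis using \<open>int (a * z mod W) = _\<close> False by simp
    qed
    have nz: "a * z mod W \<noteq> 0"
    proof
      assume "a * z mod W = 0"
      then have "2 ^ w dvd a * z" by (simp add: W_def mod_eq_0_iff_dvd)
      moreover have "coprime (2 ^ w) a" using a by simp
      ultimately have "2 ^ w dvd z" by (simp add: coprime_dvd_mult_right_iff)
      then show False using z0 W_def dvd_imp_le by fastforce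
    qed
    have "2 ^ s dvd a * z mod W" using sW z by (simp add: dvd_mod)
    then have "a * z mod W \<in> Vs"
      using nz m pq pqV VW by (auto simp: Vs_def W_def[symmetric] split: if_splits)
    then show "a \<in> (\<Union>v\<in>Vs. {a. a < W \<and> a * z mod W = v})" using a by blast
  qed
  have "card Vs * 2 ^ s \<le> 2 * V"
  proof (cases "V \<le> 2 ^ s")
    case True
    \<comment> \<open>A nonzero multiple of 2 ^ s is at least 2 ^ s, hence at least V, away from 0
      on both sides.\<close>
    have "Vs = {}"
    proof (rule equals0I)
      fix v assume v: "v \<in> Vs"
      then have "v < V \<or> W - v < V" "0 < W - v" "0 < v" by (auto simp: Vs_def)
      moreover have "2 ^ s dvd v" "2 ^ s dvd W - v" using v sW by (auto simp: Vs_def dvd_diff_nat)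
      ultimately show False using True dvd_imp_le[of "2 ^ s" v] dvd_imp_le[of "2 ^ s" "W - v"] by linarith
    qed
    then show ?thesis by simp
  next
    case False
    then have "s < w - c" by (simp add: V_def not_le)
    then obtain V' where V': "V = 2 ^ s * V'" unfolding V_def by (metis le_add_diff_inverse less_imp_le power_add)
    have "Vs \<subseteq> (\<lambda>j. 2 ^ s * j) ` {..<V'} \<union> (\<lambda>j. W - 2 ^ s * j) ` {..<V'}"
    proof
      fix v assume v: "v \<in> Vs"
      then consider "v < V" | "W - v < V" "v < W" by (auto simp: Vs_def)
      then show "v \<in> (\<lambda>j. 2 ^ s * j) ` {..<V'} \<union> (\<lambda>j. W - 2 ^ s * j) ` {..<V'}"
      proof cases
        case 1
        obtain j where "v = 2 ^ s * j" using v by (auto simp: Vs_def)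
        then show ?thesis using 1 V' by auto
      next
        case 2
        have "2 ^ s dvd W - v" using v sW by (auto simp: Vs_def dvd_diff_nat)
        then obtain j where j: "W - v = 2 ^ s * j" by blast
        then have "v = W - 2 ^ s * j" "j < V'" using 2 V' by auto
        then show ?thesis by blast
      qed
    qed
    then have "card Vs \<le> card ((\<lambda>j. 2 ^ s * j) ` {..<V'} \<union> (\<lambda>j. W - 2 ^ s * j) ` {..<V'})"
      by (intro card_mono) auto
    also have "\<dots> \<le> V' + V'"
      using card_Un_le[of "(\<lambda>j. 2 ^ s * j) ` {..<V'}" "(\<lambda>j. W - 2 ^ s * j) ` {..<V'}"]
        card_image_le[of "{..<V'}" "\<lambda>j. 2 ^ s * j"] card_image_le[of "{..<V'}" "\<lambda>j. W - 2 ^ s * j"] by simp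
    finally have "card Vs \<le> 2 * V'" by simp
    then show ?thesis using V' by simp
  qed
  moreover have "card {a::nat. a < W \<and> odd a \<and> mshift w c a x = mshift w c a y} \<le> card Vs * 2 ^ s"
  proof -
    have fin: "finite Vs" by (rule finite_subset[of _ "{..<W}"]) (auto simp: Vs_def)
    have "card {a::nat. a < W \<and> odd a \<and> mshift w c a x = mshift w c a y} \<le> card (\<Union>v\<in>Vs. {a. a < W \<and> a * z mod W = v})"
      using sub fin by (intro card_mono) auto
    also have "\<dots> \<le> (\<Sum>v\<in>Vs. card {a::nat. a < W \<and> a * z mod W = v})" using fin by (rule card_UN_le)
    also have "\<dots> \<le> (\<Sum>v\<in>Vs. 2 ^ s)"
      using mult_fiber[OF z] sw by (intro sum_mono) (simp add: W_def)
    finally show ?thesis by simp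
  qed
  ultimately show ?thesis by (simp add: W_def V_def)
qed

lemma mshift_collisions:
  assumes "c \<le> w" "x \<noteq> y" "x < 2 ^ w" "y < 2 ^ w"
  shows "card {a::nat. a < 2 ^ w \<and> odd a \<and> mshift w c a x = mshift w c a y} \<le> 2 * 2 ^ (w - c)"
proof (cases "y < x")
  case True
  then show ?thesis using mshift_collisions_less assms by blast
next
  case False
  then have "x < y" using assms by simp
  then show ?thesis using mshift_collisions_less[of c w x y] assms by (simp add: eq_commute)
qed

lemma card_odd_less: "card {a::nat. a < 2 ^ Suc w \<and> odd a} = (2::nat) ^ w"
proof -
  have "{a::nat. a < 2 ^ Suc w \<and> odd a} = (\<lambda>i. 2 * i + 1) ` {..<(2::nat) ^ w}"
    by (auto elim!: oddE)
  moreover have "inj_on (\<lambda>i. 2 * i + 1) {..<(2::nat) ^ w}" by (auto simp: inj_on_def)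
  ultimately show ?thesis by (simp add: card_image)
qed

definition coll :: "nat \<Rightarrow> nat \<Rightarrow> nat \<Rightarrow> nat set \<Rightarrow> (nat \<times> nat) set" where
  "coll w c a L = {(x, y) \<in> L \<times> L. x \<noteq> y \<and> mshift w c a x = mshift w c a y}"

text \<open>Averaging over the 2 ^ (w - 1) odd multipliers: \<open>coll\<close> consists of ordered
  pairs, and each pair of distinct keys collides for at most 2 * 2 ^ (w - c) of them.\<close>

lemma few_collisions:
  assumes L: "L \<subseteq> {..<2 ^ w}" and c: "c \<le> w" and w: "0 < w"
    and b: "card L * card L * (2 * 2 ^ (w - c)) < 2 ^ (w - 1) * b"
  shows "\<exists>a < 2 ^ w. odd a \<and> card (coll w c a L) < b"
proof (rule ccontr)
  assume "\<not> ?thesis"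
  then have ge: "b \<le> card (coll w c a L)" if "a < 2 ^ w" "odd a" for a using that by (meson not_le)
  have finL: "finite L" using L finite_subset by blast
  let ?O = "{a::nat. a < 2 ^ w \<and> odd a}"
  let ?P = "{(x, y) \<in> L \<times> L. x \<noteq> y}"
  have finP: "finite ?P" using finL by (auto intro: finite_subset[of _ "L \<times> L"])
  have cO: "card ?O = 2 ^ (w - 1)" using card_odd_less[of "w - 1"] w by simp
  have "2 ^ (w - 1) * b = (\<Sum>a\<in>?O. b)" using cO by simp
  also have "\<dots> \<le> (\<Sum>a\<in>?O. card (coll w c a L))" using ge by (intro sum_mono) auto
  also have "\<dots> = (\<Sum>a\<in>?O. \<Sum>p\<in>?P. of_bool (mshift w c a (fst p) = mshift w c a (snd p)))"
  proof (rule sum.cong)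
    fix a
    have "coll w c a L = {p\<in>?P. mshift w c a (fst p) = mshift w c a (snd p)}" by (auto simp: coll_def)
    then show "card (coll w c a L) = (\<Sum>p\<in>?P. of_bool (mshift w c a (fst p) = mshift w c a (snd p)))"
      using sum.inter_filter[OF finP, of "\<lambda>_. 1::nat"] by (simp add: of_bool_def)
  qed simp
  also have "\<dots> = (\<Sum>p\<in>?P. \<Sum>a\<in>?O. of_bool (mshift w c a (fst p) = mshift w c a (snd p)))"
    by (rule sum.swap)
  also have "\<dots> \<le> (\<Sum>p\<in>?P. 2 * 2 ^ (w - c))"
  proof (rule sum_mono)
    fix p assume p: "p \<in> ?P"
    have "(\<Sum>a\<in>?O. of_bool (mshift w c a (fst p) = mshift w c a (snd p)))
      = card {a\<in>?O. mshift w c a (fst p) = mshift w c a (snd p)}"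
      using sum.inter_filter[of ?O "\<lambda>_. 1::nat"] by (simp add: of_bool_def)
    also have "{a\<in>?O. mshift w c a (fst p) = mshift w c a (snd p)}
      = {a. a < 2 ^ w \<and> odd a \<and> mshift w c a (fst p) = mshift w c a (snd p)}" by auto
    also have "card \<dots> \<le> 2 * 2 ^ (w - c)"
      by (rule mshift_collisions[OF c]) (use p L in auto)
    finally show "(\<Sum>a\<in>?O. of_bool (mshift w c a (fst p) = mshift w c a (snd p))) \<le> (2 * 2 ^ (w - c) :: nat)" .
  qed
  also have "\<dots> = card ?P * (2 * 2 ^ (w - c))" by simp
  also have "\<dots> \<le> card L * card L * (2 * 2 ^ (w - c))"
  proof -
    have "card ?P \<le> card (L \<times> L)" using finL by (intro card_mono) auto
    then show ?thesis by (intro mult_le_mono1) (simp add: card_cartesian_product)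
  qed
  finally show False using b by simp
qed

text \<open>At every level a multiplier isolates half of the remaining keys, and the bit mask \<open>K\<close> marks the
  buckets of isolated keys. Table sizes shrink geometrically, hence few bits describe \<open>K\<close>.\<close>

lemma hash_cascade:
  assumes "L \<subseteq> {..<2 ^ w}" "card L * 8 \<le> 2 ^ u" "u \<le> w"
  shows "\<exists>a K col. (\<forall>t. a t < 2 ^ w) \<and> K \<subseteq> {..<2 ^ Suc u} \<and> inj_on col L \<and>
    (\<forall>x\<in>L. \<exists>t\<le>u. col x = 2 ^ t + mshift w t (a t) x \<and> col x \<in> K \<and>
      (\<forall>t'. t < t' \<and> t' \<le> u \<longrightarrow> 2 ^ t' + mshift w t' (a t') x \<notin> K))"
  using assms
proof (induction u arbitrary: L)
  case 0
  then have "card L = 0" by simp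
  moreover have "finite L" using "0.prems"(1) finite_subset by blast
  ultimately have "L = {}" by simp
  then show ?case by (intro exI[of _ "\<lambda>_. 0"] exI[of _ "{}"] exI[of _ "\<lambda>x. x"]) auto
next
  case (Suc u)
  have finL: "finite L" using Suc.prems finite_subset by blast
  define n where "n = card L"
  \<comment> \<open>The table has at least eight times as many buckets as there are keys, so on
    average at most n/2 ordered pairs collide.\<close>
  have "\<exists>a < 2 ^ w. 2 * card (coll w (Suc u) a L) \<le> n"
  proof (cases "n = 0")
    case True
    then have "L = {}" using finL by (simp add: n_def)
    then show ?thesis by (intro exI[of _ 0]) (simp add: coll_def)
  next
    case False
    have W: "(2::nat) ^ w = 2 ^ Suc u * 2 ^ (w - Suc u)"
      using Suc.prems(3) by (metis le_add_diff_inverse power_add)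
    have w2: "(2::nat) ^ w = 2 * 2 ^ (w - 1)" using Suc.prems(3) by (cases w) auto
    have "n * n * (2 * 2 ^ (w - Suc u)) < 2 ^ (w - 1) * (n div 2 + 1)"
    proof -
      have "n * 8 * 2 ^ (w - Suc u) \<le> 2 ^ Suc u * 2 ^ (w - Suc u)"
        using Suc.prems(2) unfolding n_def by (rule mult_le_mono1)
      then have "n * 8 * 2 ^ (w - Suc u) \<le> 2 * 2 ^ (w - 1)" using W w2 by simp
      then have 1: "n * 2 ^ (w - Suc u) * 4 \<le> 2 ^ (w - 1)" by simp
      have "2 * (n * n * (2 * 2 ^ (w - Suc u))) = n * (n * 2 ^ (w - Suc u) * 4)" by simp
      also have "\<dots> \<le> n * 2 ^ (w - 1)" using 1 by (rule mult_le_mono2)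
      also have "\<dots> < (2 * (n div 2 + 1)) * 2 ^ (w - 1)" by (rule mult_strict_right_mono) auto
      finally have "2 * (n * n * (2 * 2 ^ (w - Suc u))) < 2 * (2 ^ (w - 1) * (n div 2 + 1))"
        by (simp only: mult_ac)
      then show ?thesis unfolding nat_mult_less_cancel_disj by (rule conjunct2)
    qed
    then obtain a where "a < 2 ^ w" "card (coll w (Suc u) a L) < n div 2 + 1"
      using few_collisions[OF Suc.prems(1,3), of "n div 2 + 1"] Suc.prems(3) by (auto simp: n_def)
    then show ?thesis by (intro exI[of _ a]) auto
  qed
  then obtain b where b: "b < 2 ^ w" "2 * card (coll w (Suc u) b L) \<le> n" by blast
  let ?h = "mshift w (Suc u) b"
  \<comment> \<open>Each key that shares its bucket is the first component of a colliding pair. So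
    at most half of the keys pass on to the table of half the size.\<close>
  define R where "R = {x\<in>L. \<exists>y\<in>L. y \<noteq> x \<and> ?h y = ?h x}"
  have "R \<subseteq> fst ` coll w (Suc u) b L" by (force simp: R_def coll_def)
  moreover have fc: "finite (coll w (Suc u) b L)"
    using finL by (auto simp: coll_def intro: finite_subset[of _ "L \<times> L"])
  ultimately have "card R \<le> card (coll w (Suc u) b L)" by (metis surj_card_le)
  then have Ru: "card R * 8 \<le> 2 ^ u" using b(2) Suc.prems(2) by (simp add: n_def)
  have Rw: "R \<subseteq> {..<2 ^ w}" using Suc.prems(1) by (auto simp: R_def)
  have uw: "u \<le> w" using Suc.prems(3) by simp
  obtain a K col where IH0: "\<forall>t. a t < 2 ^ w" "K \<subseteq> {..<2 ^ Suc u}" "inj_on col R"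
    and col0: "\<forall>x\<in>R. \<exists>t\<le>u. col x = 2 ^ t + mshift w t (a t) x \<and> col x \<in> K \<and>
      (\<forall>t'. t < t' \<and> t' \<le> u \<longrightarrow> 2 ^ t' + mshift w t' (a t') x \<notin> K)"
    using Suc.IH[OF Rw Ru uw] by (elim exE conjE) (rule that)
  note IH = spec[OF IH0(1)] IH0(2,3) and col = bspec[OF col0]
  define a' where "a' = a(Suc u := b)"
  \<comment> \<open>Adding 2 ^ t to the buckets of level \<open>t\<close> places the tables of
    different levels in disjoint ranges, so one mask serves all of them.\<close>
  define K' where "K' = K \<union> (\<lambda>x. 2 ^ Suc u + ?h x) ` (L - R)"
  define col' where "col' x = (if x \<in> R then col x else 2 ^ Suc u + ?h x)" for x
  \<comment> \<open>A marked bucket of the new top table holds one isolated key, so a remaining key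
    sees no mark there. This makes the highest marked level of a key the level at which it became
    isolated.\<close>
  have KR: "2 ^ Suc u + ?h x \<notin> K'" if x: "x \<in> R" for x
  proof
    assume "2 ^ Suc u + ?h x \<in> K'"
    then obtain y where y: "y \<in> L - R" "?h y = ?h x" using IH(2) by (auto simp: K'_def)
    have "x \<in> L" "x \<noteq> y" using x y by (auto simp: R_def)
    then have "y \<in> R" unfolding R_def mem_Collect_eq
      by (intro conjI bexI[of _ x]) (use y in auto)
    then show False using y by blast
  qed
  have c1: "\<exists>t\<le>Suc u. col' x = 2 ^ t + mshift w t (a' t) x \<and> col' x \<in> K' \<and>
      (\<forall>t'. t < t' \<and> t' \<le> Suc u \<longrightarrow> 2 ^ t' + mshift w t' (a' t') x \<notin> K')" if x: "x \<in> L" for x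
  proof (cases "x \<in> R")
    case True
    obtain t where t: "t \<le> u" "col x = 2 ^ t + mshift w t (a t) x" "col x \<in> K"
      "\<And>t'. t < t' \<Longrightarrow> t' \<le> u \<Longrightarrow> 2 ^ t' + mshift w t' (a t') x \<notin> K" using col[OF True] by blast
    have "2 ^ t' + mshift w t' (a' t') x \<notin> K'" if "t < t'" "t' \<le> Suc u" for t'
    proof (cases "t' = Suc u")
      case eq: True
      then show ?thesis using KR[OF True] by (simp only: a'_def fun_upd_same not_False_eq_True)
    next
      case False
      then have t'u: "t' \<le> u" using that by simp
      have "2 ^ t' + mshift w t' (a' t') x < 2 ^ Suc t'" using mshift_less[of w t' "a' t'" x] by simp
      also have "(2::nat) ^ Suc t' \<le> 2 ^ Suc u" using t'u by (intro power_increasing) auto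
      finally have "2 ^ t' + mshift w t' (a' t') x < 2 ^ Suc u" .
      moreover have "2 ^ t' + mshift w t' (a' t') x \<notin> K" using t(4)[OF that(1) t'u] False by (simp add: a'_def)
      ultimately show ?thesis by (auto simp: K'_def)
    qed
    moreover have "a' t = a t" using t(1) by (simp add: a'_def)
    ultimately show ?thesis using t True by (intro exI[of _ t]) (simp add: col'_def K'_def)
  next
    case False
    then show ?thesis using x
      by (intro exI[of _ "Suc u"] conjI allI impI) (auto simp: col'_def K'_def a'_def)
  qed
  have K'u: "K' \<subseteq> {..<2 ^ Suc (Suc u)}"
    using IH(2) mshift_less[of w "Suc u" b] by (fastforce simp: K'_def)
  have "inj_on col' L"
  proof (rule inj_onI)
    fix x y assume x: "x \<in> L" and y: "y \<in> L" and eq: "col' x = col' y"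
    have lt: "col v < 2 ^ Suc u" if "v \<in> R" for v using col[OF that] IH(2) by auto
    consider "x \<in> R" "y \<in> R" | "x \<in> R" "y \<notin> R" | "x \<notin> R" "y \<in> R" | "x \<notin> R" "y \<notin> R" by blast
    then show "x = y"
    proof cases
      case 1
      then show ?thesis using eq IH(3) by (simp add: col'_def inj_on_def)
    next
      case 4
      then have "?h x = ?h y" using eq by (simp add: col'_def)
      then show ?thesis using 4 x y by (auto simp: R_def)
    qed (use eq lt in \<open>fastforce simp: col'_def\<close>)+
  qed
  moreover have "a' t < 2 ^ w" for t using IH(1) b by (simp add: a'_def)
  ultimately show ?case using c1 K'u by blast
qed

lemma digits_exist:
  fixes q :: nat
  assumes "\<And>t. a t < q"
  shows "\<exists>A < q ^ n. \<forall>t<n. A div q ^ t mod q = a t"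
  using assms
proof (induction n arbitrary: a)
  case (Suc n)
  obtain A where A: "A < q ^ n" "\<And>t. t < n \<Longrightarrow> A div q ^ t mod q = a (Suc t)"
    using Suc.IH[of "\<lambda>t. a (Suc t)"] Suc.prems by auto
  let ?A = "a 0 + q * A"
  have a0: "a 0 < q" by (rule Suc.prems)
  have "?A < q * Suc A" using a0 by simp
  also have "\<dots> \<le> q * q ^ n" using A(1) by (intro mult_le_mono2) simp
  finally have "?A < q ^ Suc n" by simp
  moreover have "?A div q ^ t mod q = a t" if "t < Suc n" for t
  proof (cases t)
    case 0
    then show ?thesis using a0 by simp
  next
    case (Suc i)
    have "?A div q = A" using a0 by simp
    then show ?thesis using A(2)[of i] that Suc by (simp add: div_mult2_eq)
  qed
  ultimately show ?case by blast
qed simp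

text \<open>One multiplication first compresses the \<open>w\<close>-bit keys injectively to 2 l + 3
  bits. Only then are the l + 4 multipliers of the cascade short enough to be packed as
  base-\<open>Q\<close> digits into a single number \<open>A\<close>. The description takes w + (2 l
  + 3)(l + 4) + 2 ^ (l + 4) bits, which is O(log n) when w and 2 ^ l are.\<close>

lemma perfect_hash_exists:
  assumes L: "L \<subseteq> {..<2 ^ w}" and cL: "card L \<le> 2 ^ l" and w: "2 * l + 3 \<le> w"
  defines "Q \<equiv> 2 ^ (2 * l + 3) :: nat"
  defines "cnd \<equiv> \<lambda>A t y. 2 ^ t + ((A div Q ^ t mod Q) * y mod Q) * 2 ^ t div Q"
  shows "\<exists>b A K col. b < 2 ^ w \<and> A < Q ^ (l + 4) \<and> K < 2 ^ 2 ^ (l + 4) \<and> inj_on col L \<and>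
    (\<forall>x\<in>L. \<exists>t\<le>l + 3. col x = cnd A t ((b * x mod 2 ^ w) * Q div 2 ^ w) \<and> col x \<in> set_decode K \<and>
      (\<forall>t'>t. cnd A t' ((b * x mod 2 ^ w) * Q div 2 ^ w) \<notin> set_decode K))"
proof -
  have finL: "finite L" using L finite_subset by blast
  let ?c = "2 * l + 3"
  \<comment> \<open>The range is quadratic in the number of keys with room to spare, so the average
    number of collisions is below 1 and some multiplier has none.\<close>
  have "card L * card L * (2 * 2 ^ (w - ?c)) < 2 ^ (w - 1) * 1"
  proof -
    have "card L * card L * (2 * 2 ^ (w - ?c)) \<le> 2 ^ l * 2 ^ l * (2 * 2 ^ (w - ?c))"
      using cL by (intro mult_le_mono) auto
    also have "\<dots> = 2 ^ (l + l + 1 + (w - ?c))" by (simp add: power_add)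
    also have "\<dots> < 2 ^ (w - 1)" using w by (intro power_strict_increasing) auto
    finally show ?thesis by simp
  qed
  then obtain b where b: "b < 2 ^ w" "card (coll w ?c b L) < 1"
    using few_collisions[OF L w, of 1] w by auto
  have "finite (coll w ?c b L)" using finL by (auto simp: coll_def intro: finite_subset[of _ "L \<times> L"])
  then have emp: "coll w ?c b L = {}" using b(2) by simp
  let ?g = "mshift w ?c b"
  have g: "?g x = (b * x mod 2 ^ w) * Q div 2 ^ w" for x by (simp add: mshift_def Q_def)
  have ginj: "inj_on ?g L" using emp by (auto simp: inj_on_def coll_def)
  have gL: "?g ` L \<subseteq> {..<2 ^ ?c}" using mshift_less by auto
  have le: "l + 3 \<le> ?c" by simp
  have c8: "card (?g ` L) * 8 \<le> 2 ^ (l + 3)" using cL card_image[OF ginj] by (simp add: power_add)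
  from hash_cascade[OF gL c8 le] obtain a K col where h: "\<forall>t. a t < 2 ^ ?c" "K \<subseteq> {..<2 ^ Suc (l + 3)}" "inj_on col (?g ` L)"
    and col: "\<forall>y\<in>?g ` L. \<exists>t\<le>l + 3. col y = 2 ^ t + mshift ?c t (a t) y \<and> col y \<in> K \<and>
      (\<forall>t'. t < t' \<and> t' \<le> l + 3 \<longrightarrow> 2 ^ t' + mshift ?c t' (a t') y \<notin> K)"
    by (elim exE conjE) (rule that)
  obtain A where A: "A < Q ^ (l + 4)" "\<And>t. t < l + 4 \<Longrightarrow> A div Q ^ t mod Q = a t"
    using digits_exist[of a Q "l + 4"] h(1) by (auto simp: Q_def)
  have cnd: "cnd A t y = 2 ^ t + mshift ?c t (a t) y" if "t < l + 4" for t y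
    using A(2)[OF that] by (simp add: cnd_def mshift_def Q_def)
  have finK: "finite K" using h(2) finite_subset by blast
  \<comment> \<open>Levels beyond the cascade point above the length of the mask, where nothing is
    marked; hence the clause on higher levels needs no upper limit.\<close>
  have big: "cnd A t y \<notin> K" if "l + 4 \<le> t" for t y
  proof -
    have "(2::nat) ^ Suc (l + 3) \<le> 2 ^ t" using that by (intro power_increasing) auto
    then have "2 ^ Suc (l + 3) \<le> cnd A t y" by (simp add: cnd_def trans_le_add1)
    then show ?thesis using h(2) by auto
  qed
  let ?K = "set_encode K"
  have F1: "?K < 2 ^ 2 ^ (l + 4)"
  proof -
    have "?K \<le> (\<Sum>i<2 ^ (l + 4). 2 ^ i)" unfolding set_encode_def using h(2) by (intro sum_mono2) (auto simp: eval_nat_numeral)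
    also have "\<dots> < 2 ^ m" if "m = 2 ^ (l + 4)" for m :: nat unfolding that[symmetric] by (induction m) auto
    finally show ?thesis by simp
  qed
  have F2: "inj_on (col \<circ> ?g) L" using ginj h(3) by (rule comp_inj_on)
  have F3: "\<exists>t\<le>l + 3. (col \<circ> ?g) x = cnd A t (?g x) \<and> (col \<circ> ?g) x \<in> set_decode ?K \<and>
      (\<forall>t'>t. cnd A t' (?g x) \<notin> set_decode ?K)" if xL: "x \<in> L" for x
  proof -
    obtain t where t: "t \<le> l + 3" "col (?g x) = 2 ^ t + mshift ?c t (a t) (?g x)" "col (?g x) \<in> K"
      "\<And>t'. t < t' \<Longrightarrow> t' \<le> l + 3 \<Longrightarrow> 2 ^ t' + mshift ?c t' (a t') (?g x) \<notin> K"
      using bspec[OF col imageI[OF xL]] by blast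
    have "cnd A t' (?g x) \<notin> K" if "t < t'" for t'
      using t(4)[OF that] cnd[of t' "?g x"] big[of t' "?g x"] by (cases "t' \<le> l + 3") auto
    then show ?thesis using t cnd[of t "?g x"] finK by (intro exI[of _ t]) (simp add: set_encode_inverse)
  qed
  have F4: "\<forall>x\<in>L. \<exists>t\<le>l + 3. (col \<circ> ?g) x = cnd A t ((b * x mod 2 ^ w) * Q div 2 ^ w) \<and> (col \<circ> ?g) x \<in> set_decode ?K \<and>
      (\<forall>t'>t. cnd A t' ((b * x mod 2 ^ w) * Q div 2 ^ w) \<notin> set_decode ?K)"
  proof
    fix x assume "x \<in> L"
    from F3[OF this] show "\<exists>t\<le>l + 3. (col \<circ> ?g) x = cnd A t ((b * x mod 2 ^ w) * Q div 2 ^ w) \<and> (col \<circ> ?g) x \<in> set_decode ?K \<and>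
      (\<forall>t'>t. cnd A t' ((b * x mod 2 ^ w) * Q div 2 ^ w) \<notin> set_decode ?K)" by (simp only: g)
  qed
  have "b < 2 ^ w \<and> A < Q ^ (l + 4) \<and> ?K < 2 ^ 2 ^ (l + 4) \<and> inj_on (col \<circ> ?g) L \<and>
    (\<forall>x\<in>L. \<exists>t\<le>l + 3. (col \<circ> ?g) x = cnd A t ((b * x mod 2 ^ w) * Q div 2 ^ w) \<and> (col \<circ> ?g) x \<in> set_decode ?K \<and>
      (\<forall>t'>t. cnd A t' ((b * x mod 2 ^ w) * Q div 2 ^ w) \<notin> set_decode ?K))"
    by (intro conjI b(1) A(1) F1 F2 F4)
  then show ?thesis by (rule exI[of _ "col \<circ> ?g", THEN exI[of _ ?K], THEN exI[of _ A], THEN exI[of _ b]])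
qed

section \<open>Searching for improvements with coloured elements\<close>

text \<open>A search state lists the \<open>w\<close> slots of the bag, the code of the set of used colours and the gain,
  the latter shifted by \<open>G\<close> to keep it nonnegative.\<close>

definition fits :: "nat \<Rightarrow> nat \<Rightarrow> nat set \<Rightarrow> (nat \<Rightarrow> nat set) \<Rightarrow> (nat \<Rightarrow> nat \<Rightarrow> bool) \<Rightarrow> nat list \<Rightarrow> nat \<Rightarrow> nat \<Rightarrow> bool" where
  "fits N w S El Col xs c x \<longleftrightarrow> (\<forall>s<N. s \<in> S \<and> (\<exists>z<N. z \<in> El s \<and> z \<in> El x) \<longrightarrow> (\<exists>i<w. xs ! i = s)) \<and>
       (\<exists>z<N. z \<in> El x) \<and> (\<forall>z<N. z \<in> El x \<longrightarrow> (\<exists>i<N. Col z i)) \<and>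
       (\<forall>i<N. i \<in> set_decode (xs ! w) \<longleftrightarrow> i \<in> set_decode c \<or> (\<exists>z<N. z \<in> El x \<and> Col z i)) \<and>
       \<not> (\<exists>i<N. i \<in> set_decode c \<and> (\<exists>z<N. z \<in> El x \<and> Col z i))"

text \<open>To be read backwards: \<open>xs\<close> is the state after the move and \<open>R\<close>
  holds of the state before it. Paying overwrites a slot whose former content \<open>y\<close> is
  arbitrary, so drops need no move of their own. Keeping \<open>R xs\<close> as an alternative
  allows idle rounds.\<close>

definition stp :: "nat \<Rightarrow> nat \<Rightarrow> nat set \<Rightarrow> nat set \<Rightarrow> (nat \<Rightarrow> nat set) \<Rightarrow> (nat \<Rightarrow> nat \<Rightarrow> bool) \<Rightarrow>
    (nat list \<Rightarrow> bool) \<Rightarrow> nat list \<Rightarrow> bool" where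
  "stp N w S F El Col R xs \<longleftrightarrow> R xs \<or>
    (\<exists>i<w. \<exists>y<N. \<exists>g<N. xs ! i \<in> S \<and> g = Suc (xs ! Suc w) \<and> R (xs[i := y, Suc w := g])) \<or>
    (\<exists>x<N. \<exists>c<N. \<exists>g<N. x \<in> F \<and> xs ! Suc w = Suc g \<and> R (xs[w := c, Suc w := g]) \<and> fits N w S El Col xs c x)"

lemma stp_self: "R xs \<Longrightarrow> stp N w S F El Col R xs"
  unfolding stp_def by (rule disjI1)

lemma stp_payI: "i < w \<Longrightarrow> y < N \<Longrightarrow> g < N \<Longrightarrow> xs ! i \<in> S \<Longrightarrow> g = Suc (xs ! Suc w) \<Longrightarrow> R (xs[i := y, Suc w := g]) \<Longrightarrow>
    stp N w S F El Col R xs"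
  unfolding stp_def by (rule disjI2, rule disjI1, intro exI[of _ i] exI[of _ y] exI[of _ g] conjI)

lemma stp_addI: "x < N \<Longrightarrow> c < N \<Longrightarrow> g < N \<Longrightarrow> x \<in> F \<Longrightarrow> xs ! Suc w = Suc g \<Longrightarrow> R (xs[w := c, Suc w := g]) \<Longrightarrow>
    fits N w S El Col xs c x \<Longrightarrow> stp N w S F El Col R xs"
  unfolding stp_def by (rule disjI2, rule disjI2, intro exI[of _ x] exI[of _ c] exI[of _ g] conjI)

lemma stpE:
  assumes "stp N w S F El Col R xs"
  obtains (self) "R xs"
  | (pay) i y g where "i < w" "y < N" "g < N" "xs ! i \<in> S" "g = Suc (xs ! Suc w)" "R (xs[i := y, Suc w := g])"
  | (add) x c g where "x < N" "c < N" "g < N" "x \<in> F" "xs ! Suc w = Suc g" "R (xs[w := c, Suc w := g])"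
      "fits N w S El Col xs c x"
  using assms unfolding stp_def
  by (elim disjE exE conjE) (erule self, erule (5) pay, erule (6) add)

definition ini :: "nat \<Rightarrow> nat \<Rightarrow> nat list \<Rightarrow> bool" where
  "ini w G xs \<longleftrightarrow> (\<forall>i<Suc w. xs ! i = 0) \<and> xs ! Suc w = G"

definition states :: "nat \<Rightarrow> nat \<Rightarrow> nat list set" where
  "states N w = {xs. length xs = w + 2 \<and> set xs \<subseteq> {..<N}}"

text \<open>Values of at least \<open>N\<close> cannot occur, so this is only a partial version of the hash function.\<close>

definition cand :: "nat \<Rightarrow> (nat \<Rightarrow> nat \<Rightarrow> nat \<Rightarrow> nat \<Rightarrow> bool) \<Rightarrow> nat \<Rightarrow> nat \<Rightarrow> nat \<Rightarrow> nat \<Rightarrow> nat \<Rightarrow> nat \<Rightarrow> nat \<Rightarrow> bool" where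
  "cand N D W b Q A x t c \<longleftrightarrow> (\<exists>m1<N. \<exists>h1<N. \<exists>s1<N. b * x = m1 \<and> h1 * W + s1 = m1 \<and> s1 < W \<and>
     (\<exists>m2<N. \<exists>y<N. \<exists>r2<N. s1 * Q = m2 \<and> y * W + r2 = m2 \<and> r2 < W \<and>
     (\<exists>a<N. \<exists>m3<N. \<exists>h3<N. \<exists>s3<N. D A Q t a \<and> a * y = m3 \<and> h3 * Q + s3 = m3 \<and> s3 < Q \<and>
     (\<exists>p<N. \<exists>m4<N. \<exists>v<N. \<exists>r4<N. 2 ^ t = p \<and> s3 * p = m4 \<and> v * Q + r4 = m4 \<and> r4 < Q \<and> p + v = c))))"

text \<open>The colour is the marked bucket of the highest level, exactly the value that
  \<open>perfect_hash_exists\<close> shows to be injective for suitable parameters.\<close>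

definition hcol :: "nat \<Rightarrow> (nat \<Rightarrow> nat \<Rightarrow> nat \<Rightarrow> nat \<Rightarrow> bool) \<Rightarrow> nat \<Rightarrow> nat \<Rightarrow> nat \<Rightarrow> nat \<Rightarrow> nat \<Rightarrow> nat \<Rightarrow> nat \<Rightarrow> bool" where
  "hcol N D W b Q A K x i \<longleftrightarrow> (\<exists>t<N. cand N D W b Q A x t i \<and> i \<in> set_decode K \<and>
     (\<forall>t'<N. \<forall>c<N. t < t' \<and> cand N D W b Q A x t' c \<longrightarrow> c \<notin> set_decode K))"

text \<open>Everything that describes the hash is guessed, even the moduli \<open>W\<close> and
  \<open>Q\<close>, and so is the offset \<open>G\<close>. Guesses that do not describe a hash
  function are harmless, because soundness holds for any colouring relation.\<close>

definition tst :: "nat \<Rightarrow> (nat \<Rightarrow> nat \<Rightarrow> nat \<Rightarrow> nat \<Rightarrow> bool) \<Rightarrow> nat \<Rightarrow> (nat \<Rightarrow> nat set) \<Rightarrow> nat set \<Rightarrow> nat set \<Rightarrow> bool" where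
  "tst N D w El S F \<longleftrightarrow> (\<exists>W<N. \<exists>b<N. \<exists>Q<N. \<exists>A<N. \<exists>K<N. \<exists>G<N. \<exists>xs\<in>states N w.
     (stp N w S F El (hcol N D W b Q A K) ^^ N) (ini w G) xs \<and> xs ! Suc w = Suc G)"

section \<open>Monotonicity and soundness of the search\<close>

lemma stp_mono:
  assumes "F \<subseteq> F'" "\<And>xs. R xs \<Longrightarrow> R' xs" "stp N w S F El Col R xs"
  shows "stp N w S F' El Col R' xs"
  using assms(3)
proof (cases rule: stpE)
  case self
  then show ?thesis by (intro stp_self assms(2))
next
  case (pay i y g)
  then show ?thesis by (intro stp_payI[of i _ y _ g] assms(2))
next
  case (add x c g)
  then show ?thesis by (intro stp_addI[of x _ c g] assms(2) subsetD[OF assms(1)])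
qed

lemma stp_iter_mono: "F \<subseteq> F' \<Longrightarrow> (stp N w S F El Col ^^ j) R xs \<Longrightarrow> (stp N w S F' El Col ^^ j) R xs"
proof (induction j arbitrary: xs)
  case (Suc j)
  then show ?case using stp_mono[OF Suc.prems(1), of "(stp N w S F El Col ^^ j) R" "(stp N w S F' El Col ^^ j) R"] by simp
qed simp

lemma stp_iter_le: "(stp N w S F El Col ^^ i) R xs \<Longrightarrow> i \<le> j \<Longrightarrow> (stp N w S F El Col ^^ j) R xs"
proof (induction j)
  case (Suc j)
  show ?case
  proof (cases "i = Suc j")
    case False
    then have "(stp N w S F El Col ^^ j) R xs" using Suc by simp
    then show ?thesis unfolding funpow.simps comp_apply by (rule stp_self)
  qed (use Suc in simp)
qed simp

lemma tst_mono: "F \<subseteq> F' \<Longrightarrow> tst N D w El S F \<Longrightarrow> tst N D w El S F'"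
  unfolding tst_def using stp_iter_mono by meson

text \<open>\<open>X\<close> are the sets added so far and \<open>V\<close> contains the members of
  \<open>S\<close> paid for. A member may be paid repeatedly, so the relation between gain,
  \<open>V\<close> and \<open>X\<close> is only an inequality.\<close>

definition snd_inv where
  "snd_inv N w S El Col G X xs \<longleftrightarrow> finite X \<and>
    (\<exists>V \<subseteq> S. finite V \<and> (\<forall>i<w. xs ! i \<in> S \<longrightarrow> xs ! i \<in> V) \<and> (\<forall>s\<in>S. (\<exists>x\<in>X. El s \<inter> El x \<noteq> {}) \<longrightarrow> s \<in> V) \<and>
       xs ! Suc w + card V \<le> G + card X) \<and>
    (\<forall>i<N. (\<exists>x\<in>X. \<exists>z\<in>El x. Col z i) \<longrightarrow> i \<in> set_decode (xs ! w)) \<and>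
    (\<forall>x\<in>X. El x \<noteq> {} \<and> (\<forall>z\<in>El x. \<exists>i<N. Col z i)) \<and> (\<forall>x\<in>X. \<forall>y\<in>X. x \<noteq> y \<longrightarrow> El x \<inter> El y = {})"

lemma snd_invE:
  assumes "snd_inv N w S El Col G X xs"
  obtains V where "V \<subseteq> S" "finite V" "\<forall>i<w. xs ! i \<in> S \<longrightarrow> xs ! i \<in> V"
    "\<forall>s\<in>S. (\<exists>x\<in>X. El s \<inter> El x \<noteq> {}) \<longrightarrow> s \<in> V" "xs ! Suc w + card V \<le> G + card X"
  using assms unfolding snd_inv_def by (elim exE conjE) (rule that)

lemma snd_invD:
  assumes "snd_inv N w S El Col G X xs"
  shows "finite X" "\<forall>i<N. (\<exists>x\<in>X. \<exists>z\<in>El x. Col z i) \<longrightarrow> i \<in> set_decode (xs ! w)"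
    "\<forall>x\<in>X. El x \<noteq> {} \<and> (\<forall>z\<in>El x. \<exists>i<N. Col z i)" "\<forall>x\<in>X. \<forall>y\<in>X. x \<noteq> y \<longrightarrow> El x \<inter> El y = {}"
  using assms unfolding snd_inv_def by - (elim conjE, assumption)+

text \<open>Nothing is assumed about \<open>Col\<close>: every element of an added set must have a
  colour, and a later set containing the same element would find this colour used. The same run
  works with \<open>X\<close> as the only candidates, which later identifies a minimal candidate
  family with the exchange. Initial slots contain 0, which must not name a member of
  \<open>S\<close>.\<close>

lemma stp_sound:
  assumes S: "0 \<notin> S" "S \<subseteq> {..<N}" and El: "\<And>x. El x \<subseteq> {..<N}"
  shows "(stp N w S F El Col ^^ j) (ini w G) xs \<Longrightarrow> length xs = w + 2 \<Longrightarrow>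
    \<exists>X\<subseteq>F. (stp N w S X El Col ^^ j) (ini w G) xs \<and> snd_inv N w S El Col G X xs"
proof (induction j arbitrary: xs)
  case 0
  then have "ini w G xs" by simp
  then have "snd_inv N w S El Col G {} xs" using S by (auto simp: snd_inv_def ini_def)
  then show ?case using 0 by (intro exI[of _ "{}"]) auto
next
  case (Suc j)
  let ?R = "\<lambda>X. (stp N w S X El Col ^^ j) (ini w G)"
  have fS: "finite S" using S finite_subset by blast
  have elN: "z < N" if "z \<in> El x" for z x using El that by blast
  from Suc.prems(1) have "stp N w S F El Col (?R F) xs" by simp
  then show ?case
  proof (cases rule: stpE)
    case self
    from Suc.IH[OF self Suc.prems(2)] obtain X where X: "X \<subseteq> F" "?R X xs" "snd_inv N w S El Col G X xs" by blast
    have "(stp N w S X El Col ^^ Suc j) (ini w G) xs" using X(2) unfolding funpow.simps comp_apply by (rule stp_self)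
    then show ?thesis using X(1,3) by (intro exI[of _ X] conjI)
  next
    case i: (pay i y g)
    let ?ys = "xs[i := y, Suc w := g]"
    have len: "length ?ys = w + 2" using Suc.prems(2) by simp
    from Suc.IH[OF i(6) len] obtain X where X: "X \<subseteq> F" "?R X ?ys" "snd_inv N w S El Col G X ?ys" by blast
    have "(stp N w S X El Col ^^ Suc j) (ini w G) xs"
      unfolding funpow.simps comp_apply by (rule stp_payI[where R = "?R X", OF i(1-5) X(2)])
    moreover have "snd_inv N w S El Col G X xs"
    proof -
      obtain V where V: "V \<subseteq> S" "finite V" "\<forall>i<w. ?ys ! i \<in> S \<longrightarrow> ?ys ! i \<in> V"
        "\<forall>s\<in>S. (\<exists>x\<in>X. El s \<inter> El x \<noteq> {}) \<longrightarrow> s \<in> V" "?ys ! Suc w + card V \<le> G + card X"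
        by (rule snd_invE[OF X(3)])
      have w': "?ys ! w = xs ! w" "?ys ! Suc w = Suc (xs ! Suc w)" using i(1,5) Suc.prems(2) by auto
      have sl: "?ys ! i' = xs ! i'" if "i' < w" "i' \<noteq> i" for i' using that by simp
      have "xs ! Suc w + card (insert (xs ! i) V) \<le> G + card X"
        using V(5) w'(2) card_insert_le_m1[of "Suc (card V)" V "xs ! i"] V(2) by (simp add: card_insert_if)
      moreover have "\<forall>i'<w. xs ! i' \<in> S \<longrightarrow> xs ! i' \<in> insert (xs ! i) V"
        using V(3) sl by (metis insert_iff)
      ultimately have "\<exists>V \<subseteq> S. finite V \<and> (\<forall>i<w. xs ! i \<in> S \<longrightarrow> xs ! i \<in> V) \<and> (\<forall>s\<in>S. (\<exists>x\<in>X. El s \<inter> El x \<noteq> {}) \<longrightarrow> s \<in> V) \<and>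
       xs ! Suc w + card V \<le> G + card X"
        using V i(4) by (intro exI[of _ "insert (xs ! i) V"]) auto
      then show ?thesis using snd_invD[OF X(3)] unfolding snd_inv_def w'(1) by (intro conjI)
    qed
    ultimately show ?thesis using X(1) by (intro exI[of _ X] conjI)
  next
    case (add x c g)
    note x = add(4) and g = add(5) and R = add(6)
    have c1: "\<forall>s<N. s \<in> S \<and> (\<exists>z<N. z \<in> El s \<and> z \<in> El x) \<longrightarrow> (\<exists>i<w. xs ! i = s)"
      and c2: "\<exists>z<N. z \<in> El x" and c3: "\<forall>z<N. z \<in> El x \<longrightarrow> (\<exists>i<N. Col z i)"
      and c4: "\<forall>i<N. i \<in> set_decode (xs ! w) \<longleftrightarrow> i \<in> set_decode c \<or> (\<exists>z<N. z \<in> El x \<and> Col z i)"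
      and c5: "\<not> (\<exists>i<N. i \<in> set_decode c \<and> (\<exists>z<N. z \<in> El x \<and> Col z i))"
      using add(7) unfolding fits_def by - (elim conjE, assumption)+
    let ?ys = "xs[w := c, Suc w := g]"
    have len: "length ?ys = w + 2" using Suc.prems(2) by simp
    from Suc.IH[OF R len] obtain X where X: "X \<subseteq> F" "?R X ?ys" "snd_inv N w S El Col G X ?ys" by blast
    have y: "?ys ! w = c" "?ys ! Suc w = g" "\<And>i. i < w \<Longrightarrow> ?ys ! i = xs ! i" using Suc.prems(2) by auto
    obtain V where V: "V \<subseteq> S" "finite V" "\<forall>i<w. ?ys ! i \<in> S \<longrightarrow> ?ys ! i \<in> V"
        "\<forall>s\<in>S. (\<exists>x\<in>X. El s \<inter> El x \<noteq> {}) \<longrightarrow> s \<in> V" "?ys ! Suc w + card V \<le> G + card X"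
      by (rule snd_invE[OF X(3)])
    have I: "finite X" "\<And>i. i < N \<Longrightarrow> (\<exists>x\<in>X. \<exists>z\<in>El x. Col z i) \<Longrightarrow> i \<in> set_decode c"
      "\<And>x. x \<in> X \<Longrightarrow> El x \<noteq> {} \<and> (\<forall>z\<in>El x. \<exists>i<N. Col z i)" "\<And>x y. x \<in> X \<Longrightarrow> y \<in> X \<Longrightarrow> x \<noteq> y \<Longrightarrow> El x \<inter> El y = {}"
      using snd_invD[OF X(3)] unfolding y(1) by (assumption | blast)+
    have dis: "El x \<inter> El x' = {}" if x': "x' \<in> X" for x'
    proof (rule equals0I)
      fix z assume z: "z \<in> El x \<inter> El x'"
      then obtain i where i: "i < N" "Col z i" using I(3)[OF x'] by blast
      then have "i \<in> set_decode c" using I(2)[OF i(1)] x' z by blast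
      then show False using c5 i z elN by blast
    qed
    have xX: "x \<notin> X" using dis I(3) by blast
    have "(stp N w S (insert x X) El Col ^^ Suc j) (ini w G) xs"
    proof -
      have R': "?R (insert x X) ?ys" by (rule stp_iter_mono[OF subset_insertI X(2)])
      show ?thesis unfolding funpow.simps comp_apply
        by (rule stp_addI[where R = "?R (insert x X)", OF add(1-3) insertI1 g R' add(7)])
    qed
    moreover have "snd_inv N w S El Col G (insert x X) xs"
    proof -
      have I1: "finite (insert x X)" using I by simp
      have I2: "\<exists>V \<subseteq> S. finite V \<and> (\<forall>i<w. xs ! i \<in> S \<longrightarrow> xs ! i \<in> V) \<and> (\<forall>s\<in>S. (\<exists>x\<in>insert x X. El s \<inter> El x \<noteq> {}) \<longrightarrow> s \<in> V) \<and>
         xs ! Suc w + card V \<le> G + card (insert x X)"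
      proof (intro exI[of _ V] conjI V)
        show sl: "\<forall>i<w. xs ! i \<in> S \<longrightarrow> xs ! i \<in> V" using V(3) y(3) by simp
        show "xs ! Suc w + card V \<le> G + card (insert x X)" using V(5) y(2) g xX I(1) by simp
        show "\<forall>s\<in>S. (\<exists>x\<in>insert x X. El s \<inter> El x \<noteq> {}) \<longrightarrow> s \<in> V"
        proof (intro ballI impI)
          fix s assume s: "s \<in> S" "\<exists>x\<in>insert x X. El s \<inter> El x \<noteq> {}"
          show "s \<in> V"
          proof (cases "El s \<inter> El x = {}")
            case True
            then show ?thesis using s V(4) by blast
          next
            case False
            then have "\<exists>z<N. z \<in> El s \<and> z \<in> El x" using elN by blast
            moreover have "s < N" using s S by blast
            ultimately obtain i where "i < w" "xs ! i = s" using c1 s by blast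
            then show ?thesis using sl s by blast
          qed
        qed
      qed
      have I3: "\<forall>i<N. (\<exists>x\<in>insert x X. \<exists>z\<in>El x. Col z i) \<longrightarrow> i \<in> set_decode (xs ! w)"
      proof (intro allI impI)
        fix i assume i: "i < N" "\<exists>x\<in>insert x X. \<exists>z\<in>El x. Col z i"
        then have "i \<in> set_decode c \<or> (\<exists>z<N. z \<in> El x \<and> Col z i)" using I(2)[OF i(1)] elN by blast
        then show "i \<in> set_decode (xs ! w)" using c4 i(1) by blast
      qed
      have I4: "\<forall>x\<in>insert x X. El x \<noteq> {} \<and> (\<forall>z\<in>El x. \<exists>i<N. Col z i)" using I(3) c2 c3 elN by blast
      have I5: "\<forall>a\<in>insert x X. \<forall>b\<in>insert x X. a \<noteq> b \<longrightarrow> El a \<inter> El b = {}" using I(4) dis by blast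
      show ?thesis unfolding snd_inv_def by (intro conjI I1 I2 I3 I4 I5)
    qed
    moreover have "insert x X \<subseteq> F" using X(1) x by simp
    ultimately show ?thesis by (intro exI[of _ "insert x X"] conjI)
  qed
qed

lemma tst_sound:
  assumes S: "0 \<notin> S" "S \<subseteq> {..<N}" and El: "\<And>x. El x \<subseteq> {..<N}" and t: "tst N D w El S F"
  shows "\<exists>X\<subseteq>F. tst N D w El S X \<and> finite X \<and> (\<forall>x\<in>X. \<forall>y\<in>X. x \<noteq> y \<longrightarrow> El x \<inter> El y = {}) \<and>
    card {s\<in>S. \<exists>x\<in>X. El s \<inter> El x \<noteq> {}} < card X"
proof -
  obtain W b Q A K G xs where p: "W < N" "b < N" "Q < N" "A < N" "K < N" "G < N" "xs \<in> states N w"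
    "(stp N w S F El (hcol N D W b Q A K) ^^ N) (ini w G) xs" "xs ! Suc w = Suc G"
    using t unfolding tst_def by (elim exE bexE conjE)
  have "length xs = w + 2" using p(7) by (simp add: states_def)
  from stp_sound[OF S El p(8) this] obtain X where X: "X \<subseteq> F"
    "(stp N w S X El (hcol N D W b Q A K) ^^ N) (ini w G) xs" "snd_inv N w S El (hcol N D W b Q A K) G X xs" by blast
  have "tst N D w El S X" unfolding tst_def
    by (intro exI[of _ W] exI[of _ b] exI[of _ Q] exI[of _ A] exI[of _ K] exI[of _ G] bexI[of _ xs] conjI p X(2))
  moreover obtain V where V: "V \<subseteq> S" "finite V" "\<forall>s\<in>S. (\<exists>x\<in>X. El s \<inter> El x \<noteq> {}) \<longrightarrow> s \<in> V" "xs ! Suc w + card V \<le> G + card X"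
    by (rule snd_invE[OF X(3)])
  moreover have "card {s\<in>S. \<exists>x\<in>X. El s \<inter> El x \<noteq> {}} \<le> card V"
    using V by (intro card_mono) auto
  ultimately have "tst N D w El S X" "card {s\<in>S. \<exists>x\<in>X. El s \<inter> El x \<noteq> {}} < card X" using p(9) by auto
  moreover have "finite X" "\<forall>x\<in>X. \<forall>y\<in>X. x \<noteq> y \<longrightarrow> El x \<inter> El y = {}" by (rule snd_invD[OF X(3)])+
  ultimately show ?thesis using X(1) by (intro exI[of _ X] conjI)
qed

section \<open>Completeness of the search\<close>

lemma preach_restrict: "preach A Nb F w t P X g \<Longrightarrow> X \<subseteq> Y \<Longrightarrow> preach A Nb Y w t P X g"
proof (induction rule: preach.induct)
  case init
  show ?case by (rule preach.init)
next
  case (pay t P X g a)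
  then show ?case using preach.pay by metis
next
  case (drop t P X g P')
  then show ?case using preach.drop by metis
next
  case (add t P X g b)
  then show ?case using preach.add[of A Nb Y w t P X g b] by auto
qed

text \<open>Slots may hold more than the current bag. If \<open>a\<close> is new, the bag occupies
  fewer than \<open>w\<close> of them, and any other one may be overwritten.\<close>

lemma free_slot:
  assumes "P \<subseteq> set ps" "length ps = w" "finite P" "card (insert a P) \<le> w"
  shows "\<exists>i<w. insert a P \<subseteq> set (ps[i := a])"
proof (cases "a \<in> P")
  case True
  then obtain i where "i < w" "ps ! i = a" using assms by (metis in_set_conv_nth subsetD)
  then show ?thesis using assms True by (intro exI[of _ i]) (metis insert_absorb list_update_id)
next
  case False
  have "\<forall>p\<in>P. \<exists>i<w. ps ! i = p" using assms by (metis in_set_conv_nth subsetD)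
  then obtain f where f: "\<And>p. p \<in> P \<Longrightarrow> f p < w \<and> ps ! f p = p" by metis
  have "card (f ` P) < w" using card_image_le[OF assms(3), of f] assms False by simp
  then have "f ` P \<noteq> {..<w}" by auto
  then obtain i where i: "i < w" "i \<notin> f ` P" using f by blast
  have "p \<in> set (ps[i := a])" if "p \<in> P" for p
  proof -
    have "f p \<noteq> i" using i that by blast
    then have "ps[i := a] ! f p = p" "f p < length (ps[i := a])" using f[OF that] assms(2) by simp_all
    then show ?thesis by (metis nth_mem)
  qed
  moreover have "a \<in> set (ps[i := a])" using i assms(2) by (simp add: set_update_memI)
  ultimately show ?thesis using i by blast
qed

text \<open>The slots only have to contain the bag, so a drop leaves the state as it is.
  \<open>G\<close> is at least the number of moves, which keeps the shifted gain nonnegative, and 2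
  ^ M \<le> N makes every set of colours a number within range.\<close>

lemma stp_complete:
  assumes N: "G + T < N" "T \<le> G" "0 < N" and S: "S \<subseteq> {..<N}" and B: "B \<subseteq> {..<N}"
    and El: "\<And>x. El x \<subseteq> {..<N}" "\<And>x. x \<in> B \<Longrightarrow> El x \<noteq> {}" "\<And>x y. x \<in> B \<Longrightarrow> y \<in> B \<Longrightarrow> x \<noteq> y \<Longrightarrow> El x \<inter> El y = {}"
    and col: "inj_on col (\<Union>x\<in>B. El x)" "\<And>z i. z \<in> (\<Union>x\<in>B. El x) \<Longrightarrow> i < N \<Longrightarrow> Col z i \<longleftrightarrow> i = col z"
    and cN: "\<And>z. z \<in> (\<Union>x\<in>B. El x) \<Longrightarrow> col z < M" "M \<le> N" "2 ^ M \<le> N"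
  shows "preach S (\<lambda>b. {s\<in>S. El s \<inter> El b \<noteq> {}}) B w t P X g \<Longrightarrow> t \<le> T \<Longrightarrow>
    \<exists>ps. length ps = w \<and> set ps \<subseteq> {..<N} \<and> P \<subseteq> set ps \<and>
      (stp N w S B El Col ^^ t) (ini w G) (ps @ [set_encode (col ` (\<Union>x\<in>X. El x)), nat (int G + g)])"
proof (induction rule: preach.induct)
  case init
  have "ini w G (replicate w 0 @ [set_encode (col ` (\<Union>x\<in>{}. El x)), nat (int G + 0)])"
    by (auto simp: ini_def nth_append less_Suc_eq)
  then show ?case using N by (intro exI[of _ "replicate w 0"]) (auto simp: in_set_replicate)
next
  case (pay t P X g a)
  then obtain ps where ps: "length ps = w" "set ps \<subseteq> {..<N}" "P \<subseteq> set ps"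
      "(stp N w S B El Col ^^ t) (ini w G) (ps @ [set_encode (col ` (\<Union>x\<in>X. El x)), nat (int G + g)])" by auto
  note inv = preach_inv[OF pay.hyps(1)]
  obtain i where i: "i < w" "insert a P \<subseteq> set (ps[i := a])" using free_slot[OF ps(3,1)] inv pay by blast
  let ?c = "set_encode (col ` (\<Union>x\<in>X. El x))"
  let ?xs = "ps[i := a] @ [?c, nat (int G + (g - 1))]"
  have gb: "nat (int G + g) = Suc (nat (int G + (g - 1)))" "nat (int G + g) < N"
  proof -
    have "- int t \<le> g" "g \<le> int t" "int t + 1 \<le> int G" using inv pay.prems N by auto
    then show "nat (int G + g) = Suc (nat (int G + (g - 1)))" "nat (int G + g) < N" using pay.prems N by auto
  qed
  have pi: "ps ! i < N" using ps(1,2) i(1) nth_mem by blast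
  have upd: "?xs[i := ps ! i, Suc w := nat (int G + g)] = ps @ [?c, nat (int G + g)]"
    using ps(1) i(1) by (simp add: list_update_append)
  have x1: "?xs ! i = a" "?xs ! Suc w = nat (int G + (g - 1))" using ps(1) i(1) by (auto simp: nth_append)
  have "stp N w S B El Col ((stp N w S B El Col ^^ t) (ini w G)) ?xs"
    by (rule stp_payI[OF i(1) pi gb(2)]) (use pay.hyps(2) ps(4) gb(1) upd x1 in simp_all)
  moreover have "set (ps[i := a]) \<subseteq> {..<N}" using ps(2) pay.hyps(2) S set_update_subset_insert[of ps i a] by blast
  ultimately show ?case using ps(1) i(2) by (intro exI[of _ "ps[i := a]"]) simp
next
  case (drop t P X g P')
  then show ?case by blast
next
  case (add t P X g x)
  then obtain ps where ps: "length ps = w" "set ps \<subseteq> {..<N}" "P \<subseteq> set ps"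
      "(stp N w S B El Col ^^ t) (ini w G) (ps @ [set_encode (col ` (\<Union>x\<in>X. El x)), nat (int G + g)])" by auto
  note inv = preach_inv[OF add.hyps(1)]
  have x: "x \<in> B" "x \<notin> X" "x < N" using add.hyps B by auto
  have XB: "X \<subseteq> B" using inv by blast
  let ?U = "\<lambda>X. \<Union>x\<in>X. El x"
  have enc: "set_encode (col ` ?U Y) < N" "finite (col ` ?U Y)" if "Y \<subseteq> B" for Y
  proof -
    have sub: "col ` ?U Y \<subseteq> {..<M}" using cN(1) that by blast
    show "finite (col ` ?U Y)" using sub finite_subset by blast
    have "set_encode (col ` ?U Y) \<le> (\<Sum>i<M. 2 ^ i)" unfolding set_encode_def using sub by (intro sum_mono2) auto
    also have "\<dots> < 2 ^ M" by (induction M) auto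
    finally show "set_encode (col ` ?U Y) < N" using cN(3) by simp
  qed
  let ?c = "set_encode (col ` ?U X)" and ?c' = "set_encode (col ` ?U (insert x X))"
  let ?xs = "ps @ [?c', nat (int G + (g + 1))]"
  have gb: "nat (int G + (g + 1)) = Suc (nat (int G + g))" "nat (int G + g) < N"
  proof -
    have "- int t \<le> g" "g \<le> int t" "int t + 1 \<le> int G" using inv add.prems N by auto
    then show "nat (int G + (g + 1)) = Suc (nat (int G + g))" "nat (int G + g) < N" using add.prems N by auto
  qed
  have upd: "?xs[w := ?c, Suc w := nat (int G + g)] = ps @ [?c, nat (int G + g)]"
    using ps(1) by (simp add: list_update_append)
  have nth: "?xs ! w = ?c'" "?xs ! Suc w = nat (int G + (g + 1))" "\<And>i. i < w \<Longrightarrow> ?xs ! i = ps ! i"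
    using ps(1) by (auto simp: nth_append)
  have dec: "set_decode ?c = col ` ?U X" "set_decode ?c' = col ` ?U (insert x X)"
    using enc[of X] enc[of "insert x X"] XB x by (auto simp: set_encode_inverse)
  have elx: "\<And>z. z \<in> El x \<Longrightarrow> z \<in> ?U B" using x by blast
  have colx: "(\<exists>z<N. z \<in> El x \<and> Col z i) \<longleftrightarrow> i \<in> col ` El x" if "i < N" for i
    using col(2)[OF elx that] El(1)[of x] by (auto simp: image_iff)
  have P1: "\<forall>s<N. s \<in> S \<and> (\<exists>z<N. z \<in> El s \<and> z \<in> El x) \<longrightarrow> (\<exists>i<w. ?xs ! i = s)"
  proof (intro allI impI)
    fix s assume "s < N" "s \<in> S \<and> (\<exists>z<N. z \<in> El s \<and> z \<in> El x)"
    then have "s \<in> set ps" using add.hyps(3) ps(3) by blast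
    then obtain i where "i < w" "ps ! i = s" using ps(1) by (metis in_set_conv_nth)
    then show "\<exists>i<w. ?xs ! i = s" using nth(3) by metis
  qed
  have P2: "\<exists>z<N. z \<in> El x" using El(1)[of x] El(2)[OF x(1)] by blast
  have P3: "\<forall>z<N. z \<in> El x \<longrightarrow> (\<exists>i<N. Col z i)"
  proof (intro allI impI)
    fix z assume "z < N" "z \<in> El x"
    then have "z \<in> ?U B" by (rule_tac elx)
    then show "\<exists>i<N. Col z i" using col(2)[of z "col z"] cN(1)[of z] cN(2) by (intro exI[of _ "col z"]) auto
  qed
  have P4: "\<forall>i<N. i \<in> set_decode (?xs ! w) \<longleftrightarrow> i \<in> set_decode ?c \<or> (\<exists>z<N. z \<in> El x \<and> Col z i)"
    unfolding nth dec
  proof (intro allI impI)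
    fix i assume "i < N"
    show "(i \<in> col ` ?U (insert x X)) = (i \<in> col ` ?U X \<or> (\<exists>z<N. z \<in> El x \<and> Col z i))"
      unfolding colx[OF \<open>i < N\<close>] UN_insert image_Un Un_iff by (rule disj_commute)
  qed
  have P5: "\<not> (\<exists>i<N. i \<in> set_decode ?c \<and> (\<exists>z<N. z \<in> El x \<and> Col z i))"
  proof
    assume "\<exists>i<N. i \<in> set_decode ?c \<and> (\<exists>z<N. z \<in> El x \<and> Col z i)"
    then obtain i z where i: "i < N" "i \<in> set_decode ?c" and z: "z \<in> El x" "Col z i" by (elim exE conjE)
    have "i \<in> col ` ?U X" using i(2) unfolding dec .
    then obtain z' where z': "i = col z'" "z' \<in> ?U X" by (rule imageE)
    obtain y where y: "y \<in> X" "z' \<in> El y" using z'(2) by (rule UN_E)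
    have "i = col z" using col(2)[OF elx[OF z(1)] i(1)] z(2) by (rule iffD1)
    moreover have "z' \<in> ?U B" using y XB by blast
    ultimately have "z' = z" using inj_onD[OF col(1)] elx[OF z(1)] z'(1) by simp
    moreover have "El x \<inter> El y = {}" by (rule El(3)) (use x XB y(1) in auto)
    ultimately show False using z y by blast
  qed
  have eN: "?c < N" using enc(1)[OF XB] .
  have "stp N w S B El Col ((stp N w S B El Col ^^ t) (ini w G)) ?xs"
  proof (rule stp_addI[OF x(3) eN gb(2) x(1)])
    show "fits N w S El Col ?xs ?c x" unfolding fits_def by (intro conjI P1 P2 P3 P4 P5)
    show "?xs ! Suc w = Suc (nat (int G + g))" by (rule trans[OF nth(2) gb(1)])
    show "(stp N w S B El Col ^^ t) (ini w G) (?xs[w := ?c, Suc w := nat (int G + g)])" unfolding upd by (rule ps(4))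
  qed
  then show ?case using ps(1-3) unfolding funpow.simps comp_apply by (intro exI[of _ ps] conjI)
qed

lemma cand_sound:
  assumes D: "\<And>A q u a. D A q u a \<Longrightarrow> A div q ^ u mod q = a" and c: "cand N D W b Q A x t c"
  shows "c = 2 ^ t + ((A div Q ^ t mod Q) * ((b * x mod W) * Q div W) mod Q) * 2 ^ t div Q"
proof -
  have dm: "n div d = h \<and> n mod d = r" if "h * d + r = n" "r < d" for n d h r :: nat using that by auto
  show ?thesis using c unfolding cand_def
  proof (elim exE conjE)
    fix m1 h1 s1 m2 y r2 a m3 h3 s3 p m4 v r4
    assume e: "b * x = m1" "h1 * W + s1 = m1" "s1 < W" "s1 * Q = m2" "y * W + r2 = m2" "r2 < W" "D A Q t a"
      "a * y = m3" "h3 * Q + s3 = m3" "s3 < Q" "2 ^ t = p" "s3 * p = m4" "v * Q + r4 = m4" "r4 < Q" "p + v = c"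
    show ?thesis using dm[OF e(2,3)] dm[OF e(5,6)] dm[OF e(9,10)] dm[OF e(13,14)] e D[OF e(7)] by simp
  qed
qed

text \<open>Divisions are certified by quotient and remainder. The hypotheses bound the intermediate
  products, so that all witnesses are below \<open>N\<close>.\<close>

lemma cand_complete:
  assumes D: "\<And>a. a < N \<Longrightarrow> A div Q ^ t mod Q = a \<Longrightarrow> D A Q t a"
    and N: "b * x < N" "W * Q < N" "Q * Q < N" "Q * 2 ^ t < N" and p: "0 < W" "0 < Q"
  shows "cand N D W b Q A x t (2 ^ t + ((A div Q ^ t mod Q) * ((b * x mod W) * Q div W) mod Q) * 2 ^ t div Q)"
proof -
  define s1 where "s1 = b * x mod W"
  define y where "y = s1 * Q div W"
  define a where "a = A div Q ^ t mod Q"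
  define s3 where "s3 = a * y mod Q"
  have WN: "W < N" "Q < N" using N(2,3) p mult_le_mono2[of 1 Q W] mult_le_mono2[of 1 Q Q] by linarith+
  have s1: "s1 < W" using p by (simp add: s1_def)
  have s1Q: "s1 * Q < W * Q" using s1 p by simp
  have y: "y < Q" unfolding y_def using s1Q by (intro less_mult_imp_div_less) (simp add: mult.commute)
  have a: "a < Q" using p by (simp add: a_def)
  have s3: "s3 < Q" using p by (simp add: s3_def)
  have ay: "a * y < Q * Q" using a y by (intro mult_strict_mono) auto
  have s3p: "s3 * 2 ^ t < Q * 2 ^ t" using s3 by simp
  have pN: "2 ^ t < N" using N(4) p mult_le_mono1[of 1 Q "2 ^ t"] by linarith
  show ?thesis unfolding cand_def s1_def[symmetric] y_def[symmetric] a_def[symmetric] s3_def[symmetric]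
    by (rule exI[of _ "b * x"], rule conjI[OF N(1)], rule exI[of _ "b * x div W"], rule conjI,
        rule le_less_trans[OF div_le_dividend N(1)], rule exI[of _ s1], rule conjI, rule less_trans[OF s1 WN(1)],
        intro conjI refl, simp only: s1_def div_mult_mod_eq, rule s1,
        rule exI[of _ "s1 * Q"], rule conjI, rule less_trans[OF s1Q N(2)], rule exI[of _ y], rule conjI, rule less_trans[OF y WN(2)],
        rule exI[of _ "s1 * Q mod W"], rule conjI, rule less_trans[OF mod_less_divisor[OF p(1)] WN(1)],
        intro conjI refl, simp only: y_def div_mult_mod_eq, rule mod_less_divisor[OF p(1)],
        rule exI[of _ a], rule conjI, rule less_trans[OF a WN(2)], rule exI[of _ "a * y"], rule conjI, rule less_trans[OF ay N(3)],
        rule exI[of _ "a * y div Q"], rule conjI, rule le_less_trans[OF div_le_dividend less_trans[OF ay N(3)]],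
        rule exI[of _ s3], rule conjI, rule less_trans[OF s3 WN(2)],
        intro conjI refl, rule D, rule less_trans[OF a WN(2)], simp only: a_def, simp only: s3_def div_mult_mod_eq, rule s3,
        rule exI[of _ "2 ^ t"], rule conjI[OF pN], rule exI[of _ "s3 * 2 ^ t"], rule conjI, rule less_trans[OF s3p N(4)],
        rule exI[of _ "s3 * 2 ^ t div Q"], rule conjI, rule le_less_trans[OF div_le_dividend less_trans[OF s3p N(4)]],
        rule exI[of _ "s3 * 2 ^ t mod Q"], rule conjI, rule less_trans[OF mod_less_divisor[OF p(2)] WN(2)],
        intro conjI refl, simp only: div_mult_mod_eq, rule mod_less_divisor[OF p(2)])
qed

lemma tst_complete:
  assumes pr: "preach S (\<lambda>b. {s\<in>S. El s \<inter> El b \<noteq> {}}) B w t P X 1"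
    and S: "S \<subseteq> {..<L}" and B: "B \<subseteq> {..<L}"
    and El: "\<And>x. El x \<subseteq> {..<L}" "\<And>x. x \<in> B \<Longrightarrow> El x \<noteq> {}" "\<And>x y. x \<in> B \<Longrightarrow> y \<in> B \<Longrightarrow> x \<noteq> y \<Longrightarrow> El x \<inter> El y = {}"
      "\<And>x. card (El x) \<le> k"
    and D1: "\<And>A q u a. D A q u a \<Longrightarrow> A div q ^ u mod q = a"
    and D2: "\<And>A q u a. A < N \<Longrightarrow> q < N \<Longrightarrow> u < N \<Longrightarrow> a < N \<Longrightarrow> 0 < q \<Longrightarrow> q ^ u < N \<Longrightarrow> A div q ^ u mod q = a \<Longrightarrow> D A q u a"
    and l: "k * t \<le> 2 ^ l" and m: "L \<le> 2 ^ m" "2 * l + 3 \<le> m"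
    and N: "2 ^ (m + m) < N" "(2 ^ (2 * l + 3)) ^ (l + 4) < N" "2 ^ 2 ^ (l + 4) < N" "2 * t < N"
  shows "tst N D w El S B"
proof -
  let ?Q = "2 ^ (2 * l + 3) :: nat" and ?W = "2 ^ m :: nat"
  define U where "U = (\<Union>x\<in>X. El x)"
  note inv = preach_inv[OF pr]
  have XB: "X \<subseteq> B" "finite X" "card X \<le> t" using inv by auto
  have U: "U \<subseteq> {..<2 ^ m}" using El(1) m(1) by (fastforce simp: U_def)
  have "card U \<le> (\<Sum>x\<in>X. card (El x))" unfolding U_def using XB by (intro card_UN_le) auto
  also have "\<dots> \<le> card X * k" using sum_bounded_above[of X "\<lambda>x. card (El x)" k] El(4) by simp
  also have "\<dots> \<le> k * t" using XB(3) by (simp add: mult.commute)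
  finally have cU: "card U \<le> 2 ^ l" using l by simp
  define cnd where "cnd A t y = 2 ^ t + ((A div ?Q ^ t mod ?Q) * y mod ?Q) * 2 ^ t div ?Q" for A t y
  obtain b A K col where h: "b < 2 ^ m" "A < ?Q ^ (l + 4)" "K < 2 ^ 2 ^ (l + 4)" "inj_on col U"
    and col: "\<forall>x\<in>U. \<exists>t\<le>l + 3. col x = cnd A t ((b * x mod 2 ^ m) * ?Q div 2 ^ m) \<and> col x \<in> set_decode K \<and>
      (\<forall>t'>t. cnd A t' ((b * x mod 2 ^ m) * ?Q div 2 ^ m) \<notin> set_decode K)"
    using perfect_hash_exists[OF U cU m(2), folded cnd_def] by (elim exE conjE) (rule that)
  have QW: "?Q \<le> ?W" using m(2) by (intro power_increasing) auto
  have WW: "?W * ?W < N" using N(1) by (simp add: power_add)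
  have W1: "1 * ?W \<le> ?W * ?W" by (intro mult_le_mono1) simp
  have WN: "?W < N" using W1 WW by linarith
  have QN: "?Q < N" using QW WN by linarith
  have LN: "{..<L} \<subseteq> {..<N}" using m(1) WN by auto
  have bits: "2 ^ (l + 4) \<le> N" using N(3) less_exp[of "2 ^ (l + 4)"] by linarith
  have l4: "l + 4 < N" using bits less_exp[of "l + 4"] by linarith
  let ?Col = "hcol N D ?W b ?Q A K"
  have cs: "cand N D ?W b ?Q A x t c \<Longrightarrow> c = cnd A t ((b * x mod 2 ^ m) * ?Q div 2 ^ m)" for x t c
    unfolding cnd_def by (rule cand_sound[OF D1])
  have cc: "cand N D ?W b ?Q A x t (cnd A t ((b * x mod 2 ^ m) * ?Q div 2 ^ m))" if x: "x \<in> U" and t: "t \<le> l + 3" for x t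
    unfolding cnd_def
  proof (rule cand_complete)
    have "x < 2 ^ m" using U x by auto
    then have "b * x < ?W * ?W" using h(1) by (intro mult_strict_mono) auto
    then show "b * x < N" using WW by linarith
    have "?W * ?Q \<le> ?W * ?W" using QW by (rule mult_le_mono2)
    then show "?W * ?Q < N" using WW by linarith
    have "?Q * ?Q \<le> ?W * ?W" using QW by (intro mult_le_mono)
    then show "?Q * ?Q < N" using WW by linarith
    have "(2::nat) ^ t \<le> ?Q" using t by (intro power_increasing) auto
    then have "?Q * 2 ^ t \<le> ?Q * ?Q" by (rule mult_le_mono2)
    then show "?Q * 2 ^ t < N" using \<open>?Q * ?Q < N\<close> by linarith
    show "D A ?Q t a" if "a < N" "A div ?Q ^ t mod ?Q = a" for a
    proof (rule D2[OF _ QN _ that(1) _ _ that(2)])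
      show "A < N" using h(2) N(2) by linarith
      show "t < N" using t l4 by linarith
      have "?Q ^ t \<le> ?Q ^ (l + 4)" using t by (intro power_increasing) auto
      then show "?Q ^ t < N" using N(2) by linarith
    qed simp
  qed simp_all
  have Col: "?Col x i \<longleftrightarrow> i = col x" if x: "x \<in> U" for x i
  proof -
    obtain t where t: "t \<le> l + 3" "col x = cnd A t ((b * x mod 2 ^ m) * ?Q div 2 ^ m)" "col x \<in> set_decode K"
      "\<forall>t'>t. cnd A t' ((b * x mod 2 ^ m) * ?Q div 2 ^ m) \<notin> set_decode K" using col x by blast
    have tN: "t < N" using t l4 by linarith
    have c: "cand N D ?W b ?Q A x t (col x)" using cc[OF x t(1)] t(2) by simp
    show ?thesis
    proof
      assume "?Col x i"
      then obtain t' where t': "t' < N" "cand N D ?W b ?Q A x t' i" "i \<in> set_decode K"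
        "\<forall>t''<N. \<forall>c<N. t' < t'' \<and> cand N D ?W b ?Q A x t'' c \<longrightarrow> c \<notin> set_decode K" unfolding hcol_def by blast
      have i: "i = cnd A t' ((b * x mod 2 ^ m) * ?Q div 2 ^ m)" by (rule cs[OF t'(2)])
      have "\<not> t < t'" using t(4) t'(3) i by blast
      \<comment> \<open>A lower level is refuted by the mark at level \<open>t\<close>. To be seen
        by the bounded quantifier of \<open>hcol\<close>, the marked bucket must be below
        \<open>N\<close>; it is, being the index of a set bit of \<open>K\<close>.\<close>
      moreover have "\<not> t' < t"
      proof
        assume "t' < t"
        have "2 ^ col x \<le> K"
        proof -
          have "K div 2 ^ col x \<noteq> 0" using t(3) unfolding set_decode_def by (metis even_zero mem_Collect_eq)
          then show ?thesis by (simp add: div_greater_zero_iff)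
        qed
        then have "col x < N" using less_exp[of "col x"] h(3) N(3) by linarith
        then show False using t'(4) tN c t(3) \<open>t' < t\<close> by blast
      qed
      ultimately have "t' = t" by simp
      then show "i = col x" using i t(2) by simp
    next
      assume "i = col x"
      then show "?Col x i" unfolding hcol_def using tN c t(3,4) cs by blast
    qed
  qed
  have colM: "col x < 2 ^ (l + 4)" if "x \<in> U" for x
  proof -
    have "col x \<in> set_decode K" using col that by blast
    then have "K div 2 ^ col x \<noteq> 0" unfolding set_decode_def by (metis even_zero mem_Collect_eq)
    then have "2 ^ col x \<le> K" by (simp add: div_greater_zero_iff)
    then have "(2::nat) ^ col x < 2 ^ 2 ^ (l + 4)" using h(3) by linarith
    then show ?thesis by (rule power_less_imp_less_exp[rotated]) simp
  qed
  \<comment> \<open>Only the sets actually added are kept as candidates: the hash is injective on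
    their at most k t elements, not on all elements of \<open>B\<close>.\<close>
  have prX: "preach S (\<lambda>b. {s\<in>S. El s \<inter> El b \<noteq> {}}) X w t P X 1" by (rule preach_restrict[OF pr subset_refl])
  have "t > 0" using inv by (cases t) auto
  have "\<exists>ps. length ps = w \<and> set ps \<subseteq> {..<N} \<and> P \<subseteq> set ps \<and>
      (stp N w S X El ?Col ^^ t) (ini w t) (ps @ [set_encode (col ` (\<Union>x\<in>X. El x)), nat (int t + 1)])"
  proof (rule stp_complete[where T = t and M = "2 ^ (l + 4)", OF _ _ _ _ _ _ _ _ _ _ _ _ _ prX])
    show "t + t < N" using N(4) by linarith
    show "S \<subseteq> {..<N}" by (rule subset_trans[OF S LN])
    show "X \<subseteq> {..<N}" by (rule subset_trans[OF subset_trans[OF XB(1) B] LN])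
    show "El x \<subseteq> {..<N}" for x by (rule subset_trans[OF El(1) LN])
    show "El x \<noteq> {}" if "x \<in> X" for x by (rule El(2)[OF subsetD[OF XB(1) that]])
    show "El x \<inter> El y = {}" if "x \<in> X" "y \<in> X" "x \<noteq> y" for x y
      by (rule El(3)[OF subsetD[OF XB(1) that(1)] subsetD[OF XB(1) that(2)] that(3)])
    show "inj_on col (\<Union>x\<in>X. El x)" using h(4) by (simp add: U_def)
    show "?Col z i \<longleftrightarrow> i = col z" if "z \<in> (\<Union>x\<in>X. El x)" for z i by (rule Col) (use that in \<open>simp only: U_def\<close>)
    show "col z < 2 ^ (l + 4)" if "z \<in> (\<Union>x\<in>X. El x)" for z by (rule colM) (use that in \<open>simp only: U_def\<close>)
    show "2 ^ (l + 4) \<le> N" by (rule bits)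
    show "2 ^ 2 ^ (l + 4) \<le> N" by (rule less_imp_le[OF N(3)])
    show "0 < N" using WN by linarith
  qed (rule order_refl)+
  then obtain ps where ps: "length ps = w" "set ps \<subseteq> {..<N}"
      "(stp N w S X El ?Col ^^ t) (ini w t) (ps @ [set_encode (col ` U), Suc t])"
    unfolding U_def by (auto simp: nat_add_distrib)
  let ?xs = "ps @ [set_encode (col ` U), Suc t]"
  have "set_encode (col ` U) < N"
  proof -
    have "set_encode (col ` U) \<le> (\<Sum>i<2 ^ (l + 4). 2 ^ i)" unfolding set_encode_def using colM by (intro sum_mono2) auto
    also have "\<dots> < 2 ^ M" if "M = 2 ^ (l + 4)" for M :: nat unfolding that[symmetric] by (induction M) auto
    finally show ?thesis using N(3) by simp
  qed
  then have st: "?xs \<in> states N w" using ps N(4) \<open>t > 0\<close> by (simp add: states_def)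
  have tN: "t \<le> N" using N(4) by simp
  have "(stp N w S X El ?Col ^^ N) (ini w t) ?xs" by (rule stp_iter_le[OF ps(3) tN])
  moreover have "?xs ! Suc w = Suc t" using ps(1) by (simp add: nth_append)
  moreover have "b < N" "A < N" "K < N" "t < N" using h N WN by linarith+
  ultimately have "tst N D w El S X" unfolding tst_def using WN QN st
    by (intro exI[of _ ?W] exI[of _ b] exI[of _ ?Q] exI[of _ A] exI[of _ K] exI[of _ t] bexI[of _ ?xs] conjI)
  then show ?thesis by (rule tst_mono[OF XB(1)])
qed

section \<open>Marker machines and their simulation by a Turing machine\<close>

type_synonym store = "(nat \<Rightarrow> nat) \<times> (nat \<Rightarrow> nat \<Rightarrow> bool)"

datatype test = TLt nat nat | TBit nat nat

fun holds :: "test \<Rightarrow> store \<Rightarrow> bool" where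
  "holds (TLt x y) (\<rho>, \<mu>) \<longleftrightarrow> \<rho> x < \<rho> y"
| "holds (TBit t r) (\<rho>, \<mu>) \<longleftrightarrow> \<mu> t (\<rho> r)"

datatype instr = INC nat | DEC nat | PUT nat nat bool | TEST test nat | JMP nat

fun istep :: "instr \<Rightarrow> nat \<times> store \<Rightarrow> nat \<times> store" where
  "istep (INC r) (pc, \<rho>, \<mu>) = (Suc pc, \<rho>(r := Suc (\<rho> r)), \<mu>)"
| "istep (DEC r) (pc, \<rho>, \<mu>) = (Suc pc, \<rho>(r := \<rho> r - 1), \<mu>)"
| "istep (PUT t r b) (pc, \<rho>, \<mu>) = (Suc pc, \<rho>, \<mu>(t := (\<mu> t)(\<rho> r := b)))"
| "istep (TEST b j) (pc, s) = (if holds b s then Suc pc else j, s)"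
| "istep (JMP j) (pc, s) = (j, s)"

definition fstep :: "instr list \<Rightarrow> nat \<times> store \<Rightarrow> nat \<times> store" where
  "fstep code c = (if fst c < length code then istep (code ! fst c) c else c)"

fun wf_test :: "nat \<Rightarrow> nat \<Rightarrow> test \<Rightarrow> bool" where
  "wf_test T R (TLt x y) \<longleftrightarrow> x < R \<and> y < R"
| "wf_test T R (TBit t r) \<longleftrightarrow> t < T \<and> r < R"

fun wf_instr :: "nat \<Rightarrow> nat \<Rightarrow> nat \<Rightarrow> instr \<Rightarrow> bool" where
  "wf_instr T R n (INC r) \<longleftrightarrow> 0 < r \<and> r < R"
| "wf_instr T R n (DEC r) \<longleftrightarrow> 0 < r \<and> r < R"
| "wf_instr T R n (PUT t r b) \<longleftrightarrow> t < T \<and> r < R"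
| "wf_instr T R n (TEST b j) \<longleftrightarrow> wf_test T R b \<and> j \<le> n"
| "wf_instr T R n (JMP j) \<longleftrightarrow> j \<le> n"

text \<open>A tape symbol codes a set: track \<open>t\<close> is the element \<open>t < T\<close>, and the element \<open>T + r\<close>
  marks the cell whose number is the content of register \<open>r\<close>. Register 0 always contains 0;
  its marker identifies the left end of the tape. The input symbols 1 to 4 are sets over the
  tracks 0 to 2, so the raw input is a legal tape without markers.\<close>

definition cell :: "nat \<Rightarrow> nat \<Rightarrow> store \<Rightarrow> nat \<Rightarrow> nat set" where
  "cell T R s i = {t. t < T \<and> snd s t i} \<union> {T + r |r. r < R \<and> fst s r = i}"

text \<open>The result concerns the cell where the scan stops and names the next phase: 1 sets the
  removed marker on the neighbouring cell, 2 and 3 walk back and then continue or jump. In a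
  comparison the marker met first decides, and markers on the same cell count as not less.\<close>

fun act :: "nat \<Rightarrow> instr \<Rightarrow> nat set \<Rightarrow> (nat \<times> nat set \<times> dir) option" where
  "act T (INC r) X = (if T + r \<in> X then Some (1, X - {T + r}, Right) else None)"
| "act T (DEC r) X = (if T + r \<in> X then
     (if T \<in> X then Some (2, X, Left) else Some (1, X - {T + r}, Left)) else None)"
| "act T (PUT t r b) X = (if T + r \<in> X then
     Some (2, if b then insert t X else X - {t}, Left) else None)"
| "act T (TEST (TLt x y) j) X = (if T + y \<in> X then Some (3, X, Left)
     else if T + x \<in> X then Some (2, X, Left) else None)"
| "act T (TEST (TBit t r) j) X =
     (if T + r \<in> X then Some (if t \<in> X then 2 else 3, X, Left) else None)"
| "act T (JMP j) X = Some (3, X, Left)"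

fun ireg :: "instr \<Rightarrow> nat" where
  "ireg (INC r) = r" | "ireg (DEC r) = r" | "ireg _ = 0"

fun itgt :: "instr \<Rightarrow> nat" where
  "itgt (TEST b j) = j" | "itgt (JMP j) = j" | "itgt _ = 0"

text \<open>After the start state 0 and the halting state 1 every instruction has four states: scan
  to the right, place a marker, return and go on, return and jump.\<close>

definition St :: "nat \<Rightarrow> nat" where "St i = 2 + 4 * i"

text \<open>The first move puts all register markers on cell 0. The halting move removes from cell 0
  everything except tracks 0 and 1, which is why \<open>cmd_to_tm\<close> treats this cell
  separately.\<close>

definition strans :: "nat \<Rightarrow> nat \<Rightarrow> instr list \<Rightarrow> nat \<Rightarrow> nat set \<Rightarrow> nat \<times> nat set \<times> dir" where
  "strans T R code q X =
    (if q = 0 then (St 0, X \<union> {T..<T + R}, Left)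
     else let i = (q - 2) div 4; ph = (q - 2) mod 4 in
       if i < length code then
         (if ph = 0 then (case act T (code ! i) X of None \<Rightarrow> (q, X, Right)
              | Some (p, Y, d) \<Rightarrow> (St i + p, Y, d))
          else if ph = 1 then (St i + 2, insert (T + ireg (code ! i)) X, Left)
          else if T \<in> X then
            (if ph = 2 then (St (Suc i), X, Left) else (St (itgt (code ! i)), X, Left))
          else (q, X, Left))
       else (1, X \<inter> {0, 1}, Left))"

definition mtrans :: "nat \<Rightarrow> nat \<Rightarrow> instr list \<Rightarrow> trans" where
  "mtrans T R code q s = (case strans T R code q (set_decode s) of (q', Y, d) \<Rightarrow> (q', set_encode Y, d))"

lemma set_encode_less: "X \<subseteq> {..<m} \<Longrightarrow> set_encode X < 2 ^ m"
proof -
  assume "X \<subseteq> {..<m}"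
  then have "set_encode X \<le> (\<Sum>i<m. 2 ^ i)"
    unfolding set_encode_def by (intro sum_mono2) auto
  also have "\<dots> < 2 ^ m"
    by (induction m) auto
  finally show ?thesis .
qed

lemma set_decode_lessD: "s < 2 ^ m \<Longrightarrow> set_decode s \<subseteq> {..<m}"
proof
  fix x assume "s < 2 ^ m" "x \<in> set_decode s"
  then have "s div 2 ^ x \<noteq> 0" unfolding set_decode_def by (metis even_zero mem_Collect_eq)
  then have "2 ^ x \<le> s" by (simp add: div_greater_zero_iff)
  then have "(2::nat) ^ x < 2 ^ m" using \<open>s < 2 ^ m\<close> by (rule le_less_trans)
  then show "x \<in> {..<m}" using power_less_imp_less_exp[of "2::nat" x m] by simp
qed

lemma act_bound:
  assumes "act T I X = Some (p, Y, d)" "wf_instr T R n I" "X \<subseteq> {..<T + R}"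
  shows "p < 4 \<and> Y \<subseteq> {..<T + R}"
  using assms
  by (cases "(T, I, X)" rule: act.cases) (auto split: if_splits)

lemma mtrans_wf:
  assumes wf: "\<forall>I\<in>set code. wf_instr T R (length code) I" and T: "3 \<le> T" and R: "0 < R"
  shows "tm_wf (St (Suc (length code))) (2 ^ (T + R)) (mtrans T R code)"
  unfolding tm_wf_def
proof (intro conjI allI impI)
  show "2 \<le> St (Suc (length code))" by (simp add: St_def)
  have "(2::nat) ^ 3 \<le> 2 ^ (T + R)" using T by (intro power_increasing) auto
  then show "5 \<le> (2::nat) ^ (T + R)" by simp
next
  fix q s assume q: "q < St (Suc (length code))" and s: "s < (2::nat) ^ (T + R)"
  let ?X = "set_decode s"
  have X: "?X \<subseteq> {..<T + R}" using s by (rule set_decode_lessD)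
  have "fst (strans T R code q ?X) < St (Suc (length code)) \<and>
        fst (snd (strans T R code q ?X)) \<subseteq> {..<T + R}"
  proof (cases "q = 0 \<or> \<not> (q - 2) div 4 < length code")
    case True
    then show ?thesis using X by (auto simp: strans_def St_def Let_def)
  next
    case False
    define i where "i = (q - 2) div 4"
    have i: "i < length code" using False i_def by simp
    then have wi: "wf_instr T R (length code) (code ! i)" using wf by auto
    have r: "ireg (code ! i) < R" using wi R by (cases "code ! i") auto
    have j: "itgt (code ! i) \<le> length code" using wi by (cases "code ! i") auto
    show ?thesis
    proof (cases "(q - 2) mod 4 = 0")
      case ph: True
      show ?thesis
      proof (cases "act T (code ! i) ?X")
        case None
        then show ?thesis using False ph X q i by (simp add: strans_def Let_def i_def)
      next
        case (Some a)
        obtain p Y d where a: "a = (p, Y, d)" by (cases a)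
        have "p < 4 \<and> Y \<subseteq> {..<T + R}" using act_bound[OF _ wi X] Some a by blast
        moreover have "St i + p < St (Suc (length code))" if "p < 4" using i that by (simp add: St_def)
        ultimately show ?thesis using False ph Some a i by (simp add: strans_def Let_def i_def)
      qed
    next
      case ph: False
      have "St i + 2 < St (Suc (length code))" "St (itgt (code ! i)) < St (Suc (length code))"
        "St (Suc i) < St (Suc (length code))"
        using i j by (auto simp: St_def)
      then show ?thesis using False X r q ph i by (simp add: strans_def Let_def i_def)
    qed
  qed
  then show "fst (mtrans T R code q s) < St (Suc (length code))"
    and "fst (snd (mtrans T R code q s)) < 2 ^ (T + R)"
    by (auto simp: mtrans_def set_encode_less split: prod.splits)
qed

section \<open>Machine runs with a head position on a function tape, and the simulation of single
  instructions\<close>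

definition astep :: "trans \<Rightarrow> nat \<times> nat \<times> (nat \<Rightarrow> nat) \<Rightarrow> nat \<times> nat \<times> (nat \<Rightarrow> nat)" where
  "astep \<delta> c = (case c of (q, p, f) \<Rightarrow> if q = 1 then c else
     (case \<delta> q (f p) of (q', w, d) \<Rightarrow>
       (q', (case d of Left \<Rightarrow> p - 1 | Right \<Rightarrow> Suc p), f(p := w))))"

definition ltape :: "nat list \<Rightarrow> nat \<Rightarrow> nat" where
  "ltape l i = (if i < length l then l ! i else 0)"

definition aconf :: "config \<Rightarrow> nat \<times> nat \<times> (nat \<Rightarrow> nat)" where
  "aconf c = (case c of (q, ls, rs) \<Rightarrow> (q, length ls, ltape (rev ls @ rs)))"

lemma ltape_upd: "(ltape (rev ls @ rs))(length ls := w) = ltape (rev ls @ w # tl rs)"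
proof
  fix i
  show "((ltape (rev ls @ rs))(length ls := w)) i = ltape (rev ls @ w # tl rs) i"
  proof (cases "i = length ls")
    case True
    then show ?thesis by (simp add: ltape_def nth_append)
  next
    case ne: False
    show ?thesis
    proof (cases "i < length ls")
      case True then show ?thesis using ne by (simp add: ltape_def nth_append)
    next
      case False
      then obtain m where m: "i = length ls + Suc m" using ne
        by (metis add_Suc_right less_imp_Suc_add linorder_neqE_nat)
      show ?thesis by (cases rs) (auto simp: m ltape_def nth_append)
    qed
  qed
qed

lemma ltape_head: "ltape (rev ls @ rs) (length ls) = head_sym rs"
  by (cases rs) (auto simp: ltape_def head_sym_def nth_append)

lemma aconf_step: "aconf (tm_step \<delta> c) = astep \<delta> (aconf c)"
proof (cases c)
  case (fields q ls rs)
  obtain q' w d where \<delta>: "\<delta> q (head_sym rs) = (q', w, d)" by (cases "\<delta> q (head_sym rs)")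
  show ?thesis
  proof (cases "q = 1")
    case True then show ?thesis by (simp add: fields tm_step_def astep_def aconf_def)
  next
    case False
    then show ?thesis using ltape_upd[of ls rs w] ltape_head[of ls rs] \<delta>
      by (cases d; cases ls) (auto simp: fields tm_step_def astep_def aconf_def)
  qed
qed

lemma aconf_run: "aconf ((tm_step \<delta> ^^ t) c) = (astep \<delta> ^^ t) (aconf c)"
  by (induction t) (auto simp: aconf_step)

definition sconf :: "nat \<times> nat \<times> (nat \<Rightarrow> nat set) \<Rightarrow> nat \<times> nat \<times> (nat \<Rightarrow> nat)" where
  "sconf c = (case c of (q, p, g) \<Rightarrow> (q, p, \<lambda>i. set_encode (g i)))"

lemma astep_sconf:
  assumes "finite (g p)" "q \<noteq> 1" "strans T R code q (g p) = (q', Y, d)"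
  shows "astep (mtrans T R code) (sconf (q, p, g)) =
    sconf (q', (case d of Left \<Rightarrow> p - 1 | Right \<Rightarrow> Suc p), g(p := Y))"
  using assms by (auto simp: astep_def sconf_def mtrans_def set_encode_inverse)

abbreviation mrun where "mrun T R code n \<equiv> astep (mtrans T R code) ^^ n"

lemma mrun_add:
  "mrun T R code m c = d \<Longrightarrow> mrun T R code n d = e \<Longrightarrow> mrun T R code (m + n) c = e"
  by (simp add: funpow_add add.commute[of m])

lemma St_simps [simp]: "(St i - 2) div 4 = i" "(St i - 2) mod 4 = 0" "St i \<noteq> 0" "St i \<noteq> Suc 0"
  "(St i + 1 - 2) div 4 = i" "(St i + 1 - 2) mod 4 = 1"
  "(St i + 2 - 2) div 4 = i" "(St i + 2 - 2) mod 4 = 2"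
  "(St i + 3 - 2) div 4 = i" "(St i + 3 - 2) mod 4 = 3"
  by (auto simp: St_def) presburger

lemma scan_run:
  assumes "\<And>q. q < p \<Longrightarrow> act T (code ! i) (g q) = None" "\<And>q. finite (g q)" "i < length code"
  shows "mrun T R code p (sconf (St i, 0, g)) = sconf (St i, p, g)"
  using assms(1)
proof (induction p)
  case (Suc p)
  have s: "strans T R code (St i) (g p) = (St i, g p, Right)"
    using Suc.prems[of p] assms(3) by (simp add: strans_def)
  have "mrun T R code (Suc p) (sconf (St i, 0, g)) = astep (mtrans T R code) (sconf (St i, p, g))"
    using Suc by simp
  also have "\<dots> = sconf (St i, Suc p, g)"
    using astep_sconf[where g = g, OF assms(2) _ s] by simp
  finally show ?case .
qed simp

text \<open>The marker of register 0 is on cell 0 and nowhere else, so walking left until it is seen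
  ends exactly at the origin.\<close>

lemma return_run:
  assumes o: "T \<in> g 0" "\<And>q. 0 < q \<Longrightarrow> T \<notin> g q" and fin: "\<And>q. finite (g q)" and i: "i < length code"
    and ph: "ph = 2 \<and> j = Suc i \<or> ph = 3 \<and> j = itgt (code ! i)"
  shows "mrun T R code (Suc p) (sconf (St i + ph, p, g)) = sconf (St j, 0, g)"
proof (induction p)
  case 0
  have "strans T R code (St i + ph) (g 0) = (St j, g 0, Left)"
    using ph o i by (auto simp: strans_def Let_def St_def)
  from astep_sconf[where g = g, OF fin _ this] ph show ?case by (auto simp: St_def)
next
  case (Suc p)
  have s: "strans T R code (St i + ph) (g (Suc p)) = (St i + ph, g (Suc p), Left)"
    using ph o i by (auto simp: strans_def Let_def St_def)
  have "mrun T R code (Suc (Suc p)) (sconf (St i + ph, Suc p, g)) =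
     mrun T R code (Suc p) (astep (mtrans T R code) (sconf (St i + ph, Suc p, g)))"
    by (simp only: funpow_Suc_right comp_apply)
  also have "\<dots> = mrun T R code (Suc p) (sconf (St i + ph, p, g))"
    using astep_sconf[where g = g, OF fin _ s] ph by (auto simp: St_def)
  finally show ?case using Suc by simp
qed

lemma finite_cell [simp]: "finite (cell T R s i)"
  unfolding cell_def by auto

lemma cell_mark [simp]: "T + r \<in> cell T R s i \<longleftrightarrow> r < R \<and> fst s r = i"
  by (auto simp: cell_def)

lemma cell_origin: "0 < R \<Longrightarrow> T \<in> cell T R s i \<longleftrightarrow> fst s 0 = i"
  using cell_mark[of T 0 R s i] by simp

lemma cell_track [simp]: "t < T \<Longrightarrow> t \<in> cell T R s i \<longleftrightarrow> snd s t i"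
  by (auto simp: cell_def)

lemma act_then_return:
  assumes i: "i < length code" and fin: "\<And>q. finite (g q)" "finite Y"
    and none: "\<And>q. q < p \<Longrightarrow> act T (code ! i) (g q) = None"
    and some: "act T (code ! i) (g p) = Some (ph, Y, Left)"
    and g': "g' = g(p := Y)" and o: "T \<in> g' 0" "\<And>q. 0 < q \<Longrightarrow> T \<notin> g' q"
    and ph: "ph = 2 \<and> j = Suc i \<or> ph = 3 \<and> j = itgt (code ! i)"
  shows "\<exists>n \<le> 2 * p + 5. mrun T R code n (sconf (St i, 0, g)) = sconf (St j, 0, g')"
proof -
  have fin': "finite (g' q)" for q using fin g' by auto
  have s: "strans T R code (St i) (g p) = (St i + ph, Y, Left)"
    using i some by (simp add: strans_def)
  have "mrun T R code p (sconf (St i, 0, g)) = sconf (St i, p, g)"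
    by (rule scan_run) (use assms in auto)
  moreover have "mrun T R code 1 (sconf (St i, p, g)) = sconf (St i + ph, p - 1, g')"
    using astep_sconf[where g = g, OF fin(1) _ s] g' by simp
  moreover have "mrun T R code (Suc (p - 1)) (sconf (St i + ph, p - 1, g')) = sconf (St j, 0, g')"
    by (rule return_run) (use o fin' i ph in auto)
  ultimately have "mrun T R code (p + 1 + Suc (p - 1)) (sconf (St i, 0, g)) = sconf (St j, 0, g')"
    using mrun_add by metis
  then show ?thesis by (intro exI[of _ "p + 1 + Suc (p - 1)"]) auto
qed

lemma move_then_return:
  assumes i: "i < length code" and fin: "\<And>q. finite (g q)" "finite Y"
    and none: "\<And>q. q < p \<Longrightarrow> act T (code ! i) (g q) = None"
    and some: "act T (code ! i) (g p) = Some (1, Y, d)"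
    and p': "p' = (case d of Left \<Rightarrow> p - 1 | Right \<Rightarrow> Suc p)" "p' \<noteq> p"
    and g': "g' = g(p := Y, p' := insert (T + ireg (code ! i)) (g p'))"
    and o: "T \<in> g' 0" "\<And>q. 0 < q \<Longrightarrow> T \<notin> g' q"
  shows "\<exists>n \<le> 2 * p + 5. mrun T R code n (sconf (St i, 0, g)) = sconf (St (Suc i), 0, g')"
proof -
  have fin': "finite (g' q)" for q using fin g' by auto
  have s: "strans T R code (St i) (g p) = (St i + 1, Y, d)"
    using i some by (simp add: strans_def)
  have s2: "strans T R code (St i + 1) ((g(p := Y)) p') = (St i + 2, insert (T + ireg (code ! i)) (g p'), Left)"
    unfolding strans_def Let_def St_simps using i p' by (simp add: St_def)
  have "mrun T R code p (sconf (St i, 0, g)) = sconf (St i, p, g)"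
    by (rule scan_run) (use assms in auto)
  moreover have "mrun T R code 1 (sconf (St i, p, g)) = sconf (St i + 1, p', g(p := Y))"
    using astep_sconf[where g = g, OF fin(1) _ s] p' by simp
  moreover have "mrun T R code 1 (sconf (St i + 1, p', g(p := Y))) = sconf (St i + 2, p' - 1, g')"
    using astep_sconf[where g = "g(p := Y)", OF _ _ s2] g' fin by (simp add: St_def)
  moreover have "mrun T R code (Suc (p' - 1)) (sconf (St i + 2, p' - 1, g')) = sconf (St (Suc i), 0, g')"
    by (rule return_run) (use o fin' i in auto)
  ultimately have "mrun T R code (p + 1 + 1 + Suc (p' - 1)) (sconf (St i, 0, g)) = sconf (St (Suc i), 0, g')"
    using mrun_add by metis
  moreover have "p' \<le> Suc p" using p' by (cases d) auto
  ultimately show ?thesis by (intro exI[of _ "p + 1 + 1 + Suc (p' - 1)"]) auto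
qed

lemma cell_inc:
  assumes "r < R" "v \<noteq> \<rho> r"
  shows "cell T R (\<rho>(r := v), \<mu>) = (cell T R (\<rho>, \<mu>))
    (\<rho> r := cell T R (\<rho>, \<mu>) (\<rho> r) - {T + r}, v := insert (T + r) (cell T R (\<rho>, \<mu>) v))"
proof
  fix i
  show "cell T R (\<rho>(r := v), \<mu>) i = ((cell T R (\<rho>, \<mu>))
    (\<rho> r := cell T R (\<rho>, \<mu>) (\<rho> r) - {T + r}, v := insert (T + r) (cell T R (\<rho>, \<mu>) v))) i"
    using assms by (auto simp: cell_def split: if_splits)
qed

text \<open>A walk to the relevant marker, at most one cell further, and the way back take at most 2
  M + 5 moves if no register exceeds \<open>M\<close>.\<close>

lemma istep_sim:
  assumes wf: "wf_instr T R n (code ! i)" and i: "i < length code" and R: "0 < R"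
    and z: "fst s 0 = 0" and M: "\<And>r. r < R \<Longrightarrow> fst s r \<le> M"
    and st: "istep (code ! i) (i, s) = (j, s')"
  shows "fst s' 0 = 0 \<and>
    (\<exists>n \<le> 2 * M + 5. mrun T R code n (sconf (St i, 0, cell T R s)) = sconf (St j, 0, cell T R s'))"
proof -
  obtain \<rho> \<mu> where s: "s = (\<rho>, \<mu>)" by (cases s)
  note o = cell_origin[OF R]
  have ot: "T \<in> cell T R s'' 0" "\<And>q. 0 < q \<Longrightarrow> T \<notin> cell T R s'' q" if "fst s'' 0 = 0" for s''
    using that o by auto
  have tr: "T + r < t \<Longrightarrow> \<not> t < T" for r t :: nat by simp
  have fin: "finite (cell T R s q)" for q by simp
  have bnd: "\<exists>n \<le> 2 * M + 5. P n" if "\<exists>n \<le> 2 * p + 5. P n" "p \<le> M" for P p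
    using that by (meson add_le_mono1 le_trans mult_le_mono2)
  show ?thesis
  proof (cases "code ! i")
    case (INC r)
    have j: "j = Suc i" "s' = (\<rho>(r := Suc (\<rho> r)), \<mu>)" and r: "0 < r" "r < R"
      using st wf by (auto simp: INC s)
    have z': "fst s' 0 = 0" using z r by (simp add: j s)
    have "\<exists>n \<le> 2 * \<rho> r + 5. mrun T R code n (sconf (St i, 0, cell T R s)) = sconf (St (Suc i), 0, cell T R s')"
      by (rule move_then_return[where Y = "cell T R s (\<rho> r) - {T + r}" and d = Right and p' = "Suc (\<rho> r)"])
        (use i r ot[OF z'] in \<open>auto simp: INC s j cell_inc\<close>)
    then show ?thesis using bnd M[of r] z' r by (auto simp: j s)
  next
    case (DEC r)
    have j: "j = Suc i" "s' = (\<rho>(r := \<rho> r - 1), \<mu>)" and r: "0 < r" "r < R"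
      using st wf by (auto simp: DEC s)
    have z': "fst s' 0 = 0" using z r by (simp add: j s)
    have "\<exists>n \<le> 2 * \<rho> r + 5. mrun T R code n (sconf (St i, 0, cell T R s)) = sconf (St (Suc i), 0, cell T R s')"
    proof (cases "\<rho> r = 0")
      case True
      have "s' = s" using True by (auto simp: j s)
      then show ?thesis
        by (intro act_then_return[where Y = "cell T R s (\<rho> r)" and ph = 2])
          (use i r ot[OF z'] True z o in \<open>auto simp: DEC s j\<close>)
    next
      case False
      have "cell T R s' = (cell T R s)(\<rho> r := cell T R s (\<rho> r) - {T + r},
          \<rho> r - 1 := insert (T + r) (cell T R s (\<rho> r - 1)))"
        using r False by (simp add: j s cell_inc)
      then show ?thesis
        by (intro move_then_return[where Y = "cell T R s (\<rho> r) - {T + r}" and d = Left and p' = "\<rho> r - 1"])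
          (use i r ot[OF z'] z o False in \<open>auto simp: DEC s j\<close>)
    qed
    then show ?thesis using bnd M[of r] z' r by (auto simp: j s)
  next
    case (PUT t r b)
    have j: "j = Suc i" "s' = (\<rho>, \<mu>(t := (\<mu> t)(\<rho> r := b)))" and r: "t < T" "r < R"
      using st wf by (auto simp: PUT s)
    have z': "fst s' 0 = 0" using z by (simp add: j s)
    have c: "cell T R s' = (cell T R s)(\<rho> r := (if b then insert t (cell T R s (\<rho> r)) else cell T R s (\<rho> r) - {t}))"
      using r by (auto simp: cell_def j s fun_eq_iff)
    have "\<exists>n \<le> 2 * \<rho> r + 5. mrun T R code n (sconf (St i, 0, cell T R s)) = sconf (St (Suc i), 0, cell T R s')"
      by (rule act_then_return[where ph = 2, OF _ _ _ _ _ c])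
        (use i r ot[OF z'] in \<open>auto simp: PUT s j\<close>)
    then show ?thesis using bnd M[of r] z' r by (auto simp: j s)
  next
    case (TEST b k)
    have j: "j = (if holds b s then Suc i else k)" "s' = s"
      using st by (auto simp: TEST s)
    have z': "fst s' 0 = 0" using z by (simp add: j s)
    show ?thesis
    proof (cases b)
      case (TLt x y)
      have r: "x < R" "y < R" using wf by (auto simp: TEST TLt)
      have "\<exists>n \<le> 2 * min (\<rho> x) (\<rho> y) + 5. mrun T R code n (sconf (St i, 0, cell T R s)) = sconf (St j, 0, cell T R s')"
        by (rule act_then_return[where ph = "if \<rho> x < \<rho> y then 2 else 3" and Y = "cell T R s (min (\<rho> x) (\<rho> y))"])
          (use i r ot[OF z'] in \<open>auto simp: TEST TLt s j min_def split: if_splits\<close>)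
      then show ?thesis using bnd[of "min (\<rho> x) (\<rho> y)"] M[of x] z' r by (auto simp: j s)
    next
      case (TBit t r)
      have r: "t < T" "r < R" using wf by (auto simp: TEST TBit)
      have "\<exists>n \<le> 2 * \<rho> r + 5. mrun T R code n (sconf (St i, 0, cell T R s)) = sconf (St j, 0, cell T R s')"
        by (rule act_then_return[where ph = "if \<mu> t (\<rho> r) then 2 else 3" and Y = "cell T R s (\<rho> r)"])
          (use i r ot[OF z'] in \<open>auto simp: TEST TBit s j\<close>)
      then show ?thesis using bnd[of "\<rho> r"] M[of r] z' r by (auto simp: j s)
    qed
  next
    case (JMP k)
    have j: "j = k" "s' = s" using st by (auto simp: JMP s)
    have z': "fst s' 0 = 0" using z by (simp add: j s)
    have "\<exists>n \<le> 2 * 0 + 5. mrun T R code n (sconf (St i, 0, cell T R s)) = sconf (St j, 0, cell T R s')"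
      by (rule act_then_return[where ph = 3 and Y = "cell T R s 0"])
        (use i ot[OF z'] in \<open>auto simp: JMP s j\<close>)
    then show ?thesis using z' bnd[of 0] by auto
  qed
qed

section \<open>Structured commands and their compilation to marker code\<close>

datatype cmd = Skip | Inc nat | Dec nat | Put nat nat bool | Seq cmd cmd (infixr \<open>;;\<close> 60)
  | If test cmd cmd | While test cmd

text \<open>The time is the exact number of instructions executed by the compiled code, including
  the jumps that end a first branch and a loop body.\<close>

inductive exec :: "cmd \<Rightarrow> store \<Rightarrow> nat \<Rightarrow> store \<Rightarrow> bool" where
  Skip: "exec Skip s 0 s"
| Inc: "exec (Inc r) (\<rho>, \<mu>) 1 (\<rho>(r := Suc (\<rho> r)), \<mu>)"
| Dec: "exec (Dec r) (\<rho>, \<mu>) 1 (\<rho>(r := \<rho> r - 1), \<mu>)"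
| Put: "exec (Put t r b) (\<rho>, \<mu>) 1 (\<rho>, \<mu>(t := (\<mu> t)(\<rho> r := b)))"
| Seq: "exec c1 s t1 s1 \<Longrightarrow> exec c2 s1 t2 s2 \<Longrightarrow> exec (c1 ;; c2) s (t1 + t2) s2"
| IfT: "holds b s \<Longrightarrow> exec c1 s t s' \<Longrightarrow> exec (If b c1 c2) s (1 + t + 1) s'"
| IfF: "\<not> holds b s \<Longrightarrow> exec c2 s t s' \<Longrightarrow> exec (If b c1 c2) s (1 + t) s'"
| WhileF: "\<not> holds b s \<Longrightarrow> exec (While b c) s 1 s"
| WhileT: "holds b s \<Longrightarrow> exec c s t1 s1 \<Longrightarrow> exec (While b c) s1 t2 s2 \<Longrightarrow>
    exec (While b c) s (1 + t1 + 1 + t2) s2"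

fun clen :: "cmd \<Rightarrow> nat" where
  "clen Skip = 0"
| "clen (c1 ;; c2) = clen c1 + clen c2"
| "clen (If b c1 c2) = clen c1 + clen c2 + 2"
| "clen (While b c) = clen c + 2"
| "clen _ = 1"

fun comp :: "nat \<Rightarrow> cmd \<Rightarrow> instr list" where
  "comp a Skip = []"
| "comp a (Inc r) = [INC r]"
| "comp a (Dec r) = [DEC r]"
| "comp a (Put t r b) = [PUT t r b]"
| "comp a (c1 ;; c2) = comp a c1 @ comp (a + clen c1) c2"
| "comp a (If b c1 c2) = TEST b (a + clen c1 + 2) # comp (a + 1) c1
     @ JMP (a + clen c1 + clen c2 + 2) # comp (a + clen c1 + 2) c2"
| "comp a (While b c) = TEST b (a + clen c + 2) # comp (a + 1) c @ [JMP a]"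

lemma length_comp [simp]: "length (comp a c) = clen c"
  by (induction c arbitrary: a) auto

fun wf_cmd :: "nat \<Rightarrow> nat \<Rightarrow> cmd \<Rightarrow> bool" where
  "wf_cmd T R Skip \<longleftrightarrow> True"
| "wf_cmd T R (Inc r) \<longleftrightarrow> 0 < r \<and> r < R"
| "wf_cmd T R (Dec r) \<longleftrightarrow> 0 < r \<and> r < R"
| "wf_cmd T R (Put t r b) \<longleftrightarrow> t < T \<and> r < R"
| "wf_cmd T R (c1 ;; c2) \<longleftrightarrow> wf_cmd T R c1 \<and> wf_cmd T R c2"
| "wf_cmd T R (If b c1 c2) \<longleftrightarrow> wf_test T R b \<and> wf_cmd T R c1 \<and> wf_cmd T R c2"
| "wf_cmd T R (While b c) \<longleftrightarrow> wf_test T R b \<and> wf_cmd T R c"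

lemma comp_wf: "wf_cmd T R c \<Longrightarrow> a + clen c \<le> n \<Longrightarrow> I \<in> set (comp a c) \<Longrightarrow> wf_instr T R n I"
proof (induction c arbitrary: a)
  case (Seq c1 c2)
  then show ?case using Seq.IH(1)[of a] Seq.IH(2)[of "a + clen c1"] by (auto simp: add.assoc)
next
  case (If b c1 c2)
  then show ?case using If.IH(1)[of "Suc a"] If.IH(2)[of "a + clen c1 + 2"] by (auto simp: add.assoc)
next
  case (While b c)
  then show ?case using While.IH[of "Suc a"] by auto
qed (auto simp: add.assoc)

definition code_at :: "instr list \<Rightarrow> nat \<Rightarrow> instr list \<Rightarrow> bool" where
  "code_at code a p \<longleftrightarrow> (\<forall>i<length p. a + i < length code \<and> code ! (a + i) = p ! i)"

lemma code_at_Nil [simp]: "code_at code a []"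
  by (simp add: code_at_def)

lemma code_at_Cons: "code_at code a (I # p) \<longleftrightarrow> a < length code \<and> code ! a = I \<and> code_at code (Suc a) p"
  unfolding code_at_def by (auto simp: less_Suc_eq_0_disj all_conj_distrib)

lemma code_at_append: "code_at code a (p @ p') \<longleftrightarrow> code_at code a p \<and> code_at code (a + length p) p'"
proof (induction p arbitrary: a)
  case (Cons I p)
  show ?case using Cons[of "Suc a"] by (simp add: code_at_Cons)
qed simp

lemma fstep_code: "code_at code a (I # p) \<Longrightarrow> fstep code (a, s) = istep I (a, s)"
  by (simp add: code_at_Cons fstep_def)

lemma frun_add:
  "(fstep code ^^ m) c = d \<Longrightarrow> (fstep code ^^ n) d = e \<Longrightarrow> (fstep code ^^ (m + n)) c = e"
  by (simp add: funpow_add add.commute[of m])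

lemma frun_1: "fstep code c = d \<Longrightarrow> (fstep code ^^ 1) c = d"
  by simp

lemma exec_comp:
  "exec c s t s' \<Longrightarrow> code_at code a (comp a c) \<Longrightarrow> (fstep code ^^ t) (a, s) = (a + clen c, s')"
proof (induction arbitrary: a rule: exec.induct)
  case (Seq c1 s t1 s1 c2 t2 s2)
  have "code_at code a (comp a c1)" "code_at code (a + clen c1) (comp (a + clen c1) c2)"
    using Seq.prems by (auto simp: code_at_append)
  from frun_add[OF Seq.IH(1)[OF this(1)] Seq.IH(2)[OF this(2)]] show ?case by (simp add: add.assoc)
next
  case (IfT b s c1 t s' c2)
  have c: "code_at code (a + 1) (comp (a + 1) c1)"
      "code_at code (a + 1 + clen c1) (JMP (a + clen c1 + clen c2 + 2) # comp (a + clen c1 + 2) c2)"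
    using IfT.prems by (auto simp: code_at_append code_at_Cons)
  have "fstep code (a, s) = (a + 1, s)"
    using IfT by (simp add: fstep_code[of code a "TEST b (a + clen c1 + 2)"])
  note frun_add[OF frun_1[OF this] IfT.IH[OF c(1)]]
  moreover have "fstep code (a + 1 + clen c1, s') = (a + clen (If b c1 c2), s')"
    using fstep_code[OF c(2)] by simp
  ultimately show ?case using frun_add[OF _ frun_1] by blast
next
  case (IfF b s c2 t s' c1)
  have c: "code_at code (a + clen c1 + 2) (comp (a + clen c1 + 2) c2)"
    using IfF.prems by (auto simp: code_at_append code_at_Cons)
  have "fstep code (a, s) = (a + clen c1 + 2, s)"
    using IfF by (simp add: fstep_code[of code a "TEST b (a + clen c1 + 2)"])
  from frun_add[OF frun_1[OF this] IfF.IH[OF c(1)]] show ?case by (simp add: algebra_simps)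
next
  case (WhileF b s c)
  then show ?case by (simp add: fstep_code[of code a "TEST b (a + clen c + 2)"])
next
  case (WhileT b s c t1 s1 t2 s2)
  have c: "code_at code (a + 1) (comp (a + 1) c)" "code_at code (a + 1 + clen c) [JMP a]"
    using WhileT.prems by (auto simp: code_at_append code_at_Cons)
  have "fstep code (a, s) = (a + 1, s)"
    using WhileT by (simp add: fstep_code[of code a "TEST b (a + clen c + 2)"])
  note frun_add[OF frun_1[OF this] WhileT.IH(1)[OF c(1)]]
  moreover have "fstep code (a + 1 + clen c, s1) = (a, s1)"
    using fstep_code[OF c(2)] by simp
  ultimately have "(fstep code ^^ (1 + t1 + 1)) (a, s) = (a, s1)" using frun_add[OF _ frun_1] by blast
  from frun_add[OF this WhileT.IH(2)[OF WhileT.prems]] show ?case by simp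
qed (auto simp: fstep_code)

text \<open>An instruction raises a register by at most one, so during \<open>t\<close> instructions
  no marker gets beyond cell M + t.\<close>

lemma frun_sim:
  assumes wf: "\<forall>I\<in>set code. wf_instr T R (length code) I" and R: "0 < R"
    and z: "fst s 0 = 0" and M: "\<And>r. r < R \<Longrightarrow> fst s r \<le> M"
    and run: "(fstep code ^^ t) (i, s) = (j, s')"
  shows "\<exists>n \<le> t * (2 * (M + t) + 5). mrun T R code n (sconf (St i, 0, cell T R s)) = sconf (St j, 0, cell T R s')"
    (is "\<exists>n\<le>_. ?run n i s j s'")
proof -
  have "fst s' 0 = 0 \<and> (\<forall>r<R. fst s' r \<le> M + t) \<and> (\<exists>n \<le> t * (2 * (M + t) + 5). ?run n i s j s')"
    using run
  proof (induction t arbitrary: j s')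
    case 0
    then show ?case using z M by auto
  next
    case (Suc t)
    obtain j1 s1 where 1: "(fstep code ^^ t) (i, s) = (j1, s1)"
      by (cases "(fstep code ^^ t) (i, s)") blast
    obtain n where IH: "fst s1 0 = 0" "\<And>r. r < R \<Longrightarrow> fst s1 r \<le> M + t" "n \<le> t * (2 * (M + t) + 5)" "?run n i s j1 s1"
      using Suc.IH[OF 1] by blast
    have st: "fstep code (j1, s1) = (j, s')" using Suc.prems 1 by simp
    show ?case
    proof (cases "j1 < length code")
      case True
      then have ist: "istep (code ! j1) (j1, s1) = (j, s')" using st by (simp add: fstep_def)
      have wi: "wf_instr T R (length code) (code ! j1)" using wf True by auto
      obtain n' where n': "fst s' 0 = 0" "n' \<le> 2 * (M + t) + 5" "?run n' j1 s1 j s'"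
        using istep_sim[OF wi True R IH(1,2) ist] by blast
      have "fst s' r \<le> M + Suc t" if "r < R" for r
        using IH(2)[OF that] ist
        by (cases "(code ! j1, j1, s1)" rule: istep.cases) auto
      moreover have "?run (n + n') i s j s'" using mrun_add IH(4) n'(3) by blast
      moreover have "n + n' \<le> Suc t * (2 * (M + Suc t) + 5)"
      proof -
        have "n + n' \<le> Suc t * (2 * (M + t) + 5)" using IH(3) n'(2) by simp
        also have "\<dots> \<le> Suc t * (2 * (M + Suc t) + 5)" by (intro mult_le_mono2) simp
        finally show ?thesis .
      qed
      ultimately show ?thesis using n'(1) by blast
    next
      case False
      then have e: "j = j1" "s' = s1" using st by (auto simp: fstep_def)
      have "n \<le> Suc t * (2 * (M + Suc t) + 5)"
      proof -
        have "t * (2 * (M + t) + 5) \<le> Suc t * (2 * (M + Suc t) + 5)" by (intro mult_le_mono) simp_all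
        then show ?thesis using IH(3) by linarith
      qed
      moreover have "\<forall>r<R. fst s' r \<le> M + Suc t" using IH(2) e(2) by (simp add: le_SucI)
      ultimately show ?thesis using IH(1,4) e by blast
    qed
  qed
  then show ?thesis by blast
qed

definition mem0 :: "nat list \<Rightarrow> nat \<Rightarrow> nat \<Rightarrow> bool" where
  "mem0 inp t i \<longleftrightarrow> i < length inp \<and> t \<in> set_decode (inp ! i)"

lemma takeWhile_ltape:
  assumes "\<And>i. i < length ys \<Longrightarrow> ltape l i = ys ! i" "ltape l (length ys) = 0" "0 \<notin> set ys"
  shows "takeWhile (\<lambda>s. s \<noteq> 0) l = ys"
proof -
  have len: "length ys \<le> length l"
  proof (rule ccontr)
    assume "\<not> ?thesis"
    then have "length l < length ys" by simp
    then have "ys ! length l = 0" using assms(1)[of "length l"] by (simp add: ltape_def)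
    then show False using assms(3) \<open>length l < length ys\<close> nth_mem by metis
  qed
  have ne: "\<forall>x\<in>set ys. x \<noteq> 0" using assms(3) by (intro ballI notI) simp
  have t: "take (length ys) l = ys"
    using len assms(1) by (intro nth_equalityI) (auto simp: ltape_def)
  show ?thesis
  proof (cases "length ys = length l")
    case True
    then have "l = ys" using t by simp
    then show ?thesis using ne by (simp only: takeWhile_eq_all_conv)
  next
    case False
    then have l: "l = ys @ 0 # drop (Suc (length ys)) l"
      using id_take_nth_drop[of "length ys" l] len t assms(2) by (simp add: ltape_def)
    have "takeWhile (\<lambda>s. s \<noteq> 0) (ys @ 0 # zs) = ys" for zs
      using ne by (simp add: takeWhile_append2)
    then show ?thesis by (subst l)
  qed
qed

text \<open>The command starts on the raw input, whose symbols use tracks 0 to 2; hence at least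
  three tracks. Registers that end with content 0 do not spoil the output, because the halting move
  cleans cell 0. The additional 2 moves are the initial one and the halting one.\<close>

theorem cmd_to_tm:
  assumes wf: "wf_cmd T R c" and T: "3 \<le> T" and R: "0 < R"
  shows "\<exists>Q Sg \<delta>. tm_wf Q Sg \<delta> \<and>
    (\<forall>inp t s' ys. set inp \<subseteq> {1..4} \<longrightarrow> exec c (\<lambda>_. 0, mem0 inp) t s' \<longrightarrow>
      (\<forall>i < length ys. ys ! i = set_encode (if i = 0 then cell T R s' i \<inter> {0, 1} else cell T R s' i)) \<longrightarrow>
      cell T R s' (length ys) \<inter> (if ys = [] then {0, 1} else UNIV) = {} \<longrightarrow> 0 \<notin> set ys \<longrightarrow>
      (\<exists>n \<le> t * (2 * t + 5) + 2. fst (tm_run \<delta> n inp) = 1 \<and> tm_output (tm_run \<delta> n inp) = ys))"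
proof -
  define code where "code = comp 0 c"
  have wfc: "\<forall>I\<in>set code. wf_instr T R (length code) I"
    using comp_wf[OF wf, of 0] by (auto simp: code_def)
  let ?\<delta> = "mtrans T R code"
  have wfd: "tm_wf (St (Suc (length code))) (2 ^ (T + R)) ?\<delta>"
    by (rule mtrans_wf[OF wfc T R])
  have "\<exists>n \<le> t * (2 * t + 5) + 2. fst (tm_run ?\<delta> n inp) = 1 \<and> tm_output (tm_run ?\<delta> n inp) = ys"
    if hyps: "set inp \<subseteq> {1..4}" "exec c (\<lambda>_. 0, mem0 inp) t s'"
      "\<forall>i < length ys. ys ! i = set_encode (if i = 0 then cell T R s' i \<inter> {0, 1} else cell T R s' i)"
      "cell T R s' (length ys) \<inter> (if ys = [] then {0, 1} else UNIV) = {}" "0 \<notin> set ys" for inp t s' ys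
  proof -
  note inp = hyps(1) and ex = hyps(2) and ys = hyps(3) and end0 = hyps(4) and ys0 = hyps(5)
  let ?s = "(\<lambda>_. 0, mem0 inp) :: store"
  define g where "g i = (if i < length inp then set_decode (inp ! i) else {})" for i
  have g3: "g i \<subseteq> {..<T}" for i
  proof -
    have "i < length inp \<Longrightarrow> inp ! i \<in> {1..4}" using inp nth_mem by blast
    then have "i < length inp \<Longrightarrow> inp ! i < 2 ^ 3" by fastforce
    then have "g i \<subseteq> {..<3}" using set_decode_lessD by (auto simp: g_def)
    then show ?thesis using T by auto
  qed
  have a0: "aconf (0, [], inp) = sconf (0, 0, g)"
    by (auto simp: aconf_def sconf_def ltape_def g_def fun_eq_iff)
  have c0: "cell T R ?s = g(0 := g 0 \<union> {T..<T + R})"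
  proof
    fix i
    have "{t. t < T \<and> mem0 inp t i} = g i" using g3[of i] by (auto simp: mem0_def g_def)
    moreover have "{T + r |r. r < R \<and> (0::nat) = i} = (if i = 0 then {T..<T + R} else {})"
      by (auto intro: le_Suc_ex[THEN exE] simp: nat_le_iff_add)
    ultimately show "cell T R ?s i = (g(0 := g 0 \<union> {T..<T + R})) i" by (auto simp: cell_def)
  qed
  have "mrun T R code 1 (sconf (0, 0, g)) = sconf (St 0, 0, cell T R ?s)"
    using astep_sconf[where g = g and p = 0 and q = 0 and T = T and R = R and code = code]
      finite_subset[OF g3 finite_lessThan] by (simp add: strans_def c0)
  moreover obtain n where n: "n \<le> t * (2 * (0 + t) + 5)"
      "mrun T R code n (sconf (St 0, 0, cell T R ?s)) = sconf (St (clen c), 0, cell T R s')"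
    using frun_sim[OF wfc R _ _ exec_comp[OF ex, of code 0], where M = 0] by (auto simp: code_def code_at_def)
  ultimately have "mrun T R code (1 + n) (sconf (0, 0, g)) = sconf (St (clen c), 0, cell T R s')"
    by (blast intro: mrun_add)
  moreover
  define h where "h = (cell T R s')(0 := cell T R s' 0 \<inter> {0, 1})"
  have "mrun T R code 1 (sconf (St (clen c), 0, cell T R s')) = sconf (1, 0, h)"
    using astep_sconf[where g = "cell T R s'" and p = 0 and q = "St (clen c)" and T = T and R = R and code = code]
    by (simp add: strans_def h_def code_def)
  ultimately have run: "mrun T R code (1 + n + 1) (sconf (0, 0, g)) = sconf (1, 0, h)"
    by (rule mrun_add)
  let ?c = "tm_run ?\<delta> (1 + n + 1) inp"
  have "aconf ?c = sconf (1, 0, h)"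
    using run by (simp only: tm_run_def aconf_run a0)
  then obtain rs where c: "?c = (1, [], rs)" and rs: "ltape rs = (\<lambda>i. set_encode (h i))"
    by (cases ?c) (auto simp: aconf_def sconf_def)
  have "tm_output ?c = ys"
    unfolding c tm_output_def snd_conv
  proof (rule takeWhile_ltape)
    show "ltape rs i = ys ! i" if "i < length ys" for i
      using ys that by (simp add: rs h_def)
    show "ltape rs (length ys) = 0"
      using end0 by (auto simp: rs h_def split: if_splits)
  qed (rule ys0)
  then show "\<exists>n \<le> t * (2 * t + 5) + 2. fst (tm_run ?\<delta> n inp) = 1 \<and> tm_output (tm_run ?\<delta> n inp) = ys"
    using n c by (intro exI[of _ "1 + n + 1"]) auto
  qed
  note claim = this
  show ?thesis
    by (rule exI[of _ "St (Suc (length code))"], rule exI[of _ "2 ^ (T + R)"], rule exI[of _ ?\<delta>],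
        rule conjI[OF wfd], intro allI impI, rule claim)
qed

section \<open>A query language compiled to marker machines\<close>

definition runs :: "nat \<Rightarrow> cmd \<Rightarrow> store \<Rightarrow> store \<Rightarrow> bool" where
  "runs T c s s' \<longleftrightarrow> (\<exists>t\<le>T. exec c s t s')"

lemma runs_mono: "runs T c s s' \<Longrightarrow> T \<le> T' \<Longrightarrow> runs T' c s s'"
  unfolding runs_def using le_trans by blast

lemma runs_Skip: "runs 0 Skip s s"
  unfolding runs_def using exec.Skip by blast

lemma runs_Inc: "runs 1 (Inc r) (\<rho>, \<mu>) (\<rho>(r := Suc (\<rho> r)), \<mu>)"
  unfolding runs_def using exec.Inc by blast

lemma runs_Dec: "runs 1 (Dec r) (\<rho>, \<mu>) (\<rho>(r := \<rho> r - 1), \<mu>)"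
  unfolding runs_def using exec.Dec by blast

lemma runs_Put: "runs 1 (Put t r b) (\<rho>, \<mu>) (\<rho>, \<mu>(t := (\<mu> t)(\<rho> r := b)))"
  unfolding runs_def using exec.Put by blast

lemma runs_Seq: "runs T1 c1 s s1 \<Longrightarrow> runs T2 c2 s1 s2 \<Longrightarrow> runs (T1 + T2) (c1 ;; c2) s s2"
  unfolding runs_def using exec.Seq add_mono by metis

lemma runs_If:
  assumes "holds b s \<Longrightarrow> runs T c1 s s'" "\<not> holds b s \<Longrightarrow> runs T c2 s s'"
  shows "runs (T + 2) (If b c1 c2) s s'"
proof (cases "holds b s")
  case True
  then obtain t where "t \<le> T" "exec c1 s t s'" using assms by (auto simp: runs_def)
  then show ?thesis using exec.IfT[OF True, of c1 t s' c2] by (auto simp: runs_def intro!: exI[of _ "1 + t + 1"])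
next
  case False
  then obtain t where "t \<le> T" "exec c2 s t s'" using assms by (auto simp: runs_def)
  then show ?thesis using exec.IfF[OF False, of c2 t s' c1] by (auto simp: runs_def intro!: exI[of _ "1 + t"])
qed

lemma runs_If1:
  assumes "holds b s \<Longrightarrow> runs 1 c1 s s'" "\<not> holds b s \<Longrightarrow> runs 1 c2 s s'"
  shows "runs 3 (If b c1 c2) s s'"
  using runs_If[OF assms] by (simp add: numeral_3_eq_3)

lemma runs_While_step:
  assumes "holds b s" "runs T c s s1" "runs T' (While b c) s1 s2"
  shows "runs (T + 2 + T') (While b c) s s2"
proof -
  obtain t t' where "t \<le> T" "exec c s t s1" "t' \<le> T'" "exec (While b c) s1 t' s2"
    using assms by (auto simp: runs_def)
  then show ?thesis using exec.WhileT[OF assms(1), of c t s1 t' s2]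
    by (auto simp: runs_def intro!: exI[of _ "1 + t + 1 + t'"])
qed

lemma runs_While_end: "\<not> holds b s \<Longrightarrow> runs 1 (While b c) s s"
  unfolding runs_def using exec.WhileF by blast

lemma runs_While:
  assumes "\<And>i. i < n \<Longrightarrow> holds b (s i)" "\<And>i. i < n \<Longrightarrow> runs T c (s i) (s (Suc i))" "\<not> holds b (s n)"
  shows "runs (n * (T + 2) + 1) (While b c) (s 0) (s n)"
proof -
  have "runs ((n - i) * (T + 2) + 1) (While b c) (s i) (s n)" if "i \<le> n" for i
    using that
  proof (induction rule: inc_induct)
    case base
    then show ?case using runs_While_end[OF assms(3)] by simp
  next
    case (step i)
    have "(T + 2) + ((n - Suc i) * (T + 2) + 1) = (n - i) * (T + 2) + 1"
    proof -
      have "n - i = Suc (n - Suc i)" using step by simp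
      then show ?thesis by simp
    qed
    then show ?case
      using runs_While_step[OF assms(1,2)[OF step(2)] step(3)] by simp
  qed
  from this[of 0] show ?thesis by simp
qed

definition clr :: "nat \<Rightarrow> cmd" where "clr r = While (TLt 0 r) (Dec r)"

lemma runs_clr: "\<rho> 0 = 0 \<Longrightarrow> r \<noteq> 0 \<Longrightarrow> runs (3 * \<rho> r + 1) (clr r) (\<rho>, \<mu>) (\<rho>(r := 0), \<mu>)"
proof -
  assume a: "\<rho> 0 = 0" "r \<noteq> 0"
  let ?s = "\<lambda>i. (\<rho>(r := \<rho> r - i), \<mu>)"
  have "runs (\<rho> r * (1 + 2) + 1) (clr r) (?s 0) (?s (\<rho> r))"
    unfolding clr_def
  proof (rule runs_While)
    show "runs 1 (Dec r) (?s i) (?s (Suc i))" if "i < \<rho> r" for i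
      using runs_Dec[of r "\<rho>(r := \<rho> r - i)" \<mu>] by simp
  qed (use a in auto)
  then show ?thesis by (simp add: eval_nat_numeral)
qed

definition cadd :: "nat \<Rightarrow> nat \<Rightarrow> nat \<Rightarrow> cmd" where
  "cadd r x c = While (TLt c x) (Inc c ;; Inc r) ;; clr c"

lemma runs_cadd:
  assumes "\<rho> 0 = 0" "\<rho> c = 0" "c \<noteq> r" "c \<noteq> x" "r \<noteq> x" "c \<noteq> 0" "r \<noteq> 0"
  shows "runs (7 * \<rho> x + 2) (cadd r x c) (\<rho>, \<mu>) (\<rho>(r := \<rho> r + \<rho> x), \<mu>)"
proof -
  let ?s = "\<lambda>i. (\<rho>(c := i, r := \<rho> r + i), \<mu>)"
  have 1: "runs (\<rho> x * (2 + 2) + 1) (While (TLt c x) (Inc c ;; Inc r)) (?s 0) (?s (\<rho> x))"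
  proof (rule runs_While)
    show "runs 2 (Inc c ;; Inc r) (?s i) (?s (Suc i))" for i
      using runs_Seq[OF runs_Inc[of c "\<rho>(c := i, r := \<rho> r + i)" \<mu>] runs_Inc[of r]] assms
      by (simp add: fun_upd_twist numeral_2_eq_2)
  qed (use assms in auto)
  have 2: "runs (3 * \<rho> x + 1) (clr c) (?s (\<rho> x)) (\<rho>(r := \<rho> r + \<rho> x), \<mu>)"
  proof -
    have "(\<rho>(c := \<rho> x, r := \<rho> r + \<rho> x))(c := 0) = \<rho>(r := \<rho> r + \<rho> x)"
      using assms by (auto simp: fun_eq_iff)
    then show ?thesis
      using runs_clr[of "\<rho>(c := \<rho> x, r := \<rho> r + \<rho> x)" c \<mu>] assms by (simp add: fun_upd_twist)
  qed
  have "?s 0 = (\<rho>, \<mu>)" using assms by (auto simp: fun_eq_iff)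
  with runs_Seq[OF 1 2] show ?thesis unfolding cadd_def by (simp add: algebra_simps)
qed

definition cmul :: "nat \<Rightarrow> nat \<Rightarrow> nat \<Rightarrow> nat \<Rightarrow> cmd" where
  "cmul x y t c = While (TLt 0 x) (Dec x ;; cadd t y c) ;; While (TLt 0 t) (Dec t ;; Inc x)"

lemma runs_cmul:
  assumes "\<rho> 0 = 0" "\<rho> c = 0" "\<rho> t = 0" "distinct [0, x, y, t, c]"
  shows "runs (\<rho> x * (11 * \<rho> y + 5) + 2) (cmul x y t c) (\<rho>, \<mu>) (\<rho>(x := \<rho> x * \<rho> y), \<mu>)"
proof -
  let ?s = "\<lambda>i. (\<rho>(x := \<rho> x - i, t := i * \<rho> y), \<mu>)"
  have 1: "runs (\<rho> x * (1 + (7 * \<rho> y + 2) + 2) + 1) (While (TLt 0 x) (Dec x ;; cadd t y c)) (?s 0) (?s (\<rho> x))"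
  proof (rule runs_While)
    show "runs (1 + (7 * \<rho> y + 2)) (Dec x ;; cadd t y c) (?s i) (?s (Suc i))" if "i < \<rho> x" for i
    proof (rule runs_Seq[where ?s1.0 = "(\<rho>(x := \<rho> x - Suc i, t := i * \<rho> y), \<mu>)"])
      show "runs 1 (Dec x) (?s i) (\<rho>(x := \<rho> x - Suc i, t := i * \<rho> y), \<mu>)"
        using runs_Dec[of x "\<rho>(x := \<rho> x - i, t := i * \<rho> y)" \<mu>] assms by (simp add: fun_upd_twist)
      show "runs (7 * \<rho> y + 2) (cadd t y c) (\<rho>(x := \<rho> x - Suc i, t := i * \<rho> y), \<mu>) (?s (Suc i))"
        using runs_cadd[of "\<rho>(x := \<rho> x - Suc i, t := i * \<rho> y)" c t y \<mu>] assms by (simp add: algebra_simps)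
    qed
  qed (use assms in auto)
  let ?r = "\<lambda>i. (\<rho>(x := i, t := \<rho> x * \<rho> y - i), \<mu>)"
  have 2: "runs (\<rho> x * \<rho> y * (2 + 2) + 1) (While (TLt 0 t) (Dec t ;; Inc x)) (?r 0) (?r (\<rho> x * \<rho> y))"
  proof (rule runs_While)
    show "runs 2 (Dec t ;; Inc x) (?r i) (?r (Suc i))" for i
      using runs_Seq[OF runs_Dec[of t "\<rho>(x := i, t := \<rho> x * \<rho> y - i)" \<mu>] runs_Inc[of x]] assms
      by (simp add: fun_upd_twist numeral_2_eq_2)
  qed (use assms in auto)
  have e: "?s 0 = (\<rho>, \<mu>)" "?s (\<rho> x) = ?r 0" "?r (\<rho> x * \<rho> y) = (\<rho>(x := \<rho> x * \<rho> y), \<mu>)"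
    using assms by (auto simp: fun_eq_iff)
  show ?thesis using runs_Seq[OF 1 2[folded e(2)]] unfolding cmul_def e
    by (simp add: algebra_simps)
qed

section \<open>Bounded first-order queries, programs over them, and their compilation\<close>

type_synonym interp = "nat \<Rightarrow> nat list \<Rightarrow> bool"

datatype fm = FLt nat nat | FRel nat "nat list" | Neg fm | Con fm fm | Ex nat fm

fun eval :: "nat \<Rightarrow> interp \<Rightarrow> (nat \<Rightarrow> nat) \<Rightarrow> fm \<Rightarrow> bool" where
  "eval N I e (FLt x y) \<longleftrightarrow> e x < e y"
| "eval N I e (FRel r vs) \<longleftrightarrow> I r (map e vs)"
| "eval N I e (Neg \<phi>) \<longleftrightarrow> \<not> eval N I e \<phi>"
| "eval N I e (Con \<phi> \<psi>) \<longleftrightarrow> eval N I e \<phi> \<and> eval N I e \<psi>"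
| "eval N I e (Ex v \<phi>) \<longleftrightarrow> (\<exists>x<N. eval N I (e(v := x)) \<phi>)"

text \<open>A relation of arity a over {..<N} occupies N ^ a cells of one track, so a fixed program
  takes time polynomial in \<open>N\<close>.\<close>

datatype prog = Assign nat nat nat fm | PSeq prog prog (infixr \<open>;;;\<close> 60) | PFor nat prog

definition upd :: "(nat \<Rightarrow> nat) \<Rightarrow> nat \<Rightarrow> nat list \<Rightarrow> nat \<Rightarrow> nat" where
  "upd e v xs = (\<lambda>u. if v \<le> u \<and> u < v + length xs then xs ! (u - v) else e u)"

definition tup :: "nat \<Rightarrow> nat \<Rightarrow> nat list set" where
  "tup N a = {xs. length xs = a \<and> set xs \<subseteq> {..<N}}"

fun run :: "nat \<Rightarrow> (nat \<Rightarrow> nat) \<Rightarrow> prog \<Rightarrow> interp \<Rightarrow> interp" where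
  "run N e (Assign r v a \<phi>) I = I(r := \<lambda>xs. xs \<in> tup N a \<and> eval N I (upd e v xs) \<phi>)"
| "run N e (p ;;; q) I = run N e q (run N e p I)"
| "run N e (PFor v p) I = fold (\<lambda>x. run N (e(v := x)) p) [0..<N] I"

text \<open>Well-formedness in scope \<open>d\<close>: the variables below \<open>d\<close> may occur free, and bound variables
  increase along nesting, so every register from \<open>d\<close> on is scratch.\<close>

fun wf_fm :: "nat \<Rightarrow> (nat \<Rightarrow> nat) \<Rightarrow> nat \<Rightarrow> nat \<Rightarrow> fm \<Rightarrow> bool" where
  "wf_fm n ar V d (FLt x y) \<longleftrightarrow> x < d \<and> y < d"
| "wf_fm n ar V d (FRel r vs) \<longleftrightarrow> r < n \<and> length vs = ar r \<and> (\<forall>v\<in>set vs. v < d)"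
| "wf_fm n ar V d (Neg \<phi>) \<longleftrightarrow> wf_fm n ar V d \<phi>"
| "wf_fm n ar V d (Con \<phi> \<psi>) \<longleftrightarrow> wf_fm n ar V d \<phi> \<and> wf_fm n ar V d \<psi>"
| "wf_fm n ar V d (Ex v \<phi>) \<longleftrightarrow> d \<le> v \<and> v < V \<and> wf_fm n ar V (Suc v) \<phi>"

fun wf_prog :: "nat \<Rightarrow> (nat \<Rightarrow> nat) \<Rightarrow> nat \<Rightarrow> nat \<Rightarrow> prog \<Rightarrow> bool" where
  "wf_prog n ar V d (Assign r v a \<phi>) \<longleftrightarrow> r < n \<and> a = ar r \<and> d \<le> v \<and> v + a \<le> V \<and> wf_fm n ar V (v + a) \<phi>"
| "wf_prog n ar V d (p ;;; q) \<longleftrightarrow> wf_prog n ar V d p \<and> wf_prog n ar V d q"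
| "wf_prog n ar V d (PFor v p) \<longleftrightarrow> d \<le> v \<and> v < V \<and> wf_prog n ar V (Suc v) p"

definition addr :: "nat \<Rightarrow> nat \<Rightarrow> nat list \<Rightarrow> nat" where
  "addr N = foldl (\<lambda>a x. a * N + x)"

lemma addr_simps [simp]: "addr N a [] = a" "addr N a (x # xs) = addr N (a * N + x) xs"
  by (auto simp: addr_def)

lemma addr_snoc: "addr N a (xs @ [x]) = addr N a xs * N + x"
  by (simp add: addr_def)

lemma addr_inj:
  assumes "set xs \<subseteq> {..<N}" "set ys \<subseteq> {..<N}" "length xs = length ys" "addr N a xs = addr N a ys"
  shows "xs = ys"
  using assms
proof (induction xs arbitrary: ys rule: rev_induct)
  case (snoc x xs)
  obtain y zs where ys: "ys = zs @ [y]" using snoc.prems by (cases ys rule: rev_cases) auto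
  have "x < N" "y < N" using snoc.prems ys by auto
  moreover have "addr N a xs * N + x = addr N a zs * N + y" using snoc.prems ys by (simp add: addr_snoc)
  ultimately have "x = y" "addr N a xs = addr N a zs"
    by (metis mod_mult_self3 mod_less, metis div_mult_self3 div_less add_0_right not_less_zero)
  then show ?case using snoc ys by simp
qed simp

lemma addr_le: "set xs \<subseteq> {..<N} \<Longrightarrow> a < N ^ p \<Longrightarrow> addr N a xs < N ^ (p + length xs)"
proof (induction xs rule: rev_induct)
  case (snoc x xs)
  have "addr N a xs * N + x < Suc (addr N a xs) * N" using snoc.prems by auto
  also have "\<dots> \<le> N ^ (p + length xs) * N" using snoc by (intro mult_le_mono1) auto
  finally show ?case by (simp add: addr_snoc mult.commute)
qed simp

text \<open>Registers: 0 is the origin, 1 contains the domain size, 2 the truth value, 3 an address,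
  4 to 6 are scratch, and \<open>7 + v\<close> is the variable \<open>v\<close>.\<close>

definition rg :: "nat \<Rightarrow> nat \<Rightarrow> nat \<Rightarrow> (nat \<Rightarrow> nat) \<Rightarrow> nat \<Rightarrow> nat" where
  "rg N f a e = (\<lambda>r. if r = 1 then N else if r = 2 then f else if r = 3 then a
     else if r < 7 then 0 else e (r - 7))"

lemma rg_simps [simp]:
  "rg N f a e 0 = 0" "rg N f a e 1 = N" "rg N f a e (Suc 0) = N" "rg N f a e 2 = f" "rg N f a e 3 = a" "rg N f a e 4 = 0"
  "rg N f a e 5 = 0" "rg N f a e 6 = 0" "rg N f a e (7 + v) = e v"
  "(rg N f a e)(2 := x) = rg N x a e" "(rg N f a e)(3 := x) = rg N f x e"
  "(rg N f a e)(7 + v := x) = rg N f a (e(v := x))"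
  by (auto simp: rg_def fun_eq_iff)

lemma runs_Inc_var: "runs 1 (Inc (7 + v)) (rg N f a (e(v := x)), \<mu>) (rg N f a (e(v := Suc x)), \<mu>)"
  using runs_Inc[of "7 + v" "rg N f a (e(v := x))" \<mu>] by (simp only: rg_simps fun_upd_same fun_upd_upd)

lemma runs_clr_var: "runs (3 * x + 1) (clr (7 + v)) (rg N f a (e(v := x)), \<mu>) (rg N f a (e(v := 0)), \<mu>)"
proof -
  have "runs (3 * rg N f a (e(v := x)) (7 + v) + 1) (clr (7 + v)) (rg N f a (e(v := x)), \<mu>)
    ((rg N f a (e(v := x)))(7 + v := 0), \<mu>)"
    by (rule runs_clr) simp_all
  then show ?thesis by (simp only: rg_simps fun_upd_same fun_upd_upd)
qed

fun caddr :: "nat list \<Rightarrow> cmd" where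
  "caddr [] = Skip"
| "caddr (v # vs) = cmul 3 1 4 5 ;; cadd 3 (7 + v) 5 ;; caddr vs"

definition addr_cost :: "nat \<Rightarrow> nat \<Rightarrow> nat" where
  "addr_cost N n = n * (N ^ n * (11 * N + 5) + 7 * N + 4)"

lemma runs_caddr:
  assumes "\<And>v. v \<in> set vs \<Longrightarrow> e v < N" "a < N ^ p"
  shows "runs (length vs * (N ^ (p + length vs) * (11 * N + 5) + 7 * N + 4))
    (caddr vs) (rg N f a e, \<mu>) (rg N f (addr N a (map e vs)) e, \<mu>)"
  using assms
proof (induction vs arbitrary: a p)
  case Nil
  then show ?case using runs_Skip by simp
next
  case (Cons v vs)
  have v: "e v < N" using Cons.prems by simp
  have 1: "runs (a * (11 * N + 5) + 2) (cmul 3 1 4 5) (rg N f a e, \<mu>) (rg N f (a * N) e, \<mu>)"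
    using runs_cmul[of "rg N f a e" 5 4 3 1 \<mu>] by simp
  have 2: "runs (7 * e v + 2) (cadd 3 (7 + v) 5) (rg N f (a * N) e, \<mu>) (rg N f (a * N + e v) e, \<mu>)"
    using runs_cadd[of "rg N f (a * N) e" 5 3 "7 + v" \<mu>] by simp
  have lt: "a * N + e v < N ^ Suc p"
  proof -
    have "a * N + e v < Suc a * N" using v by simp
    also have "\<dots> \<le> N ^ p * N" using Cons.prems by (intro mult_le_mono1) simp
    finally show ?thesis by (simp add: mult.commute)
  qed
  have 3: "runs (length vs * (N ^ (Suc p + length vs) * (11 * N + 5) + 7 * N + 4)) (caddr vs)
    (rg N f (a * N + e v) e, \<mu>) (rg N f (addr N (a * N + e v) (map e vs)) e, \<mu>)"
    using Cons.IH[OF _ lt] Cons.prems by simp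
  have "a \<le> N ^ (p + length (v # vs))"
  proof -
    have "N ^ p \<le> N ^ (p + length (v # vs))" using v by (intro power_increasing) auto
    then show ?thesis using Cons.prems(2) by linarith
  qed
  then have "a * (11 * N + 5) \<le> N ^ (p + length (v # vs)) * (11 * N + 5)" by (rule mult_le_mono1)
  then have "a * (11 * N + 5) + 2 + (7 * e v + 2) \<le> N ^ (p + length (v # vs)) * (11 * N + 5) + 7 * N + 4"
    using v by linarith
  then show ?case
    using runs_mono[OF runs_Seq[OF 1 runs_Seq[OF 2 3]],
      of "length (v # vs) * (N ^ (p + length (v # vs)) * (11 * N + 5) + 7 * N + 4)"] by simp
qed

lemma runs_caddr0:
  assumes "\<And>v. v \<in> set vs \<Longrightarrow> e v < N" "0 < N"
  shows "runs (addr_cost N (length vs)) (caddr vs) (rg N f 0 e, \<mu>) (rg N f (addr N 0 (map e vs)) e, \<mu>)"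
  using runs_caddr[of vs e N 0 0 f \<mu>] assms by (simp add: addr_cost_def)

text \<open>The truth value is added to register 2, which must be 0 before. The loop of a quantifier
  goes on counting after a witness is found but evaluates no more; finally its variable is reset to
  0, as variables out of scope have to be 0.\<close>

fun cfm :: "fm \<Rightarrow> cmd" where
  "cfm (FLt x y) = If (TLt (7 + x) (7 + y)) (Inc 2) Skip"
| "cfm (FRel r vs) = caddr vs ;; If (TBit r 3) (Inc 2) Skip ;; clr 3"
| "cfm (Neg \<phi>) = cfm \<phi> ;; If (TLt 0 2) (Dec 2) (Inc 2)"
| "cfm (Con \<phi> \<psi>) = cfm \<phi> ;; If (TLt 0 2) (Dec 2 ;; cfm \<psi>) Skip"
| "cfm (Ex v \<phi>) = While (TLt (7 + v) 1) (If (TLt 0 2) Skip (cfm \<phi>) ;; Inc (7 + v)) ;; clr (7 + v)"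

fun cost_fm :: "nat \<Rightarrow> fm \<Rightarrow> nat" where
  "cost_fm N (FLt x y) = 3"
| "cost_fm N (FRel r vs) = addr_cost N (length vs) + (3 + (3 * N ^ length vs + 1))"
| "cost_fm N (Neg \<phi>) = cost_fm N \<phi> + 3"
| "cost_fm N (Con \<phi> \<psi>) = cost_fm N \<phi> + (1 + cost_fm N \<psi> + 2)"
| "cost_fm N (Ex v \<phi>) = N * (cost_fm N \<phi> + 2 + 1 + 2) + 1 + (3 * N + 1)"

definition rep :: "nat \<Rightarrow> nat \<Rightarrow> (nat \<Rightarrow> nat) \<Rightarrow> interp \<Rightarrow> (nat \<Rightarrow> nat \<Rightarrow> bool) \<Rightarrow> bool" where
  "rep N n ar I \<mu> \<longleftrightarrow> (\<forall>r<n. \<forall>xs\<in>tup N (ar r). \<mu> r (addr N 0 xs) = I r xs)"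

lemma runs_cfm:
  assumes "0 < N" and rep: "rep N n ar I \<mu>"
  shows "wf_fm n ar V d \<phi> \<Longrightarrow> (\<And>v. v < d \<Longrightarrow> e v < N) \<Longrightarrow> (\<And>v. d \<le> v \<Longrightarrow> e v = 0) \<Longrightarrow>
    runs (cost_fm N \<phi>) (cfm \<phi>) (rg N 0 0 e, \<mu>) (rg N (of_bool (eval N I e \<phi>)) 0 e, \<mu>)"
proof (induction \<phi> arbitrary: d e)
  case (FLt x y)
  have "runs (1 + 2) (cfm (FLt x y)) (rg N 0 0 e, \<mu>) (rg N (of_bool (eval N I e (FLt x y))) 0 e, \<mu>)"
    unfolding cfm.simps
    by (rule runs_If) (use runs_Inc[of 2 "rg N 0 0 e" \<mu>] runs_mono[OF runs_Skip] in auto)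
  then show ?case by (simp add: numeral_3_eq_3)
next
  case (FRel r vs)
  let ?a = "addr N 0 (map e vs)"
  have 1: "runs (addr_cost N (length vs)) (caddr vs) (rg N 0 0 e, \<mu>) (rg N 0 ?a e, \<mu>)"
    by (rule runs_caddr0) (use FRel assms in auto)
  have t: "map e vs \<in> tup N (ar r)" using FRel by (auto simp: tup_def)
  then have m: "\<mu> r ?a = I r (map e vs)" using rep FRel.prems by (auto simp: rep_def)
  have 2: "runs (1 + 2) (If (TBit r 3) (Inc 2) Skip) (rg N 0 ?a e, \<mu>) (rg N (of_bool (I r (map e vs))) ?a e, \<mu>)"
    by (rule runs_If) (use runs_Inc[of 2 "rg N 0 ?a e" \<mu>] runs_mono[OF runs_Skip] m in auto)
  have 3: "runs (3 * ?a + 1) (clr 3) (rg N f ?a e, \<mu>) (rg N f 0 e, \<mu>)" for f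
    using runs_clr[of "rg N f ?a e" 3 \<mu>] by simp
  have "?a \<le> N ^ length vs"
    using addr_le[of "map e vs" N 0 0] t by (auto simp: tup_def)
  then show ?case
    using runs_mono[OF runs_Seq[OF 1 runs_Seq[OF 2 3]]] by simp
next
  case (Neg \<phi>)
  have "runs (1 + 2) (If (TLt 0 2) (Dec 2) (Inc 2)) (rg N (of_bool b) 0 e, \<mu>) (rg N (of_bool (\<not> b)) 0 e, \<mu>)" for b
    by (rule runs_If) (use runs_Inc[of 2 "rg N 0 0 e" \<mu>] runs_Dec[of 2 "rg N 1 0 e" \<mu>] in \<open>cases b; simp\<close>)+
  from runs_Seq[OF Neg.IH[OF _ Neg.prems(2,3)] this] Neg.prems(1) show ?case by (simp add: eval_nat_numeral)
next
  case (Con \<phi> \<psi>)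
  note p = Con.IH(1)[of d e] and q = Con.IH(2)[of d e]
  have "runs (1 + cost_fm N \<psi> + 2) (If (TLt 0 2) (Dec 2 ;; cfm \<psi>) Skip) (rg N (of_bool (eval N I e \<phi>)) 0 e, \<mu>)
    (rg N (of_bool (eval N I e (Con \<phi> \<psi>))) 0 e, \<mu>)"
  proof (rule runs_If)
    assume h: "holds (TLt 0 2) (rg N (of_bool (eval N I e \<phi>)) 0 e, \<mu>)"
    show "runs (1 + cost_fm N \<psi>) (Dec 2 ;; cfm \<psi>) (rg N (of_bool (eval N I e \<phi>)) 0 e, \<mu>)
      (rg N (of_bool (eval N I e (Con \<phi> \<psi>))) 0 e, \<mu>)"
      using runs_Seq[OF runs_Dec[of 2 "rg N 1 0 e" \<mu>]] q h Con.prems by (auto split: if_splits)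
  next
    assume "\<not> holds (TLt 0 2) (rg N (of_bool (eval N I e \<phi>)) 0 e, \<mu>)"
    then show "runs (1 + cost_fm N \<psi>) Skip (rg N (of_bool (eval N I e \<phi>)) 0 e, \<mu>)
      (rg N (of_bool (eval N I e (Con \<phi> \<psi>))) 0 e, \<mu>)"
      using runs_mono[OF runs_Skip] by (auto split: if_splits)
  qed
  from runs_Seq[OF p this] Con.prems show ?case by simp
next
  case (Ex v \<phi>)
  have v: "d \<le> v" "wf_fm n ar V (Suc v) \<phi>" using Ex.prems by auto
  define E where "E y \<longleftrightarrow> eval N I (e(v := y)) \<phi>" for y
  define F :: "nat \<Rightarrow> nat" where "F x = of_bool (\<exists>y<x. E y)" for x
  have F0: "F 0 = 0" by (simp add: F_def)
  have FS: "F (Suc x) = (if 0 < F x then F x else of_bool (E x))" for x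
    by (auto simp: F_def less_Suc_eq)
  let ?s = "\<lambda>x. (rg N (F x) 0 (e(v := x)), \<mu>)"
  have A: "runs (N * (cost_fm N \<phi> + 2 + 1 + 2) + 1)
     (While (TLt (7 + v) 1) (If (TLt 0 2) Skip (cfm \<phi>) ;; Inc (7 + v))) (?s 0) (?s N)"
  proof (rule runs_While)
    fix x assume x: "x < N"
    have IH: "runs (cost_fm N \<phi>) (cfm \<phi>) (rg N 0 0 (e(v := x)), \<mu>) (rg N (of_bool (E x)) 0 (e(v := x)), \<mu>)"
      unfolding E_def
    proof (rule Ex.IH[OF v(2)])
      show "(e(v := x)) u < N" if "u < Suc v" for u
        using Ex.prems(2,3)[of u] x assms(1) by (cases "u < d") auto
      show "(e(v := x)) u = 0" if "Suc v \<le> u" for u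
        using Ex.prems(3)[of u] v(1) that by auto
    qed
    have "runs (cost_fm N \<phi> + 2) (If (TLt 0 2) Skip (cfm \<phi>)) (?s x) (rg N (F (Suc x)) 0 (e(v := x)), \<mu>)"
    proof (rule runs_If)
      assume "holds (TLt 0 2) (?s x)"
      then have "F (Suc x) = F x" by (simp add: FS)
      then show "runs (cost_fm N \<phi>) Skip (?s x) (rg N (F (Suc x)) 0 (e(v := x)), \<mu>)"
        using runs_mono[OF runs_Skip] by simp
    next
      assume "\<not> holds (TLt 0 2) (?s x)"
      then have "F x = 0" "F (Suc x) = of_bool (E x)" by (simp_all add: FS)
      then show "runs (cost_fm N \<phi>) (cfm \<phi>) (?s x) (rg N (F (Suc x)) 0 (e(v := x)), \<mu>)"
        using IH by simp
    qed
    moreover have "runs 1 (Inc (7 + v)) (rg N (F (Suc x)) 0 (e(v := x)), \<mu>) (?s (Suc x))"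
      by (rule runs_Inc_var)
    ultimately show "runs (cost_fm N \<phi> + 2 + 1) (If (TLt 0 2) Skip (cfm \<phi>) ;; Inc (7 + v)) (?s x) (?s (Suc x))"
      by (rule runs_Seq)
  qed auto
  have e0: "e(v := 0) = e" using Ex.prems(3)[OF v(1)] by auto
  have B: "runs (3 * N + 1) (clr (7 + v)) (?s N) (rg N (F N) 0 e, \<mu>)"
    using runs_clr_var[of N v N "F N" 0 e \<mu>] by (simp only: e0)
  have FN: "F N = of_bool (eval N I e (Ex v \<phi>))" by (simp add: F_def E_def)
  from runs_Seq[OF A B] show ?case by (simp only: F0 e0 FN cfm.simps cost_fm.simps)
qed

definition cfor :: "nat \<Rightarrow> cmd \<Rightarrow> cmd" where
  "cfor v c = While (TLt (7 + v) 1) (c ;; Inc (7 + v)) ;; clr (7 + v)"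

definition for_cost :: "nat \<Rightarrow> nat \<Rightarrow> nat" where
  "for_cost N T = N * (T + 1 + 2) + 1 + (3 * N + 1)"

lemma runs_cfor:
  assumes "e v = 0" "P 0 \<mu>"
    and step: "\<And>x \<mu>. x < N \<Longrightarrow> P x \<mu> \<Longrightarrow>
      \<exists>\<mu>'. P (Suc x) \<mu>' \<and> runs T c (rg N 0 0 (e(v := x)), \<mu>) (rg N 0 0 (e(v := x)), \<mu>')"
  shows "\<exists>\<mu>'. P N \<mu>' \<and> runs (for_cost N T) (cfor v c) (rg N 0 0 e, \<mu>) (rg N 0 0 e, \<mu>')"
proof -
  let ?r = "\<lambda>x. rg N 0 0 (e(v := x))"
  have "\<exists>\<mu>'. P N \<mu>' \<and> runs ((N - x) * (T + 1 + 2) + 1) (While (TLt (7 + v) 1) (c ;; Inc (7 + v))) (?r x, \<mu>) (?r N, \<mu>')"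
    if "x \<le> N" "P x \<mu>" for x \<mu>
    using that
  proof (induction "N - x" arbitrary: x \<mu>)
    case 0
    then have "x = N" by simp
    then show ?case using 0 runs_While_end[of "TLt (7 + v) 1"] by auto
  next
    case (Suc n)
    then have x: "x < N" by simp
    obtain \<mu>1 where 1: "P (Suc x) \<mu>1" "runs T c (?r x, \<mu>) (?r x, \<mu>1)" using step[OF x Suc.prems(2)] by blast
    have "n = N - Suc x" "Suc x \<le> N" using Suc.hyps x by auto
    from Suc.hyps(1)[OF this 1(1)] obtain \<mu>' where 2: "P N \<mu>'"
      "runs ((N - Suc x) * (T + 1 + 2) + 1) (While (TLt (7 + v) 1) (c ;; Inc (7 + v))) (?r (Suc x), \<mu>1) (?r N, \<mu>')" by blast
    have "runs 1 (Inc (7 + v)) (?r x, \<mu>1) (?r (Suc x), \<mu>1)"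
      by (rule runs_Inc_var)
    from runs_While_step[OF _ runs_Seq[OF 1(2) this] 2(2)] x
    have r: "runs ((T + 1) + 2 + ((N - Suc x) * (T + 1 + 2) + 1)) (While (TLt (7 + v) 1) (c ;; Inc (7 + v))) (?r x, \<mu>) (?r N, \<mu>')"
      by simp
    have "N - x = Suc (N - Suc x)" using x by simp
    then have "(T + 1) + 2 + ((N - Suc x) * (T + 1 + 2) + 1) = (N - x) * (T + 1 + 2) + 1" by simp
    with r 2(1) show ?case by metis
  qed
  from this[of 0, OF _ assms(2)] obtain \<mu>' where m: "P N \<mu>'"
    "runs (N * (T + 1 + 2) + 1) (While (TLt (7 + v) 1) (c ;; Inc (7 + v))) (?r 0, \<mu>) (?r N, \<mu>')" by auto
  have e: "e(v := 0) = e" using assms(1) by auto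
  have "runs (3 * N + 1) (clr (7 + v)) (?r N, \<mu>') (rg N 0 0 e, \<mu>')"
    using runs_clr_var[of N v N 0 0 e \<mu>'] by (simp only: e)
  from runs_Seq[OF m(2) this] m(1) show ?thesis unfolding cfor_def for_cost_def e by blast
qed

fun nest :: "nat \<Rightarrow> nat \<Rightarrow> cmd \<Rightarrow> cmd" where
  "nest v 0 c = c"
| "nest v (Suc a) c = cfor v (nest (Suc v) a c)"

fun nest_cost :: "nat \<Rightarrow> nat \<Rightarrow> nat \<Rightarrow> nat" where
  "nest_cost N T 0 = T"
| "nest_cost N T (Suc a) = for_cost N (nest_cost N T a)"

fun tups :: "nat \<Rightarrow> nat \<Rightarrow> nat list list" where
  "tups N 0 = [[]]"
| "tups N (Suc a) = concat (map (\<lambda>x. map ((#) x) (tups N a)) [0..<N])"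

lemma set_tups: "set (tups N a) = tup N a"
proof (induction a)
  case (Suc a)
  show ?case
  proof (intro set_eqI iffI)
    fix xs assume "xs \<in> tup N (Suc a)"
    then show "xs \<in> set (tups N (Suc a))" using Suc by (cases xs) (auto simp: tup_def)
  qed (use Suc in \<open>auto simp: tup_def\<close>)
qed (auto simp: tup_def)

lemma upd_Cons: "upd e v (x # xs) = upd (e(v := x)) (Suc v) xs"
proof
  fix u
  show "upd e v (x # xs) u = upd (e(v := x)) (Suc v) xs u"
  proof (cases "v < u")
    case True
    then have "u - v = Suc (u - Suc v)" by simp
    then show ?thesis using True by (simp add: upd_def)
  qed (auto simp: upd_def)
qed

lemma upd_Nil [simp]: "upd e v [] = e"
  by (auto simp: upd_def fun_eq_iff)

text \<open>The loops visit the tuples in the order of \<open>tups\<close>, so their effect on the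
  memory is a \<open>fold\<close>. The invariant \<open>Q\<close> carries what the body has to know
  about the memory changed so far.\<close>

lemma runs_nest:
  assumes e: "\<And>u. v \<le> u \<Longrightarrow> e u = 0" and Q: "Q \<mu>"
    and step: "\<And>xs \<mu>. xs \<in> tup N a \<Longrightarrow> Q \<mu> \<Longrightarrow>
      Q (f xs \<mu>) \<and> runs T c (rg N 0 0 (upd e v xs), \<mu>) (rg N 0 0 (upd e v xs), f xs \<mu>)"
  shows "Q (fold f (tups N a) \<mu>) \<and>
    runs (nest_cost N T a) (nest v a c) (rg N 0 0 e, \<mu>) (rg N 0 0 e, fold f (tups N a) \<mu>)"
  using assms
proof (induction a arbitrary: v e \<mu> f)
  case 0
  then show ?case using "0.prems"(3)[of "[]" \<mu>] by (simp add: tup_def)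
next
  case (Suc a)
  let ?L = "\<lambda>x. concat (map (\<lambda>x. map ((#) x) (tups N a)) [0..<x])"
  let ?P = "\<lambda>x \<mu>'. Q \<mu>' \<and> \<mu>' = fold f (?L x) \<mu>"
  have "\<exists>\<mu>'. ?P N \<mu>' \<and> runs (for_cost N (nest_cost N T a)) (cfor v (nest (Suc v) a c)) (rg N 0 0 e, \<mu>) (rg N 0 0 e, \<mu>')"
  proof (rule runs_cfor[where P = ?P])
    show "e v = 0" "?P 0 \<mu>" using Suc.prems by auto
  next
    fix x \<mu>' assume x: "x < N" and P: "?P x \<mu>'"
    have "Q (fold (\<lambda>xs. f (x # xs)) (tups N a) \<mu>') \<and> runs (nest_cost N T a) (nest (Suc v) a c)
       (rg N 0 0 (e(v := x)), \<mu>') (rg N 0 0 (e(v := x)), fold (\<lambda>xs. f (x # xs)) (tups N a) \<mu>')"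
    proof (rule Suc.IH)
      show "(e(v := x)) u = 0" if "Suc v \<le> u" for u using Suc.prems(1)[of u] that by simp
      show "Q \<mu>'" using P by (rule conjunct1)
      show "Q (f (x # xs) \<mu>) \<and> runs T c (rg N 0 0 (upd (e(v := x)) (Suc v) xs), \<mu>)
          (rg N 0 0 (upd (e(v := x)) (Suc v) xs), f (x # xs) \<mu>)" if "xs \<in> tup N a" "Q \<mu>" for xs \<mu>
        using Suc.prems(3)[of "x # xs" \<mu>] that x by (simp add: upd_Cons tup_def)
    qed
    moreover have "fold (\<lambda>xs. f (x # xs)) (tups N a) \<mu>' = fold f (?L (Suc x)) \<mu>"
      using P by (simp add: fold_map comp_def)
    ultimately show "\<exists>\<mu>''. ?P (Suc x) \<mu>'' \<and> runs (nest_cost N T a) (nest (Suc v) a c)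
       (rg N 0 0 (e(v := x)), \<mu>') (rg N 0 0 (e(v := x)), \<mu>'')" by (metis (lifting))
  qed
  then show ?case by auto
qed

lemma fold_put:
  fixes m :: "nat \<Rightarrow> nat \<Rightarrow> bool" and k :: "'a \<Rightarrow> nat" and F t
  assumes "inj_on k S" "set L \<subseteq> S"
  defines "m' \<equiv> fold (\<lambda>x m. m(t := (m t)(k x := F x))) L m"
  shows "(\<forall>x\<in>set L. m' t (k x) = F x) \<and> (\<forall>t'. t' \<noteq> t \<longrightarrow> m' t' = m t')"
  using assms(2) unfolding m'_def
proof (induction L rule: rev_induct)
  case (snoc x L)
  have "k y = k x \<longleftrightarrow> y = x" if "y \<in> set L" for y
    using assms(1) snoc.prems that by (auto simp: inj_on_def)
  then show ?case using snoc by auto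
qed simp

text \<open>Two passes, because the formula may mention the relation being assigned: the new values
  are collected on the scratch track \<open>n\<close> and only then copied to track
  \<open>r\<close>.\<close>

fun cprog :: "nat \<Rightarrow> prog \<Rightarrow> cmd" where
  "cprog n (Assign r v a \<phi>) =
     nest v a (cfm \<phi> ;; caddr [v..<v + a] ;; If (TLt 0 2) (Put n 3 True) (Put n 3 False) ;; clr 2 ;; clr 3) ;;
     nest v a (caddr [v..<v + a] ;; If (TBit n 3) (Put r 3 True) (Put r 3 False) ;; clr 3)"
| "cprog n (p ;;; q) = cprog n p ;; cprog n q"
| "cprog n (PFor v p) = cfor v (cprog n p)"

fun cost_prog :: "nat \<Rightarrow> prog \<Rightarrow> nat" where
  "cost_prog N (Assign r v a \<phi>) =
     nest_cost N (cost_fm N \<phi> + (addr_cost N a + (3 + (4 + (3 * N ^ a + 1))))) a +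
     nest_cost N (addr_cost N a + (3 + (3 * N ^ a + 1))) a"
| "cost_prog N (p ;;; q) = cost_prog N p + cost_prog N q"
| "cost_prog N (PFor v p) = for_cost N (cost_prog N p)"

lemma map_upd: "length xs = a \<Longrightarrow> map (upd e v xs) [v..<v + a] = xs"
  by (intro nth_equalityI) (auto simp: upd_def)

lemma runs_cprog:
  assumes N: "0 < N"
  shows "wf_prog n ar V d p \<Longrightarrow> rep N n ar I \<mu> \<Longrightarrow> (\<And>v. v < d \<Longrightarrow> e v < N) \<Longrightarrow> (\<And>v. d \<le> v \<Longrightarrow> e v = 0) \<Longrightarrow>
    \<exists>\<mu>'. rep N n ar (run N e p I) \<mu>' \<and> runs (cost_prog N p) (cprog n p) (rg N 0 0 e, \<mu>) (rg N 0 0 e, \<mu>')"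
proof (induction p arbitrary: d e I \<mu>)
  case (Assign r v a \<phi>)
  note wf = Assign.prems(1) and rep = Assign.prems(2)
  have r: "r < n" "a = ar r" "d \<le> v" "wf_fm n ar V (v + a) \<phi>" using wf by auto
  let ?F = "\<lambda>xs. eval N I (upd e v xs) \<phi>"
  let ?k = "addr N 0"
  have inj: "inj_on ?k (tup N a)" by (rule inj_onI, rule addr_inj) (auto simp: tup_def)
  have kle: "?k xs \<le> N ^ a" if "xs \<in> tup N a" for xs
    using addr_le[of xs N 0 0] that by (auto simp: tup_def)
  have ez: "e u = 0" if "v \<le> u" for u using Assign.prems(4) r that by simp
  have ub: "upd e v xs u < N" if "xs \<in> tup N a" for xs u
  proof (cases "v \<le> u \<and> u < v + length xs")
    case True
    then have "xs ! (u - v) \<in> set xs" by (intro nth_mem) auto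
    then show ?thesis using that True by (auto simp: upd_def tup_def)
  next
    case False
    then show ?thesis using Assign.prems(3,4)[of u] N by (cases "u < d") (auto simp: upd_def)
  qed
  have uz: "upd e v xs u = 0" if "xs \<in> tup N a" "v + a \<le> u" for xs u
    using that ez by (auto simp: upd_def tup_def)
  have ca: "runs (addr_cost N a) (caddr [v..<v + a]) (rg N f 0 (upd e v xs), \<mu>) (rg N f (?k xs) (upd e v xs), \<mu>)"
    if "xs \<in> tup N a" for xs f \<mu>
    using runs_caddr0[of "[v..<v + a]" "upd e v xs" N f \<mu>] ub[OF that] N map_upd[of xs a e v] that
    by (simp add: tup_def)
  have c3: "runs (3 * N ^ a + 1) (clr 3) (rg N f (?k xs) e', \<mu>) (rg N f 0 e', \<mu>)"
    if "xs \<in> tup N a" for xs f e' \<mu>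
    using runs_mono[OF runs_clr[of "rg N f (?k xs) e'" 3 \<mu>], of "3 * N ^ a + 1"] kle[OF that] by simp
  define f1 where "f1 xs m = m(n := (m n)(?k xs := ?F xs))" for xs and m :: "nat \<Rightarrow> nat \<Rightarrow> bool"
  define \<mu>1 where "\<mu>1 = fold f1 (tups N a) \<mu>"
  have 1: "rep N n ar I \<mu>1 \<and> runs (nest_cost N (cost_fm N \<phi> + (addr_cost N a + (3 + (4 + (3 * N ^ a + 1))))) a)
    (nest v a (cfm \<phi> ;; caddr [v..<v + a] ;; If (TLt 0 2) (Put n 3 True) (Put n 3 False) ;; clr 2 ;; clr 3))
    (rg N 0 0 e, \<mu>) (rg N 0 0 e, \<mu>1)"
    unfolding \<mu>1_def
  proof (rule runs_nest[where Q = "rep N n ar I"])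
    show "e u = 0" if "v \<le> u" for u using ez that .
    show "rep N n ar I \<mu>" by (rule rep)
  next
    fix xs m assume xs: "xs \<in> tup N a" and m: "rep N n ar I m"
    have R: "rep N n ar I (f1 xs m)" using m by (auto simp: rep_def f1_def)
    let ?e = "upd e v xs"
    have A: "runs (cost_fm N \<phi>) (cfm \<phi>) (rg N 0 0 ?e, m) (rg N (of_bool (?F xs)) 0 ?e, m)"
      by (rule runs_cfm[OF N m r(4)]) (use ub[OF xs] uz[OF xs] in auto)
    have B: "runs 3 (If (TLt 0 2) (Put n 3 True) (Put n 3 False)) (rg N (of_bool (?F xs)) (?k xs) ?e, m)
        (rg N (of_bool (?F xs)) (?k xs) ?e, f1 xs m)"
      by (rule runs_If1) (use runs_Put[of n 3 _ "rg N (of_bool (?F xs)) (?k xs) ?e" m] in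
        \<open>auto simp: f1_def split: if_splits\<close>)
    have C: "runs 4 (clr 2) (rg N (of_bool (?F xs)) (?k xs) ?e, f1 xs m) (rg N 0 (?k xs) ?e, f1 xs m)"
      using runs_mono[OF runs_clr[of "rg N (of_bool (?F xs)) (?k xs) ?e" 2 "f1 xs m"], of 4] by (simp split: if_splits)
    show "rep N n ar I (f1 xs m) \<and> runs (cost_fm N \<phi> + (addr_cost N a + (3 + (4 + (3 * N ^ a + 1)))))
      (cfm \<phi> ;; caddr [v..<v + a] ;; If (TLt 0 2) (Put n 3 True) (Put n 3 False) ;; clr 2 ;; clr 3)
      (rg N 0 0 ?e, m) (rg N 0 0 ?e, f1 xs m)"
      by (rule conjI[OF R], rule runs_Seq[OF A runs_Seq[OF ca[OF xs] runs_Seq[OF B runs_Seq[OF C c3[OF xs]]]]])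
  qed
  \<comment> \<open>While copying, track \<open>r\<close> is partly overwritten and no longer
    represents the old interpretation; all that is needed is that track \<open>n\<close> stays
    fixed.\<close>
  define f2 where "f2 xs m = m(r := (m r)(?k xs := \<mu>1 n (?k xs)))" for xs and m :: "nat \<Rightarrow> nat \<Rightarrow> bool"
  define \<mu>2 where "\<mu>2 = fold f2 (tups N a) \<mu>1"
  have 2: "\<mu>2 n = \<mu>1 n \<and> runs (nest_cost N (addr_cost N a + (3 + (3 * N ^ a + 1))) a)
    (nest v a (caddr [v..<v + a] ;; If (TBit n 3) (Put r 3 True) (Put r 3 False) ;; clr 3))
    (rg N 0 0 e, \<mu>1) (rg N 0 0 e, \<mu>2)"
    unfolding \<mu>2_def
  proof (rule runs_nest[where Q = "\<lambda>m. m n = \<mu>1 n"])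
    show "e u = 0" if "v \<le> u" for u using ez that .
    show "\<mu>1 n = \<mu>1 n" ..
  next
    fix xs m assume xs: "xs \<in> tup N a" and m: "m n = \<mu>1 n"
    have R: "f2 xs m n = \<mu>1 n" using m r by (simp add: f2_def)
    let ?e = "upd e v xs"
    have B: "runs 3 (If (TBit n 3) (Put r 3 True) (Put r 3 False)) (rg N 0 (?k xs) ?e, m)
        (rg N 0 (?k xs) ?e, f2 xs m)"
      by (rule runs_If1) (use runs_Put[of r 3 _ "rg N 0 (?k xs) ?e" m] m in \<open>auto simp: f2_def\<close>)
    show "f2 xs m n = \<mu>1 n \<and> runs (addr_cost N a + (3 + (3 * N ^ a + 1)))
      (caddr [v..<v + a] ;; If (TBit n 3) (Put r 3 True) (Put r 3 False) ;; clr 3)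
      (rg N 0 0 ?e, m) (rg N 0 0 ?e, f2 xs m)"
      by (rule conjI[OF R], rule runs_Seq[OF ca[OF xs] runs_Seq[OF B c3[OF xs]]])
  qed
  have f: "(\<forall>x\<in>tup N a. \<mu>1 n (?k x) = ?F x)"
    using fold_put[OF inj, of "tups N a" n ?F \<mu>] by (simp add: set_tups \<mu>1_def f1_def[abs_def])
  have g: "(\<forall>x\<in>tup N a. \<mu>2 r (?k x) = \<mu>1 n (?k x)) \<and> (\<forall>t. t \<noteq> r \<longrightarrow> \<mu>2 t = \<mu>1 t)"
    using fold_put[OF inj, of "tups N a" r "\<lambda>x. \<mu>1 n (?k x)" \<mu>1] by (simp add: set_tups \<mu>2_def f2_def[abs_def])
  have "rep N n ar (run N e (Assign r v a \<phi>) I) \<mu>2"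
    using 1 f g r by (auto simp: rep_def)
  then show ?case unfolding cprog.simps cost_prog.simps
    using runs_Seq[OF conjunct2[OF 1] conjunct2[OF 2]] by blast
next
  case (PSeq p q)
  obtain \<mu>1 where 1: "rep N n ar (run N e p I) \<mu>1" "runs (cost_prog N p) (cprog n p) (rg N 0 0 e, \<mu>) (rg N 0 0 e, \<mu>1)"
    using PSeq.IH(1)[of d I \<mu> e] PSeq.prems by auto
  obtain \<mu>2 where 2: "rep N n ar (run N e (p ;;; q) I) \<mu>2" "runs (cost_prog N q) (cprog n q) (rg N 0 0 e, \<mu>1) (rg N 0 0 e, \<mu>2)"
    using PSeq.IH(2)[of d _ \<mu>1 e, OF _ 1(1)] PSeq.prems by auto
  show ?case using 2(1) runs_Seq[OF 1(2) 2(2)] by auto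
next
  case (PFor v p)
  have v: "d \<le> v" "wf_prog n ar V (Suc v) p" using PFor.prems by auto
  let ?P = "\<lambda>x. rep N n ar (fold (\<lambda>x. run N (e(v := x)) p) [0..<x] I)"
  have "\<exists>\<mu>'. ?P N \<mu>' \<and> runs (for_cost N (cost_prog N p)) (cfor v (cprog n p)) (rg N 0 0 e, \<mu>) (rg N 0 0 e, \<mu>')"
  proof (rule runs_cfor[where P = ?P])
    show "e v = 0" "?P 0 \<mu>" using PFor.prems v by auto
  next
    fix x \<mu> assume x: "x < N" and P: "?P x \<mu>"
    have lt: "(e(v := x)) u < N" if "u < Suc v" for u
      using PFor.prems(3,4)[of u] x N v that by (cases "u < d") auto
    have z: "(e(v := x)) u = 0" if "Suc v \<le> u" for u
      using PFor.prems(4)[of u] v that by simp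
    have fs: "fold f [0..<Suc x] I = f x (fold f [0..<x] I)" for f :: "nat \<Rightarrow> interp \<Rightarrow> interp" by simp
    show "\<exists>\<mu>'. ?P (Suc x) \<mu>' \<and> runs (cost_prog N p) (cprog n p) (rg N 0 0 (e(v := x)), \<mu>) (rg N 0 0 (e(v := x)), \<mu>')"
      unfolding fs by (rule PFor.IH[OF v(2) P lt z])
  qed
  then show ?case by simp
qed

section \<open>Polynomial bounds and well-formedness of the compiled commands\<close>

definition pb :: "(nat \<Rightarrow> nat) \<Rightarrow> bool" where
  "pb f \<longleftrightarrow> (\<exists>K. \<forall>N\<ge>2. f N \<le> N ^ K)"

text \<open>From \<open>N\<close> = 2 on, c < 2 ^ c turns a constant into a power; this is the
  reason for excluding smaller \<open>N\<close>.\<close>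

lemma pb_const: "pb (\<lambda>_. c)"
proof -
  have "c \<le> N ^ c" if "2 \<le> N" for N
    using less_exp[of c] power_mono[OF that, of c] by linarith
  then show ?thesis unfolding pb_def by blast
qed

lemma pb_id: "pb (\<lambda>N. N)"
  unfolding pb_def by (rule exI[of _ 1]) simp

lemma pb_mult: "pb f \<Longrightarrow> pb g \<Longrightarrow> pb (\<lambda>N. f N * g N)"
  unfolding pb_def by (metis mult_le_mono power_add)

lemma pb_add:
  assumes "pb f" "pb g"
  shows "pb (\<lambda>N. f N + g N)"
proof -
  obtain a b where a: "\<And>N. 2 \<le> N \<Longrightarrow> f N \<le> N ^ a" and b: "\<And>N. 2 \<le> N \<Longrightarrow> g N \<le> N ^ b"
    using assms by (auto simp: pb_def)
  have "f N + g N \<le> N ^ Suc (a + b)" if N: "2 \<le> N" for N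
  proof -
    have "N ^ a \<le> N ^ (a + b)" "N ^ b \<le> N ^ (a + b)" using N by (auto intro: power_increasing)
    then have "f N + g N \<le> 2 * N ^ (a + b)" using a[OF N] b[OF N] by linarith
    also have "\<dots> \<le> N * N ^ (a + b)" using N by (rule mult_le_mono1)
    finally show ?thesis by simp
  qed
  then show ?thesis unfolding pb_def by blast
qed

lemma pb_Suc: "pb f \<Longrightarrow> pb (\<lambda>N. Suc (f N))"
  using pb_add[of f "\<lambda>_. 1", OF _ pb_const] by simp

lemma pb_power: "pb f \<Longrightarrow> pb (\<lambda>N. f N ^ k)"
  by (induction k) (auto intro: pb_mult pb_const)

lemmas pb_intros = pb_const pb_id pb_mult pb_add pb_Suc pb_power

lemma pb_comp_power:
  assumes "pb f" "1 \<le> k"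
  shows "pb (\<lambda>M. f (M ^ k))"
proof -
  obtain K where K: "\<And>N. 2 \<le> N \<Longrightarrow> f N \<le> N ^ K" using assms by (auto simp: pb_def)
  have "f (M ^ k) \<le> M ^ (k * K)" if "2 \<le> M" for M
  proof -
    have "2 \<le> M ^ k" using that assms(2) self_le_power[of M k] by linarith
    then show ?thesis using K by (simp add: power_mult)
  qed
  then show ?thesis unfolding pb_def by blast
qed

lemma pb_addr_cost: "pb (\<lambda>N. addr_cost N k)"
  unfolding addr_cost_def by (intro pb_intros)

lemma pb_cost_fm: "pb (\<lambda>N. cost_fm N \<phi>)"
  by (induction \<phi>) (auto simp only: cost_fm.simps intro!: pb_intros pb_addr_cost)

lemma pb_for_cost: "pb f \<Longrightarrow> pb (\<lambda>N. for_cost N (f N))"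
  unfolding for_cost_def by (intro pb_intros)

lemma pb_nest_cost: "pb f \<Longrightarrow> pb (\<lambda>N. nest_cost N (f N) a)"
  by (induction a) (auto simp only: nest_cost.simps intro!: pb_for_cost)

lemma pb_cost_prog: "pb (\<lambda>N. cost_prog N p)"
  by (induction p) (auto simp only: cost_prog.simps
      intro!: pb_add pb_for_cost pb_nest_cost pb_cost_fm pb_addr_cost pb_mult pb_power pb_const pb_id)

lemma wf_clr [simp]: "wf_cmd T R (clr r) \<longleftrightarrow> 0 < r \<and> r < R"
  by (auto simp: clr_def)

lemma wf_cadd: "x < R \<Longrightarrow> 0 < c \<Longrightarrow> c < R \<Longrightarrow> 0 < r \<Longrightarrow> r < R \<Longrightarrow> wf_cmd T R (cadd r x c)"
  by (simp add: cadd_def)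

lemma wf_cmul: "0 < x \<Longrightarrow> x < R \<Longrightarrow> y < R \<Longrightarrow> 0 < t \<Longrightarrow> t < R \<Longrightarrow> 0 < c \<Longrightarrow> c < R \<Longrightarrow> wf_cmd T R (cmul x y t c)"
  by (simp add: cmul_def wf_cadd)

lemma wf_caddr: "\<forall>v\<in>set vs. v < V \<Longrightarrow> 7 + V \<le> R \<Longrightarrow> wf_cmd T R (caddr vs)"
  by (induction vs) (auto intro!: wf_cmul wf_cadd)

lemma wf_cfm: "wf_fm n ar V d \<phi> \<Longrightarrow> d \<le> V \<Longrightarrow> n < T \<Longrightarrow> 7 + V \<le> R \<Longrightarrow> wf_cmd T R (cfm \<phi>)"
  by (induction \<phi> arbitrary: d) (fastforce intro!: wf_caddr)+

lemma wf_cfor: "v < V \<Longrightarrow> 7 + V \<le> R \<Longrightarrow> wf_cmd T R c \<Longrightarrow> wf_cmd T R (cfor v c)"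
  by (simp add: cfor_def)

lemma wf_nest: "v + a \<le> V \<Longrightarrow> 7 + V \<le> R \<Longrightarrow> wf_cmd T R c \<Longrightarrow> wf_cmd T R (nest v a c)"
  by (induction a arbitrary: v) (auto intro!: wf_cfor)

lemma wf_cprog: "wf_prog n ar V d p \<Longrightarrow> d \<le> V \<Longrightarrow> n < T \<Longrightarrow> 7 + V \<le> R \<Longrightarrow> wf_cmd T R (cprog n p)"
proof (induction p arbitrary: d)
  case (Assign r v a \<phi>)
  have "wf_cmd T R (cfm \<phi>)" using Assign by (intro wf_cfm) auto
  moreover have "wf_cmd T R (caddr [v..<v + a])" using Assign by (intro wf_caddr) auto
  ultimately show ?case using Assign.prems by (auto intro!: wf_nest)
qed (auto intro!: wf_cfor)

section \<open>Computing the domain size from the input, and cleaning the tape\<close>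

fun cpow :: "nat \<Rightarrow> cmd" where
  "cpow 0 = Skip"
| "cpow (Suc k) = cmul 1 6 4 5 ;; cpow k"

text \<open>All input symbols are nonempty sets over the tracks 0 to 2, so the first cell without
  these tracks ends the input. Register 2 is the loop flag and register 6 the position.\<close>

definition cscan :: cmd where
  "cscan = While (TLt 0 2) (If (TBit 0 6) (Inc 6) (If (TBit 1 6) (Inc 6) (If (TBit 2 6) (Inc 6) (Dec 2))))"

text \<open>Register 6 is advanced by 2 beyond the input length, so the base of the power in
  register 1 is at least 2 and polynomial bounds of the form M ^ K apply.\<close>

definition cinit :: "nat \<Rightarrow> cmd" where
  "cinit k = Inc 2 ;; cscan ;; Inc 6 ;; Inc 6 ;; Inc 1 ;; cpow k ;; clr 6"

abbreviation z0 :: "nat \<Rightarrow> nat" where "z0 \<equiv> \<lambda>_. 0"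

lemma rg0: "rg 0 0 0 z0 = z0"
  by (auto simp: rg_def)

lemma runs_cpow:
  fixes \<rho> :: "nat \<Rightarrow> nat"
  assumes "\<rho> 0 = 0" "\<rho> 4 = 0" "\<rho> 5 = 0" "\<rho> 6 = M" "1 \<le> M" "\<rho> 1 = M ^ j"
  shows "runs (k * (M ^ (j + k) * (11 * M + 5) + 2)) (cpow k) (\<rho>, \<mu>) (\<rho>(1 := M ^ (j + k)), \<mu>)"
  using assms
proof (induction k arbitrary: j \<rho>)
  case 0
  have "\<rho>(1 := M ^ j) = \<rho>" using 0 by auto
  then show ?case using runs_Skip by simp
next
  case (Suc k)
  have 1: "runs (\<rho> 1 * (11 * \<rho> 6 + 5) + 2) (cmul 1 6 4 5) (\<rho>, \<mu>) (\<rho>(1 := \<rho> 1 * \<rho> 6), \<mu>)"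
    by (rule runs_cmul) (use Suc.prems in auto)
  have 2: "runs (k * (M ^ (Suc j + k) * (11 * M + 5) + 2)) (cpow k) (\<rho>(1 := M ^ Suc j), \<mu>)
      ((\<rho>(1 := M ^ Suc j))(1 := M ^ (Suc j + k)), \<mu>)"
    by (rule Suc.IH) (use Suc.prems in auto)
  have e: "\<rho>(1 := \<rho> 1 * \<rho> 6) = \<rho>(1 := M ^ Suc j)" using Suc.prems by (simp add: mult.commute)
  have "M ^ j \<le> M ^ (j + Suc k)" using Suc.prems by (intro power_increasing) auto
  then have le: "\<rho> 1 * (11 * \<rho> 6 + 5) \<le> M ^ (j + Suc k) * (11 * M + 5)" using Suc.prems by simp
  have r: "runs ((\<rho> 1 * (11 * \<rho> 6 + 5) + 2) + k * (M ^ (Suc j + k) * (11 * M + 5) + 2)) (cpow (Suc k))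
     (\<rho>, \<mu>) (\<rho>(1 := M ^ (j + Suc k)), \<mu>)"
    using runs_Seq[OF 1[unfolded e] 2] by simp
  show ?case by (rule runs_mono[OF r]) (use le in simp)
qed

lemma symbol_bits: "x \<in> {1..4::nat} \<Longrightarrow> 0 \<in> set_decode x \<or> 1 \<in> set_decode x \<or> 2 \<in> set_decode x"
proof -
  assume "x \<in> {1..4}"
  then have "x = 1 \<or> x = 2 \<or> x = 3 \<or> x = 4" by auto
  then show ?thesis by (auto simp: set_decode_def)
qed

lemma runs_cscan:
  assumes inp: "set inp \<subseteq> {1..4}"
  shows "runs (Suc (length inp) * (7 + 2) + 1) cscan (rg 0 1 0 z0, mem0 inp)
    ((rg 0 0 0 z0)(6 := length inp), mem0 inp)"
proof -
  let ?L = "length inp"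
  let ?s = "\<lambda>i. ((if i \<le> ?L then (rg 0 1 0 z0)(6 := i) else (rg 0 0 0 z0)(6 := ?L)), mem0 inp)"
  have "runs (Suc ?L * (7 + 2) + 1) cscan (?s 0) (?s (Suc ?L))"
    unfolding cscan_def
  proof (rule runs_While)
    fix i assume i: "i < Suc ?L"
    then show "holds (TLt 0 2) (?s i)" by simp
    let ?\<rho> = "(rg 0 1 0 z0)(6 := i)"
    have I: "runs 1 (Inc 6) (?\<rho>, mem0 inp) (?s (Suc i))" if "i < ?L"
      using runs_Inc[of 6 ?\<rho> "mem0 inp"] that by simp
    have D: "runs 1 (Dec 2) (?\<rho>, mem0 inp) (?s (Suc i))" if "i = ?L"
      using runs_Dec[of 2 ?\<rho> "mem0 inp"] that by (simp add: fun_upd_twist[of 6 2])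
    have lt: "i < ?L" if "holds (TBit t 6) (?\<rho>, mem0 inp)" for t
      using that by (simp add: mem0_def)
    have ge: "i = ?L" if "\<not> holds (TBit 0 6) (?\<rho>, mem0 inp)" "\<not> holds (TBit 1 6) (?\<rho>, mem0 inp)"
        "\<not> holds (TBit 2 6) (?\<rho>, mem0 inp)"
    proof (rule ccontr)
      assume "i \<noteq> ?L"
      then have "i < ?L" using i by simp
      then have "inp ! i \<in> {1..4}" using inp nth_mem by blast
      from symbol_bits[OF this] that \<open>i < ?L\<close> show False by (auto simp: mem0_def)
    qed
    have "runs (1 + 2 + 2 + 2) (If (TBit 0 6) (Inc 6) (If (TBit 1 6) (Inc 6) (If (TBit 2 6) (Inc 6) (Dec 2)))) (?\<rho>, mem0 inp) (?s (Suc i))"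
    proof (rule runs_If)
      show "runs (1 + 2 + 2) (Inc 6) (?\<rho>, mem0 inp) (?s (Suc i))" if "holds (TBit 0 6) (?\<rho>, mem0 inp)"
        by (rule runs_mono[OF I[OF lt[OF that]]]) simp
      assume 0: "\<not> holds (TBit 0 6) (?\<rho>, mem0 inp)"
      show "runs (1 + 2 + 2) (If (TBit 1 6) (Inc 6) (If (TBit 2 6) (Inc 6) (Dec 2))) (?\<rho>, mem0 inp) (?s (Suc i))"
      proof (rule runs_If)
        show "runs (1 + 2) (Inc 6) (?\<rho>, mem0 inp) (?s (Suc i))" if "holds (TBit 1 6) (?\<rho>, mem0 inp)"
          by (rule runs_mono[OF I[OF lt[OF that]]]) simp
        assume 1: "\<not> holds (TBit 1 6) (?\<rho>, mem0 inp)"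
        show "runs (1 + 2) (If (TBit 2 6) (Inc 6) (Dec 2)) (?\<rho>, mem0 inp) (?s (Suc i))"
        proof (rule runs_If)
          show "runs 1 (Inc 6) (?\<rho>, mem0 inp) (?s (Suc i))" if "holds (TBit 2 6) (?\<rho>, mem0 inp)"
            by (rule I[OF lt[OF that]])
          show "runs 1 (Dec 2) (?\<rho>, mem0 inp) (?s (Suc i))" if "\<not> holds (TBit 2 6) (?\<rho>, mem0 inp)"
            by (rule D[OF ge[OF 0 1 that]])
        qed
      qed
    qed
    moreover have "?s i = (?\<rho>, mem0 inp)" using i by simp
    ultimately show "runs 7 (If (TBit 0 6) (Inc 6) (If (TBit 1 6) (Inc 6) (If (TBit 2 6) (Inc 6) (Dec 2)))) (?s i) (?s (Suc i))"
      by (simp only: runs_mono[of "1 + 2 + 2 + 2"])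
  qed simp
  moreover have "?s 0 = (rg 0 1 0 z0, mem0 inp)" by (auto simp: rg_def fun_eq_iff)
  ultimately show ?thesis by simp
qed

definition init_cost :: "nat \<Rightarrow> nat \<Rightarrow> nat" where
  "init_cost k M = 1 + ((Suc M * (7 + 2) + 1) + (1 + (1 + (1 + (k * (M ^ k * (11 * M + 5) + 2) + (3 * M + 1))))))"

lemma runs_cinit:
  assumes inp: "set inp \<subseteq> {1..4}"
  defines "M \<equiv> length inp + 2"
  shows "runs (init_cost k M) (cinit k) (z0, mem0 inp) (rg (M ^ k) 0 0 z0, mem0 inp)"
proof -
  let ?m = "mem0 inp"
  have 1: "runs 1 (Inc 2) (z0, ?m) (rg 0 1 0 z0, ?m)"
    using runs_Inc[of 2 "rg 0 0 0 z0" ?m] unfolding rg_simps unfolding rg0 by simp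
  have 2: "runs (Suc M * (7 + 2) + 1) cscan (rg 0 1 0 z0, ?m) ((rg 0 0 0 z0)(6 := length inp), ?m)"
    by (rule runs_mono[OF runs_cscan[OF inp]]) (simp add: M_def)
  have 3: "runs 1 (Inc 6) ((rg 0 0 0 z0)(6 := length inp), ?m) ((rg 0 0 0 z0)(6 := Suc (length inp)), ?m)"
    using runs_Inc[of 6 "(rg 0 0 0 z0)(6 := length inp)" ?m] by (simp only: fun_upd_same fun_upd_upd)
  have 4: "runs 1 (Inc 6) ((rg 0 0 0 z0)(6 := Suc (length inp)), ?m) ((rg 0 0 0 z0)(6 := M), ?m)"
    using runs_Inc[of 6 "(rg 0 0 0 z0)(6 := Suc (length inp))" ?m] by (simp add: M_def)
  let ?\<rho> = "((rg 0 0 0 z0)(6 := M))(1 := 1)"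
  have 5: "runs 1 (Inc 1) ((rg 0 0 0 z0)(6 := M), ?m) (?\<rho>, ?m)"
    using runs_Inc[of 1 "(rg 0 0 0 z0)(6 := M)" ?m] by simp
  have 6: "runs (k * (M ^ (0 + k) * (11 * M + 5) + 2)) (cpow k) (?\<rho>, ?m) (?\<rho>(1 := M ^ (0 + k)), ?m)"
    by (rule runs_cpow) (auto simp: M_def)
  have "(?\<rho>(1 := M ^ (0 + k)))(6 := 0) = rg (M ^ k) 0 0 z0"
    by (auto simp: rg_def fun_eq_iff)
  then have 7: "runs (3 * M + 1) (clr 6) (?\<rho>(1 := M ^ (0 + k)), ?m) (rg (M ^ k) 0 0 z0, ?m)"
    using runs_clr[of "?\<rho>(1 := M ^ (0 + k))" 6 ?m] by simp
  show ?thesis unfolding init_cost_def cinit_def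
    using runs_Seq[OF 1 runs_Seq[OF 2 runs_Seq[OF 3 runs_Seq[OF 4 runs_Seq[OF 5 runs_Seq[OF 6 7]]]]]]
    by (simp only: add_0)
qed

fun cputs :: "nat list \<Rightarrow> cmd" where
  "cputs [] = Skip"
| "cputs (t # ts) = Put t 7 False ;; cputs ts"

lemma runs_cputs: "runs (length ts) (cputs ts) (\<rho>, \<mu>) (\<rho>, \<lambda>t i. \<mu> t i \<and> \<not> (t \<in> set ts \<and> i = \<rho> 7))"
proof (induction ts arbitrary: \<mu>)
  case Nil
  then show ?case using runs_Skip by simp
next
  case (Cons t ts)
  let ?m = "\<mu>(t := (\<mu> t)(\<rho> 7 := False))"
  have "(\<lambda>t' i. ?m t' i \<and> \<not> (t' \<in> set ts \<and> i = \<rho> 7)) = (\<lambda>t' i. \<mu> t' i \<and> \<not> (t' \<in> set (t # ts) \<and> i = \<rho> 7))"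
    by (auto simp: fun_eq_iff)
  then show ?case using runs_Seq[OF runs_Put[of t 7 False \<rho> \<mu>] Cons.IH[of ?m]] by simp
qed

text \<open>Below \<open>N\<close> only the two output tracks survive; register 1, the last one that
  is not 0, is cleared so that its marker returns to cell 0.\<close>

definition cfinal :: "nat \<Rightarrow> cmd" where
  "cfinal T = cfor 0 (cputs [2..<T]) ;; clr 1"

lemma runs_cfinal:
  "runs (for_cost N (T - 2) + (3 * N + 1)) (cfinal T) (rg N 0 0 z0, \<mu>)
    (z0, \<lambda>t i. \<mu> t i \<and> \<not> (2 \<le> t \<and> t < T \<and> i < N))"
proof -
  let ?P = "\<lambda>x m. m = (\<lambda>t i. \<mu> t i \<and> \<not> (2 \<le> t \<and> t < T \<and> i < x))"
  have "\<exists>m. ?P N m \<and> runs (for_cost N (T - 2)) (cfor 0 (cputs [2..<T])) (rg N 0 0 z0, \<mu>) (rg N 0 0 z0, m)"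
  proof (rule runs_cfor[where P = ?P])
    fix x m assume "x < N" and m: "?P x m"
    let ?m = "\<lambda>t i. m t i \<and> \<not> (t \<in> set [2..<T] \<and> i = rg N 0 0 (z0(0 := x)) 7)"
    have "rg N 0 0 (z0(0 := x)) 7 = x" by (simp add: rg_def)
    then have "?P (Suc x) ?m" using m by (auto simp: fun_eq_iff less_Suc_eq)
    moreover have "runs (T - 2) (cputs [2..<T]) (rg N 0 0 (z0(0 := x)), m) (rg N 0 0 (z0(0 := x)), ?m)"
      using runs_cputs[of "[2..<T]" "rg N 0 0 (z0(0 := x))" m] by (simp only: length_upt)
    ultimately show "\<exists>m'. ?P (Suc x) m' \<and> runs (T - 2) (cputs [2..<T]) (rg N 0 0 (z0(0 := x)), m) (rg N 0 0 (z0(0 := x)), m')"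
      by blast
  qed auto
  then have 1: "runs (for_cost N (T - 2)) (cfor 0 (cputs [2..<T])) (rg N 0 0 z0, \<mu>)
    (rg N 0 0 z0, \<lambda>t i. \<mu> t i \<and> \<not> (2 \<le> t \<and> t < T \<and> i < N))" by blast
  have "(rg N 0 0 z0)(1 := 0) = z0" by (auto simp: rg_def fun_eq_iff)
  then have 2: "runs (3 * N + 1) (clr 1) (rg N 0 0 z0, m) (z0, m)" for m
    using runs_clr[of "rg N 0 0 z0" 1 m] by simp
  show ?thesis unfolding cfinal_def by (rule runs_Seq[OF 1 2])
qed

definition I0 :: "nat list \<Rightarrow> interp" where
  "I0 inp r xs \<longleftrightarrow> (\<exists>i. xs = [i] \<and> mem0 inp r i)"

lemma mem0_ge3: "set inp \<subseteq> {1..4} \<Longrightarrow> 3 \<le> t \<Longrightarrow> \<not> mem0 inp t i"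
proof
  assume "set inp \<subseteq> {1..4}" "3 \<le> t" "mem0 inp t i"
  then have "inp ! i \<in> set inp" "t \<in> set_decode (inp ! i)" by (simp_all add: mem0_def)
  then have "inp ! i \<in> {1..4}" "t \<in> set_decode (inp ! i)" using \<open>set inp \<subseteq> {1..4}\<close> by blast+
  then have "t \<in> {..<3}" using set_decode_lessD[of "inp ! i" 3] by fastforce
  then show False using \<open>3 \<le> t\<close> by simp
qed

lemma sym_encode:
  assumes "y \<in> {1..3::nat}"
  shows "set_encode {t. (t = 0 \<and> odd y) \<or> (t = 1 \<and> 2 \<le> y)} = y"
proof -
  have "y = 1 \<or> y = 2 \<or> y = 3" using assms by auto
  then show ?thesis
  proof (elim disjE)
    assume y: "y = 1"
    have "{t::nat. (t = 0 \<and> odd y) \<or> (t = 1 \<and> 2 \<le> y)} = {0}" using y by auto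
    then show ?thesis using y by (simp add: set_encode_def)
  next
    assume y: "y = 2"
    have "{t::nat. (t = 0 \<and> odd y) \<or> (t = 1 \<and> 2 \<le> y)} = {1}" using y by auto
    then show ?thesis using y by (simp add: set_encode_def)
  next
    assume y: "y = 3"
    have "{t::nat. (t = 0 \<and> odd y) \<or> (t = 1 \<and> 2 \<le> y)} = {0, 1}" using y by auto
    then show ?thesis using y by (simp add: set_encode_def)
  qed
qed

text \<open>Output symbols 1 to 3 are two-bit numbers: relation 0 supplies the low bits and relation
  1 the high ones. The condition includes position \<open>length ys\<close>, where both must be
  false, since the blank there ends the output.\<close>

theorem prog_to_tm:
  assumes wf: "wf_prog n ar V 0 p" and n: "3 \<le> n" "ar 0 = 1" "ar 1 = 1" "ar 2 = 1" and k: "1 \<le> k"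
  shows "\<exists>Q Sg \<delta> K. tm_wf Q Sg \<delta> \<and>
    (\<forall>inp ys. set inp \<subseteq> {1..4} \<longrightarrow> length ys < (length inp + 2) ^ k \<longrightarrow> set ys \<subseteq> {1..3} \<longrightarrow>
      (\<forall>i \<le> length ys.
        (run ((length inp + 2) ^ k) z0 p (I0 inp) 0 [i] \<longleftrightarrow> i < length ys \<and> odd (ys ! i)) \<and>
        (run ((length inp + 2) ^ k) z0 p (I0 inp) 1 [i] \<longleftrightarrow> i < length ys \<and> 2 \<le> ys ! i)) \<longrightarrow>
      (\<exists>t \<le> (length inp + 2) ^ K. fst (tm_run \<delta> t inp) = 1 \<and> tm_output (tm_run \<delta> t inp) = ys))"
proof -
  define T where "T = Suc n"
  define R where "R = 8 + V"
  define c where "c = cinit k ;; cprog n p ;; cfinal T"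
  have "wf_cmd T R (cpow j)" for j
    by (induction j) (auto intro!: wf_cmul simp: R_def)
  moreover have "\<forall>t\<in>set ts. t < T \<Longrightarrow> wf_cmd T R (cputs ts)" for ts
    by (induction ts) (auto simp: R_def)
  moreover have "wf_cmd T R (cprog n p)"
    using wf_cprog[OF wf] by (simp add: T_def R_def)
  ultimately have wfc: "wf_cmd T R c"
    using n by (auto simp: c_def cinit_def cscan_def cfinal_def T_def R_def intro!: wf_cfor[where V = "Suc V"])
  define tc where "tc M = init_cost k M + (cost_prog (M ^ k) p + (for_cost (M ^ k) (T - 2) + (3 * M ^ k + 1)))" for M
  define tt where "tt M = tc M * (2 * tc M + 5) + 2" for M
  have "pb tc"
    unfolding tc_def[abs_def] init_cost_def for_cost_def by (intro pb_intros pb_comp_power pb_cost_prog k)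
  then have "pb tt" unfolding tt_def[abs_def] by (intro pb_intros)
  then obtain K where K: "\<And>M. 2 \<le> M \<Longrightarrow> tt M \<le> M ^ K" by (auto simp: pb_def)
  have TR: "3 \<le> T" "0 < R" using n(1) by (simp_all add: T_def R_def)
  obtain Q Sg \<delta> where tm: "tm_wf Q Sg \<delta>" and sim: "\<forall>inp t s' ys. set inp \<subseteq> {1..4} \<longrightarrow> exec c (\<lambda>_. 0, mem0 inp) t s' \<longrightarrow>
      (\<forall>i < length ys. ys ! i = set_encode (if i = 0 then cell T R s' i \<inter> {0, 1} else cell T R s' i)) \<longrightarrow>
      cell T R s' (length ys) \<inter> (if ys = [] then {0, 1} else UNIV) = {} \<longrightarrow> 0 \<notin> set ys \<longrightarrow>
      (\<exists>n \<le> t * (2 * t + 5) + 2. fst (tm_run \<delta> n inp) = 1 \<and> tm_output (tm_run \<delta> n inp) = ys)"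
    using cmd_to_tm[OF wfc TR] by (elim exE conjE) (rule that)
  have "\<exists>t \<le> (length inp + 2) ^ K. fst (tm_run \<delta> t inp) = 1 \<and> tm_output (tm_run \<delta> t inp) = ys"
    if inp: "set inp \<subseteq> {1..4}" and len: "length ys < (length inp + 2) ^ k" and ys: "set ys \<subseteq> {1..3}"
      and out: "\<And>i. i \<le> length ys \<Longrightarrow>
        (run ((length inp + 2) ^ k) z0 p (I0 inp) 0 [i] \<longleftrightarrow> i < length ys \<and> odd (ys ! i)) \<and>
        (run ((length inp + 2) ^ k) z0 p (I0 inp) 1 [i] \<longleftrightarrow> i < length ys \<and> 2 \<le> ys ! i)" for inp ys
  proof -
    define M where "M = length inp + 2"
    define N where "N = M ^ k"
    have N: "0 < N" by (simp add: N_def M_def)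
    have "rep N n ar (I0 inp) (mem0 inp)"
      unfolding rep_def
    proof (intro allI impI ballI)
      fix r xs assume r: "r < n" and xs: "xs \<in> tup N (ar r)"
      show "mem0 inp r (addr N 0 xs) = I0 inp r xs"
      proof (cases "r < 3")
        case True
        then have "r = 0 \<or> r = 1 \<or> r = 2" by auto
        then have "ar r = 1" using n by auto
        then obtain i where "xs = [i]" using xs by (auto simp: tup_def length_Suc_conv)
        then show ?thesis by (simp add: I0_def)
      next
        case False
        then show ?thesis using mem0_ge3[OF inp] by (simp add: I0_def)
      qed
    qed
    from runs_cprog[OF N wf this, of z0] N obtain \<mu> where \<mu>: "rep N n ar (run N z0 p (I0 inp)) \<mu>"
      and r: "runs (cost_prog N p) (cprog n p) (rg N 0 0 z0, mem0 inp) (rg N 0 0 z0, \<mu>)" by auto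
    let ?\<mu> = "\<lambda>t i. \<mu> t i \<and> \<not> (2 \<le> t \<and> t < T \<and> i < N)"
    let ?s = "(z0, ?\<mu>)"
    have "runs (tc M) c (z0, mem0 inp) ?s"
      unfolding c_def tc_def
      using runs_Seq[OF runs_cinit[OF inp, of k, folded M_def, folded N_def] runs_Seq[OF r runs_cfinal]]
      by (simp only: N_def)
    then obtain t where t: "t \<le> tc M" "exec c (z0, mem0 inp) t ?s" by (auto simp: runs_def)
    have bits: "\<mu> 0 i = (i < length ys \<and> odd (ys ! i))" "\<mu> 1 i = (i < length ys \<and> 2 \<le> ys ! i)"
      if i: "i \<le> length ys" for i
    proof -
      have t: "[i] \<in> tup N 1" using i len by (simp add: tup_def N_def M_def)
      have "\<mu> r (addr N 0 [i]) = run N z0 p (I0 inp) r [i]" if "r < n" "ar r = 1" for r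
        using \<mu> t that unfolding rep_def by metis
      then have "\<mu> 0 i = run N z0 p (I0 inp) 0 [i]" "\<mu> 1 i = run N z0 p (I0 inp) 1 [i]"
        using n by simp_all
      then show "\<mu> 0 i = (i < length ys \<and> odd (ys ! i))" "\<mu> 1 i = (i < length ys \<and> 2 \<le> ys ! i)"
        using out[OF i] by (auto simp: N_def M_def)
    qed
    have cl: "cell T R ?s i \<inter> (if i = 0 then {0, 1} else UNIV) =
        {t. t = 0 \<and> i < length ys \<and> odd (ys ! i) \<or> t = 1 \<and> i < length ys \<and> 2 \<le> ys ! i}" if i: "i \<le> length ys" for i
    proof -
      have "i < N" using i len by (simp add: N_def M_def)
      have T3: "3 \<le> T" using n(1) by (simp add: T_def)
      show ?thesis
      proof (rule set_eqI)
        fix t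
        show "t \<in> cell T R ?s i \<inter> (if i = 0 then {0, 1} else UNIV) \<longleftrightarrow>
          t \<in> {t. t = 0 \<and> i < length ys \<and> odd (ys ! i) \<or> t = 1 \<and> i < length ys \<and> 2 \<le> ys ! i}"
        proof (cases "t < T")
          case True
          then have c: "t \<in> cell T R ?s i \<longleftrightarrow> ?\<mu> t i" by simp
          consider "t = 0" | "t = 1" | "2 \<le> t" by linarith
          then show ?thesis
            by cases (use c bits[OF i] True \<open>i < N\<close> in simp_all)
        next
          case False
          then show ?thesis using T3 by (auto simp: cell_def)
        qed
      qed
    qed
    have "\<exists>m \<le> t * (2 * t + 5) + 2. fst (tm_run \<delta> m inp) = 1 \<and> tm_output (tm_run \<delta> m inp) = ys"
    proof (rule sim[rule_format, OF inp t(2)])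
      fix i assume i: "i < length ys"
      show "ys ! i = set_encode (if i = 0 then cell T R ?s i \<inter> {0, 1} else cell T R ?s i)"
      proof -
        have y: "ys ! i \<in> {1..3}" using ys nth_mem[OF i] by blast
        have "(if i = 0 then cell T R ?s i \<inter> {0, 1} else cell T R ?s i) =
          {t. (t = 0 \<and> odd (ys ! i)) \<or> (t = 1 \<and> 2 \<le> ys ! i)}"
          using cl[of i] i by (auto split: if_splits)
        then show "ys ! i = set_encode (if i = 0 then cell T R ?s i \<inter> {0, 1} else cell T R ?s i)"
          using sym_encode[OF y] by simp
      qed
    next
      show "cell T R ?s (length ys) \<inter> (if ys = [] then {0, 1} else UNIV) = {}"
        using cl[of "length ys"] by (auto split: if_splits)
      show "0 \<notin> set ys" using ys by auto
    qed
    then obtain m where m: "m \<le> t * (2 * t + 5) + 2" "fst (tm_run \<delta> m inp) = 1 \<and> tm_output (tm_run \<delta> m inp) = ys"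
      by blast
    have "t * (2 * t + 5) + 2 \<le> tt M"
      unfolding tt_def using t(1) by (intro add_mono mult_le_mono) auto
    moreover have "tt M \<le> M ^ K" by (rule K) (simp add: M_def)
    ultimately have "m \<le> (length inp + 2) ^ K" using m(1) by (simp add: M_def)
    then show ?thesis using m(2) by blast
  qed
  note claim = this
  show ?thesis
    by (rule exI[of _ Q], rule exI[of _ Sg], rule exI[of _ \<delta>], rule exI[of _ K], rule conjI[OF tm],
        intro allI impI, rule claim) blast+
qed

section \<open>Arithmetic in the query language\<close>

definition "Or \<phi> \<psi> = Neg (Con (Neg \<phi>) (Neg \<psi>))"
definition "Imp \<phi> \<psi> = Neg (Con \<phi> (Neg \<psi>))"
definition "FAll v \<phi> = Neg (Ex v (Neg \<phi>))"
definition "FLe x y = Neg (FLt y x)"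
definition "FEq x y = Con (FLe x y) (FLe y x)"
definition "FFalse v = Ex v (FLt v v)"
definition "Zero v x = Neg (Ex v (FLt v x))"
definition "Succ v x y = Con (FLt x y) (Neg (Ex v (Con (FLt x v) (FLt v y))))"
definition "One v x = Ex v (Con (Zero (Suc v) v) (Succ (Suc v) v x))"

lemma eval_macros [simp]:
  "eval N I e (Or \<phi> \<psi>) \<longleftrightarrow> eval N I e \<phi> \<or> eval N I e \<psi>"
  "eval N I e (Imp \<phi> \<psi>) \<longleftrightarrow> (eval N I e \<phi> \<longrightarrow> eval N I e \<psi>)"
  "eval N I e (FAll v \<phi>) \<longleftrightarrow> (\<forall>x<N. eval N I (e(v := x)) \<phi>)"
  "eval N I e (FLe x y) \<longleftrightarrow> e x \<le> e y"
  "eval N I e (FEq x y) \<longleftrightarrow> e x = e y"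
  "\<not> eval N I e (FFalse v)"
  by (auto simp: Or_def Imp_def FAll_def FLe_def FEq_def FFalse_def)

lemma eval_Zero [simp]: "0 < N \<Longrightarrow> v \<noteq> x \<Longrightarrow> eval N I e (Zero v x) \<longleftrightarrow> e x = 0"
  by (auto simp: Zero_def)

lemma eval_Succ [simp]:
  "e y < N \<Longrightarrow> v \<noteq> x \<Longrightarrow> v \<noteq> y \<Longrightarrow> eval N I e (Succ v x y) \<longleftrightarrow> e y = Suc (e x)"
proof -
  assume a: "e y < N" "v \<noteq> x" "v \<noteq> y"
  have "eval N I e (Succ v x y) \<longleftrightarrow> e x < e y \<and> (\<forall>z<N. \<not> (e x < z \<and> z < e y))"
    using a by (auto simp: Succ_def)
  also have "\<dots> \<longleftrightarrow> e y = Suc (e x)"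
  proof
    assume h: "e x < e y \<and> (\<forall>z<N. \<not> (e x < z \<and> z < e y))"
    then have "\<not> Suc (e x) < e y" using a(1) by (metis less_trans lessI)
    then show "e y = Suc (e x)" using h by simp
  qed auto
  finally show ?thesis .
qed

lemma eval_One [simp]:
  "e x < N \<Longrightarrow> v \<noteq> x \<Longrightarrow> Suc v \<noteq> x \<Longrightarrow> eval N I e (One v x) \<longleftrightarrow> e x = 1"
proof -
  assume a: "e x < N" "v \<noteq> x" "Suc v \<noteq> x"
  have "eval N I e (One v x) \<longleftrightarrow> (\<exists>z<N. z = 0 \<and> e x = Suc z)"
    unfolding One_def using a by simp
  then show ?thesis using a(1) by auto
qed

lemma wf_macros [simp]:
  "wf_fm n ar V d (Or \<phi> \<psi>) \<longleftrightarrow> wf_fm n ar V d \<phi> \<and> wf_fm n ar V d \<psi>"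
  "wf_fm n ar V d (Imp \<phi> \<psi>) \<longleftrightarrow> wf_fm n ar V d \<phi> \<and> wf_fm n ar V d \<psi>"
  "wf_fm n ar V d (FAll v \<phi>) \<longleftrightarrow> d \<le> v \<and> v < V \<and> wf_fm n ar V (Suc v) \<phi>"
  "wf_fm n ar V d (FLe x y) \<longleftrightarrow> x < d \<and> y < d"
  "wf_fm n ar V d (FEq x y) \<longleftrightarrow> x < d \<and> y < d"
  "wf_fm n ar V d (FFalse v) \<longleftrightarrow> d \<le> v \<and> v < V"
  "wf_fm n ar V d (Zero v x) \<longleftrightarrow> d \<le> v \<and> v < V \<and> x < Suc v"
  "wf_fm n ar V d (Succ v x y) \<longleftrightarrow> x < d \<and> y < d \<and> d \<le> v \<and> v < V"
  by (auto simp: Or_def Imp_def FAll_def FLe_def FEq_def FFalse_def Zero_def Succ_def)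

lemma wf_One [simp]: "x < d \<Longrightarrow> d \<le> v \<Longrightarrow> Suc v < V \<Longrightarrow> wf_fm n ar V d (One v x)"
  by (simp add: One_def)

fun exs :: "nat \<Rightarrow> nat \<Rightarrow> fm \<Rightarrow> fm" where
  "exs v 0 \<phi> = \<phi>"
| "exs v (Suc a) \<phi> = Ex v (exs (Suc v) a \<phi>)"

lemma tup_Suc: "(\<exists>xs\<in>tup N (Suc a). P xs) \<longleftrightarrow> (\<exists>x<N. \<exists>xs\<in>tup N a. P (x # xs))"
proof
  assume "\<exists>xs\<in>tup N (Suc a). P xs"
  then obtain xs where xs: "xs \<in> tup N (Suc a)" "P xs" by blast
  then obtain y ys where "xs = y # ys" by (cases xs) (auto simp: tup_def)
  then show "\<exists>x<N. \<exists>xs\<in>tup N a. P (x # xs)" using xs by (auto simp: tup_def)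
next
  assume "\<exists>x<N. \<exists>xs\<in>tup N a. P (x # xs)"
  then obtain x xs where "x < N" "xs \<in> tup N a" "P (x # xs)" by blast
  moreover from this have "x # xs \<in> tup N (Suc a)" by (simp add: tup_def)
  ultimately show "\<exists>xs\<in>tup N (Suc a). P xs" by blast
qed

lemma eval_exs [simp]: "eval N I e (exs v a \<phi>) \<longleftrightarrow> (\<exists>xs\<in>tup N a. eval N I (upd e v xs) \<phi>)"
proof (induction a arbitrary: v e)
  case 0
  have "tup N 0 = {[]}" by (auto simp: tup_def)
  then show ?case by simp
next
  case (Suc a)
  then show ?case by (simp only: exs.simps eval.simps tup_Suc upd_Cons)
qed

lemma wf_exs [simp]: "d \<le> v \<Longrightarrow> v + a \<le> V \<Longrightarrow> wf_fm n ar V d (exs v a \<phi>) \<longleftrightarrow> wf_fm n ar V (if a = 0 then d else v + a) \<phi>"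
  by (induction a arbitrary: v d) auto

fun conjs :: "nat \<Rightarrow> fm list \<Rightarrow> fm" where
  "conjs v [] = Neg (FFalse v)"
| "conjs v (\<phi> # \<phi>s) = Con \<phi> (conjs v \<phi>s)"

fun disjs :: "nat \<Rightarrow> fm list \<Rightarrow> fm" where
  "disjs v [] = FFalse v"
| "disjs v (\<phi> # \<phi>s) = Or \<phi> (disjs v \<phi>s)"

lemma eval_conjs [simp]: "eval N I e (conjs v \<phi>s) \<longleftrightarrow> (\<forall>\<phi>\<in>set \<phi>s. eval N I e \<phi>)"
  by (induction \<phi>s) auto

lemma eval_disjs [simp]: "eval N I e (disjs v \<phi>s) \<longleftrightarrow> (\<exists>\<phi>\<in>set \<phi>s. eval N I e \<phi>)"
  by (induction \<phi>s) auto

lemma wf_conjs [simp]: "d \<le> v \<Longrightarrow> v < V \<Longrightarrow> wf_fm n ar V d (conjs v \<phi>s) \<longleftrightarrow> (\<forall>\<phi>\<in>set \<phi>s. wf_fm n ar V d \<phi>)"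
  by (induction \<phi>s) auto

lemma wf_disjs [simp]: "d \<le> v \<Longrightarrow> v < V \<Longrightarrow> wf_fm n ar V d (disjs v \<phi>s) \<longleftrightarrow> (\<forall>\<phi>\<in>set \<phi>s. wf_fm n ar V d \<phi>)"
  by (induction \<phi>s) auto

fun writes :: "prog \<Rightarrow> nat set" where
  "writes (Assign r v a \<phi>) = {r}"
| "writes (p ;;; q) = writes p \<union> writes q"
| "writes (PFor v p) = writes p"

lemma run_frame: "r \<notin> writes p \<Longrightarrow> run N e p I r = I r"
proof (induction p arbitrary: e I)
  case (PFor v p)
  have "fold (\<lambda>x. run N (e(v := x)) p) xs I r = I r" for xs
    using PFor by (induction xs arbitrary: I) auto
  then show ?case by simp
qed auto

lemma run_For_inv:
  assumes "P 0 I" "\<And>x J. x < N \<Longrightarrow> P x J \<Longrightarrow> P (Suc x) (run N (e(v := x)) p J)"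
  shows "P N (run N e (PFor v p) I)"
proof -
  have "P x (fold (\<lambda>x. run N (e(v := x)) p) [0..<x] I)" if "x \<le> N" for x
    using that by (induction x) (use assms in auto)
  then show ?thesis by simp
qed

lemma tup_simps [simp]:
  "[] \<in> tup N 0" "[x] \<in> tup N 1 \<longleftrightarrow> x < N" "[x] \<in> tup N (Suc 0) \<longleftrightarrow> x < N" "[x, y] \<in> tup N 2 \<longleftrightarrow> x < N \<and> y < N"
  "[x, y, z] \<in> tup N 3 \<longleftrightarrow> x < N \<and> y < N \<and> z < N"
  "[x, y, z, u] \<in> tup N 4 \<longleftrightarrow> x < N \<and> y < N \<and> z < N \<and> u < N"
  by (auto simp: tup_def)

text \<open>The loop variable only counts: after \<open>t\<close> rounds the relation is the graph
  of \<open>f\<close> for second arguments below \<open>t\<close>, and a round applies the recursion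
  once to all of them. The bound \<open>bd\<close> ensures that the previous value exists within the
  domain.\<close>

lemma run_recursion:
  assumes \<phi>: "\<And>J t x y z. t < N \<Longrightarrow> x < N \<Longrightarrow> y < N \<Longrightarrow> z < N \<Longrightarrow> (\<And>r'. r' \<noteq> r \<Longrightarrow> J r' = I r') \<Longrightarrow>
      eval N J (upd (e(v := t)) u [x, y, z]) \<phi> \<longleftrightarrow>
        y = 0 \<and> z = f x 0 \<or> (\<exists>y'<N. \<exists>z'<N. y = Suc y' \<and> z = h x z' \<and> J r [x, y', z'])"
    and emp: "\<And>x y z. \<not> I r [x, y, z]" and f: "\<And>x y. f x (Suc y) = h x (f x y)"
    and bd: "\<And>x y. x < N \<Longrightarrow> f x (Suc y) < N \<Longrightarrow> f x y < N"
    and xyz: "x < N" "y < N" "z < N"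
  shows "run N e (PFor v (Assign r u 3 \<phi>)) I r [x, y, z] \<longleftrightarrow> f x y = z"
proof -
  let ?P = "\<lambda>t J. (\<forall>r'. r' \<noteq> r \<longrightarrow> J r' = I r') \<and> (\<forall>x<N. \<forall>y<N. \<forall>z<N. J r [x, y, z] \<longleftrightarrow> y < t \<and> f x y = z)"
  have "?P N (run N e (PFor v (Assign r u 3 \<phi>)) I)"
  proof (rule run_For_inv[where P = ?P])
    show "?P 0 I" using emp by simp
  next
    fix t J assume t: "t < N" and P: "?P t J"
    let ?J = "run N (e(v := t)) (Assign r u 3 \<phi>) J"
    have "?J r [x, y, z] \<longleftrightarrow> y < Suc t \<and> f x y = z" if xyz: "x < N" "y < N" "z < N" for x y z
    proof -
      have "?J r [x, y, z] \<longleftrightarrow> eval N J (upd (e(v := t)) u [x, y, z]) \<phi>"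
        using xyz by simp
      also have "\<dots> \<longleftrightarrow> y = 0 \<and> z = f x 0 \<or> (\<exists>y'<N. \<exists>z'<N. y = Suc y' \<and> z = h x z' \<and> J r [x, y', z'])"
        by (rule \<phi>[OF t xyz]) (use P in blast)
      also have "\<dots> \<longleftrightarrow> y = 0 \<and> z = f x 0 \<or> (\<exists>y'<N. \<exists>z'<N. y = Suc y' \<and> z = h x z' \<and> y' < t \<and> f x y' = z')"
      proof -
        have "J r [x, y', z'] \<longleftrightarrow> y' < t \<and> f x y' = z'" if "y' < N" "z' < N" for y' z'
          using P xyz(1) that by simp
        then show ?thesis by (simp cong: conj_cong)
      qed
      also have "\<dots> \<longleftrightarrow> y < Suc t \<and> f x y = z"
      proof (cases y)
        case (Suc y')
        then show ?thesis using f[of x y'] bd[of x y'] xyz by auto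
      qed auto
      finally show ?thesis .
    qed
    then show "?P (Suc t) ?J" using P by simp
  qed
  then show ?thesis using xyz by simp
qed

definition "RAdd = (3::nat)"
definition "RMul = (4::nat)"
definition "RExp = (5::nat)"
definition "RDig = (11::nat)"
definition "RBit = (12::nat)"
definition "RPow = (25::nat)"

definition p_add :: prog where
  "p_add = PFor 0 (Assign RAdd 20 3 (Or (Con (Zero 23 21) (FEq 22 20))
     (Ex 23 (Ex 24 (Con (Succ 25 23 21) (Con (Succ 25 24 22) (FRel RAdd [20, 23, 24])))))))"

definition p_mul :: prog where
  "p_mul = PFor 0 (Assign RMul 20 3 (Or (Con (Zero 23 21) (Zero 23 22))
     (Ex 23 (Ex 24 (Con (Succ 25 23 21) (Con (FRel RAdd [20, 24, 22]) (FRel RMul [20, 23, 24])))))))"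

definition p_exp :: prog where
  "p_exp = PFor 0 (Assign RExp 20 3 (Or (Con (Zero 23 21) (One 23 22))
     (Ex 23 (Ex 24 (Con (Succ 25 23 21) (Con (FRel RMul [20, 24, 22]) (FRel RExp [20, 23, 24])))))))"

text \<open>The digit is certified by A = (h q + a) q ^ u + r with a < q and r < q ^ u.\<close>

definition p_dig :: prog where
  "p_dig = Assign RDig 20 4 (Con (FLt 23 21) (Ex 24 (Ex 25 (Ex 26 (Ex 27 (Ex 28 (Ex 29
     (Con (FRel RExp [21, 22, 24]) (Con (FRel RMul [25, 21, 27]) (Con (FRel RAdd [27, 23, 28])
     (Con (FRel RMul [28, 24, 29]) (Con (FRel RAdd [29, 26, 20]) (FLt 26 24)))))))))))))"

definition p_bit :: prog where
  "p_bit = Assign RBit 20 2 (Ex 22 (Ex 23 (Con (One 24 22) (Con (Succ 24 22 23) (FRel RDig [20, 23, 21, 22])))))"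

definition p_pow :: prog where
  "p_pow = Assign RPow 20 2 (Ex 22 (Ex 23 (Con (One 24 22) (Con (Succ 24 22 23) (FRel RExp [23, 20, 21])))))"

definition p_arith :: prog where
  "p_arith = p_add ;;; p_mul ;;; p_exp ;;; p_dig ;;; p_bit ;;; p_pow"

text \<open>Digits are characterised in one direction only under q ^ u < N, because this power has
  to occur as a witness.\<close>

definition arith :: "nat \<Rightarrow> interp \<Rightarrow> bool" where
  "arith N I \<longleftrightarrow>
     (\<forall>x<N. \<forall>y<N. \<forall>z<N. (I RAdd [x, y, z] \<longleftrightarrow> x + y = z) \<and> (I RMul [x, y, z] \<longleftrightarrow> x * y = z) \<and> (I RExp [x, y, z] \<longleftrightarrow> x ^ y = z)) \<and>
     (\<forall>A<N. \<forall>q<N. \<forall>u<N. \<forall>a<N. (I RDig [A, q, u, a] \<longrightarrow> A div q ^ u mod q = a) \<and>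
        (0 < q \<longrightarrow> q ^ u < N \<longrightarrow> A div q ^ u mod q = a \<longrightarrow> I RDig [A, q, u, a])) \<and>
     (\<forall>c<N. \<forall>i<N. I RBit [c, i] \<longleftrightarrow> i \<in> set_decode c) \<and>
     (\<forall>t<N. \<forall>p<N. I RPow [t, p] \<longleftrightarrow> 2 ^ t = p)"

lemmas rel_defs = RAdd_def RMul_def RExp_def RDig_def RBit_def RPow_def

lemma div_mod_digit:
  fixes A q p a :: nat
  shows "a < q \<Longrightarrow> r < p \<Longrightarrow> (h * q + a) * p + r = A \<Longrightarrow> A div p mod q = a"
  by auto

lemma two_one: "3 \<le> N \<Longrightarrow> (\<exists>x<N. \<exists>y<N. x = 1 \<and> y = Suc x \<and> F y x) \<longleftrightarrow> F (2::nat) (1::nat)"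
  by (auto simp: numeral_2_eq_2)

lemma p_arith_spec:
  assumes N: "3 \<le> N" and I: "\<And>r xs. 3 \<le> r \<Longrightarrow> \<not> I r xs"
  shows "arith N (run N e p_arith I)"
proof -
  let ?I1 = "run N e p_add I"
  have 1: "?I1 RAdd [x, y, z] \<longleftrightarrow> x + y = z" if "x < N" "y < N" "z < N" for x y z
    unfolding p_add_def
    by (rule run_recursion[where f = "\<lambda>x y. x + y" and h = "\<lambda>x z. Suc z"])
      (use N I that in \<open>auto simp: upd_Cons rel_defs\<close>)
  let ?I2 = "run N e p_mul ?I1"
  have fr1: "?I1 r = I r" if "r \<noteq> RAdd" for r by (rule run_frame) (use that in \<open>simp add: p_add_def\<close>)
  have 2: "?I2 RMul [x, y, z] \<longleftrightarrow> x * y = z" if xyz: "x < N" "y < N" "z < N" for x y z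
    unfolding p_mul_def
  proof (rule run_recursion[where f = "\<lambda>x y. x * y" and h = "\<lambda>x z. x + z"])
    fix J t x y z assume b: "x < N" "y < N" "z < N" and J: "\<And>r'. r' \<noteq> RMul \<Longrightarrow> J r' = ?I1 r'"
    have "J RAdd = ?I1 RAdd" by (rule J) (simp add: rel_defs)
    then show "eval N J (upd (e(0 := t)) 20 [x, y, z]) (Or (Con (Zero 23 21) (Zero 23 22))
     (Ex 23 (Ex 24 (Con (Succ 25 23 21) (Con (FRel RAdd [20, 24, 22]) (FRel RMul [20, 23, 24])))))) \<longleftrightarrow>
        y = 0 \<and> z = x * 0 \<or> (\<exists>y'<N. \<exists>z'<N. y = Suc y' \<and> z = x + z' \<and> J RMul [x, y', z'])"
      using 1 b N by (auto simp: upd_Cons)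
  qed (use xyz fr1 I in \<open>auto simp: rel_defs\<close>)
  let ?I3 = "run N e p_exp ?I2"
  have fr2: "?I2 r = ?I1 r" if "r \<noteq> RMul" for r by (rule run_frame) (use that in \<open>simp add: p_mul_def\<close>)
  have 3: "?I3 RExp [x, y, z] \<longleftrightarrow> x ^ y = z" if xyz: "x < N" "y < N" "z < N" for x y z
    unfolding p_exp_def
  proof (rule run_recursion[where f = "\<lambda>x y. x ^ y" and h = "\<lambda>x z. x * z"])
    fix J t x y z assume b: "x < N" "y < N" "z < N" and J: "\<And>r'. r' \<noteq> RExp \<Longrightarrow> J r' = ?I2 r'"
    have "J RMul = ?I2 RMul" by (rule J) (simp add: rel_defs)
    then show "eval N J (upd (e(0 := t)) 20 [x, y, z]) (Or (Con (Zero 23 21) (One 23 22))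
     (Ex 23 (Ex 24 (Con (Succ 25 23 21) (Con (FRel RMul [20, 24, 22]) (FRel RExp [20, 23, 24])))))) \<longleftrightarrow>
        y = 0 \<and> z = x ^ 0 \<or> (\<exists>y'<N. \<exists>z'<N. y = Suc y' \<and> z = x * z' \<and> J RExp [x, y', z'])"
      using 2 b N by (auto simp: upd_Cons)
  next
    fix x y assume x: "x < N" "x ^ Suc y < N"
    show "x ^ y < N"
    proof (cases "x = 0")
      case True
      then show ?thesis using N by (simp add: power_0_left)
    next
      case False
      then have "x ^ y \<le> x ^ Suc y" by simp
      then show ?thesis using x by linarith
    qed
  qed (use xyz fr1 fr2 I in \<open>auto simp: rel_defs\<close>)
  let ?I4 = "run N e p_dig ?I3"
  have fr3: "?I3 r = ?I2 r" if "r \<noteq> RExp" for r by (rule run_frame) (use that in \<open>simp add: p_exp_def\<close>)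
  have ops: "?I3 RAdd [x, y, z] \<longleftrightarrow> x + y = z" "?I3 RMul [x, y, z] \<longleftrightarrow> x * y = z" "?I3 RExp [x, y, z] \<longleftrightarrow> x ^ y = z"
    if "x < N" "y < N" "z < N" for x y z
    using that 1 2 3 fr2[of RAdd] fr3[of RAdd] fr3[of RMul] by (auto simp: rel_defs)
  have dig: "?I4 RDig [A, q, u, a] \<longleftrightarrow> a < q \<and> (\<exists>p<N. \<exists>h<N. \<exists>r<N. \<exists>m1<N. \<exists>m2<N. \<exists>m3<N.
      q ^ u = p \<and> h * q = m1 \<and> m1 + a = m2 \<and> m2 * p = m3 \<and> m3 + r = A \<and> r < p)"
    if "A < N" "q < N" "u < N" "a < N" for A q u a
    using that unfolding p_dig_def by (simp add: upd_Cons ops cong: conj_cong)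
  have 4: "(?I4 RDig [A, q, u, a] \<longrightarrow> A div q ^ u mod q = a) \<and>
        (0 < q \<longrightarrow> q ^ u < N \<longrightarrow> A div q ^ u mod q = a \<longrightarrow> ?I4 RDig [A, q, u, a])"
    if b: "A < N" "q < N" "u < N" "a < N" for A q u a
  proof (intro conjI impI)
    assume "?I4 RDig [A, q, u, a]"
    then show "A div q ^ u mod q = a" unfolding dig[OF b] using div_mod_digit by blast
  next
    assume q: "0 < q" "q ^ u < N" and a: "A div q ^ u mod q = a"
    let ?p = "q ^ u"
    let ?h = "A div ?p div q"
    have p0: "0 < ?p" using q by simp
    have e1: "?h * q + a = A div ?p" using a by (metis div_mult_mod_eq)
    have e2: "(?h * q + a) * ?p + A mod ?p = A" unfolding e1 by (rule div_mult_mod_eq)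
    have l3: "(?h * q + a) * ?p \<le> A" using e2 by linarith
    have l2: "?h * q + a \<le> A" using e1 by simp
    have B1: "?h < N" using b(1) by (meson div_le_dividend le_less_trans)
    have B2: "A mod ?p < N" using b(1) mod_less_eq_dividend le_less_trans by blast
    have B: "?h * q < N" "?h * q + a < N" "(?h * q + a) * ?p < N" using l2 l3 b(1) by linarith+
    have aq: "a < q" using a q(1) mod_less_divisor by blast
    show "?I4 RDig [A, q, u, a]"
      unfolding dig[OF b]
      by (rule conjI[OF aq], rule exI[of _ ?p], rule conjI[OF q(2)], rule exI[of _ ?h], rule conjI[OF B1],
          rule exI[of _ "A mod ?p"], rule conjI[OF B2], rule exI[of _ "?h * q"], rule conjI[OF B(1)],
          rule exI[of _ "?h * q + a"], rule conjI[OF B(2)], rule exI[of _ "(?h * q + a) * ?p"], rule conjI[OF B(3)],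
          intro conjI refl e2 mod_less_divisor p0)
  qed
  let ?I5 = "run N e p_bit ?I4"
  have fr4: "?I4 r = ?I3 r" if "r \<noteq> RDig" for r by (rule run_frame) (use that in \<open>simp add: p_dig_def\<close>)
  have fr5: "?I5 r = ?I4 r" if "r \<noteq> RBit" for r by (rule run_frame) (use that in \<open>simp add: p_bit_def\<close>)
  have 5: "?I5 RBit [c, i] \<longleftrightarrow> i \<in> set_decode c" if b: "c < N" "i < N" for c i
  proof -
    have "?I5 RBit [c, i] \<longleftrightarrow> (\<exists>x<N. \<exists>y<N. x = 1 \<and> y = Suc x \<and> ?I4 RDig [c, y, i, x])"
      using b unfolding p_bit_def by (simp add: upd_Cons cong: conj_cong)
    also have "\<dots> \<longleftrightarrow> ?I4 RDig [c, 2, i, 1]" by (rule two_one[OF N])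
    also have "\<dots> \<longleftrightarrow> c div 2 ^ i mod 2 = 1"
    proof
      assume h: "c div 2 ^ i mod 2 = 1"
      then have "c div 2 ^ i \<noteq> 0" by (metis mod_0 zero_neq_one)
      then have "2 ^ i \<le> c" by (simp add: div_greater_zero_iff)
      then have "2 ^ i < N" using b by linarith
      then show "?I4 RDig [c, 2, i, 1]" using 4[of c 2 i 1] b N h by simp
    qed (use 4[of c 2 i 1] b N in simp)
    finally show ?thesis by (simp add: set_decode_def odd_iff_mod_2_eq_one)
  qed
  let ?I6 = "run N e p_pow ?I5"
  have fr6: "?I6 r = ?I5 r" if "r \<noteq> RPow" for r by (rule run_frame) (use that in \<open>simp add: p_pow_def\<close>)
  have 6: "?I6 RPow [t, p] \<longleftrightarrow> 2 ^ t = p" if b: "t < N" "p < N" for t p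
  proof -
    have "?I6 RPow [t, p] \<longleftrightarrow> (\<exists>x<N. \<exists>y<N. x = 1 \<and> y = Suc x \<and> ?I5 RExp [y, t, p])"
      using b unfolding p_pow_def by (simp add: upd_Cons cong: conj_cong)
    also have "\<dots> \<longleftrightarrow> ?I5 RExp [2, t, p]" by (rule two_one[OF N])
    also have "?I5 RExp = ?I3 RExp" using fr4[of RExp] fr5[of RExp] by (simp add: rel_defs)
    finally show ?thesis using ops(3)[of 2 t p] b N by simp
  qed
  have eq: "?I6 RAdd = ?I3 RAdd" "?I6 RMul = ?I3 RMul" "?I6 RExp = ?I3 RExp" "?I6 RDig = ?I4 RDig" "?I6 RBit = ?I5 RBit"
    using fr4 fr5 fr6 by (simp_all add: rel_defs)
  define J where "J = ?I6"
  have "arith N J"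
    unfolding arith_def
  proof (intro conjI)
    show "\<forall>x<N. \<forall>y<N. \<forall>z<N. (J RAdd [x, y, z] \<longleftrightarrow> x + y = z) \<and> (J RMul [x, y, z] \<longleftrightarrow> x * y = z) \<and>
      (J RExp [x, y, z] \<longleftrightarrow> x ^ y = z)"
      unfolding J_def eq using ops by blast
    show "\<forall>A<N. \<forall>q<N. \<forall>u<N. \<forall>a<N. (J RDig [A, q, u, a] \<longrightarrow> A div q ^ u mod q = a) \<and>
        (0 < q \<longrightarrow> q ^ u < N \<longrightarrow> A div q ^ u mod q = a \<longrightarrow> J RDig [A, q, u, a])"
      unfolding J_def eq by (intro allI impI) (rule 4)
    show "\<forall>c<N. \<forall>i<N. J RBit [c, i] \<longleftrightarrow> i \<in> set_decode c"
      unfolding J_def eq by (intro allI impI) (rule 5)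
    show "\<forall>t<N. \<forall>p<N. J RPow [t, p] \<longleftrightarrow> 2 ^ t = p"
      unfolding J_def by (intro allI impI) (rule 6)
  qed
  then show ?thesis by (simp add: p_arith_def J_def)
qed

section \<open>Reading an instance\<close>

declare bits.simps [simp del]

lemma set_bits: "set (bits n) \<subseteq> {1, 2}"
proof (induction n rule: bits.induct)
  case (1 n)
  show ?case
  proof (cases "n < 2")
    case True
    then show ?thesis by (subst bits.simps) auto
  next
    case False
    have "n mod 2 + 1 \<in> {1, 2::nat}" by auto
    then show ?thesis using 1[OF False] False by (subst bits.simps) simp
  qed
qed

lemma bits_nonempty: "bits n \<noteq> []"
  by (subst bits.simps) simp

lemma length_bits: "length (bits n) \<le> n + 1"
proof (induction n rule: bits.induct)
  case (1 n)
  show ?case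
  proof (cases "n < 2")
    case True
    then show ?thesis by (subst bits.simps) simp
  next
    case False
    have "length (bits n) = length (bits (n div 2)) + 1" using False by (subst bits.simps) simp
    also have "\<dots> \<le> n div 2 + 2" using 1[OF False] by simp
    also have "\<dots> \<le> n + 1" using False by linarith
    finally show ?thesis .
  qed
qed

lemma foldl_bits: "foldl (\<lambda>a s. 2 * a + (s - 1)) 0 (bits n) = n"
proof (induction n rule: bits.induct)
  case (1 n)
  show ?case
  proof (cases "n < 2")
    case True
    then show ?thesis by (subst bits.simps) simp
  next
    case False
    then show ?thesis using 1[OF False] by (subst bits.simps) simp
  qed
qed

lemma bits_inject: "bits a = bits b \<Longrightarrow> a = b"
  using foldl_bits[of a] foldl_bits[of b] by simp

text \<open>This is the form in which a loop can write the code: digits from the top, leading zeros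
  suppressed by the comparison with 2 ^ j, and digit 0 always written so that 0 has a code.\<close>

lemma bits_digits:
  "n < 2 ^ N \<Longrightarrow> 0 < N \<Longrightarrow>
   bits n = concat (map (\<lambda>j. if j = 0 \<or> 2 ^ j \<le> n then [n div 2 ^ j mod 2 + 1] else []) (rev [0..<N]))"
proof (induction n arbitrary: N rule: bits.induct)
  case (1 n)
  let ?g = "\<lambda>n j. if j = 0 \<or> 2 ^ j \<le> n then [n div 2 ^ j mod 2 + 1] else []"
  obtain N' where N': "N = Suc N'" using 1(3) by (cases N) auto
  have "[0..<Suc N'] = 0 # map Suc [0..<N']" by (simp add: upt_conv_Cons map_Suc_upt del: upt_Suc)
  then have r: "rev [0..<N] = map Suc (rev [0..<N']) @ [0]" unfolding N' by (simp add: rev_map)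
  show ?case
  proof (cases "n < 2")
    case True
    have "\<not> 2 ^ Suc j \<le> n" for j
    proof -
      have "(1::nat) \<le> 2 ^ j" by simp
      then show ?thesis using True unfolding power_Suc by linarith
    qed
    then have "concat (map (?g n) (map Suc (rev [0..<N']))) = []" by simp
    then show ?thesis unfolding r map_append concat_append using True by (subst bits.simps) simp
  next
    case False
    have "0 < N'" using 1(2) False N' by (cases N') auto
    moreover have "n div 2 < 2 ^ N'" using 1(2) N' by (simp add: less_mult_imp_div_less mult.commute)
    ultimately have IH: "bits (n div 2) = concat (map (?g (n div 2)) (rev [0..<N']))" using 1(1)[OF False] by blast
    have "?g n (Suc j) = ?g (n div 2) j" for j
    proof -
      have "2 ^ Suc j \<le> n \<longleftrightarrow> 2 ^ j \<le> n div 2" by (simp add: less_eq_div_iff_mult_less_eq mult.commute)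
      moreover have "j = 0 \<Longrightarrow> 2 ^ j \<le> n div 2" using False by simp
      moreover have "n div 2 ^ Suc j = n div 2 div 2 ^ j" by (simp add: div_mult2_eq)
      ultimately show ?thesis by auto
    qed
    then have "concat (map (?g n) (map Suc (rev [0..<N']))) = bits (n div 2)" unfolding IH map_map comp_def by simp
    then show ?thesis unfolding r map_append concat_append using False by (subst bits.simps) simp
  qed
qed

section \<open>Sets and elements as positions of the input\<close>

definition symb :: "nat list \<Rightarrow> nat \<Rightarrow> nat" where
  "symb inp p = (if p < length inp then inp ! p else 0)"

lemma symb_append: "symb (P @ w) (length P + d) = symb w d"
  by (simp add: symb_def nth_append)

lemma symb_prefix: "d < length w \<Longrightarrow> symb (w @ R) d = w ! d"
  by (simp add: symb_def nth_append)

lemma enc_nats_simps [simp]: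
  "enc_nats [] = []" "enc_nats (x # xs) = bits x @ 3 # enc_nats xs" "enc_nats (xs @ ys) = enc_nats xs @ enc_nats ys"
  by (simp_all add: enc_nats_def)

lemma set_enc_nats: "set (enc_nats xs) \<subseteq> {1, 2, 3}"
  using set_bits by (induction xs) auto

text \<open>Regrouping puts a separator in front of every set. The remaining last separator starts
  no set, and it is the one that \<open>setpos\<close> excludes by asking for a later 4.\<close>

lemma enc_instance_blocks:
  "enc_instance n xss = bits n @ concat (map (\<lambda>xs. 4 # enc_nats xs) xss) @ [4]"
proof -
  have "4 # concat (map (\<lambda>xs. enc_nats xs @ [4]) xss) = concat (map (\<lambda>xs. 4 # enc_nats xs) xss) @ [4]"
    by (induction xss) auto
  then show ?thesis by (simp add: enc_instance_def)
qed

definition spos :: "nat \<Rightarrow> nat list list \<Rightarrow> nat \<Rightarrow> nat" where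
  "spos n xss i = length (bits n @ concat (map (\<lambda>xs. 4 # enc_nats xs) (take i xss)))"

lemma instance_split:
  assumes "i < length xss"
  obtains P R where "enc_instance n xss = P @ 4 # enc_nats (xss ! i) @ 4 # R" "length P = spos n xss i"
proof -
  let ?f = "\<lambda>xs. 4 # enc_nats xs"
  have x: "xss = take i xss @ xss ! i # drop (Suc i) xss" by (rule id_take_nth_drop[OF assms])
  have "\<exists>R. concat (map ?f ys) @ [4] = 4 # R" for ys by (cases ys) auto
  then obtain R where R: "concat (map ?f (drop (Suc i) xss)) @ [4] = 4 # R" by blast
  have "concat (map ?f xss) = concat (map ?f (take i xss)) @ ?f (xss ! i) @ concat (map ?f (drop (Suc i) xss))"
    by (subst x) simp
  then have "enc_instance n xss = (bits n @ concat (map ?f (take i xss))) @ 4 # enc_nats (xss ! i) @ 4 # R"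
    unfolding enc_instance_blocks using R by simp
  then show thesis by (rule that) (simp add: spos_def)
qed

lemma length_concat_take: "length (concat (map g (take i xs))) \<le> length (concat (map g xs))"
proof -
  have "concat (map g xs) = concat (map g (take i xs)) @ concat (map g (drop i xs))"
    unfolding concat_append[symmetric] map_append[symmetric] append_take_drop_id ..
  then show ?thesis by simp
qed

lemma marker_positions:
  assumes "c \<notin> set B"
  shows "(\<And>x. x \<in> set xs \<Longrightarrow> c \<notin> set (f x)) \<Longrightarrow> p < length (B @ concat (map (\<lambda>x. c # f x) xs)) \<Longrightarrow>
    (B @ concat (map (\<lambda>x. c # f x) xs)) ! p = c \<longleftrightarrow>
    (\<exists>i<length xs. p = length (B @ concat (map (\<lambda>x. c # f x) (take i xs))))"
proof (induction xs rule: rev_induct)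
  case Nil
  then show ?case using assms nth_mem[of p B] by auto
next
  case (snoc x xs)
  let ?L = "\<lambda>xs. B @ concat (map (\<lambda>x. c # f x) xs)"
  have e: "?L (xs @ [x]) = ?L xs @ c # f x" by simp
  have tk: "take i (xs @ [x]) = take i xs" if "i \<le> length xs" for i using that by simp
  have le: "length (?L (take i xs)) \<le> length (?L xs)" for i using length_concat_take[of "\<lambda>x. c # f x" i xs] by simp
  consider "p < length (?L xs)" | "p = length (?L xs)" | "length (?L xs) < p" by linarith
  then show ?case
  proof cases
    case 1
    have "?L (xs @ [x]) ! p = ?L xs ! p" unfolding e using 1 by (rule nth_append_left)
    moreover have "(?L xs ! p = c) = (\<exists>i<length xs. p = length (?L (take i xs)))" using snoc 1 by simp
    moreover have "(\<exists>i<length (xs @ [x]). p = length (?L (take i (xs @ [x])))) \<longleftrightarrow> (\<exists>i<length xs. p = length (?L (take i xs)))"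
      using 1 tk by (auto simp: less_Suc_eq)
    ultimately show ?thesis by (simp only:)
  next
    case 2
    have "?L (xs @ [x]) ! p = c" unfolding e 2 by (simp only: nth_append_length)
    moreover have "length xs < length (xs @ [x]) \<and> p = length (?L (take (length xs) (xs @ [x])))" using 2 by simp
    ultimately show ?thesis by blast
  next
    case 3
    then obtain d where d: "p = length (?L xs) + Suc d" using less_imp_Suc_add by fastforce
    have dl: "d < length (f x)" using snoc.prems(2) unfolding e d by simp
    have "?L (xs @ [x]) ! p = (c # f x) ! Suc d" unfolding e d by (rule nth_append_length_plus)
    then have "?L (xs @ [x]) ! p = f x ! d" by simp
    moreover have "f x ! d \<noteq> c" using nth_mem[OF dl] snoc.prems(1)[of x] by auto
    moreover have "p \<noteq> length (?L (take i (xs @ [x])))" if "i < length (xs @ [x])" for i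
      using le[of i] tk[of i] that 3 by simp
    then have "\<not> (\<exists>i<length (xs @ [x]). p = length (?L (take i (xs @ [x]))))" by blast
    ultimately show ?thesis by (simp only: simp_thms)
  qed
qed

lemma token_positions:
  shows "(\<And>x. x \<in> set xs \<Longrightarrow> c \<notin> set (g x)) \<Longrightarrow> p < length (concat (map (\<lambda>x. g x @ [c]) xs)) \<Longrightarrow>
    p = 0 \<or> concat (map (\<lambda>x. g x @ [c]) xs) ! (p - 1) = c \<longleftrightarrow>
    (\<exists>j<length xs. p = length (concat (map (\<lambda>x. g x @ [c]) (take j xs))))"
proof (induction xs rule: rev_induct)
  case (snoc x xs)
  let ?L = "\<lambda>xs. concat (map (\<lambda>x. g x @ [c]) xs)"
  have e: "?L (xs @ [x]) = ?L xs @ (g x @ [c])" by simp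
  have tk: "take i (xs @ [x]) = take i xs" if "i \<le> length xs" for i using that by simp
  have le: "length (?L (take i xs)) \<le> length (?L xs)" for i by (rule length_concat_take)
  consider "p < length (?L xs)" | "p = length (?L xs)" | "length (?L xs) < p" by linarith
  then show ?case
  proof cases
    case 1
    then have "p - 1 < length (?L xs)" by simp
    then have "?L (xs @ [x]) ! (p - 1) = ?L xs ! (p - 1)" unfolding e by (rule nth_append_left)
    moreover have "(p = 0 \<or> ?L xs ! (p - 1) = c) = (\<exists>i<length xs. p = length (?L (take i xs)))" using snoc 1 by simp
    moreover have "(\<exists>i<length (xs @ [x]). p = length (?L (take i (xs @ [x])))) \<longleftrightarrow> (\<exists>i<length xs. p = length (?L (take i xs)))"
      using 1 tk by (auto simp: less_Suc_eq)
    ultimately show ?thesis by (simp only:)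
  next
    case 2
    have "p = 0 \<or> ?L (xs @ [x]) ! (p - 1) = c"
    proof (cases xs rule: rev_cases)
      case Nil
      then show ?thesis using 2 by simp
    next
      case (snoc ys y)
      have "?L xs = (?L ys @ g y) @ [c]" unfolding snoc by simp
      then have p: "p - 1 = length (?L ys @ g y)" and "?L (xs @ [x]) = (?L ys @ g y) @ c # g x @ [c]" using 2 by simp_all
      then show ?thesis by (simp only: nth_append_length simp_thms)
    qed
    moreover have "length xs < length (xs @ [x]) \<and> p = length (?L (take (length xs) (xs @ [x])))" using 2 by simp
    ultimately show ?thesis by blast
  next
    case 3
    then obtain d where d: "p = Suc (length (?L xs) + d)" using less_imp_Suc_add by blast
    have dl: "d < length (g x)" using snoc.prems(2) unfolding e d by simp
    have "?L (xs @ [x]) ! (p - 1) = (g x @ [c]) ! d" unfolding e d diff_Suc_1 by (rule nth_append_length_plus)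
    then have "?L (xs @ [x]) ! (p - 1) = g x ! d" using dl by (simp add: nth_append)
    moreover have "g x ! d \<noteq> c" using nth_mem[OF dl] snoc.prems(1)[of x] by auto
    moreover have "p \<noteq> length (?L (take i (xs @ [x])))" if "i < length (xs @ [x])" for i
      using le[of i] tk[of i] that 3 by simp
    then have "\<not> (\<exists>i<length (xs @ [x]). p = length (?L (take i (xs @ [x]))))" by blast
    moreover have "p \<noteq> 0" using d by simp
    ultimately show ?thesis by (simp only: simp_thms)
  qed
qed simp

definition setpos :: "(nat \<Rightarrow> nat) \<Rightarrow> nat \<Rightarrow> bool" where
  "setpos f s \<longleftrightarrow> f s = 4 \<and> (\<exists>q>s. f q = 4)"

text \<open>The symbol at \<open>t\<close> must not be a separator itself: behind the last element,
  and at once in an empty set, comes the closing 4.\<close>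

definition inset :: "(nat \<Rightarrow> nat) \<Rightarrow> nat \<Rightarrow> nat \<Rightarrow> bool" where
  "inset f s t \<longleftrightarrow> s < t \<and> f t \<noteq> 3 \<and> f t \<noteq> 4 \<and> (f (t - 1) = 3 \<or> f (t - 1) = 4) \<and> \<not> (\<exists>z. s < z \<and> z < t \<and> f z = 4)"

definition same :: "(nat \<Rightarrow> nat) \<Rightarrow> nat \<Rightarrow> nat \<Rightarrow> bool" where
  "same f x t \<longleftrightarrow> (\<exists>n. f (x + n) = 3 \<and> f (t + n) = 3 \<and> (\<forall>d<n. f (t + d) \<noteq> 3 \<and> f (x + d) = f (t + d)))"

text \<open>An element is named by the least position at which its code, ended by a separator, can be read.\<close>

definition Elt :: "(nat \<Rightarrow> nat) \<Rightarrow> nat \<Rightarrow> nat set" where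
  "Elt f s = {x. setpos f s \<and> (\<exists>t. inset f s t \<and> same f x t \<and> (\<forall>y<x. \<not> same f y t))}"

definition reads :: "(nat \<Rightarrow> nat) \<Rightarrow> nat \<Rightarrow> nat list \<Rightarrow> bool" where
  "reads f x w \<longleftrightarrow> (\<forall>d<length w. f (x + d) = w ! d) \<and> f (x + length w) = 3"

lemma reads_same:
  assumes t: "reads f t w" and w: "3 \<notin> set w"
  shows "same f x t \<longleftrightarrow> reads f x w"
proof
  have n3: "w ! d \<noteq> 3" if "d < length w" for d using w nth_mem[OF that] by metis
  {
    assume "same f x t"
    then obtain n where n: "f (x + n) = 3" "f (t + n) = 3" "\<forall>d<n. f (t + d) \<noteq> 3 \<and> f (x + d) = f (t + d)"
      unfolding same_def by blast
    have "\<not> length w < n" using n(3) t unfolding reads_def by blast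
    moreover have "\<not> n < length w" using n(2) t n3 unfolding reads_def by metis
    ultimately have "n = length w" by simp
    then show "reads f x w" using n t unfolding reads_def by metis
  next
    assume "reads f x w"
    then show "same f x t" unfolding same_def using t n3 unfolding reads_def by (intro exI[of _ "length w"]) simp
  }
qed

text \<open>The terminating 3 makes the codes prefix-free.\<close>

lemma reads_inject:
  assumes "reads f x w" "reads f x w'" "3 \<notin> set w" "3 \<notin> set w'"
  shows "w = w'"
proof -
  have *: "\<not> length w < length w'" if "reads f x w" "reads f x w'" "3 \<notin> set w'" for w w'
    using that nth_mem[of "length w" w'] unfolding reads_def by metis
  have len: "length w = length w'" using *[OF assms(1,2,4)] *[OF assms(2,1,3)] by simp
  then show ?thesis
  proof (rule nth_equalityI)
    fix i assume "i < length w"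
    then have "f (x + i) = w ! i" "f (x + i) = w' ! i" using assms(1,2) len unfolding reads_def by simp_all
    then show "w ! i = w' ! i" by simp
  qed
qed

lemma setpos_iff: "setpos (symb (enc_instance n xss)) s \<longleftrightarrow> (\<exists>i<length xss. s = spos n xss i)"
proof
  let ?inp = "enc_instance n xss"
  let ?l = "bits n @ concat (map (\<lambda>xs. 4 # enc_nats xs) xss)"
  {
    assume "setpos (symb ?inp) s"
    then obtain q where q: "symb ?inp s = 4" "s < q" "symb ?inp q = 4" unfolding setpos_def by blast
    have "q < length ?inp" using q(3) by (simp add: symb_def split: if_splits)
    moreover have e: "?inp = ?l @ [4]" by (simp add: enc_instance_blocks)
    ultimately have s: "s < length ?l" using q(2) by simp
    have "?l ! s = 4" using q(1) symb_prefix[OF s, of "[4]"] unfolding e by simp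
    moreover have "4 \<notin> set (bits n)" "\<And>xs. 4 \<notin> set (enc_nats xs)" using set_bits[of n] set_enc_nats by fastforce+
    ultimately show "\<exists>i<length xss. s = spos n xss i"
      using marker_positions[of 4 "bits n" xss enc_nats s] s unfolding spos_def by simp
  next
    assume "\<exists>i<length xss. s = spos n xss i"
    then obtain i where i: "i < length xss" "s = spos n xss i" by blast
    obtain P R where P: "?inp = P @ 4 # enc_nats (xss ! i) @ 4 # R" "length P = spos n xss i"
      by (rule instance_split[OF i(1)])
    have "symb ?inp s = 4" unfolding P(1) i(2) P(2)[symmetric] using symb_append[of P _ 0] by (simp add: symb_def)
    moreover have "symb ?inp (s + Suc (length (enc_nats (xss ! i)))) = 4"
      unfolding P(1) i(2) P(2)[symmetric] symb_append by (simp add: symb_def nth_append)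
    ultimately show "setpos (symb ?inp) s" unfolding setpos_def by (intro conjI exI[of _ "s + Suc (length (enc_nats (xss ! i)))"]) simp_all
  }
qed

lemma spos_Suc: "i < length xss \<Longrightarrow> spos n xss (Suc i) = spos n xss i + Suc (length (enc_nats (xss ! i)))"
  by (simp add: spos_def take_Suc_conv_app_nth)

lemma spos_less: "j \<le> length xss \<Longrightarrow> i < j \<Longrightarrow> spos n xss i < spos n xss j"
proof (induction j)
  case (Suc j)
  then show ?case using spos_Suc[of j xss n] by (cases "i = j") auto
qed simp

lemma spos_pos: "0 < spos n xss i"
  using bits_nonempty[of n] by (simp add: spos_def)

lemma inset_iff:
  assumes i: "i < length xss"
  shows "inset (symb (enc_instance n xss)) (spos n xss i) t \<longleftrightarrow>
    (\<exists>j<length (xss ! i). t = Suc (spos n xss i + length (enc_nats (take j (xss ! i)))))"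
proof -
  let ?f = "symb (enc_instance n xss)" and ?s = "spos n xss i" and ?E = "enc_nats (xss ! i)"
  obtain P R where P: "enc_instance n xss = P @ 4 # ?E @ 4 # R" "length P = ?s"
    by (rule instance_split[OF i])
  have f0: "?f ?s = 4" unfolding P(1) P(2)[symmetric] using symb_append[of P _ 0] by (simp add: symb_def)
  have f1: "?f (Suc (?s + p)) = ?E ! p" if "p < length ?E" for p
    unfolding P(1) P(2)[symmetric] using symb_append[of P _ "Suc p"] that by (simp add: symb_def nth_append)
  have f2: "?f (Suc (?s + length ?E)) = 4"
    unfolding P(1) P(2)[symmetric] using symb_append[of P _ "Suc (length ?E)"] by (simp add: symb_def nth_append)
  have E3: "?E ! p \<in> {1, 2, 3}" if "p < length ?E" for p using nth_mem[OF that] set_enc_nats[of "xss ! i"] by blast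
  have tp: "p = 0 \<or> ?E ! (p - 1) = 3 \<longleftrightarrow> (\<exists>j<length (xss ! i). p = length (enc_nats (take j (xss ! i))))"
    if "p < length ?E" for p
    unfolding enc_nats_def by (rule token_positions) (use set_bits that in \<open>fastforce simp: enc_nats_def\<close>)+
  have pre: "?f (Suc (?s + p) - 1) = 3 \<or> ?f (Suc (?s + p) - 1) = 4 \<longleftrightarrow> p = 0 \<or> ?E ! (p - 1) = 3" if "p < length ?E" for p
  proof (cases p)
    case 0
    then show ?thesis using f0 by simp
  next
    case (Suc q)
    then show ?thesis using f1[of q] E3[of q] that by auto
  qed
  show ?thesis
  proof
    assume h: "inset ?f ?s t"
    then obtain p where t: "t = Suc (?s + p)" unfolding inset_def using less_imp_Suc_add by blast
    have "p \<noteq> length ?E" using h f2 t unfolding inset_def by auto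
    moreover have "\<not> length ?E < p"
    proof
      assume "length ?E < p"
      then have "?s < Suc (?s + length ?E)" "Suc (?s + length ?E) < t" using t by auto
      then show False using h f2 unfolding inset_def by blast
    qed
    ultimately have p: "p < length ?E" by simp
    have "?f (t - 1) = 3 \<or> ?f (t - 1) = 4" using h unfolding inset_def by blast
    then have "p = 0 \<or> ?E ! (p - 1) = 3" using pre[OF p] t by blast
    then show "\<exists>j<length (xss ! i). t = Suc (?s + length (enc_nats (take j (xss ! i))))" using iffD1[OF tp[OF p]] unfolding t by simp
  next
    assume "\<exists>j<length (xss ! i). t = Suc (?s + length (enc_nats (take j (xss ! i))))"
    then obtain j where j: "j < length (xss ! i)" "t = Suc (?s + length (enc_nats (take j (xss ! i))))" by blast
    let ?p = "length (enc_nats (take j (xss ! i)))"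
    have e: "?E = enc_nats (take j (xss ! i)) @ bits (xss ! i ! j) @ 3 # enc_nats (drop (Suc j) (xss ! i))"
      using arg_cong[OF id_take_nth_drop[OF j(1)], of enc_nats] by (simp only: enc_nats_simps)
    have p: "?p < length ?E" unfolding e by simp
    have nth0: "(X @ ys @ zs) ! length X = ys ! 0" if "ys \<noteq> []" for X ys zs :: "nat list"
      using that by (simp add: nth_append)
    have "?E ! ?p = bits (xss ! i ! j) ! 0"
      unfolding e using nth0[OF bits_nonempty] .
    moreover have "bits (xss ! i ! j) ! 0 \<in> {1, 2}" using bits_nonempty[of "xss ! i ! j"] set_bits by (meson length_greater_0_conv nth_mem subsetD)
    ultimately have "?f t \<noteq> 3" "?f t \<noteq> 4" using f1[OF p] j(2) by auto
    moreover have "?p = 0 \<or> ?E ! (?p - 1) = 3" by (rule iffD2[OF tp[OF p]]) (use j(1) in blast)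
    then have "?f (t - 1) = 3 \<or> ?f (t - 1) = 4" unfolding j(2) by (rule iffD2[OF pre[OF p]])
    moreover have "\<not> (\<exists>z. ?s < z \<and> z < t \<and> ?f z = 4)"
    proof
      assume "\<exists>z. ?s < z \<and> z < t \<and> ?f z = 4"
      then obtain z where z: "?s < z" "z < t" "?f z = 4" by blast
      obtain q where q: "z = Suc (?s + q)" using z(1) less_imp_Suc_add by blast
      have "q < length ?E" using z(2) j(2) q p by simp
      then show False using f1[of q] E3[of q] z(3) q by auto
    qed
    ultimately show "inset ?f ?s t" unfolding inset_def using j(2) by auto
  qed
qed

lemma token_reads:
  assumes i: "i < length xss" and j: "j < length (xss ! i)"
  shows "reads (symb (enc_instance n xss)) (Suc (spos n xss i + length (enc_nats (take j (xss ! i))))) (bits (xss ! i ! j))"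
proof -
  obtain P R where P: "enc_instance n xss = P @ 4 # enc_nats (xss ! i) @ 4 # R" "length P = spos n xss i"
    by (rule instance_split[OF i])
  have "enc_nats (xss ! i) = enc_nats (take j (xss ! i)) @ bits (xss ! i ! j) @ 3 # enc_nats (drop (Suc j) (xss ! i))"
    using arg_cong[OF id_take_nth_drop[OF j], of enc_nats] by (simp only: enc_nats_simps)
  then have e: "enc_instance n xss = (P @ 4 # enc_nats (take j (xss ! i))) @ bits (xss ! i ! j) @ (3 # enc_nats (drop (Suc j) (xss ! i)) @ 4 # R)"
    (is "_ = ?P @ ?w @ ?R") unfolding P(1) by simp
  have l: "Suc (spos n xss i + length (enc_nats (take j (xss ! i)))) = length ?P" using P(2) by simp
  show ?thesis unfolding reads_def e l add.assoc symb_append using symb_prefix[of _ ?w ?R] symb_append[of ?w ?R 0]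
    by (simp add: symb_def)
qed

text \<open>Different codes cannot be read at the same position, so the least reading position is an
  injective name. It may lie inside a longer code that ends in the same digits, which does no harm.
  Names are smaller than the input length, whatever the values of the elements.\<close>

theorem instance_elements:
  fixes n xss
  defines "f \<equiv> symb (enc_instance n xss)"
  obtains cn where "inj_on cn (\<Union>(set ` set xss))" "\<And>v. v \<in> \<Union>(set ` set xss) \<Longrightarrow> cn v < length (enc_instance n xss)"
    "\<And>i. i < length xss \<Longrightarrow> Elt f (spos n xss i) = cn ` set (xss ! i)"
proof -
  define cn where "cn v = (LEAST x. reads f x (bits v))" for v
  have no3: "3 \<notin> set (bits v)" for v using set_bits[of v] by auto
  have rd: "\<exists>x. reads f x (bits v)" if v: "v \<in> \<Union>(set ` set xss)" for v
  proof -
    obtain xs where xs: "xs \<in> set xss" "v \<in> set xs" using v by blast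
    obtain i where "i < length xss" "xss ! i = xs" using xs(1) unfolding in_set_conv_nth by blast
    moreover obtain j where "j < length xs" "xs ! j = v" using xs(2) unfolding in_set_conv_nth by blast
    ultimately have "i < length xss" "j < length (xss ! i)" "xss ! i ! j = v" by simp_all
    then show ?thesis unfolding f_def using token_reads by blast
  qed
  have cn: "reads f (cn v) (bits v)" if "v \<in> \<Union>(set ` set xss)" for v
    unfolding cn_def using rd[OF that] by (rule LeastI_ex)
  have least: "reads f x (bits v) \<and> (\<forall>y<x. \<not> reads f y (bits v)) \<longleftrightarrow> x = cn v" if "v \<in> \<Union>(set ` set xss)" for v x
  proof
    assume "reads f x (bits v) \<and> (\<forall>y<x. \<not> reads f y (bits v))"
    then show "x = cn v" unfolding cn_def by (intro Least_equality[symmetric]) (auto simp: not_less[symmetric])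
  next
    assume x: "x = cn v"
    have "\<not> reads f y (bits v)" if "y < x" for y using that unfolding x cn_def by (rule not_less_Least)
    then show "reads f x (bits v) \<and> (\<forall>y<x. \<not> reads f y (bits v))" using cn[OF that] x by blast
  qed
  show thesis
  proof (rule that)
    show "inj_on cn (\<Union>(set ` set xss))"
    proof (rule inj_onI)
      fix v v' assume v: "v \<in> \<Union>(set ` set xss)" "v' \<in> \<Union>(set ` set xss)" "cn v = cn v'"
      have "bits v = bits v'" using reads_inject[OF cn[OF v(1)] _ no3 no3] cn[OF v(2)] v(3) by simp
      then show "v = v'" by (rule bits_inject)
    qed
    show "cn v < length (enc_instance n xss)" if "v \<in> \<Union>(set ` set xss)" for v
    proof -
      have "f (cn v + length (bits v)) \<noteq> 0" using cn[OF that] unfolding reads_def by simp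
      then show ?thesis unfolding f_def by (simp add: symb_def split: if_splits)
    qed
    fix i assume i: "i < length xss"
    have vi: "xss ! i ! j \<in> \<Union>(set ` set xss)" if "j < length (xss ! i)" for j
      by (rule UnionI, rule imageI, rule nth_mem[OF i], rule nth_mem[OF that])
    have "x \<in> Elt f (spos n xss i) \<longleftrightarrow> (\<exists>j<length (xss ! i). x = cn (xss ! i ! j))" for x
    proof -
      let ?t = "\<lambda>j. Suc (spos n xss i + length (enc_nats (take j (xss ! i))))"
      have ex_pos: "(\<exists>t. (\<exists>j<n. t = h j) \<and> Q t) \<longleftrightarrow> (\<exists>j<n. Q (h j))" for n :: nat and h :: "nat \<Rightarrow> nat" and Q by auto
      have sp: "setpos f (spos n xss i)" unfolding f_def setpos_iff using i by blast
      have "x \<in> Elt f (spos n xss i) \<longleftrightarrow> (\<exists>j<length (xss ! i). same f x (?t j) \<and> (\<forall>y<x. \<not> same f y (?t j)))"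
        unfolding Elt_def mem_Collect_eq inset_iff[OF i, of n, folded f_def] ex_pos using sp by (simp only: simp_thms)
      also have "\<dots> \<longleftrightarrow> (\<exists>j<length (xss ! i). x = cn (xss ! i ! j))"
      proof -
        have "same f x (?t j) \<and> (\<forall>y<x. \<not> same f y (?t j)) \<longleftrightarrow> x = cn (xss ! i ! j)" if "j < length (xss ! i)" for j
          unfolding reads_same[OF token_reads[OF i that, of n, folded f_def] no3] using vi[OF that] by (rule least)
        then show ?thesis by (intro ex_cong1 conj_cong refl)
      qed
      finally show ?thesis .
    qed
    then show "Elt f (spos n xss i) = cn ` set (xss ! i)" unfolding set_conv_nth by blast
  qed
qed

lemma set_enc_instance: "set (enc_instance n xss) \<subseteq> {1..4}"
proof -
  have "set (bits n) \<subseteq> {1..4}" "set (enc_nats xs) \<subseteq> {1..4}" for xs using set_bits[of n] set_enc_nats[of xs] by auto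
  then show ?thesis unfolding enc_instance_blocks by auto
qed

lemma length_enc_nats: "set xs \<subseteq> {..<n} \<Longrightarrow> length (enc_nats xs) \<le> length xs * (n + 1)"
proof (induction xs)
  case (Cons x xs)
  then show ?case using length_bits[of x] by auto
qed simp

lemma length_enc_instance:
  assumes "valid_instance k n xss"
  shows "length (enc_instance n xss) \<le> (n + 2) + length xss * (k * (n + 1) + 1)"
proof -
  have "length (concat (map (\<lambda>xs. 4 # enc_nats xs) yss)) \<le> length yss * (k * (n + 1) + 1)" if "set yss \<subseteq> set xss" for yss
    using that
  proof (induction yss)
    case (Cons y yss)
    have "length (enc_nats y) \<le> length y * (n + 1)" using Cons.prems assms by (intro length_enc_nats) (auto simp: valid_instance_def)
    also have "\<dots> \<le> k * (n + 1)" using Cons.prems assms by (intro mult_le_mono1) (auto simp: valid_instance_def)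
    finally show ?case using Cons by simp
  qed simp
  from this[of xss] show ?thesis unfolding enc_instance_blocks using length_bits[of n] by simp
qed

section \<open>The search as a query program\<close>

abbreviation "rIn \<equiv> 7 :: nat"
abbreviation "rSame \<equiv> 8 :: nat"
abbreviation "rSet \<equiv> 9 :: nat"
abbreviation "rEl \<equiv> 10 :: nat"
abbreviation "rCol \<equiv> 13 :: nat"
abbreviation "rR \<equiv> 14 :: nat"
abbreviation "rT \<equiv> 15 :: nat"
abbreviation "rS \<equiv> 16 :: nat"
abbreviation "rF \<equiv> 17 :: nat"
abbreviation "rFX \<equiv> 18 :: nat"
abbreviation "rOA \<equiv> 19 :: nat"
abbreviation "rOB \<equiv> 20 :: nat"
abbreviation "rLen \<equiv> 21 :: nat"
abbreviation "rIdx \<equiv> 22 :: nat"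
abbreviation "rCand \<equiv> 23 :: nat"
abbreviation "rFne \<equiv> 24 :: nat"
abbreviation "rCnd \<equiv> 26 :: nat"
abbreviation "rA0 \<equiv> 27 :: nat"
abbreviation "rA1 \<equiv> 28 :: nat"

text \<open>Only number 14, the relation of reachable search states, has an arity that depends on
  \<open>w\<close>. Since \<open>w\<close> is fixed by k and \<epsilon>, the N ^ (w + 2) states are
  polynomially many.\<close>

definition arr :: "nat \<Rightarrow> nat \<Rightarrow> nat" where
  "arr w r = (if r \<in> {0, 1, 2, 9, 16, 17, 18, 19, 20, 21, 22, 24} then 1 else if r \<in> {3, 4, 5, 23} then 3
     else if r = 11 then 4 else if r = 14 then w + 2 else if r \<in> {15, 26, 27, 28} then 0 else 2)"

lemma arithD:
  assumes "arith N I"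
  shows "x < N \<Longrightarrow> y < N \<Longrightarrow> z < N \<Longrightarrow> I RAdd [x, y, z] \<longleftrightarrow> x + y = z"
    "x < N \<Longrightarrow> y < N \<Longrightarrow> z < N \<Longrightarrow> I RMul [x, y, z] \<longleftrightarrow> x * y = z"
    "x < N \<Longrightarrow> y < N \<Longrightarrow> I RBit [x, y] \<longleftrightarrow> y \<in> set_decode x"
    "x < N \<Longrightarrow> y < N \<Longrightarrow> I RPow [x, y] \<longleftrightarrow> 2 ^ x = y"
proof -
  note a = assms[unfolded arith_def]
  show "I RAdd [x, y, z] \<longleftrightarrow> x + y = z" if "x < N" "y < N" "z < N"
    using conjunct1[OF a, rule_format, OF that] by (rule conjunct1)
  show "I RMul [x, y, z] \<longleftrightarrow> x * y = z" if "x < N" "y < N" "z < N"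
    using conjunct2[OF conjunct1[OF a, rule_format, OF that]] by (rule conjunct1)
  show "I RBit [x, y] \<longleftrightarrow> y \<in> set_decode x" if "x < N" "y < N"
    by (rule conjunct1[OF conjunct2[OF conjunct2[OF a]], rule_format, OF that])
  show "I RPow [x, y] \<longleftrightarrow> 2 ^ x = y" if "x < N" "y < N"
    by (rule conjunct2[OF conjunct2[OF conjunct2[OF a]], rule_format, OF that])
qed

lemma arith_cong: "(\<And>r. r \<in> {3, 4, 5, 11, 12, 25} \<Longrightarrow> J r = I r) \<Longrightarrow> arith N I \<Longrightarrow> arith N J"
proof -
  assume J: "\<And>r. r \<in> {3, 4, 5, 11, 12, 25} \<Longrightarrow> J r = I r" and A: "arith N I"
  have e: "J RAdd = I RAdd" "J RMul = I RMul" "J RExp = I RExp" "J RDig = I RDig" "J RBit = I RBit" "J RPow = I RPow"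
    by (rule J, simp add: rel_defs)+
  show "arith N J" using A unfolding arith_def e .
qed

definition DM :: "nat \<Rightarrow> nat \<Rightarrow> nat \<Rightarrow> nat \<Rightarrow> nat \<Rightarrow> fm" where
  "DM h d r n v = Ex v (Con (FRel RMul [h, d, v]) (FRel RAdd [v, r, n]))"

lemma eval_DM:
  assumes "arith N I" "e h < N" "e d < N" "e r < N" "e n < N" "v \<noteq> h" "v \<noteq> d" "v \<noteq> r" "v \<noteq> n"
  shows "eval N I e (DM h d r n v) \<longleftrightarrow> e h * e d + e r = e n"
proof -
  have "eval N I e (DM h d r n v) \<longleftrightarrow> (\<exists>x<N. e h * e d = x \<and> x + e r = e n)"
    unfolding DM_def using assms by (simp add: arithD cong: conj_cong)
  also have "\<dots> \<longleftrightarrow> e h * e d + e r = e n"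
  proof
    assume h: "e h * e d + e r = e n"
    then have "e h * e d < N" using assms(5) by linarith
    then show "\<exists>x<N. e h * e d = x \<and> x + e r = e n" using h by blast
  qed blast
  finally show ?thesis .
qed

text \<open>Variables 2 to 5 hold the parameters W, b, Q, A; variables 20, 21, 22 hold the element,
  the level and the candidate. The mask K is variable 6 and enters only in \<open>phi_col\<close>,
  the offset G is variable 7.\<close>

definition phi_cand :: fm where
  "phi_cand = Ex 23 (Ex 24 (Ex 25 (Con (FRel RMul [3, 20, 23]) (Con (DM 24 2 25 23 26) (Con (FLt 25 2)
    (Ex 26 (Ex 27 (Ex 28 (Con (FRel RMul [25, 4, 26]) (Con (DM 27 2 28 26 29) (Con (FLt 28 2)
    (Ex 29 (Ex 30 (Ex 31 (Ex 32 (Con (FRel RDig [5, 4, 21, 29]) (Con (FRel RMul [29, 27, 30])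
      (Con (DM 31 4 32 30 33) (Con (FLt 32 4)
    (Ex 33 (Ex 34 (Ex 35 (Ex 36 (Con (FRel RPow [21, 33]) (Con (FRel RMul [32, 33, 34])
      (Con (DM 35 4 36 34 37) (Con (FLt 36 4) (FRel RAdd [33, 35, 22]))))))))))))))))))))))))))))"

definition phi_col :: fm where
  "phi_col = Ex 22 (Con (FRel rCand [20, 22, 21]) (Con (FRel RBit [6, 21])
    (FAll 23 (FAll 24 (Imp (Con (FLt 22 23) (FRel rCand [20, 23, 24])) (Neg (FRel RBit [6, 24])))))))"

definition p_col :: prog where
  "p_col = Assign rCand 20 3 phi_cand ;;; Assign rCol 20 2 phi_col"

lemma eval_cand:
  assumes "arith N I" "e 2 < N" "e 3 < N" "e 4 < N" "e 5 < N" "e 20 < N" "e 21 < N" "e 22 < N"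
  shows "eval N I e phi_cand \<longleftrightarrow> cand N (\<lambda>A q u a. I RDig [A, q, u, a]) (e 2) (e 3) (e 4) (e 5) (e 20) (e 21) (e 22)"
  unfolding phi_cand_def cand_def using assms by (simp add: arithD[OF assms(1)] eval_DM cong: conj_cong)

lemma run_col:
  assumes A: "arith N I" and e: "e 2 < N" "e 3 < N" "e 4 < N" "e 5 < N" "e 6 < N" and xi: "x < N" "i < N"
  shows "run N e p_col I rCol [x, i] \<longleftrightarrow> hcol N (\<lambda>A q u a. I RDig [A, q, u, a]) (e 2) (e 3) (e 4) (e 5) (e 6) x i"
proof -
  define J where "J = run N e (Assign rCand 20 3 phi_cand) I"
  have c: "J rCand [x, t, c] \<longleftrightarrow> cand N (\<lambda>A q u a. I RDig [A, q, u, a]) (e 2) (e 3) (e 4) (e 5) x t c"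
    if "x < N" "t < N" "c < N" for x t c
    unfolding J_def using that A e by (simp add: upd_Cons eval_cand)
  have "J RBit = I RBit" by (simp add: J_def rel_defs)
  then have b: "J RBit [x, y] \<longleftrightarrow> y \<in> set_decode x" if "x < N" "y < N" for x y using arithD(3)[OF A] that by simp
  have "run N e p_col I rCol [x, i] \<longleftrightarrow> eval N J (upd e 20 [x, i]) phi_col"
    unfolding p_col_def using xi by (simp add: J_def)
  also have "\<dots> \<longleftrightarrow> hcol N (\<lambda>A q u a. I RDig [A, q, u, a]) (e 2) (e 3) (e 4) (e 5) (e 6) x i"
    unfolding phi_col_def hcol_def using xi e by (simp add: upd_Cons b c cong: conj_cong imp_cong)
  finally show ?thesis .
qed

text \<open>A state is held in consecutive variables: the \<open>w\<close> slots from 20 on, the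
  colour set in 20 + w and the gain in 21 + w.\<close>

definition vars :: "nat \<Rightarrow> nat list" where
  "vars w = [20..<22 + w]"

lemma map_vars: "length xs = w + 2 \<Longrightarrow> (\<And>i. i < w + 2 \<Longrightarrow> E (20 + i) = xs ! i) \<Longrightarrow> map E (vars w) = xs"
  by (rule nth_equalityI) (simp_all add: vars_def)

definition phi_ini :: "nat \<Rightarrow> fm" where
  "phi_ini w = Con (conjs (22 + w) (map (\<lambda>i. Zero (22 + w) (20 + i)) [0..<Suc w])) (FEq (21 + w) 7)"

lemma eval_ini:
  assumes E: "\<And>i. i < w + 2 \<Longrightarrow> E (20 + i) = xs ! i" and N: "0 < N"
  shows "eval N I E (phi_ini w) \<longleftrightarrow> ini w (E 7) xs"
proof -
  have z: "eval N I E (Zero (22 + w) (20 + i)) \<longleftrightarrow> xs ! i = 0" if "i < Suc w" for i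
    using eval_Zero[OF N, of "22 + w" "20 + i" I E] E[of i] that by simp
  have l: "E (21 + w) = xs ! Suc w" using E[of "Suc w"] by simp
  show ?thesis unfolding phi_ini_def ini_def eval.simps eval_conjs eval_macros l set_map set_upt
    using z by auto
qed

definition phi_fits :: "nat \<Rightarrow> fm" where
  "phi_fits w = Con (FAll (25 + w) (Imp (Con (FRel rS [25 + w]) (Ex (26 + w) (Con (FRel rEl [25 + w, 26 + w]) (FRel rEl [22 + w, 26 + w]))))
       (disjs (26 + w) (map (\<lambda>i. FEq (20 + i) (25 + w)) [0..<w]))))
    (Con (Ex (25 + w) (FRel rEl [22 + w, 25 + w]))
    (Con (FAll (25 + w) (Imp (FRel rEl [22 + w, 25 + w]) (Ex (26 + w) (FRel rCol [25 + w, 26 + w]))))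
    (Con (FAll (25 + w) (Con
        (Imp (FRel RBit [20 + w, 25 + w]) (Or (FRel RBit [23 + w, 25 + w]) (Ex (26 + w) (Con (FRel rEl [22 + w, 26 + w]) (FRel rCol [26 + w, 25 + w])))))
        (Imp (Or (FRel RBit [23 + w, 25 + w]) (Ex (26 + w) (Con (FRel rEl [22 + w, 26 + w]) (FRel rCol [26 + w, 25 + w])))) (FRel RBit [20 + w, 25 + w]))))
    (Neg (Ex (25 + w) (Con (FRel RBit [23 + w, 25 + w]) (Ex (26 + w) (Con (FRel rEl [22 + w, 26 + w]) (FRel rCol [26 + w, 25 + w])))))))))"

lemma eval_fits:
  assumes A: "arith N I" and S: "\<And>s. s < N \<Longrightarrow> I rS [s] \<longleftrightarrow> s \<in> S"
    and El: "\<And>s z. s < N \<Longrightarrow> z < N \<Longrightarrow> I rEl [s, z] \<longleftrightarrow> z \<in> El s"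
    and Col: "\<And>z i. z < N \<Longrightarrow> i < N \<Longrightarrow> I rCol [z, i] \<longleftrightarrow> Col z i"
    and E: "\<And>i. i < w + 2 \<Longrightarrow> E (20 + i) = xs ! i" "xs ! w < N" "E (22 + w) = x" "E (23 + w) = c" "x < N" "c < N"
  shows "eval N I E (phi_fits w) \<longleftrightarrow> fits N w S El Col xs c x"
proof -
  have d: "eval N I (E(25 + w := s)) (disjs (26 + w) (map (\<lambda>i. FEq (20 + i) (25 + w)) [0..<w])) \<longleftrightarrow> (\<exists>i<w. xs ! i = s)" for s
  proof -
    have "eval N I (E(25 + w := s)) (FEq (20 + i) (25 + w)) \<longleftrightarrow> xs ! i = s" if "i < w" for i
      using E(1)[of i] that by simp
    then show ?thesis unfolding eval_disjs set_map set_upt by auto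
  qed
  have w: "E (20 + w) = xs ! w" using E(1)[of w] by simp
  show ?thesis unfolding phi_fits_def fits_def eval.simps eval_macros d iff_conv_conj_imp[symmetric]
  proof (intro arg_cong2[where f = "(\<and>)"], goal_cases)
    case 1
    show ?case using S El E(4-) E(3) by (simp cong: conj_cong imp_cong)
  next
    case 2
    show ?case using El E(3,5) by (simp cong: conj_cong)
  next
    case 3
    show ?case using El Col E(3,5) by (simp cong: conj_cong imp_cong)
  next
    case 4
    show ?case using El Col E(2-) w by (simp add: arithD(3)[OF A] cong: conj_cong imp_cong)
  next
    case 5
    show ?case using El Col E(2-) by (simp add: arithD(3)[OF A] cong: conj_cong)
  qed
qed

definition phi_pay :: "nat \<Rightarrow> nat \<Rightarrow> fm" where
  "phi_pay w i = Ex (22 + w) (Ex (23 + w) (Con (FRel rS [20 + i]) (Con (Succ (24 + w) (21 + w) (23 + w))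
     (FRel rR ((vars w)[i := 22 + w, Suc w := 23 + w])))))"

definition phi_stp :: "nat \<Rightarrow> fm" where
  "phi_stp w = Or (FRel rR (vars w)) (Or (disjs (22 + w) (map (phi_pay w) [0..<w]))
    (Ex (22 + w) (Ex (23 + w) (Ex (24 + w) (Con (FRel rFX [22 + w]) (Con (Succ (25 + w) (24 + w) (21 + w))
      (Con (FRel rR ((vars w)[w := 23 + w, Suc w := 24 + w])) (phi_fits w))))))))"

lemma eval_stp:
  assumes A: "arith N I" and S: "\<And>s. s < N \<Longrightarrow> I rS [s] \<longleftrightarrow> s \<in> S" and F: "\<And>s. s < N \<Longrightarrow> I rFX [s] \<longleftrightarrow> s \<in> F"
    and El: "\<And>s z. s < N \<Longrightarrow> z < N \<Longrightarrow> I rEl [s, z] \<longleftrightarrow> z \<in> El s"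
    and Col: "\<And>z i. z < N \<Longrightarrow> i < N \<Longrightarrow> I rCol [z, i] \<longleftrightarrow> Col z i"
    and xs: "length xs = w + 2" "\<And>i. i < w + 2 \<Longrightarrow> xs ! i < N" and E: "\<And>i. i < w + 2 \<Longrightarrow> E (20 + i) = xs ! i"
  shows "eval N I E (phi_stp w) \<longleftrightarrow> stp N w S F El Col (I rR) xs"
proof -
  have mv: "map E' (vars w) = xs" if "\<And>i. i < w + 2 \<Longrightarrow> E' (20 + i) = E (20 + i)" for E'
    by (rule map_vars) (use xs that E in simp_all)
  have l: "E (21 + w) = xs ! Suc w" using E[of "Suc w"] by simp
  have p: "eval N I E (phi_pay w i) \<longleftrightarrow> (\<exists>y<N. \<exists>g<N. xs ! i \<in> S \<and> g = Suc (xs ! Suc w) \<and> I rR (xs[i := y, Suc w := g]))" if i: "i < w" for i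
  proof -
    have m: "map (E(22 + w := y, 23 + w := g)) (vars w) = xs" for y g by (rule mv) simp
    have "E (20 + i) = xs ! i" "xs ! i < N" using E xs i by simp_all
    then show ?thesis unfolding phi_pay_def using i l S by (simp add: map_update m cong: conj_cong)
  qed
  have m: "map (E(22 + w := x, 23 + w := c, 24 + w := g)) (vars w) = xs" for x c g by (rule mv) simp
  have ft: "eval N I (E(22 + w := x, 23 + w := c, 24 + w := g)) (phi_fits w) \<longleftrightarrow> fits N w S El Col xs c x" if "x < N" "c < N" for x c g
    by (rule eval_fits[OF A S El Col]) (use E xs(2) that in simp_all)
  have a: "eval N I E (Ex (22 + w) (Ex (23 + w) (Ex (24 + w) (Con (FRel rFX [22 + w]) (Con (Succ (25 + w) (24 + w) (21 + w))
      (Con (FRel rR ((vars w)[w := 23 + w, Suc w := 24 + w])) (phi_fits w))))))) \<longleftrightarrow>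
    (\<exists>x<N. \<exists>c<N. \<exists>g<N. x \<in> F \<and> xs ! Suc w = Suc g \<and> I rR (xs[w := c, Suc w := g]) \<and> fits N w S El Col xs c x)"
    using l F xs(2)[of "Suc w"] ft by (simp add: map_update m cong: conj_cong)
  have d: "eval N I E (disjs (22 + w) (map (phi_pay w) [0..<w])) \<longleftrightarrow>
     (\<exists>i<w. \<exists>y<N. \<exists>g<N. xs ! i \<in> S \<and> g = Suc (xs ! Suc w) \<and> I rR (xs[i := y, Suc w := g]))"
    unfolding eval_disjs set_map set_upt using p by auto
  have r: "eval N I E (FRel rR (vars w)) \<longleftrightarrow> I rR xs" using mv[of E] by simp
  show ?thesis unfolding phi_stp_def eval_macros(1) a d r stp_def ..
qed

text \<open>The program represents the reached set only on states with entries below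
  \<open>N\<close>; a move from such a state inspects no others.\<close>

lemma stp_cong_imp:
  assumes "\<And>ys. ys \<in> states N w \<Longrightarrow> R ys \<Longrightarrow> R' ys" "xs \<in> states N w" "stp N w S F El Col R xs"
  shows "stp N w S F El Col R' xs"
proof -
  have up: "xs[i := y, j := g] \<in> states N w" if "y < N" "g < N" for i j y g
    using assms(2) that set_update_subset_insert[of xs i y] set_update_subset_insert[of "xs[i := y]" j g]
    by (auto simp: states_def)
  show ?thesis using assms(3)
  proof (cases rule: stpE)
    case self
    then show ?thesis by (intro stp_self assms(1)[OF assms(2)])
  next
    case (pay i y g)
    show ?thesis by (rule stp_payI[OF pay(1-5)]) (intro assms(1) up pay)
  next
    case (add x c g)
    show ?thesis by (rule stp_addI[OF add(1-5) _ add(7)]) (intro assms(1) up add)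
  qed
qed

text \<open>A run succeeds if the gain is one above the offset in variable 7. The result is joined
  to the old value of \<open>rT\<close>, so that the surrounding loops form a disjunction.\<close>

definition p_reach :: "nat \<Rightarrow> prog" where
  "p_reach w = Assign rR 20 (w + 2) (phi_ini w) ;;; PFor 8 (Assign rR 20 (w + 2) (phi_stp w)) ;;;
     Assign rT 20 0 (Or (FRel rT []) (exs 20 (w + 2) (Con (FRel rR (vars w)) (Succ (22 + w) 7 (21 + w)))))"

lemma upd_nth: "i < length xs \<Longrightarrow> upd e v xs (v + i) = xs ! i"
  by (simp add: upd_def)

lemma upd_below: "u < v \<Longrightarrow> upd e v xs u = e u"
  by (simp add: upd_def)

lemma run_reach:
  assumes A: "arith N I" and S: "\<And>s. s < N \<Longrightarrow> I rS [s] \<longleftrightarrow> s \<in> S" and F: "\<And>s. s < N \<Longrightarrow> I rFX [s] \<longleftrightarrow> s \<in> F"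
    and El: "\<And>s z. s < N \<Longrightarrow> z < N \<Longrightarrow> I rEl [s, z] \<longleftrightarrow> z \<in> El s"
    and Col: "\<And>z i. z < N \<Longrightarrow> i < N \<Longrightarrow> I rCol [z, i] \<longleftrightarrow> Col z i" and N: "0 < N"
  shows "run N e (p_reach w) I rT [] \<longleftrightarrow> I rT [] \<or> (\<exists>xs\<in>states N w. (stp N w S F El Col ^^ N) (ini w (e 7)) xs \<and> xs ! Suc w = Suc (e 7))"
proof -
  have st: "tup N (w + 2) = states N w" by (simp add: tup_def states_def)
  define J where "J = run N e (Assign rR 20 (w + 2) (phi_ini w)) I"
  define K where "K = run N e (PFor 8 (Assign rR 20 (w + 2) (phi_stp w))) J"
  have len: "length xs = w + 2" "\<And>i. i < w + 2 \<Longrightarrow> xs ! i < N" if xs: "xs \<in> states N w" for xs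
  proof -
    show l: "length xs = w + 2" using xs by (simp add: states_def)
    fix i assume "i < w + 2"
    then have "xs ! i \<in> set xs" using l by simp
    then show "xs ! i < N" using xs by (auto simp: states_def)
  qed
  let ?P = "\<lambda>j K. (\<forall>r. r \<noteq> rR \<longrightarrow> K r = I r) \<and> (\<forall>xs\<in>states N w. K rR xs \<longleftrightarrow> (stp N w S F El Col ^^ j) (ini w (e 7)) xs)"
  have "?P N K" unfolding K_def
  proof (rule run_For_inv[where P = ?P])
    show "?P 0 J"
    proof (intro conjI allI impI ballI)
      show "J r = I r" if "r \<noteq> rR" for r using that by (simp add: J_def)
      fix xs assume xs: "xs \<in> states N w"
      have "J rR xs \<longleftrightarrow> eval N I (upd e 20 xs) (phi_ini w)" unfolding J_def using xs st by simp
      also have "\<dots> \<longleftrightarrow> ini w (upd e 20 xs 7) xs"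
        by (rule eval_ini[OF _ N]) (simp only: upd_nth len(1)[OF xs])
      finally show "J rR xs = (stp N w S F El Col ^^ 0) (ini w (e 7)) xs" by (simp add: upd_below)
    qed
  next
    fix j M assume M: "?P j M"
    let ?M = "run N (e(8 := j)) (Assign rR 20 (w + 2) (phi_stp w)) M"
    have fr: "M r = I r" if "r \<noteq> rR" for r using M that by blast
    have AM: "arith N M" by (rule arith_cong[OF _ A]) (rule fr, auto)
    show "?P (Suc j) ?M"
    proof (intro conjI allI impI ballI)
      show "?M r = I r" if "r \<noteq> rR" for r using that fr by simp
      fix xs assume xs: "xs \<in> states N w"
      have "?M rR xs \<longleftrightarrow> eval N M (upd (e(8 := j)) 20 xs) (phi_stp w)" using xs st by simp
      also have "\<dots> \<longleftrightarrow> stp N w S F El Col (M rR) xs"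
        by (rule eval_stp[OF AM]) (use S F El Col fr len[OF xs] upd_nth[of _ xs] in simp_all)
      also have "\<dots> \<longleftrightarrow> stp N w S F El Col ((stp N w S F El Col ^^ j) (ini w (e 7))) xs"
        using stp_cong_imp[of N w "M rR" "(stp N w S F El Col ^^ j) (ini w (e 7))", OF _ xs]
          stp_cong_imp[of N w "(stp N w S F El Col ^^ j) (ini w (e 7))" "M rR", OF _ xs] M by blast
      finally show "?M rR xs = (stp N w S F El Col ^^ Suc j) (ini w (e 7)) xs" unfolding funpow.simps comp_apply .
    qed
  qed
  then have K: "K rT = I rT" "\<And>xs. xs \<in> states N w \<Longrightarrow> K rR xs \<longleftrightarrow> (stp N w S F El Col ^^ N) (ini w (e 7)) xs" by simp_all
  have f: "eval N K (upd e 20 xs) (Con (FRel rR (vars w)) (Succ (22 + w) 7 (21 + w))) \<longleftrightarrow>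
      (stp N w S F El Col ^^ N) (ini w (e 7)) xs \<and> xs ! Suc w = Suc (e 7)" if xs: "xs \<in> states N w" for xs
  proof -
    have m: "map (upd e 20 xs) (vars w) = xs" by (rule map_vars) (use len[OF xs] upd_nth[of _ xs e 20] in simp_all)
    have u: "upd e 20 xs (21 + w) = xs ! Suc w" using upd_nth[of "Suc w" xs e 20] len(1)[OF xs] by simp
    have "upd e 20 xs (21 + w) < N" unfolding u using len(2)[OF xs] by simp
    then have "eval N K (upd e 20 xs) (Succ (22 + w) 7 (21 + w)) \<longleftrightarrow> upd e 20 xs (21 + w) = Suc (upd e 20 xs 7)"
      by (rule eval_Succ) simp_all
    then show ?thesis using K(2)[OF xs] m u by (simp add: upd_below)
  qed
  have "run N e (p_reach w) I rT [] \<longleftrightarrow> eval N K e (Or (FRel rT []) (exs 20 (w + 2) (Con (FRel rR (vars w)) (Succ (22 + w) 7 (21 + w)))))"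
    unfolding p_reach_def K_def J_def by simp
  also have "\<dots> \<longleftrightarrow> I rT [] \<or> (\<exists>xs\<in>states N w. (stp N w S F El Col ^^ N) (ini w (e 7)) xs \<and> xs ! Suc w = Suc (e 7))"
    unfolding eval_macros(1) eval_exs st using f K(1) by simp
  finally show ?thesis .
qed

lemma run_For_or:
  assumes wr: "writes p \<subseteq> W" and step: "\<And>x J. x < N \<Longrightarrow> (\<And>r. r \<notin> W \<Longrightarrow> J r = I r) \<Longrightarrow> run N (e(v := x)) p J t [] \<longleftrightarrow> J t [] \<or> \<Phi> x"
    and J: "\<And>r. r \<notin> W \<Longrightarrow> J r = I r"
  shows "run N e (PFor v p) J t [] \<longleftrightarrow> J t [] \<or> (\<exists>x<N. \<Phi> x)"
proof -
  let ?P = "\<lambda>x K. (\<forall>r. r \<notin> W \<longrightarrow> K r = I r) \<and> (K t [] \<longleftrightarrow> J t [] \<or> (\<exists>y<x. \<Phi> y))"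
  have "?P N (run N e (PFor v p) J)"
  proof (rule run_For_inv[where P = ?P])
    show "?P 0 J" using J by simp
  next
    fix x K assume x: "x < N" and K: "?P x K"
    have "run N (e(v := x)) p K r = I r" if "r \<notin> W" for r using run_frame[of r p N "e(v := x)" K] wr that K by auto
    moreover have "run N (e(v := x)) p K t [] \<longleftrightarrow> K t [] \<or> \<Phi> x" by (rule step[OF x]) (use K in blast)
    ultimately show "?P (Suc x) (run N (e(v := x)) p K)" using K by (auto simp: less_Suc_eq)
  qed
  then show ?thesis by blast
qed

text \<open>The parameters are loop variables rather than quantified ones, because the relations for
  colours and reachable states have to be recomputed for every choice, and formulas contain no
  assignments.\<close>

definition p_test :: "nat \<Rightarrow> prog" where
  "p_test w = Assign rT 20 0 (FFalse 20) ;;;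
     PFor 2 (PFor 3 (PFor 4 (PFor 5 (PFor 6 (PFor 7 (p_col ;;; p_reach w))))))"

lemma writes_test: "writes (p_test w) = {rT, rCand, rCol, rR}"
  by (auto simp: p_test_def p_col_def p_reach_def)

lemma run_test:
  assumes A: "arith N I" and S: "\<And>s. s < N \<Longrightarrow> I rS [s] \<longleftrightarrow> s \<in> S" and F: "\<And>s. s < N \<Longrightarrow> I rFX [s] \<longleftrightarrow> s \<in> F"
    and El: "\<And>s z. s < N \<Longrightarrow> z < N \<Longrightarrow> I rEl [s, z] \<longleftrightarrow> z \<in> El s" and N: "0 < N"
  shows "run N e (p_test w) I rT [] \<longleftrightarrow> tst N (\<lambda>A q u a. I RDig [A, q, u, a]) w El S F"
proof -
  let ?D = "\<lambda>A q u a. I RDig [A, q, u, a]"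
  define W where "W = {rT, rCand, rCol, rR}"
  define b where "b = p_col ;;; p_reach w"
  let ?\<Phi> = "\<lambda>W b Q A K G. \<exists>xs\<in>states N w. (stp N w S F El (hcol N ?D W b Q A K) ^^ N) (ini w G) xs \<and> xs ! Suc w = Suc G"
  have wb: "writes b \<subseteq> W" by (simp add: b_def W_def p_col_def p_reach_def)
  have h7: "run N e b J rT [] \<longleftrightarrow> J rT [] \<or> ?\<Phi> (e 2) (e 3) (e 4) (e 5) (e 6) (e 7)"
    if e: "e 2 < N" "e 3 < N" "e 4 < N" "e 5 < N" "e 6 < N" and J: "\<And>r. r \<notin> W \<Longrightarrow> J r = I r" for e J
  proof -
    have J': "J r = I r" if "r \<in> {3, 4, 5, 11, 12, 25, rS, rFX, rEl}" for r by (rule J) (use that in \<open>auto simp: W_def\<close>)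
    have AJ: "arith N J" by (rule arith_cong[OF _ A]) (rule J', auto)
    define K where "K = run N e p_col J"
    have K: "K r = J r" if "r \<notin> {rCand, rCol}" for r unfolding K_def by (rule run_frame) (use that in \<open>simp add: p_col_def\<close>)
    have AK: "arith N K" by (rule arith_cong[OF _ AJ]) (rule K, auto)
    have D: "J RDig = I RDig" using J'[of 11] by (simp add: rel_defs)
    have Kc: "K rCol [z, i] \<longleftrightarrow> hcol N ?D (e 2) (e 3) (e 4) (e 5) (e 6) z i" if "z < N" "i < N" for z i
      unfolding K_def using run_col[OF AJ e that] D by simp
    have KI: "K rS = I rS" "K rFX = I rFX" "K rEl = I rEl" using K J' by simp_all
    have "run N e b J rT [] \<longleftrightarrow> run N e (p_reach w) K rT []" by (simp add: b_def K_def)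
    also have "\<dots> \<longleftrightarrow> K rT [] \<or> ?\<Phi> (e 2) (e 3) (e 4) (e 5) (e 6) (e 7)"
      by (rule run_reach[OF AK _ _ _ Kc N]) (simp_all only: KI S F El)
    also have "K rT = J rT" by (rule K) simp
    finally show ?thesis .
  qed
  have h6: "run N e (PFor 7 b) J rT [] \<longleftrightarrow> J rT [] \<or> (\<exists>G<N. ?\<Phi> (e 2) (e 3) (e 4) (e 5) (e 6) G)"
    if e: "e 2 < N" "e 3 < N" "e 4 < N" "e 5 < N" "e 6 < N" and J: "\<And>r. r \<notin> W \<Longrightarrow> J r = I r" for e J
  proof (rule run_For_or[OF _ _ J])
    fix x J assume x: "x < N" "\<And>r. r \<notin> W \<Longrightarrow> J r = I r"
    show "run N (e(7 := x)) b J rT [] \<longleftrightarrow> J rT [] \<or> ?\<Phi> (e 2) (e 3) (e 4) (e 5) (e 6) x"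
      using h7[of "e(7 := x)" J] e x by simp
  qed (use wb in simp_all)
  have h5: "run N e (PFor 6 (PFor 7 b)) J rT [] \<longleftrightarrow> J rT [] \<or> (\<exists>K<N. \<exists>G<N. ?\<Phi> (e 2) (e 3) (e 4) (e 5) K G)"
    if e: "e 2 < N" "e 3 < N" "e 4 < N" "e 5 < N" and J: "\<And>r. r \<notin> W \<Longrightarrow> J r = I r" for e J
  proof (rule run_For_or[OF _ _ J])
    fix x J assume x: "x < N" "\<And>r. r \<notin> W \<Longrightarrow> J r = I r"
    show "run N (e(6 := x)) (PFor 7 b) J rT [] \<longleftrightarrow> J rT [] \<or> (\<exists>G<N. ?\<Phi> (e 2) (e 3) (e 4) (e 5) x G)"
      using h6[of "e(6 := x)" J] e x by simp
  qed (use wb in simp_all)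
  have h4: "run N e (PFor 5 (PFor 6 (PFor 7 b))) J rT [] \<longleftrightarrow> J rT [] \<or> (\<exists>A<N. \<exists>K<N. \<exists>G<N. ?\<Phi> (e 2) (e 3) (e 4) A K G)"
    if e: "e 2 < N" "e 3 < N" "e 4 < N" and J: "\<And>r. r \<notin> W \<Longrightarrow> J r = I r" for e J
  proof (rule run_For_or[OF _ _ J])
    fix x J assume x: "x < N" "\<And>r. r \<notin> W \<Longrightarrow> J r = I r"
    show "run N (e(5 := x)) (PFor 6 (PFor 7 b)) J rT [] \<longleftrightarrow> J rT [] \<or> (\<exists>K<N. \<exists>G<N. ?\<Phi> (e 2) (e 3) (e 4) x K G)"
      using h5[of "e(5 := x)" J] e x by simp
  qed (use wb in simp_all)
  have h3: "run N e (PFor 4 (PFor 5 (PFor 6 (PFor 7 b)))) J rT [] \<longleftrightarrow>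
      J rT [] \<or> (\<exists>Q<N. \<exists>A<N. \<exists>K<N. \<exists>G<N. ?\<Phi> (e 2) (e 3) Q A K G)"
    if e: "e 2 < N" "e 3 < N" and J: "\<And>r. r \<notin> W \<Longrightarrow> J r = I r" for e J
  proof (rule run_For_or[OF _ _ J])
    fix x J assume x: "x < N" "\<And>r. r \<notin> W \<Longrightarrow> J r = I r"
    show "run N (e(4 := x)) (PFor 5 (PFor 6 (PFor 7 b))) J rT [] \<longleftrightarrow>
        J rT [] \<or> (\<exists>A<N. \<exists>K<N. \<exists>G<N. ?\<Phi> (e 2) (e 3) x A K G)"
      using h4[of "e(4 := x)" J] e x by simp
  qed (use wb in simp_all)
  have h2: "run N e (PFor 3 (PFor 4 (PFor 5 (PFor 6 (PFor 7 b))))) J rT [] \<longleftrightarrow>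
      J rT [] \<or> (\<exists>b<N. \<exists>Q<N. \<exists>A<N. \<exists>K<N. \<exists>G<N. ?\<Phi> (e 2) b Q A K G)"
    if e: "e 2 < N" and J: "\<And>r. r \<notin> W \<Longrightarrow> J r = I r" for e J
  proof (rule run_For_or[OF _ _ J])
    fix x J assume x: "x < N" "\<And>r. r \<notin> W \<Longrightarrow> J r = I r"
    show "run N (e(3 := x)) (PFor 4 (PFor 5 (PFor 6 (PFor 7 b)))) J rT [] \<longleftrightarrow>
        J rT [] \<or> (\<exists>Q<N. \<exists>A<N. \<exists>K<N. \<exists>G<N. ?\<Phi> (e 2) x Q A K G)"
      using h3[of "e(3 := x)" J] e x by simp
  qed (use wb in simp_all)
  have h1: "run N e (PFor 2 (PFor 3 (PFor 4 (PFor 5 (PFor 6 (PFor 7 b)))))) J rT [] \<longleftrightarrow>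
      J rT [] \<or> (\<exists>W<N. \<exists>b<N. \<exists>Q<N. \<exists>A<N. \<exists>K<N. \<exists>G<N. ?\<Phi> W b Q A K G)"
    if J: "\<And>r. r \<notin> W \<Longrightarrow> J r = I r" for e J
  proof (rule run_For_or[OF _ _ J])
    fix x J assume x: "x < N" "\<And>r. r \<notin> W \<Longrightarrow> J r = I r"
    show "run N (e(2 := x)) (PFor 3 (PFor 4 (PFor 5 (PFor 6 (PFor 7 b))))) J rT [] \<longleftrightarrow>
        J rT [] \<or> (\<exists>b<N. \<exists>Q<N. \<exists>A<N. \<exists>K<N. \<exists>G<N. ?\<Phi> x b Q A K G)"
      using h2[of "e(2 := x)" J] x by simp
  qed (use wb in simp_all)
  define J0 where "J0 = run N e (Assign rT 20 0 (FFalse 20)) I"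
  have J0: "J0 r = I r" if "r \<notin> W" for r using that by (simp add: J0_def W_def)
  have "\<not> J0 rT []" by (simp add: J0_def)
  moreover have "run N e (p_test w) I = run N e (PFor 2 (PFor 3 (PFor 4 (PFor 5 (PFor 6 (PFor 7 b)))))) J0"
    unfolding p_test_def b_def J0_def run.simps(2) ..
  ultimately show ?thesis unfolding tst_def using h1[OF J0] by simp
qed

lemma set_vars: "v \<in> set (vars w) \<Longrightarrow> v < 22 + w"
  by (simp add: vars_def)

lemma wf_vars: "i < 25 + w \<Longrightarrow> j < 25 + w \<Longrightarrow> v \<in> set ((vars w)[a := i, b := j]) \<Longrightarrow> v < max 22 (max (max (Suc i) (Suc j)) (22 + w))"
  using set_update_subset_insert[of "vars w" a i] set_update_subset_insert[of "(vars w)[a := i]" b j] set_vars[of v w] by fastforce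

lemma wf_p_test: "wf_prog 29 (arr w) (60 + w) 2 (p_test w)"
proof -
  have 1: "v < 24 + w" if "v \<in> set ((vars w)[i := 22 + w, Suc w := 23 + w])" for v i
    using wf_vars[OF _ _ that] by simp
  have 2: "v < 25 + w" if "v \<in> set ((vars w)[w := 23 + w, Suc w := 24 + w])" for v
    using wf_vars[OF _ _ that] by simp
  have l: "length (vars w) = w + 2" by (simp add: vars_def)
  have s: "\<forall>v\<in>set (vars w). v < 22 + w" using set_vars by blast
  have pay: "wf_fm 29 (arr w) (60 + w) (22 + w) (phi_pay w i)" if "i < w" for i
    using that 1 by (auto simp: phi_pay_def arr_def l)
  have fits: "wf_fm 29 (arr w) (60 + w) (25 + w) (phi_fits w)"
    by (auto simp: phi_fits_def arr_def rel_defs)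
  have stp: "wf_fm 29 (arr w) (60 + w) (22 + w) (phi_stp w)"
    using pay fits 2 s by (auto simp: phi_stp_def arr_def l)
  have ini: "wf_fm 29 (arr w) (60 + w) (22 + w) (phi_ini w)"
    by (auto simp: phi_ini_def)
  have cand: "wf_fm 29 (arr w) (60 + w) 23 phi_cand"
    by (simp add: phi_cand_def arr_def rel_defs DM_def)
  have col: "wf_fm 29 (arr w) (60 + w) 22 phi_col"
    by (simp add: phi_col_def arr_def rel_defs)
  have ex: "wf_fm 29 (arr w) (60 + w) 20 (exs 20 (w + 2) (Con (FRel rR (vars w)) (Succ (22 + w) 7 (21 + w))))"
    by (auto simp: arr_def l dest: set_vars)
  show ?thesis unfolding p_test_def p_col_def p_reach_def
    using stp ini cand col ex by (simp add: arr_def)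
qed

section \<open>Parsing the input by queries\<close>

definition is3 :: "nat \<Rightarrow> fm" where "is3 x = Con (FRel 0 [x]) (FRel 1 [x])"
definition is4 :: "nat \<Rightarrow> fm" where "is4 x = FRel 2 [x]"
definition eqc :: "nat \<Rightarrow> nat \<Rightarrow> fm" where
  "eqc x y = Con (Con (Imp (FRel 0 [x]) (FRel 0 [y])) (Imp (FRel 0 [y]) (FRel 0 [x])))
    (Con (Con (Imp (FRel 1 [x]) (FRel 1 [y])) (Imp (FRel 1 [y]) (FRel 1 [x])))
      (Con (Imp (FRel 2 [x]) (FRel 2 [y])) (Imp (FRel 2 [y]) (FRel 2 [x]))))"

text \<open>Among the symbols 0 to 4, only 3 has both low bits and only 4 has bit 2; equal bits mean
  equal symbols.\<close>

lemma mem0_symb: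
  assumes "set inp \<subseteq> {1..4}"
  shows "mem0 inp 0 x \<and> mem0 inp 1 x \<longleftrightarrow> symb inp x = 3" "mem0 inp 2 x \<longleftrightarrow> symb inp x = 4"
    "(mem0 inp 0 x \<longleftrightarrow> mem0 inp 0 y) \<and> (mem0 inp 1 x \<longleftrightarrow> mem0 inp 1 y) \<and> (mem0 inp 2 x \<longleftrightarrow> mem0 inp 2 y) \<longleftrightarrow> symb inp x = symb inp y"
proof -
  have m: "mem0 inp r x \<longleftrightarrow> r \<in> set_decode (symb inp x)" for r x by (simp add: mem0_def symb_def)
  have c: "symb inp x = 0 \<or> symb inp x = 1 \<or> symb inp x = 2 \<or> symb inp x = 3 \<or> symb inp x = 4" for x
  proof (cases "x < length inp")
    case True
    then have "inp ! x \<in> {1..4}" using assms nth_mem by blast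
    then show ?thesis using True by (auto simp: symb_def)
  qed (simp add: symb_def)
  have d: "set_decode (0::nat) = {}" "0 \<in> set_decode 1" "1 \<notin> set_decode 1" "2 \<notin> set_decode 1" "0 \<notin> set_decode 2" "1 \<in> set_decode 2"
    "2 \<notin> set_decode 2" "0 \<in> set_decode 3" "1 \<in> set_decode 3" "2 \<notin> set_decode 3" "0 \<notin> set_decode 4" "1 \<notin> set_decode 4" "2 \<in> set_decode 4"
    by (simp_all add: set_decode_def)
  show "mem0 inp 0 x \<and> mem0 inp 1 x \<longleftrightarrow> symb inp x = 3" unfolding m using c[of x] d by (elim disjE) simp_all
  show "mem0 inp 2 x \<longleftrightarrow> symb inp x = 4" unfolding m using c[of x] d by (elim disjE) simp_all
  show "(mem0 inp 0 x \<longleftrightarrow> mem0 inp 0 y) \<and> (mem0 inp 1 x \<longleftrightarrow> mem0 inp 1 y) \<and> (mem0 inp 2 x \<longleftrightarrow> mem0 inp 2 y) \<longleftrightarrow> symb inp x = symb inp y"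
    unfolding m using c[of x] c[of y] by (elim disjE) (simp_all only: d empty_iff simp_thms numeral_eq_iff num.distinct num.inject zero_neq_numeral one_eq_numeral_iff numeral_eq_one_iff zero_neq_one one_neq_zero numeral_neq_zero)
qed

definition phi_in :: fm where
  "phi_in = Con (FLt 20 21) (Con (Neg (is3 21)) (Con (Neg (is4 21)) (Con (Ex 22 (Con (Succ 23 22 21) (Or (is3 22) (is4 22))))
     (Neg (Ex 22 (Con (FLt 20 22) (Con (FLt 22 21) (is4 22))))))))"

definition phi_same :: fm where
  "phi_same = Ex 22 (Ex 23 (Ex 24 (Con (FRel RAdd [20, 22, 23]) (Con (FRel RAdd [21, 22, 24]) (Con (is3 23) (Con (is3 24)
     (FAll 25 (Imp (FLt 25 22) (FAll 26 (FAll 27 (Imp (Con (FRel RAdd [20, 25, 26]) (FRel RAdd [21, 25, 27]))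
       (Con (Neg (is3 27)) (eqc 26 27)))))))))))))"

definition p_parse :: prog where
  "p_parse = Assign rSet 20 1 (Con (is4 20) (Ex 21 (Con (FLt 20 21) (is4 21)))) ;;;
     Assign rIn 20 2 phi_in ;;; Assign rSame 20 2 phi_same ;;;
     Assign rEl 20 2 (Con (FRel rSet [20]) (Ex 22 (Con (FRel rIn [20, 22]) (Con (FRel rSame [21, 22])
       (Neg (Ex 23 (Con (FLt 23 21) (FRel rSame [23, 22]))))))))"

lemma eval_symbs:
  assumes "set inp \<subseteq> {1..4}" "\<And>r i. r < 3 \<Longrightarrow> I r [i] \<longleftrightarrow> mem0 inp r i"
  shows "eval N I e (is3 x) \<longleftrightarrow> symb inp (e x) = 3" "eval N I e (is4 x) \<longleftrightarrow> symb inp (e x) = 4"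
    "eval N I e (eqc x y) \<longleftrightarrow> symb inp (e x) = symb inp (e y)"
proof -
  show "eval N I e (is3 x) \<longleftrightarrow> symb inp (e x) = 3" using assms(2) mem0_symb(1)[OF assms(1)] by (simp add: is3_def)
  show "eval N I e (is4 x) \<longleftrightarrow> symb inp (e x) = 4" using assms(2) mem0_symb(2)[OF assms(1)] by (simp add: is4_def)
  show "eval N I e (eqc x y) \<longleftrightarrow> symb inp (e x) = symb inp (e y)"
    unfolding mem0_symb(3)[OF assms(1), symmetric] using assms(2) by (auto simp: eqc_def)
qed

lemma eval_in:
  assumes c: "set inp \<subseteq> {1..4}" "\<And>r i. r < 3 \<Longrightarrow> I r [i] \<longleftrightarrow> mem0 inp r i" and b: "s < N" "t < N"
  shows "eval N I (upd e 20 [s, t]) phi_in \<longleftrightarrow> inset (symb inp) s t"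
proof -
  have "eval N I (upd e 20 [s, t]) phi_in \<longleftrightarrow> s < t \<and> symb inp t \<noteq> 3 \<and> symb inp t \<noteq> 4 \<and>
     (\<exists>q<N. t = Suc q \<and> (symb inp q = 3 \<or> symb inp q = 4)) \<and> \<not> (\<exists>z<N. s < z \<and> z < t \<and> symb inp z = 4)"
    unfolding phi_in_def using b by (simp add: upd_Cons eval_symbs[OF c])
  also have "(\<exists>z<N. s < z \<and> z < t \<and> symb inp z = 4) \<longleftrightarrow> (\<exists>z. s < z \<and> z < t \<and> symb inp z = 4)"
    using b(2) less_trans by blast
  also have "s < t \<and> symb inp t \<noteq> 3 \<and> symb inp t \<noteq> 4 \<and>
     (\<exists>q<N. t = Suc q \<and> (symb inp q = 3 \<or> symb inp q = 4)) \<and> \<not> (\<exists>z. s < z \<and> z < t \<and> symb inp z = 4) \<longleftrightarrow> inset (symb inp) s t"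
  proof (cases t)
    case (Suc q)
    then have "q < N" using b by simp
    then show ?thesis unfolding inset_def Suc by simp
  qed (simp add: inset_def)
  finally show ?thesis .
qed

lemma symb_less: "symb inp p \<noteq> 0 \<Longrightarrow> p < length inp"
  by (simp add: symb_def split: if_splits)

lemma eval_same:
  assumes A: "arith N I" and c: "set inp \<subseteq> {1..4}" "\<And>r i. r < 3 \<Longrightarrow> I r [i] \<longleftrightarrow> mem0 inp r i"
    and b: "x < N" "t < N" and L: "length inp < N"
  shows "eval N I (upd e 20 [x, t]) phi_same \<longleftrightarrow> same (symb inp) x t"
proof -
  let ?f = "symb inp"
  have "eval N I (upd e 20 [x, t]) phi_same \<longleftrightarrow> (\<exists>n<N. \<exists>a<N. \<exists>a'<N. x + n = a \<and> t + n = a' \<and> ?f a = 3 \<and> ?f a' = 3 \<and>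
     (\<forall>d<N. d < n \<longrightarrow> (\<forall>y<N. \<forall>y'<N. x + d = y \<and> t + d = y' \<longrightarrow> ?f y' \<noteq> 3 \<and> ?f y = ?f y')))"
    unfolding phi_same_def using b
    by (simp only: eval.simps eval_macros eval_symbs[OF c] list.map upd_Cons upd_Nil)
      (simp add: arithD(1)[OF A] cong: conj_cong imp_cong)
  also have "\<dots> \<longleftrightarrow> same ?f x t"
  proof
    assume "\<exists>n<N. \<exists>a<N. \<exists>a'<N. x + n = a \<and> t + n = a' \<and> ?f a = 3 \<and> ?f a' = 3 \<and>
     (\<forall>d<N. d < n \<longrightarrow> (\<forall>y<N. \<forall>y'<N. x + d = y \<and> t + d = y' \<longrightarrow> ?f y' \<noteq> 3 \<and> ?f y = ?f y'))"
    then obtain n where n: "n < N" "x + n < N" "t + n < N" "?f (x + n) = 3" "?f (t + n) = 3"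
      "\<forall>d<N. d < n \<longrightarrow> (\<forall>y<N. \<forall>y'<N. x + d = y \<and> t + d = y' \<longrightarrow> ?f y' \<noteq> 3 \<and> ?f y = ?f y')" by blast
    have "?f (t + d) \<noteq> 3 \<and> ?f (x + d) = ?f (t + d)" if "d < n" for d
    proof -
      have "d < N" "x + d < N" "t + d < N" using n(1-3) that by linarith+
      then show ?thesis using n(6) that by blast
    qed
    then show "same ?f x t" unfolding same_def using n(4,5) by blast
  next
    assume "same ?f x t"
    then obtain n where n: "?f (x + n) = 3" "?f (t + n) = 3" "\<forall>d<n. ?f (t + d) \<noteq> 3 \<and> ?f (x + d) = ?f (t + d)"
      unfolding same_def by blast
    \<comment> \<open>Both readings end with a 3 and thus inside the input, so the bounded
      quantifiers lose nothing.\<close>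
    have "x + n < length inp" "t + n < length inp" using n(1,2) by (simp_all add: symb_less)
    then have l: "n < N" "x + n < N" "t + n < N" using L by linarith+
    show "\<exists>n<N. \<exists>a<N. \<exists>a'<N. x + n = a \<and> t + n = a' \<and> ?f a = 3 \<and> ?f a' = 3 \<and>
     (\<forall>d<N. d < n \<longrightarrow> (\<forall>y<N. \<forall>y'<N. x + d = y \<and> t + d = y' \<longrightarrow> ?f y' \<noteq> 3 \<and> ?f y = ?f y'))"
      by (intro exI[of _ n] exI[of _ "x + n"] exI[of _ "t + n"]) (use l n in blast)
  qed
  finally show ?thesis .
qed

lemma run_parse:
  assumes A: "arith N I" and c: "set inp \<subseteq> {1..4}" "\<And>r i. r < 3 \<Longrightarrow> I r [i] \<longleftrightarrow> mem0 inp r i" and L: "length inp < N"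
  shows "s < N \<Longrightarrow> run N e p_parse I rSet [s] \<longleftrightarrow> setpos (symb inp) s"
    and "s < N \<Longrightarrow> x < N \<Longrightarrow> run N e p_parse I rEl [s, x] \<longleftrightarrow> x \<in> Elt (symb inp) s"
proof -
  let ?f = "symb inp"
  define I1 where "I1 = run N e (Assign rSet 20 1 (Con (is4 20) (Ex 21 (Con (FLt 20 21) (is4 21))))) I"
  define I2 where "I2 = run N e (Assign rIn 20 2 phi_in) I1"
  define I3 where "I3 = run N e (Assign rSame 20 2 phi_same) I2"
  have st: "I1 rSet [s] \<longleftrightarrow> setpos ?f s" if "s < N" for s
  proof -
    have "I1 rSet [s] \<longleftrightarrow> ?f s = 4 \<and> (\<exists>q<N. s < q \<and> ?f q = 4)"
      using that unfolding I1_def by (simp add: upd_Cons eval_symbs[OF c])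
    also have "\<dots> \<longleftrightarrow> setpos ?f s"
    proof -
      have "q < N" if "?f q = 4" for q using symb_less[of inp q] that L by simp
      then show ?thesis unfolding setpos_def by blast
    qed
    finally show ?thesis .
  qed
  have c1: "I1 r [i] \<longleftrightarrow> mem0 inp r i" if "r < 3" for r i using that c(2) by (simp add: I1_def)
  have inn: "I2 rIn [s, t] \<longleftrightarrow> inset ?f s t" if "s < N" "t < N" for s t
    using that eval_in[OF c(1) c1 that] by (simp add: I2_def)
  have c2: "I2 r [i] \<longleftrightarrow> mem0 inp r i" if "r < 3" for r i using that c1 by (simp add: I2_def)
  have A2: "arith N I2" by (rule arith_cong[OF _ A]) (auto simp: I2_def I1_def)
  have sm: "I3 rSame [x, t] \<longleftrightarrow> same ?f x t" if "x < N" "t < N" for x t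
    using that eval_same[OF A2 c(1) c2 that L] by (simp add: I3_def)
  have fr: "I3 rSet = I1 rSet" "I3 rIn = I2 rIn" by (simp_all add: I3_def I2_def)
  have J: "run N e p_parse I = run N e (Assign rEl 20 2 (Con (FRel rSet [20]) (Ex 22 (Con (FRel rIn [20, 22]) (Con (FRel rSame [21, 22])
       (Neg (Ex 23 (Con (FLt 23 21) (FRel rSame [23, 22]))))))))) I3"
    by (simp only: p_parse_def run.simps(2) I1_def I2_def I3_def)
  show "run N e p_parse I rSet [s] \<longleftrightarrow> setpos ?f s" if "s < N"
    unfolding J using st[OF that] fr by simp
  show "run N e p_parse I rEl [s, x] \<longleftrightarrow> x \<in> Elt ?f s" if b: "s < N" "x < N"
  proof -
    have "run N e p_parse I rEl [s, x] \<longleftrightarrow> I3 rSet [s] \<and> (\<exists>t<N. I3 rIn [s, t] \<and> I3 rSame [x, t] \<and> \<not> (\<exists>y<N. y < x \<and> I3 rSame [y, t]))"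
      unfolding J using b by (simp add: upd_Cons)
    also have "\<dots> \<longleftrightarrow> setpos ?f s \<and> (\<exists>t<N. inset ?f s t \<and> same ?f x t \<and> \<not> (\<exists>y<N. y < x \<and> same ?f y t))"
      using b st inn sm fr by (simp cong: conj_cong)
    also have "\<dots> \<longleftrightarrow> x \<in> Elt ?f s"
    proof -
      have tN: "t < N" if "inset ?f s t" for t
      proof -
        have "?f (t - 1) \<noteq> 0" using that unfolding inset_def by auto
        then show ?thesis using symb_less[of inp "t - 1"] L by simp
      qed
      have y: "(\<exists>y<N. y < x \<and> same ?f y t) \<longleftrightarrow> \<not> (\<forall>y<x. \<not> same ?f y t)" for t
        using b(2) less_trans by blast
      show ?thesis unfolding Elt_def y using tN by auto
    qed
    finally show ?thesis .
  qed
qed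

lemma writes_parse: "writes p_parse = {rSet, rIn, rSame, rEl}"
  by (auto simp: p_parse_def)

section \<open>Local search\<close>

text \<open>By soundness some subfamily of \<open>F\<close> is a genuine exchange and passes the
  test by itself; minimality forces it to be all of \<open>F\<close>. Since sets of \<open>F\<close>
  are nonempty, \<open>F\<close> is disjoint from the part of \<open>S\<close> that is kept, and the
  sizes add up.\<close>

lemma improve:
  assumes S: "S \<subseteq> Fn" "\<forall>x\<in>S. \<forall>y\<in>S. x \<noteq> y \<longrightarrow> El x \<inter> El y = {}" and Fn: "Fn \<subseteq> {..<N}" "0 \<notin> Fn" "\<And>x. x \<in> Fn \<Longrightarrow> El x \<noteq> {}"
    and El: "\<And>x. El x \<subseteq> {..<N}" and F: "F \<subseteq> Fn" "tst N D w El S F" "\<And>f. f \<in> F \<Longrightarrow> \<not> tst N D w El S (F - {f})"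
    and S': "S' = F \<union> {s\<in>S. \<not> (\<exists>y\<in>F. El s \<inter> El y \<noteq> {})}"
  shows "S' \<subseteq> Fn" "\<forall>x\<in>S'. \<forall>y\<in>S'. x \<noteq> y \<longrightarrow> El x \<inter> El y = {}" "card S < card S'"
proof -
  have S0: "0 \<notin> S" "S \<subseteq> {..<N}" using S(1) Fn by auto
  then have fS: "finite S" using finite_subset by blast
  obtain X where X: "X \<subseteq> F" "tst N D w El S X" "finite X" "\<forall>x\<in>X. \<forall>y\<in>X. x \<noteq> y \<longrightarrow> El x \<inter> El y = {}"
    "card {s\<in>S. \<exists>x\<in>X. El s \<inter> El x \<noteq> {}} < card X"
    using tst_sound[OF S0 El F(2)] by (elim exE conjE)
  have "X = F"
  proof (rule ccontr)
    assume "X \<noteq> F"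
    then obtain f where f: "f \<in> F" "f \<notin> X" using X(1) by blast
    then have "X \<subseteq> F - {f}" using X(1) by blast
    then show False using tst_mono[OF _ X(2)] F(3)[OF f(1)] by blast
  qed
  note X = X[unfolded this]
  let ?C = "{s\<in>S. \<exists>x\<in>F. El s \<inter> El x \<noteq> {}}"
  have e: "S' = F \<union> (S - ?C)" using S' by auto
  show "S' \<subseteq> Fn" using S' F(1) S(1) by auto
  show "\<forall>x\<in>S'. \<forall>y\<in>S'. x \<noteq> y \<longrightarrow> El x \<inter> El y = {}"
  proof (intro ballI impI)
    fix x y assume x: "x \<in> S'" and y: "y \<in> S'" and xy: "x \<noteq> y"
    have "x \<in> F \<or> (x \<in> S \<and> (\<forall>z\<in>F. El x \<inter> El z = {}))" "y \<in> F \<or> (y \<in> S \<and> (\<forall>z\<in>F. El y \<inter> El z = {}))" using x y S' by auto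
    then show "El x \<inter> El y = {}" using X(4) S(2) xy Int_commute[of "El x" "El y"] by (elim disjE) simp_all
  qed
  have "F \<inter> (S - ?C) = {}"
  proof (rule equals0I)
    fix s assume s: "s \<in> F \<inter> (S - ?C)"
    then have "El s \<inter> El s \<noteq> {}" using F(1) Fn(3) by auto
    then have "s \<in> ?C" using s by blast
    then show False using s by blast
  qed
  then have "card S' = card F + card (S - ?C)" unfolding e using X(3) fS by (intro card_Un_disjoint) auto
  also have "card (S - ?C) = card S - card ?C" using fS by (intro card_Diff_subset) auto
  finally show "card S < card S'" using X(5) card_mono[OF fS, of ?C] by auto
qed

text \<open>The candidate in variable 1 is left out for a test, and deleted for good if the test
  still succeeds.\<close>

definition p_step :: "nat \<Rightarrow> prog" where
  "p_step w = Assign rFX 20 1 (Con (FRel rF [20]) (Neg (FEq 20 1))) ;;; p_test w ;;;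
     Assign rF 20 1 (Con (FRel rF [20]) (Neg (Con (FRel rT []) (FEq 20 1))))"

definition phi_upd :: fm where
  "phi_upd = Or (Con (FRel rT []) (Or (FRel rF [20]) (Con (FRel rS [20]) (Neg (Ex 21 (Con (FRel rF [21])
      (Ex 22 (Con (FRel rEl [20, 22]) (FRel rEl [21, 22])))))))))
    (Con (Neg (FRel rT [])) (FRel rS [20]))"

text \<open>If the test fails even with all candidates, no deletion takes place; the final test then
  fails as well and the packing is left unchanged.\<close>

definition p_round :: "nat \<Rightarrow> prog" where
  "p_round w = Assign rF 20 1 (FRel rFne [20]) ;;; PFor 1 (p_step w) ;;;
     Assign rFX 20 1 (FRel rF [20]) ;;; p_test w ;;; Assign rS 20 1 phi_upd"

definition p_search :: "nat \<Rightarrow> prog" where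
  "p_search w = Assign rS 20 1 (FFalse 21) ;;; PFor 0 (p_round w)"

definition W_search :: "nat set" where
  "W_search = {rT, rCand, rCol, rR, rS, rF, rFX}"

lemma writes_search: "writes (p_search w) = W_search"
  by (auto simp: p_search_def p_round_def p_step_def W_search_def writes_test)

text \<open>Either the packing is locally optimal or every round so far has enlarged it. As there
  are fewer than \<open>N\<close> candidates, the second case is impossible after \<open>N\<close>
  rounds.\<close>

lemma run_search:
  assumes A: "arith N I" and El: "\<And>s z. s < N \<Longrightarrow> z < N \<Longrightarrow> I rEl [s, z] \<longleftrightarrow> z \<in> El s"
    and Fne: "\<And>s. s < N \<Longrightarrow> I rFne [s] \<longleftrightarrow> s \<in> Fn"
    and Fn: "Fn \<subseteq> {..<N}" "0 \<notin> Fn" "\<And>x. x \<in> Fn \<Longrightarrow> El x \<noteq> {}" "card Fn < N" and ElN: "\<And>x. El x \<subseteq> {..<N}"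
  shows "\<exists>S\<subseteq>Fn. (\<forall>s<N. run N e (p_search w) I rS [s] \<longleftrightarrow> s \<in> S) \<and> (\<forall>x\<in>S. \<forall>y\<in>S. x \<noteq> y \<longrightarrow> El x \<inter> El y = {}) \<and>
    \<not> tst N (\<lambda>A q u a. I RDig [A, q, u, a]) w El S Fn"
proof -
  let ?D = "\<lambda>A q u a. I RDig [A, q, u, a]"
  let ?t = "tst N ?D w El"
  let ?base = "\<lambda>J::interp. \<forall>r. r \<notin> W_search \<longrightarrow> J r = I r"
  let ?disj = "\<lambda>S. \<forall>x\<in>S. \<forall>y\<in>S. x \<noteq> y \<longrightarrow> El x \<inter> El y = {}"
  have N: "0 < N" using Fn(4) by simp
  have base: "J r = I r" if "?base J" "r \<in> {3, 4, 5, 11, 12, 25, rEl, rFne}" for J r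
    using that by (auto simp: W_search_def)
  have test: "run N e (p_test w) J rT [] \<longleftrightarrow> ?t S F"
    if J: "?base J" "\<forall>s<N. J rS [s] \<longleftrightarrow> s \<in> S" "\<forall>s<N. J rFX [s] \<longleftrightarrow> s \<in> F" for e J S F
  proof -
    have AJ: "arith N J" by (rule arith_cong[OF _ A]) (rule base[OF J(1)], auto)
    have D: "J RDig = I RDig" using base[OF J(1), of 11] by (simp add: rel_defs)
    have E: "J rEl = I rEl" using base[OF J(1)] by simp
    show ?thesis using run_test[OF AJ, of S F El e w] J(2,3) El N unfolding D E by simp
  qed
  have tfr: "run N e (p_test w) J r = J r" if "r \<notin> {rT, rCand, rCol, rR}" for e J r
    by (rule run_frame) (use that in \<open>simp add: writes_test\<close>)
  have step: "\<exists>F\<subseteq>Fn. (\<forall>s<N. K rF [s] \<longleftrightarrow> s \<in> F) \<and> (?t S F \<longleftrightarrow> ?t S Fn) \<and> (\<forall>f\<in>F. f < N \<longrightarrow> \<not> ?t S (F - {f}))"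
    and step_base: "?base K" and stepS: "\<forall>s<N. K rS [s] \<longleftrightarrow> s \<in> S"
    if J: "?base J" "\<forall>s<N. J rS [s] \<longleftrightarrow> s \<in> S" "\<forall>s<N. J rF [s] \<longleftrightarrow> s \<in> Fn" and K: "K = run N e (PFor 1 (p_step w)) J" for e J K S
  proof -
    let ?Q = "\<lambda>i K. ?base K \<and> (\<forall>s<N. K rS [s] \<longleftrightarrow> s \<in> S) \<and>
      (\<exists>F\<subseteq>Fn. (\<forall>s<N. K rF [s] \<longleftrightarrow> s \<in> F) \<and> (?t S F \<longleftrightarrow> ?t S Fn) \<and> (\<forall>f\<in>F. f < i \<longrightarrow> \<not> ?t S (F - {f})))"
    have "?Q N K" unfolding K
    proof (rule run_For_inv[where P = ?Q])
      have "\<forall>f\<in>Fn. f < 0 \<longrightarrow> \<not> ?t S (Fn - {f})" by simp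
      then show "?Q 0 J" using J by (intro conjI exI[of _ Fn] subset_refl refl)
    next
      fix i K assume i: "i < N" and Q: "?Q i K"
      have Kb: "?base K" and KS: "\<forall>s<N. K rS [s] \<longleftrightarrow> s \<in> S" using Q by - (elim conjE, assumption)+
      obtain F where F: "F \<subseteq> Fn" "\<forall>s<N. K rF [s] \<longleftrightarrow> s \<in> F" "?t S F \<longleftrightarrow> ?t S Fn" "\<forall>f\<in>F. f < i \<longrightarrow> \<not> ?t S (F - {f})"
        using Q by (elim conjE exE)
      let ?e = "e(1 := i)"
      define K1 where "K1 = run N ?e (Assign rFX 20 1 (Con (FRel rF [20]) (Neg (FEq 20 1)))) K"
      define K2 where "K2 = run N ?e (p_test w) K1"
      define K3 where "K3 = run N ?e (p_step w) K"
      have k1: "\<forall>s<N. K1 rFX [s] \<longleftrightarrow> s \<in> F - {i}" unfolding K1_def using F(2) by (simp add: upd_Cons)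
      have k1r: "K1 r = K r" if "r \<noteq> rFX" for r using that by (simp add: K1_def)
      have k1b: "?base K1" using Kb k1r by (auto simp: W_search_def)
      have T: "K2 rT [] \<longleftrightarrow> ?t S (F - {i})"
        unfolding K2_def by (rule test[OF k1b _ k1]) (use KS k1r in simp)
      have k2r: "K2 r = K1 r" if "r \<notin> {rT, rCand, rCol, rR}" for r unfolding K2_def by (rule tfr[OF that])
      have k3: "K3 = run N ?e (Assign rF 20 1 (Con (FRel rF [20]) (Neg (Con (FRel rT []) (FEq 20 1))))) K2"
        unfolding K3_def p_step_def K2_def K1_def by simp
      have k3F: "K3 rF [s] \<longleftrightarrow> s \<in> F \<and> \<not> (?t S (F - {i}) \<and> s = i)" if "s < N" for s
        unfolding k3 using that F(2) T k2r[of rF] k1r[of rF] by (simp add: upd_Cons)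
      have k3r: "K3 r = K r" if "r \<notin> {rT, rCand, rCol, rR, rF, rFX}" for r
        unfolding k3 using that k2r[of r] k1r[of r] by simp
      have 1: "?base K3" using Kb k3r by (auto simp: W_search_def)
      have 2: "\<forall>s<N. K3 rS [s] \<longleftrightarrow> s \<in> S" using KS k3r[of rS] by simp
      have 3: "\<exists>F\<subseteq>Fn. (\<forall>s<N. K3 rF [s] \<longleftrightarrow> s \<in> F) \<and> (?t S F \<longleftrightarrow> ?t S Fn) \<and> (\<forall>f\<in>F. f < Suc i \<longrightarrow> \<not> ?t S (F - {f}))"
      proof (cases "?t S (F - {i})")
        case True
        have a: "F - {i} \<subseteq> Fn" using F(1) by blast
        have b: "\<forall>s<N. K3 rF [s] \<longleftrightarrow> s \<in> F - {i}" using k3F True by simp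
        have c: "?t S (F - {i}) \<longleftrightarrow> ?t S Fn" using True tst_mono[OF a True] by simp
        \<comment> \<open>A candidate that proved necessary stays necessary: by monotonicity further
          deletions cannot make the test succeed without it.\<close>
        have d: "\<forall>f\<in>F - {i}. f < Suc i \<longrightarrow> \<not> ?t S (F - {i} - {f})"
        proof (intro ballI impI notI)
          fix f assume f: "f \<in> F - {i}" "f < Suc i" and t: "?t S (F - {i} - {f})"
          have "?t S (F - {f})" by (rule tst_mono[OF _ t]) blast
          then show False using F(4) f by auto
        qed
        show ?thesis using a b c d by (intro exI[of _ "F - {i}"] conjI)
      next
        case False
        have b: "\<forall>s<N. K3 rF [s] \<longleftrightarrow> s \<in> F" using k3F False by simp
        have d: "\<forall>f\<in>F. f < Suc i \<longrightarrow> \<not> ?t S (F - {f})" using F(4) False by (auto simp: less_Suc_eq)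
        show ?thesis using F(1) b F(3) d by (intro exI[of _ F] conjI)
      qed
      show "?Q (Suc i) (run N ?e (p_step w) K)" unfolding K3_def[symmetric] using 1 2 3 by (intro conjI)
    qed
    then show "\<exists>F\<subseteq>Fn. (\<forall>s<N. K rF [s] \<longleftrightarrow> s \<in> F) \<and> (?t S F \<longleftrightarrow> ?t S Fn) \<and> (\<forall>f\<in>F. f < N \<longrightarrow> \<not> ?t S (F - {f}))"
      "?base K" "\<forall>s<N. K rS [s] \<longleftrightarrow> s \<in> S" by - (elim conjE, assumption)+
  qed
  define J0 where "J0 = run N e (Assign rS 20 1 (FFalse 21)) I"
  let ?P = "\<lambda>i J. ?base J \<and> (\<exists>S\<subseteq>Fn. (\<forall>s<N. J rS [s] \<longleftrightarrow> s \<in> S) \<and> ?disj S \<and> (\<not> ?t S Fn \<or> i \<le> card S))"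
  have "?P N (run N e (PFor 0 (p_round w)) J0)"
  proof (rule run_For_inv[where P = ?P])
    have "?base J0" by (simp add: J0_def W_search_def)
    moreover have "\<forall>s<N. J0 rS [s] \<longleftrightarrow> s \<in> {}" by (simp add: J0_def)
    ultimately show "?P 0 J0" by (intro conjI exI[of _ "{}"]) simp_all
  next
    fix i J assume i: "i < N" and P: "?P i J"
    have Jb: "?base J" using P by (rule conjunct1)
    obtain S where S: "S \<subseteq> Fn" "\<forall>s<N. J rS [s] \<longleftrightarrow> s \<in> S" "?disj S" "\<not> ?t S Fn \<or> i \<le> card S"
      using P by (elim conjE exE)
    let ?e = "e(0 := i)"
    define J1 where "J1 = run N ?e (Assign rF 20 1 (FRel rFne [20])) J"
    define J2 where "J2 = run N ?e (PFor 1 (p_step w)) J1"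
    define J3 where "J3 = run N ?e (Assign rFX 20 1 (FRel rF [20])) J2"
    define J4 where "J4 = run N ?e (p_test w) J3"
    define J5 where "J5 = run N ?e (p_round w) J"
    have j1b: "?base J1" using Jb by (simp add: J1_def W_search_def)
    have j1S: "\<forall>s<N. J1 rS [s] \<longleftrightarrow> s \<in> S" using S(2) by (simp add: J1_def)
    have j1F: "\<forall>s<N. J1 rF [s] \<longleftrightarrow> s \<in> Fn" using Fne base[OF Jb, of rFne] by (simp add: J1_def upd_Cons)
    obtain F where F: "F \<subseteq> Fn" "\<forall>s<N. J2 rF [s] \<longleftrightarrow> s \<in> F" "?t S F \<longleftrightarrow> ?t S Fn" "\<forall>f\<in>F. f < N \<longrightarrow> \<not> ?t S (F - {f})"
      using step[OF j1b j1S j1F J2_def] by (elim conjE exE)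
    have j2b: "?base J2" by (rule step_base[OF j1b j1S j1F J2_def])
    have j2S: "\<forall>s<N. J2 rS [s] \<longleftrightarrow> s \<in> S" by (rule stepS[OF j1b j1S j1F J2_def])
    have j3b: "?base J3" using j2b by (simp add: J3_def W_search_def)
    have j3S: "\<forall>s<N. J3 rS [s] \<longleftrightarrow> s \<in> S" using j2S by (simp add: J3_def)
    have j3F: "\<forall>s<N. J3 rFX [s] \<longleftrightarrow> s \<in> F" using F(2) by (simp add: J3_def upd_Cons)
    have T: "J4 rT [] \<longleftrightarrow> ?t S F" unfolding J4_def by (rule test[OF j3b j3S j3F])
    have j4: "J4 r = J3 r" if "r \<notin> {rT, rCand, rCol, rR}" for r unfolding J4_def by (rule tfr[OF that])
    have j5: "J5 = run N ?e (Assign rS 20 1 phi_upd) J4"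
      unfolding J5_def p_round_def J4_def J3_def J2_def J1_def by simp
    have j5b: "?base J5" unfolding j5 using j3b j4 by (auto simp: W_search_def)
    have E4: "J4 rEl [s, z] \<longleftrightarrow> z \<in> El s" if "s < N" "z < N" for s z
      using El[OF that] base[OF j3b, of rEl] j4[of rEl] by simp
    have F4: "J4 rF [s] \<longleftrightarrow> s \<in> F" "J4 rS [s] \<longleftrightarrow> s \<in> S" if "s < N" for s
      using F(2) j3S that j4[of rF] j4[of rS] by (simp_all add: J3_def)
    have j5S: "J5 rS [s] \<longleftrightarrow> (if ?t S F then s \<in> F \<union> {s\<in>S. \<not> (\<exists>y\<in>F. El s \<inter> El y \<noteq> {})} else s \<in> S)" if s: "s < N" for s
    proof -
      have "J5 rS [s] \<longleftrightarrow> (J4 rT [] \<and> (J4 rF [s] \<or> J4 rS [s] \<and> \<not> (\<exists>y<N. J4 rF [y] \<and> (\<exists>z<N. J4 rEl [s, z] \<and> J4 rEl [y, z])))) \<or> (\<not> J4 rT [] \<and> J4 rS [s])"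
        unfolding j5 phi_upd_def using s by (simp add: upd_Cons)
      moreover have "(\<exists>y<N. J4 rF [y] \<and> (\<exists>z<N. J4 rEl [s, z] \<and> J4 rEl [y, z])) \<longleftrightarrow> (\<exists>y\<in>F. El s \<inter> El y \<noteq> {})"
      proof -
        have "J4 rF [y] \<and> (\<exists>z<N. J4 rEl [s, z] \<and> J4 rEl [y, z]) \<longleftrightarrow> y \<in> F \<and> El s \<inter> El y \<noteq> {}" if y: "y < N" for y
          using F4(1)[OF y] E4[OF s] E4[OF y] ElN[of s] by blast
        then show ?thesis using F(1) Fn(1) by blast
      qed
      moreover note T F4[OF s]
      ultimately show ?thesis by auto
    qed
    have "\<exists>S\<subseteq>Fn. (\<forall>s<N. J5 rS [s] \<longleftrightarrow> s \<in> S) \<and> ?disj S \<and> (\<not> ?t S Fn \<or> Suc i \<le> card S)"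
    proof (cases "?t S F")
      case True
      let ?S' = "F \<union> {s\<in>S. \<not> (\<exists>y\<in>F. El s \<inter> El y \<noteq> {})}"
      have min: "\<not> ?t S (F - {f})" if "f \<in> F" for f using F(1,4) Fn(1) that by blast
      note imp = improve[OF S(1,3) Fn(1-3) ElN F(1) True min refl]
      have "i \<le> card S" using S(4) True F(3) by blast
      then have "Suc i \<le> card ?S'" using imp(3) by linarith
      moreover have "\<forall>s<N. J5 rS [s] \<longleftrightarrow> s \<in> ?S'" using j5S True by simp
      ultimately show ?thesis using imp(1,2) by (intro exI[of _ ?S'] conjI disjI2)
    next
      case False
      have "\<forall>s<N. J5 rS [s] \<longleftrightarrow> s \<in> S" using j5S False by simp
      moreover have "\<not> ?t S Fn" using False F(3) by blast
      ultimately show ?thesis using S(1,3) by (intro exI[of _ S] conjI disjI1)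
    qed
    then show "?P (Suc i) (run N ?e (p_round w) J)" unfolding J5_def[symmetric] using j5b by (intro conjI)
  qed
  moreover have "run N e (p_search w) I = run N e (PFor 0 (p_round w)) J0" by (simp only: p_search_def run.simps(2) J0_def)
  ultimately obtain S where S: "S \<subseteq> Fn" "\<forall>s<N. run N e (p_search w) I rS [s] \<longleftrightarrow> s \<in> S" "?disj S" "\<not> ?t S Fn \<or> N \<le> card S"
    by (elim conjE exE) simp
  have "card S \<le> card Fn" using S(1) Fn(1) finite_subset by (intro card_mono) auto
  then have "\<not> ?t S Fn" using S(4) Fn(4) by linarith
  then show ?thesis using S(1-3) by (intro exI[of _ S] conjI)
qed

section \<open>Writing the output\<close>

text \<open>The set \<open>rLen\<close> contains just the current output length. It is updated last,
  because both output tracks are written at the old length.\<close>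

definition p_app :: prog where
  "p_app = Assign rOA 20 1 (Or (FRel rOA [20]) (Con (FRel rLen [20]) (Con (FRel rCnd []) (FRel rA0 [])))) ;;;
     Assign rOB 20 1 (Or (FRel rOB [20]) (Con (FRel rLen [20]) (Con (FRel rCnd []) (FRel rA1 [])))) ;;;
     Assign rLen 20 1 (Or (Con (Neg (FRel rCnd [])) (FRel rLen [20]))
       (Con (FRel rCnd []) (Ex 21 (Con (FRel rLen [21]) (Succ 22 21 20)))))"

definition outs :: "nat \<Rightarrow> nat list \<Rightarrow> interp \<Rightarrow> bool" where
  "outs N ys I \<longleftrightarrow> (\<forall>x<N. (I rLen [x] \<longleftrightarrow> x = length ys) \<and> (I rOA [x] \<longleftrightarrow> x < length ys \<and> odd (ys ! x)) \<and>
     (I rOB [x] \<longleftrightarrow> x < length ys \<and> 2 \<le> ys ! x))"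

lemma outs_cong: "J rLen = I rLen \<Longrightarrow> J rOA = I rOA \<Longrightarrow> J rOB = I rOB \<Longrightarrow> outs N ys J \<longleftrightarrow> outs N ys I"
  by (simp add: outs_def)

lemma run_app:
  assumes o: "outs N ys I" and l: "length ys < N" and c: "I rCnd [] \<Longrightarrow> (I rA0 [] \<longleftrightarrow> odd c) \<and> (I rA1 [] \<longleftrightarrow> 2 \<le> c)"
  shows "outs N (if I rCnd [] then ys @ [c] else ys) (run N e p_app I)"
proof -
  let ?J = "run N e p_app I"
  have o': "I rLen [x] \<longleftrightarrow> x = length ys" "I rOA [x] \<longleftrightarrow> x < length ys \<and> odd (ys ! x)"
    "I rOB [x] \<longleftrightarrow> x < length ys \<and> 2 \<le> ys ! x" if "x < N" for x using o that unfolding outs_def by blast+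
  have J: "?J rOA [x] \<longleftrightarrow> I rOA [x] \<or> I rLen [x] \<and> I rCnd [] \<and> I rA0 []"
    "?J rOB [x] \<longleftrightarrow> I rOB [x] \<or> I rLen [x] \<and> I rCnd [] \<and> I rA1 []"
    "?J rLen [x] \<longleftrightarrow> \<not> I rCnd [] \<and> I rLen [x] \<or> I rCnd [] \<and> (\<exists>y<N. I rLen [y] \<and> x = Suc y)" if "x < N" for x
    using that unfolding p_app_def by (simp_all add: upd_Cons)
  show ?thesis
  proof (cases "I rCnd []")
    case True
    have "(?J rLen [x] \<longleftrightarrow> x = length (ys @ [c])) \<and> (?J rOA [x] \<longleftrightarrow> x < length (ys @ [c]) \<and> odd ((ys @ [c]) ! x)) \<and>
      (?J rOB [x] \<longleftrightarrow> x < length (ys @ [c]) \<and> 2 \<le> (ys @ [c]) ! x)" if x: "x < N" for x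
    proof -
      have "(\<exists>y<N. I rLen [y] \<and> x = Suc y) \<longleftrightarrow> x = Suc (length ys)" using o'(1) l x by auto
      then show ?thesis unfolding J[OF x] using True c[OF True] o'(1)[OF x] o'(2)[OF x] o'(3)[OF x]
        by (auto simp: nth_append less_Suc_eq)
    qed
    then show ?thesis using True unfolding outs_def by simp
  next
    case False
    then show ?thesis using o J unfolding outs_def by simp
  qed
qed

text \<open>The comparison is expressed through the bits of \<open>c\<close>, since 2 ^ j itself
  need not be below \<open>N\<close>.\<close>

lemma power_le_bits: "2 ^ j \<le> (c::nat) \<longleftrightarrow> (\<exists>i\<ge>j. i \<in> set_decode c)"
proof
  assume "2 ^ j \<le> c"
  then have "c div 2 ^ j \<noteq> 0" by (simp add: div_greater_zero_iff)
  moreover have "set_encode (set_decode (c div 2 ^ j)) = c div 2 ^ j" by (rule set_decode_inverse)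
  ultimately have "set_decode (c div 2 ^ j) \<noteq> {}" using set_encode_empty by force
  then obtain i where "odd (c div 2 ^ j div 2 ^ i)" unfolding set_decode_def by blast
  then have "j + i \<in> set_decode c" by (simp add: set_decode_def div_mult2_eq power_add)
  then show "\<exists>i\<ge>j. i \<in> set_decode c" using le_add1 by blast
next
  assume "\<exists>i\<ge>j. i \<in> set_decode c"
  then obtain i where i: "j \<le> i" "odd (c div 2 ^ i)" unfolding set_decode_def by blast
  then have "c div 2 ^ i \<noteq> 0" by (metis even_zero)
  then have "2 ^ i \<le> c" by (simp add: div_greater_zero_iff)
  moreover have "(2::nat) ^ j \<le> 2 ^ i" using i(1) by (intro power_increasing) auto
  ultimately show "2 ^ j \<le> c" by linarith
qed

text \<open>Loops count upwards while digits are due from the top. Variable 20 is N - 1 minus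
  variable 1, where N - 1 is recognised as the largest value.\<close>

definition mirror :: fm where
  "mirror = Ex 21 (Con (FRel RAdd [20, 1, 21]) (Neg (Ex 22 (FLt 21 22))))"

definition p_char :: prog where
  "p_char = Assign rCnd 20 0 (Con (FRel rFX [0]) (Ex 20 (Con mirror (Or (Zero 21 20)
       (Ex 21 (Con (FRel rIdx [21]) (Ex 22 (Con (FLe 20 22) (FRel RBit [21, 22])))))))) ) ;;;
     Assign rA1 20 0 (Ex 20 (Con mirror (Ex 21 (Con (FRel rIdx [21]) (FRel RBit [21, 20]))))) ;;;
     Assign rA0 20 0 (Neg (FRel rA1 [])) ;;; p_app"

definition W_char :: "nat set" where
  "W_char = {rOA, rOB, rLen, rCnd, rA0, rA1}"

lemma writes_char: "writes p_char = W_char"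
  by (auto simp: p_char_def p_app_def W_char_def)

lemma run_char:
  assumes A: "arith N I" and idx: "\<And>x. x < N \<Longrightarrow> I rIdx [x] \<longleftrightarrow> x = c" and c: "c < N" and e: "e 1 < N"
    and o: "outs N ys I" "length ys < N" and j: "j = N - 1 - e 1"
  shows "outs N (ys @ (if I rFX [e 0] \<and> (j = 0 \<or> 2 ^ j \<le> c) then [c div 2 ^ j mod 2 + 1] else [])) (run N e p_char I)"
proof -
  have jN: "j < N" "j + e 1 = N - 1" using e j by auto
  have mir: "eval N J (e(20 := y)) mirror \<longleftrightarrow> y = j" if "y < N" "arith N J" for y J
  proof -
    have "eval N J (e(20 := y)) mirror \<longleftrightarrow> (\<exists>m<N. y + e 1 = m \<and> \<not> (\<exists>z<N. m < z))"
      unfolding mirror_def using that e by (simp add: arithD(1)[OF that(2)] cong: conj_cong)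
    also have "\<dots> \<longleftrightarrow> y + e 1 = N - 1"
    proof
      assume "\<exists>m<N. y + e 1 = m \<and> \<not> (\<exists>z<N. m < z)"
      then obtain m where m: "m < N" "y + e 1 = m" "\<not> (\<exists>z<N. m < z)" by blast
      have "\<not> m < N - 1" using m(1,3) by (metis diff_less less_numeral_extra(1) gr_implies_not_zero neq0_conv)
      then have "m = N - 1" using m(1) by linarith
      then show "y + e 1 = N - 1" using m(2) by simp
    next
      assume h: "y + e 1 = N - 1"
      have "N - 1 < N" using e by simp
      moreover have "\<not> (\<exists>z<N. N - 1 < z)" by auto
      ultimately show "\<exists>m<N. y + e 1 = m \<and> \<not> (\<exists>z<N. m < z)" using h by blast
    qed
    also have "\<dots> \<longleftrightarrow> y = j" using jN by auto
    finally show ?thesis .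
  qed
  define I1 where "I1 = run N e (Assign rCnd 20 0 (Con (FRel rFX [0]) (Ex 20 (Con mirror (Or (Zero 21 20)
       (Ex 21 (Con (FRel rIdx [21]) (Ex 22 (Con (FLe 20 22) (FRel RBit [21, 22]))))))))) ) I"
  define I2 where "I2 = run N e (Assign rA1 20 0 (Ex 20 (Con mirror (Ex 21 (Con (FRel rIdx [21]) (FRel RBit [21, 20])))))) I1"
  define I3 where "I3 = run N e (Assign rA0 20 0 (Neg (FRel rA1 []))) I2"
  have A1: "arith N I1" by (rule arith_cong[OF _ A]) (auto simp: I1_def)
  have idx1: "I1 rIdx [x] \<longleftrightarrow> x = c" if "x < N" for x using idx[OF that] by (simp add: I1_def)
  have bitN: "(\<exists>i<N. j \<le> i \<and> i \<in> set_decode c) \<longleftrightarrow> 2 ^ j \<le> c"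
  proof -
    have "i < N" if "i \<in> set_decode c" for i
    proof -
      have "2 ^ i \<le> c" unfolding power_le_bits using that by blast
      then show ?thesis using less_exp[of i] c by linarith
    qed
    then show ?thesis unfolding power_le_bits by blast
  qed
  have one: "(\<exists>x<N. x = a \<and> Q x) \<longleftrightarrow> Q a" if "a < N" for a :: nat and Q using that by blast
  have cnd: "I1 rCnd [] \<longleftrightarrow> I rFX [e 0] \<and> (j = 0 \<or> 2 ^ j \<le> c)"
  proof -
    have "I1 rCnd [] \<longleftrightarrow> I rFX [e 0] \<and> (\<exists>y<N. y = j \<and> (y = 0 \<or> (\<exists>x<N. x = c \<and> (\<exists>i<N. y \<le> i \<and> i \<in> set_decode x))))"
      unfolding I1_def using e by (simp add: mir[OF _ A] idx arithD(3)[OF A] cong: conj_cong)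
    then show ?thesis unfolding one[OF jN(1)] one[OF c] bitN .
  qed
  have a1: "I2 rA1 [] \<longleftrightarrow> j \<in> set_decode c"
  proof -
    have "I2 rA1 [] \<longleftrightarrow> (\<exists>y<N. y = j \<and> (\<exists>x<N. x = c \<and> y \<in> set_decode x))"
      unfolding I2_def by (simp add: mir[OF _ A1] idx1 arithD(3)[OF A1] cong: conj_cong)
    then show ?thesis unfolding one[OF jN(1)] one[OF c] .
  qed
  have I3: "I3 rCnd = I1 rCnd" "I3 rA1 = I2 rA1" "I3 rA0 [] \<longleftrightarrow> \<not> I2 rA1 []" "outs N ys I3"
    using o(1) by (simp_all add: I3_def I2_def I1_def outs_def)
  have bit: "odd (c div 2 ^ j mod 2 + 1) \<longleftrightarrow> j \<notin> set_decode c" "2 \<le> c div 2 ^ j mod 2 + 1 \<longleftrightarrow> j \<in> set_decode c"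
    by (auto simp: set_decode_def odd_iff_mod_2_eq_one)
  have R: "run N e p_char I = run N e p_app I3" by (simp only: p_char_def run.simps(2) I1_def I2_def I3_def)
  have "outs N (if I3 rCnd [] then ys @ [c div 2 ^ j mod 2 + 1] else ys) (run N e p_char I)"
    unfolding R by (rule run_app[OF I3(4) o(2)]) (use I3 a1 bit in simp)
  moreover have "(if b then ys @ [x] else ys) = ys @ (if b then [x] else [])" for b and x :: nat by simp
  ultimately show ?thesis unfolding I3(1) cnd by (simp only:)
qed

lemma run_bits:
  assumes A: "arith N I" and idx: "\<And>x. x < N \<Longrightarrow> I rIdx [x] \<longleftrightarrow> x = c" and c: "c < N"
    and o: "outs N ys I" "length ys + (if I rFX [e 0] then length (bits c) else 0) < N"
  shows "outs N (ys @ (if I rFX [e 0] then bits c else [])) (run N e (PFor 1 p_char) I)"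
proof -
  define g where "g j = (if I rFX [e 0] \<and> (j = 0 \<or> 2 ^ j \<le> c) then [c div 2 ^ j mod 2 + 1] else [])" for j
  define h where "h x = map (\<lambda>j. N - 1 - j) [0..<x]" for x
  define ob where "ob x = concat (map g (h x))" for x
  have "h N = rev [0..<N]" unfolding h_def
    by (rule nth_equalityI) (simp_all add: rev_nth)
  moreover have "c < 2 ^ N" using c less_exp[of N] by linarith
  ultimately have full: "ob N = (if I rFX [e 0] then bits c else [])"
    using bits_digits[of c N] c unfolding ob_def g_def by simp
  have le: "length (ob x) \<le> length (ob N)" if "x \<le> N" for x
  proof -
    have "h x = take x (h N)" using that by (simp add: h_def take_map)
    then show ?thesis unfolding ob_def using length_concat_take[of g x "h N"] by simp
  qed
  have ob0: "ob 0 = []" and obS: "ob (Suc x) = ob x @ g (N - 1 - x)" for x by (simp_all add: ob_def h_def)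
  let ?P = "\<lambda>x J. (\<forall>r. r \<notin> W_char \<longrightarrow> J r = I r) \<and> outs N (ys @ ob x) J"
  have "?P N (run N e (PFor 1 p_char) I)"
  proof (rule run_For_inv[where P = ?P])
    show "?P 0 I" using o(1) ob0 by simp
  next
    fix x J assume x: "x < N" and P: "?P x J"
    have Jr: "J r = I r" if "r \<notin> W_char" for r using P that by blast
    have AJ: "arith N J" by (rule arith_cong[OF _ A]) (rule Jr, auto simp: W_char_def)
    have J: "J rIdx = I rIdx" "J rFX = I rFX" by (rule Jr, simp add: W_char_def)+
    let ?e = "e(1 := x)"
    have "length (ob x) \<le> length (ob N)" using le x by simp
    moreover have "length ys + length (ob N) < N" unfolding full using o(2) by (cases "I rFX [e 0]") simp_all
    ultimately have l: "length (ys @ ob x) < N" by simp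
    have rc: "outs N ((ys @ ob x) @ (if J rFX [?e 0] \<and> (N - 1 - ?e 1 = 0 \<or> 2 ^ (N - 1 - ?e 1) \<le> c)
        then [c div 2 ^ (N - 1 - ?e 1) mod 2 + 1] else [])) (run N ?e p_char J)"
      by (rule run_char[OF AJ _ c _ conjunct2[OF P] l refl]) (use idx x J in simp_all)
    have e': "?e 1 = x" "?e 0 = e 0" by simp_all
    have "outs N ((ys @ ob x) @ g (N - 1 - x)) (run N ?e p_char J)" using rc unfolding g_def e' J(2) .
    then have "outs N (ys @ ob (Suc x)) (run N ?e p_char J)" unfolding obS append_assoc .
    moreover have "run N ?e p_char J r = I r" if "r \<notin> W_char" for r
      using run_frame[of r p_char N ?e J] that writes_char Jr by simp
    ultimately show "?P (Suc x) (run N ?e p_char J)" by simp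
  qed
  then show ?thesis unfolding full by blast
qed

text \<open>\<open>rIdx\<close> holds the number of sets that start before the current position,
  which is the index of the set starting there; it is therefore increased only after
  writing.\<close>

definition p_item :: prog where
  "p_item = PFor 1 p_char ;;; Assign rCnd 20 0 (FRel rFX [0]) ;;; Assign rA0 20 0 (Neg (FFalse 20)) ;;;
     Assign rA1 20 0 (Neg (FFalse 20)) ;;; p_app ;;;
     Assign rIdx 20 1 (Or (Con (Neg (FRel rSet [0])) (FRel rIdx [20]))
       (Con (FRel rSet [0]) (Ex 21 (Con (FRel rIdx [21]) (Succ 22 21 20)))))"

lemma run_item:
  assumes A: "arith N I" and idx: "\<And>x. x < N \<Longrightarrow> I rIdx [x] \<longleftrightarrow> x = c" and c: "c < N"
    and o: "outs N ys I" "length ys + (if I rFX [e 0] then Suc (length (bits c)) else 0) < N" and z: "Suc c < N"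
  shows "outs N (ys @ (if I rFX [e 0] then bits c @ [3] else [])) (run N e p_item I)"
    and "x < N \<Longrightarrow> run N e p_item I rIdx [x] \<longleftrightarrow> x = (if I rSet [e 0] then Suc c else c)"
    and "r \<notin> insert rIdx W_char \<Longrightarrow> run N e p_item I r = I r"
proof -
  define I1 where "I1 = run N e (PFor 1 p_char) I"
  define I2 where "I2 = run N e (Assign rA1 20 0 (Neg (FFalse 20))) (run N e (Assign rA0 20 0 (Neg (FFalse 20)))
      (run N e (Assign rCnd 20 0 (FRel rFX [0])) I1))"
  define I3 where "I3 = run N e p_app I2"
  have r1: "I1 r = I r" if "r \<notin> W_char" for r unfolding I1_def by (rule run_frame) (use that writes_char in simp)
  have FX: "I1 rFX = I rFX" "I1 rSet = I rSet" "I1 rIdx = I rIdx" by (rule r1, simp add: W_char_def)+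
  define zs where "zs = (if I rFX [e 0] then bits c else [])"
  have o1: "outs N (ys @ zs) I1"
    unfolding I1_def zs_def by (rule run_bits[OF A idx c o(1)]) (use o(2) in \<open>cases "I rFX [e 0]"; simp\<close>)+
  have lz: "length (ys @ zs) < N" unfolding zs_def using o(2) by (cases "I rFX [e 0]") simp_all
  have i2: "I2 rLen = I1 rLen" "I2 rOA = I1 rOA" "I2 rOB = I1 rOB" by (simp_all add: I2_def)
  have o2: "outs N (ys @ zs) I2" using iffD2[OF outs_cong[OF i2] o1] .
  have cnd: "I2 rCnd [] \<longleftrightarrow> I rFX [e 0]" "I2 rA0 []" "I2 rA1 []" using FX by (simp_all add: I2_def)
  have R: "run N e p_item I = run N e (Assign rIdx 20 1 (Or (Con (Neg (FRel rSet [0])) (FRel rIdx [20]))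
       (Con (FRel rSet [0]) (Ex 21 (Con (FRel rIdx [21]) (Succ 22 21 20)))))) I3"
    by (simp only: p_item_def run.simps(2) I1_def I2_def I3_def)
  have "outs N (if I2 rCnd [] then (ys @ zs) @ [3] else ys @ zs) I3"
    unfolding I3_def by (rule run_app[OF o2 lz]) (simp add: cnd(2,3))
  then have o3: "outs N (ys @ (if I rFX [e 0] then bits c @ [3] else [])) I3"
    unfolding cnd(1) zs_def by (cases "I rFX [e 0]") simp_all
  have i3: "run N e p_item I rLen = I3 rLen" "run N e p_item I rOA = I3 rOA" "run N e p_item I rOB = I3 rOB"
    unfolding R by simp_all
  show "outs N (ys @ (if I rFX [e 0] then bits c @ [3] else [])) (run N e p_item I)"
    by (rule iffD2[OF outs_cong[OF i3] o3])
  have r3: "I3 r = I r" if "r \<notin> W_char" for r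
  proof -
    have "I3 r = I2 r" unfolding I3_def by (rule run_frame) (use that in \<open>simp add: p_app_def W_char_def\<close>)
    also have "\<dots> = I1 r" using that by (simp add: I2_def W_char_def)
    finally show ?thesis using r1[OF that] by simp
  qed
  have J3: "I3 rSet = I rSet" "I3 rIdx = I rIdx" by (rule r3, simp add: W_char_def)+
  show "run N e p_item I r = I r" if "r \<notin> insert rIdx W_char" unfolding R using r3[of r] that by simp
  show "run N e p_item I rIdx [x] \<longleftrightarrow> x = (if I rSet [e 0] then Suc c else c)" if x: "x < N"
  proof -
    have "run N e p_item I rIdx [x] \<longleftrightarrow> \<not> I rSet [e 0] \<and> x = c \<or> I rSet [e 0] \<and> (\<exists>y<N. y = c \<and> x = Suc y)"
      unfolding R using x by (simp add: upd_Cons J3 idx cong: conj_cong)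
    then show ?thesis using c by auto
  qed
qed

text \<open>Empty sets do not take part in the search, where an added set needs an element to be
  recognised as used. They are disjoint from everything and are added to the packing here.\<close>

definition p_out :: prog where
  "p_out = Assign rFX 20 1 (Or (FRel rS [20]) (Con (FRel rSet [20]) (Neg (Ex 21 (FRel rEl [20, 21]))))) ;;;
     Assign rOA 20 1 (FFalse 21) ;;; Assign rOB 20 1 (FFalse 21) ;;; Assign rLen 20 1 (Zero 21 20) ;;;
     Assign rIdx 20 1 (Zero 21 20) ;;; PFor 0 p_item ;;; Assign 0 20 1 (FRel rOA [20]) ;;; Assign 1 20 1 (FRel rOB [20])"

lemma run_out:
  assumes A: "arith N I" and st: "\<And>s. s < N \<Longrightarrow> I rSet [s] \<longleftrightarrow> (\<exists>i<m. s = sp i)"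
    and sp: "\<And>i j. j \<le> m \<Longrightarrow> i < j \<Longrightarrow> sp i < sp j" "\<And>i. i < m \<Longrightarrow> sp i < N"
    and Ch: "\<And>s. s < N \<Longrightarrow> I rS [s] \<or> I rSet [s] \<and> \<not> (\<exists>x<N. I rEl [s, x]) \<longleftrightarrow> s \<in> Ch" "Ch \<subseteq> sp ` {..<m}"
    and ys: "ys = enc_nats (filter (\<lambda>i. sp i \<in> Ch) [0..<m])" "length ys < N" and m: "Suc m < N" and x: "x < N"
  shows "run N e p_out I 0 [x] \<longleftrightarrow> x < length ys \<and> odd (ys ! x)" "run N e p_out I 1 [x] \<longleftrightarrow> x < length ys \<and> 2 \<le> ys ! x"
proof -
  define I1 where "I1 = run N e (Assign rIdx 20 1 (Zero 21 20)) (run N e (Assign rLen 20 1 (Zero 21 20))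
     (run N e (Assign rOB 20 1 (FFalse 21)) (run N e (Assign rOA 20 1 (FFalse 21))
     (run N e (Assign rFX 20 1 (Or (FRel rS [20]) (Con (FRel rSet [20]) (Neg (Ex 21 (FRel rEl [20, 21])))))) I))))"
  have N: "0 < N" using m by simp
  have fx: "I1 rFX [s] \<longleftrightarrow> s \<in> Ch" if "s < N" for s
    using Ch(1)[OF that] that by (simp add: I1_def upd_Cons)
  have st1: "I1 rSet [s] \<longleftrightarrow> (\<exists>i<m. s = sp i)" if "s < N" for s using st[OF that] by (simp add: I1_def)
  have A1: "arith N I1" by (rule arith_cong[OF _ A]) (auto simp: I1_def)
  have o1: "outs N [] I1" using N by (simp add: I1_def outs_def upd_Cons)
  have idx1: "I1 rIdx [x] \<longleftrightarrow> x = 0" if "x < N" for x using that N by (simp add: I1_def upd_Cons)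
  let ?ch = "\<lambda>i. sp i \<in> Ch"
  have pre: "length (enc_nats (filter ?ch [0..<c])) \<le> length ys" if "c \<le> m" for c
  proof -
    have "[0..<m] = [0..<c] @ [c..<m]" using that upt_add_eq_append[of 0 c "m - c"] by simp
    then show ?thesis unfolding ys(1) by simp
  qed
  \<comment> \<open>\<open>c\<close> counts the sets starting before position \<open>p\<close>; the
    buffer contains the chosen indices among them.\<close>
  let ?P = "\<lambda>p J. (\<forall>r. r \<notin> insert rIdx W_char \<longrightarrow> J r = I1 r) \<and>
    (\<exists>c\<le>m. (\<forall>i<m. sp i < p \<longleftrightarrow> i < c) \<and> (\<forall>x<N. J rIdx [x] \<longleftrightarrow> x = c) \<and> outs N (enc_nats (filter ?ch [0..<c])) J)"
  define J where "J = run N e (PFor 0 p_item) I1"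
  have "?P N J" unfolding J_def
  proof (rule run_For_inv[where P = ?P])
    show "?P 0 I1" using idx1 o1 by (intro conjI exI[of _ 0]) simp_all
  next
    fix p K assume p: "p < N" and P: "?P p K"
    have Kr: "K r = I1 r" if "r \<notin> insert rIdx W_char" for r using P that by blast
    obtain c where c: "c \<le> m" "\<forall>i<m. sp i < p \<longleftrightarrow> i < c" "\<forall>x<N. K rIdx [x] \<longleftrightarrow> x = c" "outs N (enc_nats (filter ?ch [0..<c])) K"
      using P by (elim conjE exE)
    let ?e = "e(0 := p)"
    have AK: "arith N K" by (rule arith_cong[OF _ A1]) (rule Kr, auto simp: W_char_def)
    have KF: "K rFX = I1 rFX" "K rSet = I1 rSet" by (rule Kr, simp add: W_char_def)+
    have set_c: "c < m \<and> sp c = p" if h: "\<exists>i<m. p = sp i"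
    proof -
      obtain i where i: "i < m" "p = sp i" using h by blast
      have "\<not> i < c" using c(2) i by blast
      moreover have "\<not> c < i" using c(2) i sp(1)[of i c] by auto
      ultimately show ?thesis using i by simp
    qed
    have ch_c: "c < m \<and> sp c = p" if "p \<in> Ch" using set_c Ch(2) that by blast
    have F: "K rFX [p] \<longleftrightarrow> p \<in> Ch" using fx[OF p] KF by simp
    have T: "K rSet [p] \<longleftrightarrow> (\<exists>i<m. p = sp i)" using st1[OF p] KF by simp
    have ext: "enc_nats (filter ?ch [0..<Suc c]) = enc_nats (filter ?ch [0..<c]) @ bits c @ [3]" if "p \<in> Ch"
      using ch_c[OF that] that by simp
    have len: "length (enc_nats (filter ?ch [0..<c])) + (if p \<in> Ch then Suc (length (bits c)) else 0) < N"
    proof (cases "p \<in> Ch")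
      case True
      then have "length (enc_nats (filter ?ch [0..<Suc c])) \<le> length ys" using pre[of "Suc c"] ch_c by simp
      then show ?thesis using ext[OF True] True ys(2) by simp
    next
      case False
      then show ?thesis using pre[OF c(1)] ys(2) by simp
    qed
    define K' where "K' = run N ?e p_item K"
    have cN: "c < N" "Suc c < N" using c(1) m by auto
    have idx: "\<And>x. x < N \<Longrightarrow> K rIdx [x] \<longleftrightarrow> x = c" using c(3) by blast
    have len': "length (enc_nats (filter ?ch [0..<c])) + (if K rFX [?e 0] then Suc (length (bits c)) else 0) < N"
      using len F by simp
    have it1: "outs N (enc_nats (filter ?ch [0..<c]) @ (if K rFX [?e 0] then bits c @ [3] else [])) K'"
      unfolding K'_def by (rule run_item(1)[where e = ?e, OF AK _ cN(1) c(4) len' cN(2)]) (rule idx)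
    have it2: "K' rIdx [x] \<longleftrightarrow> x = (if K rSet [?e 0] then Suc c else c)" if x: "x < N" for x
      unfolding K'_def by (rule run_item(2)[where e = ?e, OF AK _ cN(1) c(4) len' cN(2) x]) (rule idx)
    have it3: "K' r = K r" if r: "r \<notin> insert rIdx W_char" for r
      unfolding K'_def by (rule run_item(3)[where e = ?e, OF AK _ cN(1) c(4) len' cN(2) r]) (rule idx)
    have 1: "K' r = I1 r" if "r \<notin> insert rIdx W_char" for r using it3[OF that] Kr[OF that] by simp
    have o': "outs N (enc_nats (filter ?ch [0..<c]) @ (if p \<in> Ch then bits c @ [3] else [])) K'" using it1 F by simp
    have i': "K' rIdx [x] \<longleftrightarrow> x = (if \<exists>i<m. p = sp i then Suc c else c)" if "x < N" for x using it2[OF that] T by simp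
    have 2: "\<exists>c\<le>m. (\<forall>i<m. sp i < Suc p \<longleftrightarrow> i < c) \<and> (\<forall>x<N. K' rIdx [x] \<longleftrightarrow> x = c) \<and> outs N (enc_nats (filter ?ch [0..<c])) K'"
    proof (cases "\<exists>i<m. p = sp i")
      case True
      have c': "c < m" "sp c = p" using set_c[OF True] by auto
      have a: "\<forall>i<m. sp i < Suc p \<longleftrightarrow> i < Suc c"
      proof (intro allI impI)
        fix i assume i: "i < m"
        have "sp i = p \<longleftrightarrow> i = c" using sp(1)[of i c] sp(1)[of c i] c' i by (cases i c rule: linorder_cases) auto
        then show "sp i < Suc p \<longleftrightarrow> i < Suc c" using c(2) i by (auto simp: less_Suc_eq)
      qed
      have b: "\<forall>x<N. K' rIdx [x] \<longleftrightarrow> x = Suc c" using i' True by simp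
      have d: "outs N (enc_nats (filter ?ch [0..<Suc c])) K'"
      proof (cases "p \<in> Ch")
        case True
        then show ?thesis using o' ext by simp
      next
        case False
        then show ?thesis using o' c'(2) by simp
      qed
      show ?thesis using c'(1) a b d by (intro exI[of _ "Suc c"] conjI Suc_leI)
    next
      case False
      then have nC: "p \<notin> Ch" using Ch(2) by blast
      have a: "\<forall>i<m. sp i < Suc p \<longleftrightarrow> i < c" using c(2) False by (auto simp: less_Suc_eq)
      have b: "\<forall>x<N. K' rIdx [x] \<longleftrightarrow> x = c" using i' False by simp
      have d: "outs N (enc_nats (filter ?ch [0..<c])) K'" using o' nC by simp
      show ?thesis using c(1) a b d by (intro exI[of _ c] conjI)
    qed
    show "?P (Suc p) (run N ?e p_item K)" unfolding K'_def[symmetric] using 1 2 by blast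
  qed
  then obtain c where c: "c \<le> m" "\<forall>i<m. sp i < N \<longleftrightarrow> i < c" "outs N (enc_nats (filter ?ch [0..<c])) J" by blast
  have "c = m"
  proof (rule ccontr)
    assume "c \<noteq> m"
    then have "c < m" using c(1) by simp
    then show False using c(2) sp(2)[of c] by blast
  qed
  then have o: "outs N ys J" using c(3) ys(1) by simp
  have R: "run N e p_out I = run N e (Assign 1 20 1 (FRel rOB [20])) (run N e (Assign 0 20 1 (FRel rOA [20])) J)"
    by (simp only: p_out_def run.simps(2) J_def I1_def)
  show "run N e p_out I 0 [x] \<longleftrightarrow> x < length ys \<and> odd (ys ! x)" unfolding R using o x by (simp add: outs_def upd_Cons)
  show "run N e p_out I 1 [x] \<longleftrightarrow> x < length ys \<and> 2 \<le> ys ! x" unfolding R using o x by (simp add: outs_def upd_Cons)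
qed

definition p_main :: "nat \<Rightarrow> prog" where
  "p_main w = p_arith ;;; p_parse ;;; Assign rFne 20 1 (Con (FRel rSet [20]) (Ex 21 (FRel rEl [20, 21]))) ;;; p_search w ;;; p_out"

lemma wf_mono_test: "wf_prog 29 (arr w) (60 + w) 1 (p_test w)" "wf_prog 29 (arr w) (60 + w) 2 (p_test w)"
  using wf_p_test[of w] by (simp_all add: p_test_def)

lemma wf_main: "wf_prog 29 (arr w) (60 + w) 0 (p_main w)"
proof -
  have a: "wf_prog 29 (arr w) (60 + w) 0 p_arith"
    by (simp add: p_arith_def p_add_def p_mul_def p_exp_def p_dig_def p_bit_def p_pow_def arr_def rel_defs)
  have p: "wf_prog 29 (arr w) (60 + w) 0 p_parse"
    by (simp add: p_parse_def phi_in_def phi_same_def is3_def is4_def eqc_def arr_def rel_defs)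
  have s: "wf_prog 29 (arr w) (60 + w) 0 (p_search w)"
    using wf_mono_test[of w] wf_mono_test(2)[of w, unfolded numeral_2_eq_2] by (simp add: p_search_def p_round_def p_step_def phi_upd_def arr_def)
  have o: "wf_prog 29 (arr w) (60 + w) 0 p_out"
    by (simp add: p_out_def p_item_def p_char_def p_app_def mirror_def arr_def rel_defs)
  show ?thesis using a p s o by (simp add: p_main_def arr_def)
qed

section \<open>The approximation guarantee\<close>

lemma power_bracket:
  fixes a :: nat
  assumes "0 < a"
  obtains m where "a \<le> 2 ^ m" "2 ^ m \<le> 2 * a"
proof -
  define m where "m = (LEAST m. a \<le> 2 ^ m)"
  have ex: "a \<le> 2 ^ a" using less_exp[of a] by simp
  have 1: "a \<le> 2 ^ m" unfolding m_def by (rule LeastI[of "\<lambda>m. a \<le> 2 ^ m", OF ex])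
  have "2 ^ m \<le> 2 * a"
  proof (cases m)
    case 0
    then show ?thesis using assms by simp
  next
    case (Suc m')
    have "m' < (LEAST m. a \<le> 2 ^ m)" using Suc unfolding m_def[symmetric] by simp
    then have "\<not> a \<le> 2 ^ m'" by (rule not_less_Least[of m' "\<lambda>m. a \<le> 2 ^ m"])
    then show ?thesis using Suc by simp
  qed
  then show thesis using 1 that by blast
qed

lemma quad_le_exp: "(2 * l + 3) * (l + 4) \<le> (2::nat) ^ (l + 4)"
proof (induction l)
  case (Suc l)
  show ?case
  proof (cases l)
    case 0
    then show ?thesis by simp
  next
    case (Suc j)
    have "(2 * Suc l + 3) * (Suc l + 4) \<le> 2 * ((2 * l + 3) * (l + 4))"
      unfolding Suc by (simp add: algebra_simps)
    also have "\<dots> \<le> 2 * 2 ^ (l + 4)" using Suc.IH by (rule mult_le_mono2)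
    finally have "(2 * Suc l + 3) * (Suc l + 4) \<le> 2 ^ Suc (l + 4)" unfolding power_Suc .
    then show ?thesis by (simp only: add_Suc)
  qed
qed simp

text \<open>Put c = 2 (k C + 1). The hash size satisfies 2 ^ l \<le> c (m0 + 1), so every quantity
  is at most 2 ^ X with X = 2 m0 + 16 c (m0 + 1), apart from the smaller 2 t. From 2 ^ m0 \<le> (L +
  2) ^ 2 this power is at most (L + 2) ^ (48 c + 4); the exponent 48 c + 5 makes the bounds
  strict.\<close>

lemma size_bounds:
  fixes k C L t m0 :: nat
  defines "N \<equiv> (L + 2) ^ (48 * (2 * (k * C + 1)) + 5)"
  assumes k: "1 \<le> k" and m0: "L + 2 \<le> 2 ^ m0" "2 ^ m0 \<le> 2 * (L + 2)" and t: "t \<le> C * (m0 + 1)"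
  obtains l m where "k * t \<le> 2 ^ l" "L \<le> 2 ^ m" "2 * l + 3 \<le> m" "2 ^ (m + m) < N" "(2 ^ (2 * l + 3)) ^ (l + 4) < N"
    "2 ^ 2 ^ (l + 4) < N" "2 * t < N"
proof -
  define c where "c = 2 * (k * C + 1)"
  have a0: "0 < k * C * (m0 + 1) + 1" by simp
  obtain l where l: "k * C * (m0 + 1) + 1 \<le> 2 ^ l" "2 ^ l \<le> 2 * (k * C * (m0 + 1) + 1)"
    by (rule power_bracket[OF a0])
  define X where "X = 2 * m0 + 16 * c * (m0 + 1)"
  have "k * t \<le> k * (C * (m0 + 1))" using t by (rule mult_le_mono2)
  also have "\<dots> = k * C * (m0 + 1)" by (rule mult.assoc[symmetric])
  also have "\<dots> \<le> 2 ^ l" using l(1) by linarith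
  finally have kt: "k * t \<le> 2 ^ l" .
  have "2 * (k * C * (m0 + 1) + 1) \<le> c * (m0 + 1)" unfolding c_def by (simp add: algebra_simps)
  then have "(2::nat) ^ l \<le> c * (m0 + 1)" using l(2) by linarith
  then have "16 * (2::nat) ^ l \<le> 16 * (c * (m0 + 1))" by simp
  then have l4: "(2::nat) ^ (l + 4) \<le> 16 * c * (m0 + 1)" unfolding mult.assoc[symmetric] power_add by simp
  have q: "(2 * l + 3) * (l + 4) \<le> (2::nat) ^ (l + 4)" by (rule quad_le_exp)
  have "(2 * l + 3) * 2 \<le> (2 * l + 3) * (l + 4)" by (rule mult_le_mono2) simp
  then have q2: "(2 * l + 3) * 2 \<le> (2::nat) ^ (l + 4)" using q by linarith
  define m where "m = max m0 (2 * l + 3)"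
  have m: "m + m \<le> X" using q2 l4 unfolding m_def X_def by (simp add: max_def)
  have XN: "2 ^ X < N"
  proof -
    have "X = m0 * (2 + 16 * c) + 16 * c" by (simp add: X_def algebra_simps)
    then have "(2::nat) ^ X = (2 ^ m0) ^ (2 + 16 * c) * 2 ^ (16 * c)" by (simp only: power_add power_mult)
    also have "\<dots> \<le> ((L + 2) ^ 2) ^ (2 + 16 * c) * (L + 2) ^ (16 * c)"
    proof (rule mult_le_mono)
      have "(2::nat) * (L + 2) \<le> (L + 2) * (L + 2)" by (rule mult_le_mono1) simp
      then have "2 ^ m0 \<le> (L + 2) ^ 2" using m0(2) by (simp add: power2_eq_square)
      then show "(2 ^ m0) ^ (2 + 16 * c) \<le> ((L + 2) ^ 2) ^ (2 + 16 * c)" by (rule power_mono) simp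
      show "2 ^ (16 * c) \<le> (L + 2) ^ (16 * c)" by (rule power_mono) simp_all
    qed
    also have "\<dots> = (L + 2) ^ (2 * (2 + 16 * c) + 16 * c)" by (simp only: power_add power_mult)
    also have "\<dots> = (L + 2) ^ (48 * c + 4)" by (rule arg_cong[where f = "\<lambda>x. (L + 2) ^ x"]) simp
    also have "\<dots> < (L + 2) ^ (48 * c + 5)" by (rule power_strict_increasing) simp_all
    finally show ?thesis unfolding N_def c_def .
  qed
  have pX: "2 ^ x < N" if "x \<le> X" for x
  proof -
    have "(2::nat) ^ x \<le> 2 ^ X" using that by (rule power_increasing) simp
    then show ?thesis using XN by linarith
  qed
  show thesis
  proof (rule that[of l m])
    show "k * t \<le> 2 ^ l" by (rule kt)
    have "(2::nat) ^ m0 \<le> 2 ^ m" by (rule power_increasing) (simp_all add: m_def)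
    then show "L \<le> 2 ^ m" using m0(1) by linarith
    show "2 * l + 3 \<le> m" by (simp add: m_def)
    show "2 ^ (m + m) < N" by (rule pX[OF m])
    have "(2 * l + 3) * (l + 4) \<le> X" using q l4 unfolding X_def by linarith
    then show "(2 ^ (2 * l + 3)) ^ (l + 4) < N" unfolding power_mult[symmetric] by (rule pX)
    have "2 ^ (l + 4) \<le> X" using l4 unfolding X_def by linarith
    then show "2 ^ 2 ^ (l + 4) < N" by (rule pX)
    have "t \<le> k * t" using k by simp
    then have "2 * t \<le> 2 * 2 ^ l" using kt by linarith
    also have "\<dots> \<le> (2::nat) ^ (l + 4)" by (simp add: power_add)
    also have "\<dots> < 2 ^ 2 ^ (l + 4)" by (rule less_exp)
    finally show "2 * t < N" using \<open>2 ^ 2 ^ (l + 4) < N\<close> by linarith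
  qed
qed

text \<open>Pairwise disjoint sets that meet \<open>E\<close> can be told apart by a point of
  \<open>E\<close>. Used for both packings, this yields the two degree bounds of
  \<open>conflict\<close>.\<close>

lemma count_hits:
  assumes E: "finite E" and disj: "\<forall>x\<in>T. \<forall>y\<in>T. x \<noteq> y \<longrightarrow> El x \<inter> El y = {}"
  shows "card {x\<in>T. El x \<inter> E \<noteq> {}} \<le> card E"
proof -
  define g where "g x = (SOME z. z \<in> El x \<inter> E)" for x
  have g: "g x \<in> El x \<inter> E" if "El x \<inter> E \<noteq> {}" for x
  proof -
    have "\<exists>z. z \<in> El x \<inter> E" using that by (simp only: ex_in_conv not_False_eq_True)
    then show ?thesis unfolding g_def by (rule someI_ex)
  qed
  show ?thesis
  proof (rule card_inj_on_le[of g])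
    show "inj_on g {x\<in>T. El x \<inter> E \<noteq> {}}"
    proof (rule inj_onI)
      fix x y assume x: "x \<in> {x\<in>T. El x \<inter> E \<noteq> {}}" and y: "y \<in> {x\<in>T. El x \<inter> E \<noteq> {}}" and e: "g x = g y"
      have xT: "x \<in> T" "El x \<inter> E \<noteq> {}" and yT: "y \<in> T" "El y \<inter> E \<noteq> {}" using x y by simp_all
      have z: "g x \<in> El x" "g x \<in> El y" using g[OF xT(2)] g[OF yT(2)] e by simp_all
      show "x = y"
      proof (rule ccontr)
        assume "x \<noteq> y"
        then have "El x \<inter> El y = {}" using disj xT(1) yT(1) by simp
        then show False using z by blast
      qed
    qed
    show "g ` {x\<in>T. El x \<inter> E \<noteq> {}} \<subseteq> E" using g by blast
  qed (rule E)
qed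

text \<open>If \<open>B\<close> were too large, the conflict graph of \<open>S\<close> and
  \<open>B\<close> would have a short process of gain 1. By completeness the test would succeed with
  the candidates \<open>B\<close>, and by monotonicity with all candidates, against local
  optimality.\<close>

lemma local_optimum_bound:
  fixes k C L w :: nat and S Fn :: "nat set" and El :: "nat \<Rightarrow> nat set"
  defines "N \<equiv> (L + 2) ^ (48 * (2 * (k * C + 1)) + 5)"
  assumes big: "\<And>(A::nat set) (B::nat set) Nb m. conflict A B Nb k \<Longrightarrow> (real k + 1 + \<epsilon>) * real (card A) < 3 * real (card B) \<Longrightarrow>
      card A < 2 ^ m \<Longrightarrow> \<exists>t P X. t \<le> C * (m + 1) \<and> preach A Nb B w t P X 1"
    and k: "2 \<le> k" and Fn: "Fn \<subseteq> {..<L}" "\<And>x. x \<in> Fn \<Longrightarrow> El x \<noteq> {}"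
    and El: "\<And>x. El x \<subseteq> {..<L}" "\<And>x. card (El x) \<le> k"
    and S: "S \<subseteq> Fn" "\<forall>x\<in>S. \<forall>y\<in>S. x \<noteq> y \<longrightarrow> El x \<inter> El y = {}" "\<not> tst N D w El S Fn"
    and B: "B \<subseteq> Fn" "\<forall>x\<in>B. \<forall>y\<in>B. x \<noteq> y \<longrightarrow> El x \<inter> El y = {}"
    and D1: "\<And>A q u a. D A q u a \<Longrightarrow> A div q ^ u mod q = a"
    and D2: "\<And>A q u a. A < N \<Longrightarrow> q < N \<Longrightarrow> u < N \<Longrightarrow> a < N \<Longrightarrow> 0 < q \<Longrightarrow> q ^ u < N \<Longrightarrow> A div q ^ u mod q = a \<Longrightarrow> D A q u a"
  shows "3 * real (card B) \<le> (real k + 1 + \<epsilon>) * real (card S)"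
proof (rule ccontr)
  assume "\<not> ?thesis"
  then have lt: "(real k + 1 + \<epsilon>) * real (card S) < 3 * real (card B)" by simp
  let ?Nb = "\<lambda>b. {s\<in>S. El s \<inter> El b \<noteq> {}}"
  have fin: "finite S" "finite B" using S(1) B(1) Fn(1) by (meson finite_lessThan finite_subset subset_trans)+
  have fE: "finite (El x)" for x using El(1)[of x] finite_subset by blast
  have c1: "?Nb b \<subseteq> S" "card (?Nb b) \<le> k" for b
  proof -
    have "card (?Nb b) \<le> card (El b)" by (rule count_hits[OF fE S(2)])
    then show "card (?Nb b) \<le> k" using El(2)[of b] by linarith
  qed blast
  have c2: "card {b\<in>B. a \<in> ?Nb b} \<le> k" if "a \<in> S" for a
  proof -
    have "{b\<in>B. a \<in> ?Nb b} = {b\<in>B. El b \<inter> El a \<noteq> {}}" using that by blast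
    also have "card \<dots> \<le> card (El a)" by (rule count_hits[OF fE B(2)])
    finally show ?thesis using El(2)[of a] by linarith
  qed
  have conf: "conflict S B ?Nb k" by unfold_locales (use fin c1 c2 k in auto)
  have L2: "0 < L + 2" by simp
  obtain m0 where m0: "L + 2 \<le> 2 ^ m0" "2 ^ m0 \<le> 2 * (L + 2)" by (rule power_bracket[OF L2])
  have "card S \<le> card {..<L}" using S(1) Fn(1) by (intro card_mono) auto
  then have cS: "card S < 2 ^ m0" using m0(1) by simp
  obtain t P X where t: "t \<le> C * (m0 + 1)" "preach S ?Nb B w t P X 1" using big[OF conf lt cS] by blast
  have k1: "1 \<le> k" using k by simp
  obtain l m where lm: "k * t \<le> 2 ^ l" "L \<le> 2 ^ m" "2 * l + 3 \<le> m" "2 ^ (m + m) < N" "(2 ^ (2 * l + 3)) ^ (l + 4) < N"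
    "2 ^ 2 ^ (l + 4) < N" "2 * t < N"
    by (rule size_bounds[OF k1 m0 t(1), folded N_def])
  have "tst N D w El S B"
  proof (rule tst_complete[OF t(2), where L = L and k = k and l = l and m = m])
    show "S \<subseteq> {..<L}" "B \<subseteq> {..<L}" using S(1) B(1) Fn(1) by blast+
    show "El x \<noteq> {}" if "x \<in> B" for x using Fn(2) B(1) that by blast
    show "El x \<inter> El y = {}" if "x \<in> B" "y \<in> B" "x \<noteq> y" for x y using B(2) that by blast
    show "D A q u a" if "A < N" "q < N" "u < N" "a < N" "0 < q" "q ^ u < N" "A div q ^ u mod q = a" for A q u a
      by (rule D2[OF that])
  qed (rule El D1 lm, assumption?)+
  then have "tst N D w El S Fn" by (rule tst_mono[OF B(1)])
  then show False using S(3) by blast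
qed

text \<open>An assigned relation holds only for tuples within range. This makes the soundness of
  digits unconditional, as needed for the soundness of colours.\<close>

lemma dig_tup: "run N e p_arith I RDig xs \<Longrightarrow> xs \<in> tup N 4"
  by (simp add: p_arith_def p_dig_def p_bit_def p_pow_def rel_defs)

lemma writes_arith: "writes p_arith = {3, 4, 5, 11, 12, 25}"
  by (auto simp: p_arith_def p_add_def p_mul_def p_exp_def p_dig_def p_bit_def p_pow_def rel_defs)

lemma length_enc_instance_ge: "length xss \<le> length (enc_instance n xss)"
proof -
  have "length xss \<le> length (concat (map (\<lambda>xs. 4 # enc_nats xs) xss))" by (induction xss) auto
  then show ?thesis unfolding enc_instance_blocks by simp
qed

lemma main_output:
  fixes k C w n :: nat and xss :: "nat list list" and \<epsilon> :: real
  defines "inp \<equiv> enc_instance n xss"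
  defines "N \<equiv> (length inp + 2) ^ (48 * (2 * (k * C + 1)) + 5)"
  assumes eps: "0 < \<epsilon>" and k: "3 \<le> k"
    and big: "\<forall>(A::nat set) (B::nat set) Nb m. conflict A B Nb k \<longrightarrow> (real k + 1 + \<epsilon>) * real (card A) < 3 * real (card B) \<longrightarrow>
      card A < 2 ^ m \<longrightarrow> (\<exists>t P X. t \<le> C * (m + 1) \<and> preach A Nb B w t P X 1)"
    and v: "valid_instance k n xss"
  shows "\<exists>is. set is \<subseteq> {..<length xss} \<and> length (enc_nats is) < N \<and>
    (\<forall>i\<le>length (enc_nats is).
      (run N z0 (p_main w) (I0 inp) 0 [i] \<longleftrightarrow> i < length (enc_nats is) \<and> odd (enc_nats is ! i)) \<and>
      (run N z0 (p_main w) (I0 inp) 1 [i] \<longleftrightarrow> i < length (enc_nats is) \<and> 2 \<le> enc_nats is ! i)) \<and>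
    is_packing (set ` set xss) ((\<lambda>i. set (xss ! i)) ` set is) \<and>
    real (opt_packing (set ` set xss)) \<le> (real k + 1 + \<epsilon>) / 3 * real (card ((\<lambda>i. set (xss ! i)) ` set is))"
proof -
  define L where "L = length inp"
  define f where "f = symb inp"
  define m where "m = length xss"
  define sp where "sp = spos n xss"
  define El where "El = Elt f"
  have inp4: "set inp \<subseteq> {1..4}" unfolding inp_def by (rule set_enc_instance)
  have mL: "m \<le> L" unfolding m_def L_def inp_def by (rule length_enc_instance_ge)
  have N2: "(L + 2) * (L + 2) \<le> N"
  proof -
    have "(L + 2) ^ 2 \<le> N" unfolding N_def L_def[symmetric] by (rule power_increasing) simp_all
    then show ?thesis by (simp add: power2_eq_square)
  qed
  have "2 * (L + 2) \<le> (L + 2) * (L + 2)" by (rule mult_le_mono1) simp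
  then have NL: "2 * (L + 2) \<le> N" using N2 by linarith
  have NL2: "L + 4 \<le> N" using NL by simp
  then have LN1: "L < N" and N3: "3 \<le> N" and N0: "0 < N" by simp_all
  have mN: "Suc m < N" using NL2 mL by simp
  note Nn = LN1 N3 mN N0
  obtain cn where cn: "inj_on cn (\<Union>(set ` set xss))" "\<And>v. v \<in> \<Union>(set ` set xss) \<Longrightarrow> cn v < L"
    "\<And>i. i < m \<Longrightarrow> El (sp i) = cn ` set (xss ! i)"
    using instance_elements[of xss n] unfolding El_def f_def inp_def sp_def m_def L_def by blast
  have sub: "set (xss ! i) \<subseteq> \<Union>(set ` set xss)" if "i < m" for i
    using that unfolding m_def by (intro Union_upper imageI nth_mem)
  have vi: "sorted_wrt (<) (xss ! i)" "length (xss ! i) \<le> k" if "i < m" for i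
    using v that nth_mem[of i xss] unfolding valid_instance_def m_def by blast+
  have dx: "distinct xss" using v unfolding valid_instance_def by blast
  have sp_less: "j \<le> m \<Longrightarrow> i < j \<Longrightarrow> sp i < sp j" for i j unfolding sp_def m_def by (rule spos_less)
  have inj_sp: "i = j" if "i < m" "j < m" "sp i = sp j" for i j
    using sp_less[of i j] sp_less[of j i] that by (cases i j rule: linorder_cases) auto
  have pos: "setpos f s \<longleftrightarrow> (\<exists>i<m. s = sp i)" for s unfolding f_def inp_def sp_def m_def by (rule setpos_iff)
  have posL: "s < L" if "setpos f s" for s
    using that symb_less[of inp s] unfolding setpos_def f_def L_def by simp
  have spL: "sp i < L" if "i < m" for i using posL pos that by blast
  have El0: "El x = {}" if "\<not> setpos f x" for x using that unfolding El_def Elt_def by blast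
  have ElL: "El x \<subseteq> {..<L}" and ElK: "card (El x) \<le> k" for x
  proof -
    have "El x \<subseteq> {..<L} \<and> card (El x) \<le> k"
    proof (cases "setpos f x")
      case True
      then obtain i where i: "i < m" "x = sp i" using pos by blast
      have "card (El x) \<le> card (set (xss ! i))" unfolding i(2) cn(3)[OF i(1)] by (rule card_image_le) simp
      also have "\<dots> \<le> length (xss ! i)" by (rule card_length)
      finally have "card (El x) \<le> k" using vi(2)[OF i(1)] by linarith
      moreover have "El x \<subseteq> {..<L}" unfolding i(2) cn(3)[OF i(1)]
        by (intro image_subsetI lessThan_iff[THEN iffD2] cn(2) subsetD[OF sub[OF i(1)]])
      ultimately show ?thesis by blast
    qed (simp add: El0)
    then show "El x \<subseteq> {..<L}" "card (El x) \<le> k" by blast+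
  qed
  have ElN: "El x \<subseteq> {..<N}" for x using ElL[of x] Nn(1) by auto
  define Fn where "Fn = {s. setpos f s \<and> El s \<noteq> {}}"
  have FnL: "Fn \<subseteq> {..<L}" using posL unfolding Fn_def by blast
  then have FnN: "Fn \<subseteq> {..<N}" using Nn(1) by auto
  have "card Fn \<le> card {..<L}" using FnL by (intro card_mono) auto
  then have cFn: "card Fn < N" using Nn(1) by simp
  have Fn0: "0 \<notin> Fn" unfolding Fn_def using pos spos_pos[of n xss] unfolding sp_def by (metis (mono_tags, lifting) less_numeral_extra(3) mem_Collect_eq)
  have Fne: "\<And>x. x \<in> Fn \<Longrightarrow> El x \<noteq> {}" unfolding Fn_def by blast

  define I1 where "I1 = run N z0 p_arith (I0 inp)"
  define I2 where "I2 = run N z0 p_parse I1"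
  define I3 where "I3 = run N z0 (Assign rFne 20 1 (Con (FRel rSet [20]) (Ex 21 (FRel rEl [20, 21])))) I2"
  define I4 where "I4 = run N z0 (p_search w) I3"
  have A1: "arith N I1" unfolding I1_def
  proof (rule p_arith_spec[OF Nn(2)])
    fix r :: nat and xs assume "3 \<le> r"
    then show "\<not> I0 inp r xs" using mem0_ge3[OF inp4] unfolding I0_def by blast
  qed
  have in1: "I1 r [i] \<longleftrightarrow> mem0 inp r i" if "r < 3" for r i
  proof -
    have "I1 r = I0 inp r" unfolding I1_def by (rule run_frame) (use that writes_arith in auto)
    then show ?thesis by (simp add: I0_def)
  qed
  have LN: "length inp < N" using Nn(1) unfolding L_def .
  have set2: "I2 rSet [s] \<longleftrightarrow> setpos f s" if "s < N" for s
    unfolding I2_def f_def by (rule run_parse(1)[OF A1 inp4 in1 LN that])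
  have el2: "I2 rEl [s, x] \<longleftrightarrow> x \<in> El s" if "s < N" "x < N" for s x
    unfolding I2_def f_def El_def by (rule run_parse(2)[OF A1 inp4 in1 LN that])
  have r2: "I2 r = I1 r" if "r \<notin> {rSet, rIn, rSame, rEl}" for r
    unfolding I2_def by (rule run_frame) (use that writes_parse in simp)
  have r3: "I3 r = I2 r" if "r \<noteq> rFne" for r using that by (simp add: I3_def)
  have A3: "arith N I3"
    by (rule arith_cong[OF _ A1]) (use r2 r3 in auto)
  have fne3: "I3 rFne [s] \<longleftrightarrow> s \<in> Fn" if "s < N" for s
  proof -
    have "I3 rFne [s] \<longleftrightarrow> I2 rSet [s] \<and> (\<exists>x<N. I2 rEl [s, x])" unfolding I3_def using that by (simp add: upd_Cons)
    also have "\<dots> \<longleftrightarrow> s \<in> Fn" unfolding Fn_def using set2[OF that] el2[OF that] ElN[of s] by auto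
    finally show ?thesis .
  qed
  have el3: "I3 rEl [s, x] \<longleftrightarrow> x \<in> El s" if "s < N" "x < N" for s x using el2[OF that] r3[of rEl] by simp
  let ?D = "\<lambda>A q u a. I3 RDig [A, q, u, a]"
  obtain S where S: "S \<subseteq> Fn" "\<forall>s<N. I4 rS [s] \<longleftrightarrow> s \<in> S" "\<forall>x\<in>S. \<forall>y\<in>S. x \<noteq> y \<longrightarrow> El x \<inter> El y = {}" "\<not> tst N ?D w El S Fn"
  proof -
    assume *: "\<And>S. S \<subseteq> Fn \<Longrightarrow> \<forall>s<N. I4 rS [s] \<longleftrightarrow> s \<in> S \<Longrightarrow> \<forall>x\<in>S. \<forall>y\<in>S. x \<noteq> y \<longrightarrow> El x \<inter> El y = {} \<Longrightarrow>
      \<not> tst N ?D w El S Fn \<Longrightarrow> thesis"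
    have "\<exists>S\<subseteq>Fn. (\<forall>s<N. I4 rS [s] \<longleftrightarrow> s \<in> S) \<and> (\<forall>x\<in>S. \<forall>y\<in>S. x \<noteq> y \<longrightarrow> El x \<inter> El y = {}) \<and> \<not> tst N ?D w El S Fn"
      unfolding I4_def by (rule run_search[OF A3 _ _ FnN Fn0 _ cFn ElN]) (rule el3 fne3 Fne; assumption)+
    then show thesis by (elim exE conjE) (rule *)
  qed
  have r4: "I4 r = I3 r" if "r \<notin> W_search" for r
    unfolding I4_def by (rule run_frame) (use that writes_search in simp)
  have A4: "arith N I4" by (rule arith_cong[OF _ A3]) (rule r4, auto simp: W_search_def)
  have D: "I3 RDig = I1 RDig" using r2[of RDig] r3[of RDig] by (simp add: rel_defs)
  have D1: "A div q ^ u mod q = a" if d: "?D A q u a" for A q u a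
  proof -
    have "[A, q, u, a] \<in> tup N 4" using d unfolding D I1_def by (rule dig_tup)
    then have b: "A < N" "q < N" "u < N" "a < N" by simp_all
    show ?thesis using conjunct1[OF conjunct2[OF A3[unfolded arith_def]], rule_format, OF b] d by blast
  qed
  have D2: "?D A q u a" if "A < N" "q < N" "u < N" "a < N" "0 < q" "q ^ u < N" "A div q ^ u mod q = a" for A q u a
    using conjunct1[OF conjunct2[OF A3[unfolded arith_def]], rule_format, OF that(1-4)] that(5-7) by blast

  \<comment> \<open>Empty sets are split off. All of them are output, and an optimum contains at
    most all of them; since the ratio is at least 1, the guarantee for nonempty sets carries
    over.\<close>
  define E0 where "E0 = {i\<in>{..<m}. set (xss ! i) = {}}"
  define Is where "Is = {i\<in>{..<m}. sp i \<in> S}"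
  define Ch where "Ch = S \<union> sp ` E0"
  define "is" where "is = filter (\<lambda>i. sp i \<in> Ch) [0..<m]"
  have SI: "S = sp ` Is"
  proof
    show "S \<subseteq> sp ` Is"
    proof
      fix s assume s: "s \<in> S"
      then obtain i where "i < m" "s = sp i" using S(1) pos unfolding Fn_def by blast
      then show "s \<in> sp ` Is" using s unfolding Is_def by blast
    qed
  qed (auto simp: Is_def)
  have set_is: "set is = Is \<union> E0"
  proof -
    have "sp i \<in> sp ` E0 \<longleftrightarrow> i \<in> E0" if "i < m" for i using inj_sp[OF that] that unfolding E0_def by blast
    then show ?thesis unfolding is_def Ch_def Is_def E0_def by auto
  qed
  have isE: "i \<notin> E0" if "i \<in> Is" for i
    using that S(1) cn(3)[of i] unfolding Is_def E0_def Fn_def by auto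
  have ChP: "I4 rS [s] \<or> I4 rSet [s] \<and> \<not> (\<exists>x<N. I4 rEl [s, x]) \<longleftrightarrow> s \<in> Ch" if s: "s < N" for s
  proof -
    have a: "I4 rSet = I2 rSet" "I4 rEl = I2 rEl" using r4 r3 by (simp_all add: W_search_def)
    have "(\<exists>x<N. I4 rEl [s, x]) \<longleftrightarrow> El s \<noteq> {}" unfolding a using el2[OF s] ElN[of s] by auto
    moreover have "setpos f s \<and> \<not> El s \<noteq> {} \<longleftrightarrow> s \<in> sp ` E0"
    proof -
      have "setpos f s \<and> \<not> El s \<noteq> {} \<longleftrightarrow> (\<exists>i<m. s = sp i \<and> set (xss ! i) = {})" unfolding pos using cn(3) by auto
      then show ?thesis unfolding E0_def by auto
    qed
    moreover have "I4 rSet [s] \<longleftrightarrow> setpos f s" unfolding a by (rule set2[OF s])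
    moreover have "I4 rS [s] \<longleftrightarrow> s \<in> S" using S(2) s by blast
    ultimately show ?thesis unfolding Ch_def by simp
  qed
  have Chs: "Ch \<subseteq> sp ` {..<m}" 
  proof -
    have "Is \<subseteq> {..<m}" "E0 \<subseteq> {..<m}" by (auto simp: Is_def E0_def)
    then show ?thesis unfolding Ch_def using SI by blast
  qed
  have len: "length (enc_nats is) < N"
  proof -
    have "length (enc_nats is) \<le> length is * (m + 1)" by (rule length_enc_nats) (auto simp: is_def)
    also have "\<dots> \<le> m * (m + 1)" using length_filter_le[of "\<lambda>i. sp i \<in> Ch" "[0..<m]"] unfolding is_def by (intro mult_le_mono1) simp
    also have "\<dots> \<le> L * (L + 1)" using mL by (intro mult_le_mono) simp_all
    also have "\<dots> < (L + 2) * (L + 2)" by (simp add: algebra_simps)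
    finally show ?thesis using N2 by linarith
  qed
  have main: "run N z0 (p_main w) (I0 inp) = run N z0 p_out I4"
    by (simp only: p_main_def run.simps(2) I4_def I3_def I2_def I1_def)
  have out: "(run N z0 (p_main w) (I0 inp) 0 [x] \<longleftrightarrow> x < length (enc_nats is) \<and> odd (enc_nats is ! x)) \<and>
      (run N z0 (p_main w) (I0 inp) 1 [x] \<longleftrightarrow> x < length (enc_nats is) \<and> 2 \<le> enc_nats is ! x)" if x: "x \<le> length (enc_nats is)" for x
  proof -
    have s4: "I4 rSet [s] \<longleftrightarrow> (\<exists>i<m. s = sp i)" if "s < N" for s
      using set2[OF that] pos r4[of rSet] r3[of rSet] by (simp add: W_search_def)
    have spN: "sp i < N" if "i < m" for i using spL[OF that] Nn(1) by linarith
    have xN: "x < N" using x len by linarith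
    have e: "enc_nats is = enc_nats (filter (\<lambda>i. sp i \<in> Ch) [0..<m])" by (simp only: is_def)
    show ?thesis unfolding main
      by (intro conjI run_out[OF A4 _ _ _ _ Chs e len Nn(3) xN]) (rule s4 sp_less spN ChP; assumption)+
  qed
  have inj_set: "inj_on (\<lambda>i. set (xss ! i)) {..<m}"
  proof (rule inj_onI)
    fix i j assume i: "i \<in> {..<m}" and j: "j \<in> {..<m}" and e: "set (xss ! i) = set (xss ! j)"
    have "xss ! i = xss ! j" using vi(1)[of i] vi(1)[of j] i j e by (intro strict_sorted_equal) auto
    then show "i = j" using dx i j nth_eq_iff_index_eq unfolding m_def by auto
  qed
  have disj_iff: "El (sp i) \<inter> El (sp j) = {} \<longleftrightarrow> set (xss ! i) \<inter> set (xss ! j) = {}" if "i < m" "j < m" for i j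
    unfolding cn(3)[OF that(1)] cn(3)[OF that(2)] inj_on_image_Int[OF cn(1) sub[OF that(1)] sub[OF that(2)], symmetric] by simp
  have isub: "set is \<subseteq> {..<m}" unfolding is_def by auto
  have pack: "is_packing (set ` set xss) ((\<lambda>i. set (xss ! i)) ` set is)"
    unfolding is_packing_def
  proof
    show "(\<lambda>i. set (xss ! i)) ` set is \<subseteq> set ` set xss" using isub unfolding m_def by auto
    show "pairwise disjnt ((\<lambda>i. set (xss ! i)) ` set is)"
    proof (rule pairwiseI)
      fix a b assume "a \<in> (\<lambda>i. set (xss ! i)) ` set is" "b \<in> (\<lambda>i. set (xss ! i)) ` set is" "a \<noteq> b"
      then obtain i j where ij: "i \<in> set is" "j \<in> set is" "a = set (xss ! i)" "b = set (xss ! j)" "i \<noteq> j" by blast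
      have l: "i < m" "j < m" using ij(1,2) isub by auto
      show "disjnt a b"
      proof (cases "i \<in> E0 \<or> j \<in> E0")
        case True
        then show ?thesis unfolding ij(3,4) E0_def disjnt_def by auto
      next
        case False
        then have "sp i \<in> S" "sp j \<in> S" using ij(1,2) unfolding set_is Is_def by auto
        moreover have "sp i \<noteq> sp j" using inj_sp[OF l] ij(5) by blast
        ultimately have "El (sp i) \<inter> El (sp j) = {}" using S(3) by blast
        then show ?thesis unfolding ij(3,4) disjnt_def using disj_iff[OF l] by blast
      qed
    qed
  qed
  let ?q = "(real k + 1 + \<epsilon>) / 3"
  have q1: "1 \<le> ?q" using k eps by simp
  have fI: "finite Is" "finite E0" unfolding Is_def E0_def by simp_all
  have card_is: "card ((\<lambda>i. set (xss ! i)) ` set is) = card Is + card E0"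
  proof -
    have "card ((\<lambda>i. set (xss ! i)) ` set is) = card (set is)" by (rule card_image) (rule inj_on_subset[OF inj_set isub])
    also have "\<dots> = card Is + card E0" unfolding set_is using fI isE by (intro card_Un_disjoint) auto
    finally show ?thesis .
  qed
  have inj_on_sp: "inj_on sp I" if "I \<subseteq> {..<m}" for I using inj_sp that by (intro inj_onI) blast
  have cardS: "card S = card Is" unfolding SI by (rule card_image) (rule inj_on_sp, auto simp: Is_def)
  have opt: "real (card P) \<le> ?q * real (card ((\<lambda>i. set (xss ! i)) ` set is))" if P: "is_packing (set ` set xss) P" for P
  proof -
    define Ip where "Ip = {i\<in>{..<m}. set (xss ! i) \<in> P}"
    have Ipm: "Ip \<subseteq> {..<m}" unfolding Ip_def by blast
    have "P = (\<lambda>i. set (xss ! i)) ` Ip"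
    proof
      show "P \<subseteq> (\<lambda>i. set (xss ! i)) ` Ip"
      proof
        fix p assume p: "p \<in> P"
        then obtain xs where xs: "xs \<in> set xss" "p = set xs" using P unfolding is_packing_def by blast
        obtain i where "i < m" "xss ! i = xs" using xs(1) unfolding in_set_conv_nth m_def by blast
        then show "p \<in> (\<lambda>i. set (xss ! i)) ` Ip" using p xs(2) unfolding Ip_def by blast
      qed
    qed (auto simp: Ip_def)
    then have cP: "card P = card Ip" using card_image[OF inj_on_subset[OF inj_set Ipm]] by simp
    have fIp: "finite Ip" using Ipm finite_subset by blast
    let ?B = "sp ` (Ip - E0)"
    have cB: "card ?B = card (Ip - E0)" by (rule card_image, rule inj_on_sp) (use Ipm in blast)
    have "3 * real (card ?B) \<le> (real k + 1 + \<epsilon>) * real (card S)"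
    proof (rule local_optimum_bound[where L = L and C = C and w = w and D = ?D and El = El and Fn = Fn])
      show "2 \<le> k" using k by simp
      show "?B \<subseteq> Fn"
      proof
        fix s assume "s \<in> ?B"
        then obtain i where i: "i < m" "i \<notin> E0" "s = sp i" using Ipm by blast
        then have "El s \<noteq> {}" using cn(3)[OF i(1)] unfolding E0_def by auto
        then show "s \<in> Fn" unfolding Fn_def using pos i by blast
      qed
      show "\<forall>x\<in>?B. \<forall>y\<in>?B. x \<noteq> y \<longrightarrow> El x \<inter> El y = {}"
      proof (intro ballI impI)
        fix x y assume "x \<in> ?B" "y \<in> ?B" and xy: "x \<noteq> y"
        then obtain i j where ij: "i \<in> Ip" "j \<in> Ip" "x = sp i" "y = sp j" by blast
        have l: "i < m" "j < m" using ij(1,2) Ipm by auto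
        have "i \<noteq> j" using xy ij by blast
        then have "set (xss ! i) \<noteq> set (xss ! j)" using inj_set l unfolding inj_on_def by blast
        moreover have "set (xss ! i) \<in> P" "set (xss ! j) \<in> P" using ij(1,2) unfolding Ip_def by blast+
        ultimately have "disjnt (set (xss ! i)) (set (xss ! j))" using P unfolding is_packing_def pairwise_def by blast
        then show "El x \<inter> El y = {}" unfolding ij(3,4) disj_iff[OF l] disjnt_def .
      qed
      show "\<not> tst ((L + 2) ^ (48 * (2 * (k * C + 1)) + 5)) ?D w El S Fn"
        using S(4) unfolding N_def L_def .
      show "\<exists>t P X. t \<le> C * (m + 1) \<and> preach A Nb B w t P X 1"
        if "conflict A B Nb k" "(real k + 1 + \<epsilon>) * real (card A) < 3 * real (card B)" "card A < 2 ^ m" for A B :: "nat set" and Nb m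
        by (rule big[rule_format, OF that])
      show "?D A q u a" if "A < (L + 2) ^ (48 * (2 * (k * C + 1)) + 5)" "q < (L + 2) ^ (48 * (2 * (k * C + 1)) + 5)"
        "u < (L + 2) ^ (48 * (2 * (k * C + 1)) + 5)" "a < (L + 2) ^ (48 * (2 * (k * C + 1)) + 5)" "0 < q"
        "q ^ u < (L + 2) ^ (48 * (2 * (k * C + 1)) + 5)" "A div q ^ u mod q = a" for A q u a
        by (rule D2) (use that in \<open>simp_all only: N_def L_def\<close>)
      show "A div q ^ u mod q = a" if "?D A q u a" for A q u a by (rule D1[OF that])
      show "El x \<noteq> {}" if "x \<in> Fn" for x by (rule Fne[OF that])
      show "\<forall>x\<in>S. \<forall>y\<in>S. x \<noteq> y \<longrightarrow> El x \<inter> El y = {}" by (rule S(3))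
    qed (rule FnL ElL ElK S(1))+
    then have b: "real (card (Ip - E0)) \<le> ?q * real (card Is)" unfolding cB cardS by (simp add: field_simps)
    have "card Ip \<le> card ((Ip - E0) \<union> E0)" using fIp fI by (intro card_mono) auto
    also have "\<dots> \<le> card (Ip - E0) + card E0" by (rule card_Un_le)
    finally have "card Ip \<le> card (Ip - E0) + card E0" .
    then have "real (card P) \<le> real (card (Ip - E0)) + real (card E0)" unfolding cP of_nat_add[symmetric] of_nat_le_iff .
    moreover have "1 * real (card E0) \<le> ?q * real (card E0)" using q1 by (rule mult_right_mono) simp
    ultimately have "real (card P) \<le> ?q * real (card Is) + ?q * real (card E0)" using b by linarith
    then show ?thesis unfolding card_is by (simp only: of_nat_add distrib_left)
  qed
  have opt_le: "real (opt_packing (set ` set xss)) \<le> ?q * real (card ((\<lambda>i. set (xss ! i)) ` set is))"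
  proof -
    let ?X = "{card S |S. is_packing (set ` set xss) S}"
    have "?X \<subseteq> card ` Pow (set ` set xss)" unfolding is_packing_def by blast
    then have "finite ?X" by (rule finite_subset) simp
    moreover have "is_packing (set ` set xss) {}" by (simp add: is_packing_def)
    then have "?X \<noteq> {}" by blast
    ultimately have "Max ?X \<in> ?X" by (rule Max_in)
    then obtain P where P: "Max ?X = card P" "is_packing (set ` set xss) P" by blast
    show ?thesis unfolding opt_packing_def P(1) by (rule opt[OF P(2)])
  qed
  show ?thesis
  proof (intro exI[of _ "is"] conjI allI impI)
    show "set is \<subseteq> {..<length xss}" using isub unfolding m_def .
  qed (rule len pack opt_le conjunct1[OF out] conjunct2[OF out], assumption?)+
qed

text \<open>With M = |F| + n the input length plus 2 is at most (k + 5)(M + 1) ^ 2, by the crude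
  bound n + 1 for the length of a code. The summand independent of M covers the case M = 0.\<close>

lemma time_bound:
  assumes "valid_instance k n xss"
  shows "(length (enc_instance n xss) + 2) ^ K \<le> ((k + 5) ^ K * 2 ^ (2 * K)) * (length xss + n) ^ (2 * K) + (k + 5) ^ K * 2 ^ (2 * K)"
proof -
  define M where "M = length xss + n"
  define q where "q = (M + 1) * (M + 1)"
  have "length xss * (k * (n + 1) + 1) \<le> (M + 1) * ((k + 1) * (M + 1))"
  proof (rule mult_le_mono)
    show "length xss \<le> M + 1" by (simp add: M_def)
    have "k * (n + 1) \<le> k * (M + 1)" unfolding M_def by (intro mult_le_mono2) simp
    moreover have "(k + 1) * (M + 1) = k * (M + 1) + (M + 1)" by (simp only: add_mult_distrib mult_1)
    ultimately show "k * (n + 1) + 1 \<le> (k + 1) * (M + 1)" by linarith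
  qed
  also have "\<dots> = (k + 1) * q" unfolding q_def by (simp only: mult.left_commute)
  finally have 1: "length xss * (k * (n + 1) + 1) \<le> (k + 1) * q" .
  have "M + 1 \<le> q" unfolding q_def by simp
  then have "4 * (M + 1) \<le> 4 * q" by (rule mult_le_mono2)
  moreover have "n + 4 \<le> 4 * (M + 1)" by (simp add: M_def)
  ultimately have 2: "n + 4 \<le> 4 * q" by (metis le_trans)
  have 3: "(k + 5) * q = (k + 1) * q + 4 * q" by (simp add: add_mult_distrib)
  have "length (enc_instance n xss) + 2 \<le> (k + 5) * (M + 1) ^ 2"
    unfolding power2_eq_square q_def[symmetric] 3 using length_enc_instance[OF assms] 1 2 by linarith
  then have "(length (enc_instance n xss) + 2) ^ K \<le> ((k + 5) * (M + 1) ^ 2) ^ K" by (rule power_mono) simp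
  also have "\<dots> = (k + 5) ^ K * (M + 1) ^ (2 * K)" by (simp only: power_mult_distrib power_mult)
  also have "\<dots> \<le> (k + 5) ^ K * (2 ^ (2 * K) * M ^ (2 * K) + 2 ^ (2 * K))"
  proof (rule mult_le_mono2)
    show "(M + 1) ^ (2 * K) \<le> 2 ^ (2 * K) * M ^ (2 * K) + 2 ^ (2 * K)"
    proof (cases "M = 0")
      case True
      have "(1::nat) \<le> 2 ^ (2 * K)" by simp
      moreover have "(M + 1) ^ (2 * K) = 1" using True by simp
      ultimately show ?thesis by linarith
    next
      case False
      then have "(M + 1) ^ (2 * K) \<le> (2 * M) ^ (2 * K)" by (intro power_mono) auto
      then show ?thesis unfolding power_mult_distrib by linarith
    qed
  qed
  finally show ?thesis unfolding M_def by (simp only: distrib_left mult.assoc)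
qed

theorem theorem2:
  fixes \<epsilon> :: real and k :: nat
  assumes "\<epsilon> > 0" and "k \<ge> 3"
  shows "\<exists>Q Sg \<delta> (c::nat) (d::nat). tm_wf Q Sg \<delta> \<and>
    (\<forall>n xss. valid_instance k n xss \<longrightarrow>
      (\<exists>t \<le> c * (length xss + n) ^ d + c.
         fst (tm_run \<delta> t (enc_instance n xss)) = 1 \<and>
         (\<exists>is. tm_output (tm_run \<delta> t (enc_instance n xss)) = enc_nats is \<and>
               set is \<subseteq> {..<length xss} \<and>
               is_packing (set ` set xss) ((\<lambda>i. set (xss ! i)) ` set is) \<and>
               real (opt_packing (set ` set xss))
                 \<le> (real k + 1 + \<epsilon>) / 3 * real (card ((\<lambda>i. set (xss ! i)) ` set is)))))"
proof -
  have "2 \<le> k" using assms(2) by simp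
  from bounded_improvement[OF assms(1) this] obtain w C where
    big: "\<forall>(A::nat set) (B::nat set) Nb m. conflict A B Nb k \<longrightarrow> (real k + 1 + \<epsilon>) * real (card A) < 3 * real (card B) \<longrightarrow>
      card A < 2 ^ m \<longrightarrow> (\<exists>t P X. t \<le> C * (m + 1) \<and> preach A Nb B w t P X 1)" by (elim exE)
  \<comment> \<open>The exponent demanded by \<open>size_bounds\<close>; it depends on k and
    \<epsilon> only, so that N is a fixed power of the input length plus 2.\<close>
  let ?e = "48 * (2 * (k * C + 1)) + 5"
  have ar: "3 \<le> (29::nat)" "arr w 0 = 1" "arr w 1 = 1" "arr w 2 = 1" "1 \<le> ?e" by (simp_all add: arr_def)
  obtain Q Sg \<delta> K where tm: "tm_wf Q Sg \<delta>" and
    run: "\<forall>inp ys. set inp \<subseteq> {1..4} \<longrightarrow> length ys < (length inp + 2) ^ ?e \<longrightarrow> set ys \<subseteq> {1..3} \<longrightarrow>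
      (\<forall>i \<le> length ys.
        (run ((length inp + 2) ^ ?e) z0 (p_main w) (I0 inp) 0 [i] \<longleftrightarrow> i < length ys \<and> odd (ys ! i)) \<and>
        (run ((length inp + 2) ^ ?e) z0 (p_main w) (I0 inp) 1 [i] \<longleftrightarrow> i < length ys \<and> 2 \<le> ys ! i)) \<longrightarrow>
      (\<exists>t \<le> (length inp + 2) ^ K. fst (tm_run \<delta> t inp) = 1 \<and> tm_output (tm_run \<delta> t inp) = ys)"
    using prog_to_tm[OF wf_main ar] by (elim exE conjE)
  let ?c = "(k + 5) ^ K * 2 ^ (2 * K)"
  show ?thesis
  proof (rule exI[of _ Q], rule exI[of _ Sg], rule exI[of _ \<delta>], rule exI[of _ ?c], rule exI[of _ "2 * K"], intro conjI allI impI)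
    show "tm_wf Q Sg \<delta>" by (rule tm)
    fix n xss assume v: "valid_instance k n xss"
    let ?inp = "enc_instance n xss"
    obtain "is" where i: "set is \<subseteq> {..<length xss}" "length (enc_nats is) < (length ?inp + 2) ^ ?e"
      "\<forall>i\<le>length (enc_nats is).
        (run ((length ?inp + 2) ^ ?e) z0 (p_main w) (I0 ?inp) 0 [i] \<longleftrightarrow> i < length (enc_nats is) \<and> odd (enc_nats is ! i)) \<and>
        (run ((length ?inp + 2) ^ ?e) z0 (p_main w) (I0 ?inp) 1 [i] \<longleftrightarrow> i < length (enc_nats is) \<and> 2 \<le> enc_nats is ! i)"
      "is_packing (set ` set xss) ((\<lambda>i. set (xss ! i)) ` set is)"
      "real (opt_packing (set ` set xss)) \<le> (real k + 1 + \<epsilon>) / 3 * real (card ((\<lambda>i. set (xss ! i)) ` set is))"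
      using main_output[OF assms big v] by (elim exE conjE)
    have s: "set (enc_nats is) \<subseteq> {1..3}" using set_enc_nats[of "is"] by auto
    obtain t where t: "t \<le> (length ?inp + 2) ^ K" "fst (tm_run \<delta> t ?inp) = 1" "tm_output (tm_run \<delta> t ?inp) = enc_nats is"
      using run[THEN spec, THEN spec, THEN mp, OF set_enc_instance, THEN mp, OF i(2), THEN mp, OF s, THEN mp, OF i(3)] by (elim exE conjE)
    show "\<exists>t \<le> ?c * (length xss + n) ^ (2 * K) + ?c. fst (tm_run \<delta> t ?inp) = 1 \<and>
         (\<exists>is. tm_output (tm_run \<delta> t ?inp) = enc_nats is \<and> set is \<subseteq> {..<length xss} \<and>
               is_packing (set ` set xss) ((\<lambda>i. set (xss ! i)) ` set is) \<and>
               real (opt_packing (set ` set xss)) \<le> (real k + 1 + \<epsilon>) / 3 * real (card ((\<lambda>i. set (xss ! i)) ` set is)))"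
      by (intro exI[of _ t] exI[of _ "is"] conjI le_trans[OF t(1) time_bound[OF v]] t(2,3) i(1,4,5))
  qed
qed

end
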